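(* Let $(R,\mathfrak m)$ be a one-dimensional Noetherian Cohen-Macaulay local ring with $R/\mathfrak m$ infinite, having a canonical module $\omega_R$ that is a fractional ideal with $R\subseteq\omega_R\subseteq\overline R$. Let $I$ be an $\mathfrak m$-primary (proper) ideal of $R$, let $I^\vee=(\omega_R:I)$, let $zR$ (with $z\in Q(R)$) be a minimal reduction of $I^\vee$, and let $a,b\in R$. The ring $R(I)_{a,b}$ is almost Gorenstein if and only if $II^\vee=zI$ and $z\mathfrak m=\mathfrak m I^\vee$. In particular, whether $R(I)_{a,b}$ is almost Gorenstein does not depend on $a$ and $b$.
   Context: All rings are commutative with unity. For a Noetherian ring $R$, a nonzero proper ideal $I$ and $a,b\in R$, the Rees algebra is the subring $\bigoplus_{n\ge 0} I^n t^n$ of $R[t]$, and $R(I)_{a,b}$ denotes the quotient of $\bigoplus_{n\ge 0} I^n t^n$ by the ideal $\big((t^2+at+b)R[t]\big)\cap \bigoplus_{n\ge 0} I^n t^n$. As an $R$-module $R(I)_{a,b}\cong R\oplus I$; its elements are written uniquely as $r+it$ with $r\in R$, $i\in I$, with product $(r+it)(s+jt)=rs-bij+(rj+is-aij)t$. If $(R,\mathfrak m)$ is local, then $R(I)_{a,b}$ is local with maximal ideal $\{m+it \mid m\in\mathfrak m, i\in I\}$. $Q(R)$ is the total ring of fractions of $R$, $\overline R$ the integral closure of $R$ in $Q(R)$, and $(A:B)=\{q\in Q(R)\mid qB\subseteq A\}$. If $H$ is a fractional ideal and $y\in R$ is regular with $yH\subseteq R$, then for a minimal reduction $xR$ of the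 ideal $yH$ one calls $xy^{-1}R$ a minimal reduction of $H$; the element $z$ is then invertible in $Q(R)$. A one-dimensional Cohen-Macaulay local ring $(S,\mathfrak n)$ is almost Gorenstein if it has a canonical module that is isomorphic to a fractional ideal $\omega_S$ of $S$ with $S\subseteq\omega_S\subseteq(\mathfrak n:\mathfrak n)$ (colon in $Q(S)$). *)

theory Defs
  imports
    "HOL-Library.Extended_Nat"
    "HOL-Algebra.QuotRing"
    "HOL-Algebra.Ideal_Product"
    "HOL-Algebra.Ring_Divisibility"
    "HOL-Algebra.UnivPoly"
begin

section \<open>Local rings, dimension, depth\<close>

definition local_ring :: "('a, 'r) ring_scheme \<Rightarrow> 'a set \<Rightarrow> bool" where
  "local_ring R m \<longleftrightarrow> cring R \<and> maximalideal m R \<and> (\<forall>n. maximalideal n R \<longrightarrow> n = m)"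

definition krull_dim :: "('a, 'r) ring_scheme \<Rightarrow> enat" where
  "krull_dim R = Sup {enat n | n. \<exists>P :: nat \<Rightarrow> 'a set.
     (\<forall>i\<le>n. primeideal (P i) R) \<and> (\<forall>i<n. P i \<subset> P (Suc i))}"

text \<open>The requirement that \<open>R / (xs)\<close> be nonzero is automatic for sequences in a proper ideal,
  the only ones considered here.\<close>

definition regular_sequence :: "('a, 'r) ring_scheme \<Rightarrow> 'a list \<Rightarrow> bool" where
  "regular_sequence R xs \<longleftrightarrow> set xs \<subseteq> carrier R \<and>
     (\<forall>i<length xs. \<forall>r\<in>carrier R.
        xs ! i \<otimes>\<^bsub>R\<^esub> r \<in> Idl\<^bsub>R\<^esub> (set (take i xs)) \<longrightarrow> r \<in> Idl\<^bsub>R\<^esub> (set (take i xs)))"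

definition depth :: "('a, 'r) ring_scheme \<Rightarrow> 'a set \<Rightarrow> enat" where
  "depth R m = Sup {enat (length xs) | xs. regular_sequence R xs \<and> set xs \<subseteq> m}"

definition cohen_macaulay_local :: "('a, 'r) ring_scheme \<Rightarrow> 'a set \<Rightarrow> bool" where
  "cohen_macaulay_local R m \<longleftrightarrow>
     noetherian_ring R \<and> local_ring R m \<and> depth R m = krull_dim R"


section \<open>Ideals: primary ideals, powers, reductions\<close>

definition radical :: "('a, 'r) ring_scheme \<Rightarrow> 'a set \<Rightarrow> 'a set" where
  "radical R I = {r \<in> carrier R. \<exists>n::nat. r [^]\<^bsub>R\<^esub> n \<in> I}"

definition primary_ideal :: "('a, 'r) ring_scheme \<Rightarrow> 'a set \<Rightarrow> 'a set \<Rightarrow> bool" where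
  "primary_ideal R m I \<longleftrightarrow> ideal I R \<and> I \<noteq> carrier R \<and> radical R I = m \<and>
     (\<forall>r\<in>carrier R. \<forall>s\<in>carrier R. r \<otimes>\<^bsub>R\<^esub> s \<in> I \<longrightarrow> r \<in> I \<or> s \<in> radical R I)"

primrec ideal_power :: "('a, 'r) ring_scheme \<Rightarrow> 'a set \<Rightarrow> nat \<Rightarrow> 'a set" where
  "ideal_power R I 0 = carrier R"
| "ideal_power R I (Suc n) = I \<cdot>\<^bsub>R\<^esub> ideal_power R I n"

definition is_reduction :: "('a, 'r) ring_scheme \<Rightarrow> 'a set \<Rightarrow> 'a set \<Rightarrow> bool" where
  "is_reduction R J I \<longleftrightarrow> ideal J R \<and> ideal I R \<and> J \<subseteq> I \<and>
     (\<exists>n. J \<cdot>\<^bsub>R\<^esub> ideal_power R I n = ideal_power R I (Suc n))"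

definition is_minimal_reduction :: "('a, 'r) ring_scheme \<Rightarrow> 'a set \<Rightarrow> 'a set \<Rightarrow> bool" where
  "is_minimal_reduction R J I \<longleftrightarrow> is_reduction R J I \<and>
     (\<forall>J'. is_reduction R J' I \<and> J' \<subseteq> J \<longrightarrow> J' = J)"


section \<open>The total ring of fractions\<close>

definition regular_elements :: "('a, 'r) ring_scheme \<Rightarrow> 'a set" where
  "regular_elements R =
     {s \<in> carrier R. \<forall>r\<in>carrier R. s \<otimes>\<^bsub>R\<^esub> r = \<zero>\<^bsub>R\<^esub> \<longrightarrow> r = \<zero>\<^bsub>R\<^esub>}"

text \<open>\<open>fraction R r s\<close> is the fraction \<open>r / s\<close>, as an equivalence class of pairs. Since all
  denominators are regular, cross multiplication is already an equivalence relation.\<close>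

definition fraction :: "('a, 'r) ring_scheme \<Rightarrow> 'a \<Rightarrow> 'a \<Rightarrow> ('a \<times> 'a) set" where
  "fraction R r s = {(r', s'). r' \<in> carrier R \<and> s' \<in> regular_elements R \<and>
     r \<otimes>\<^bsub>R\<^esub> s' = r' \<otimes>\<^bsub>R\<^esub> s}"

definition total_frac :: "('a, 'r) ring_scheme \<Rightarrow> ('a \<times> 'a) set ring" where
  "total_frac R = \<lparr>
     carrier = {fraction R r s | r s. r \<in> carrier R \<and> s \<in> regular_elements R},
     monoid.mult = (\<lambda>p q. \<Union>(r, s)\<in>p. \<Union>(r', s')\<in>q. fraction R (r \<otimes>\<^bsub>R\<^esub> r') (s \<otimes>\<^bsub>R\<^esub> s')),
     one = fraction R \<one>\<^bsub>R\<^esub> \<one>\<^bsub>R\<^esub>,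
     ring.zero = fraction R \<zero>\<^bsub>R\<^esub> \<one>\<^bsub>R\<^esub>,
     add = (\<lambda>p q. \<Union>(r, s)\<in>p. \<Union>(r', s')\<in>q.
       fraction R (r \<otimes>\<^bsub>R\<^esub> s' \<oplus>\<^bsub>R\<^esub> r' \<otimes>\<^bsub>R\<^esub> s) (s \<otimes>\<^bsub>R\<^esub> s'))\<rparr>"

definition to_frac :: "('a, 'r) ring_scheme \<Rightarrow> 'a \<Rightarrow> ('a \<times> 'a) set" where
  "to_frac R r = fraction R r \<one>\<^bsub>R\<^esub>"

definition integral_closure :: "('a, 'r) ring_scheme \<Rightarrow> ('a \<times> 'a) set set" where
  "integral_closure R = {q \<in> carrier (total_frac R). \<exists>n c. 0 < n \<and> (\<forall>i<n. c i \<in> carrier R) \<and>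
     q [^]\<^bsub>total_frac R\<^esub> (n::nat) \<oplus>\<^bsub>total_frac R\<^esub>
       (\<Oplus>\<^bsub>total_frac R\<^esub>i\<in>{..<n}. to_frac R (c i) \<otimes>\<^bsub>total_frac R\<^esub> q [^]\<^bsub>total_frac R\<^esub> i)
     = \<zero>\<^bsub>total_frac R\<^esub>}"

definition frac_colon ::
    "('a, 'r) ring_scheme \<Rightarrow> ('a \<times> 'a) set set \<Rightarrow> ('a \<times> 'a) set set \<Rightarrow> ('a \<times> 'a) set set" where
  "frac_colon R A B = {q \<in> carrier (total_frac R). \<forall>b\<in>B. q \<otimes>\<^bsub>total_frac R\<^esub> b \<in> A}"

text \<open>A subset \<open>H\<close> of the total ring of fractions with its scalar multiplication by \<open>R\<close>.\<close>

definition frac_module ::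
    "('a, 'r) ring_scheme \<Rightarrow> ('a \<times> 'a) set set \<Rightarrow> ('a, ('a \<times> 'a) set) module" where
  "frac_module R H = \<lparr>
     carrier = H,
     monoid.mult = monoid.mult (total_frac R),
     one = one (total_frac R),
     ring.zero = ring.zero (total_frac R),
     add = add (total_frac R),
     smult = (\<lambda>r q. to_frac R r \<otimes>\<^bsub>total_frac R\<^esub> q)\<rparr>"

definition fractional_ideal :: "('a, 'r) ring_scheme \<Rightarrow> ('a \<times> 'a) set set \<Rightarrow> bool" where
  "fractional_ideal R H \<longleftrightarrow> submodule H R (frac_module R (carrier (total_frac R))) \<and>
     (\<exists>y\<in>regular_elements R. to_frac R y <#\<^bsub>total_frac R\<^esub> H \<subseteq> to_frac R ` carrier R)"

text \<open>\<open>Z\<close> is \<open>x y\<^sup>-\<^sup>1 R\<close>, where \<open>x R\<close> is a minimal reduction of the ideal \<open>y H\<close> of \<open>R\<close>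
  (written as a subset of \<open>R\<close>).\<close>

definition frac_minimal_reduction ::
    "('a, 'r) ring_scheme \<Rightarrow> ('a \<times> 'a) set set \<Rightarrow> ('a \<times> 'a) set set \<Rightarrow> bool" where
  "frac_minimal_reduction R Z H \<longleftrightarrow> (\<exists>y\<in>regular_elements R. \<exists>x\<in>carrier R.
     to_frac R y <#\<^bsub>total_frac R\<^esub> H \<subseteq> to_frac R ` carrier R \<and>
     is_minimal_reduction R (PIdl\<^bsub>R\<^esub> x)
       {r \<in> carrier R. to_frac R r \<in> to_frac R y <#\<^bsub>total_frac R\<^esub> H} \<and>
     Z = fraction R x y <#\<^bsub>total_frac R\<^esub> to_frac R ` carrier R)"


section \<open>Ext and canonical modules\<close>

text \<open>The unused ring multiplication and unit in the records of power and quotient modules are undefined.\<close>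

definition self_module :: "('a, 'r) ring_scheme \<Rightarrow> ('a, 'a) module" where
  "self_module R = \<lparr>carrier = carrier R, monoid.mult = monoid.mult R, one = one R,
     ring.zero = ring.zero R, add = add R, smult = monoid.mult R\<rparr>"

definition power_module :: "('a, 'm, 'n) module_scheme \<Rightarrow> nat \<Rightarrow> ('a, nat \<Rightarrow> 'm) module" where
  "power_module M n = \<lparr>
     carrier = {..<n} \<rightarrow>\<^sub>E carrier M,
     monoid.mult = undefined,
     one = undefined,
     ring.zero = (\<lambda>j\<in>{..<n}. \<zero>\<^bsub>M\<^esub>),
     add = (\<lambda>v w. \<lambda>j\<in>{..<n}. v j \<oplus>\<^bsub>M\<^esub> w j),
     smult = (\<lambda>r v. \<lambda>j\<in>{..<n}. r \<odot>\<^bsub>M\<^esub> v j)\<rparr>"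

abbreviation free_module :: "('a, 'r) ring_scheme \<Rightarrow> nat \<Rightarrow> ('a, nat \<Rightarrow> 'a) module" where
  "free_module R n \<equiv> power_module (self_module R) n"

definition quotient_module ::
    "('a, 'm, 'n) module_scheme \<Rightarrow> 'm set \<Rightarrow> ('a, 'm set) module" where
  "quotient_module M N = \<lparr>
     carrier = a_rcosets\<^bsub>M\<^esub> N,
     monoid.mult = undefined,
     one = undefined,
     ring.zero = N,
     add = set_add M,
     smult = (\<lambda>r C. \<Union>x\<in>C. N +>\<^bsub>M\<^esub> (r \<odot>\<^bsub>M\<^esub> x))\<rparr>"

definition lin_comb ::
    "('a, 'm, 'n) module_scheme \<Rightarrow> nat \<Rightarrow> (nat \<Rightarrow> 'a) \<Rightarrow> (nat \<Rightarrow> 'm) \<Rightarrow> 'm" where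
  "lin_comb M n c e = (\<Oplus>\<^bsub>M\<^esub>j\<in>{..<n}. c j \<odot>\<^bsub>M\<^esub> e j)"

definition finitely_generated :: "('a, 'r) ring_scheme \<Rightarrow> ('a, 'm, 'n) module_scheme \<Rightarrow> bool" where
  "finitely_generated R M \<longleftrightarrow> (\<exists>n e. (\<forall>j<n. e j \<in> carrier M) \<and>
     carrier M = (\<lambda>c. lin_comb M n c e) ` carrier (free_module R n))"

text \<open>The map \<open>M\<^sup>q \<rightarrow> M\<^sup>p\<close> given by a \<open>p \<times> q\<close> matrix \<open>A\<close> over the base ring.\<close>

definition matrix_map :: "('a, 'm, 'n) module_scheme \<Rightarrow> nat \<Rightarrow> nat \<Rightarrow> (nat \<Rightarrow> nat \<Rightarrow> 'a) \<Rightarrow>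
    (nat \<Rightarrow> 'm) \<Rightarrow> (nat \<Rightarrow> 'm)" where
  "matrix_map M p q A v = (\<lambda>j\<in>{..<p}. \<Oplus>\<^bsub>M\<^esub>k\<in>{..<q}. A j k \<odot>\<^bsub>M\<^esub> v k)"

text \<open>A resolution \<open>\<dots> \<rightarrow> R\<^bsup>n 2\<^esup> \<rightarrow> R\<^bsup>n 1\<^esup> \<rightarrow> R\<^bsup>n 0\<^esup> \<rightarrow> M \<rightarrow> 0\<close> by finitely generated free modules:
  \<open>A i\<close> is the \<open>n i \<times> n (i + 1)\<close> matrix of the differential \<open>R\<^bsup>n (i + 1)\<^esup> \<rightarrow> R\<^bsup>n i\<^esup>\<close>, and the
  augmentation sends the standard basis of \<open>R\<^bsup>n 0\<^esup>\<close> to \<open>e 0, \<dots>, e (n 0 - 1)\<close>.\<close>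

definition free_resolution :: "('a, 'r) ring_scheme \<Rightarrow> ('a, 'm, 'k) module_scheme \<Rightarrow>
    (nat \<Rightarrow> nat) \<Rightarrow> (nat \<Rightarrow> nat \<Rightarrow> nat \<Rightarrow> 'a) \<Rightarrow> (nat \<Rightarrow> 'm) \<Rightarrow> bool" where
  "free_resolution R M n A e \<longleftrightarrow>
     (\<forall>i. \<forall>j<n i. \<forall>k<n (Suc i). A i j k \<in> carrier R) \<and>
     (\<forall>j<n 0. e j \<in> carrier M) \<and>
     (\<lambda>c. lin_comb M (n 0) c e) ` carrier (free_module R (n 0)) = carrier M \<and>
     {c \<in> carrier (free_module R (n 0)). lin_comb M (n 0) c e = \<zero>\<^bsub>M\<^esub>}
       = matrix_map (self_module R) (n 0) (n 1) (A 0) ` carrier (free_module R (n 1)) \<and>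
     (\<forall>i. {c \<in> carrier (free_module R (n (Suc i))).
             matrix_map (self_module R) (n i) (n (Suc i)) (A i) c = \<zero>\<^bsub>free_module R (n i)\<^esub>}
       = matrix_map (self_module R) (n (Suc i)) (n (Suc (Suc i))) (A (Suc i))
           ` carrier (free_module R (n (Suc (Suc i)))))"

text \<open>\<open>Hom(R\<^sup>p, N) = N\<^sup>p\<close>, and \<open>Hom(-, N)\<close> turns a matrix into its transpose. Hence for a free
  resolution \<open>(n, A, e)\<close> of \<open>M\<close>, \<open>ext_module n A N i\<close> is \<open>Ext\<^sup>i(M, N)\<close>.\<close>

definition codiff :: "(nat \<Rightarrow> nat) \<Rightarrow> (nat \<Rightarrow> nat \<Rightarrow> nat \<Rightarrow> 'a) \<Rightarrow> ('a, 'm, 'k) module_scheme \<Rightarrow>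
    nat \<Rightarrow> (nat \<Rightarrow> 'm) \<Rightarrow> (nat \<Rightarrow> 'm)" where
  "codiff n A N i = matrix_map N (n (Suc i)) (n i) (\<lambda>k j. A i j k)"

definition cocycles :: "(nat \<Rightarrow> nat) \<Rightarrow> (nat \<Rightarrow> nat \<Rightarrow> nat \<Rightarrow> 'a) \<Rightarrow> ('a, 'm, 'k) module_scheme \<Rightarrow>
    nat \<Rightarrow> (nat \<Rightarrow> 'm) set" where
  "cocycles n A N i =
     {w \<in> carrier (power_module N (n i)). codiff n A N i w = \<zero>\<^bsub>power_module N (n (Suc i))\<^esub>}"

definition coboundaries :: "(nat \<Rightarrow> nat) \<Rightarrow> (nat \<Rightarrow> nat \<Rightarrow> nat \<Rightarrow> 'a) \<Rightarrow>
    ('a, 'm, 'k) module_scheme \<Rightarrow> nat \<Rightarrow> (nat \<Rightarrow> 'm) set" where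
  "coboundaries n A N i = (case i of
       0 \<Rightarrow> {\<zero>\<^bsub>power_module N (n 0)\<^esub>}
     | Suc k \<Rightarrow> codiff n A N k ` carrier (power_module N (n k)))"

definition ext_module :: "(nat \<Rightarrow> nat) \<Rightarrow> (nat \<Rightarrow> nat \<Rightarrow> nat \<Rightarrow> 'a) \<Rightarrow>
    ('a, 'm, 'k) module_scheme \<Rightarrow> nat \<Rightarrow> ('a, (nat \<Rightarrow> 'm) set) module" where
  "ext_module n A N i =
     quotient_module (power_module N (n i)\<lparr>carrier := cocycles n A N i\<rparr>) (coboundaries n A N i)"

text \<open>The \<open>R\<close>-module \<open>V\<close> is a vector space of dimension \<open>d\<close> over \<open>R / m\<close>; the scalars in the
  basis condition are lifted to \<open>R\<close>.\<close>

definition residue_dim ::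
    "('a, 'r) ring_scheme \<Rightarrow> 'a set \<Rightarrow> ('a, 'm, 'k) module_scheme \<Rightarrow> nat \<Rightarrow> bool" where
  "residue_dim R m V d \<longleftrightarrow>
     (\<forall>r\<in>m. \<forall>v\<in>carrier V. r \<odot>\<^bsub>V\<^esub> v = \<zero>\<^bsub>V\<^esub>) \<and>
     (\<exists>b. (\<forall>j<d. b j \<in> carrier V) \<and>
        (\<lambda>c. lin_comb V d c b) ` carrier (free_module R d) = carrier V \<and>
        (\<forall>c\<in>carrier (free_module R d). lin_comb V d c b = \<zero>\<^bsub>V\<^esub> \<longrightarrow> (\<forall>j<d. c j \<in> m)))"

text \<open>A finitely generated module \<open>C\<close> over a Cohen-Macaulay local ring \<open>(R, m)\<close> of dimension \<open>d\<close>
  with residue field \<open>k\<close> is canonical (maximal Cohen-Macaulay, of type 1 and of finite injective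
  dimension) if \<open>dim\<^sub>k Ext\<^sup>i(k, C)\<close> is 1 for \<open>i = d\<close> and 0 otherwise. By the comparison theorem the
  choice of the resolution of \<open>k\<close> is immaterial.\<close>

definition canonical_module ::
    "('a, 'r) ring_scheme \<Rightarrow> 'a set \<Rightarrow> ('a, 'm, 'k) module_scheme \<Rightarrow> bool" where
  "canonical_module R m C \<longleftrightarrow>
     cohen_macaulay_local R m \<and> module R C \<and> finitely_generated R C \<and>
     (\<exists>n A e. free_resolution R (quotient_module (self_module R) m) n A e \<and>
        (\<forall>i. residue_dim R m (ext_module n A C i) (if enat i = krull_dim R then 1 else 0)))"


section \<open>Almost Gorenstein rings\<close>

text \<open>Being canonical is invariant under isomorphism, so ``a canonical module isomorphic to the fractional
  ideal \<open>\<omega>\<close>'' is expressed by requiring \<open>\<omega>\<close> itself, as an \<open>S\<close>-module, to be canonical.\<close>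

definition almost_gorenstein :: "('a, 'r) ring_scheme \<Rightarrow> bool" where
  "almost_gorenstein S \<longleftrightarrow> (\<exists>n. cohen_macaulay_local S n \<and> krull_dim S = 1 \<and>
     (\<exists>\<omega>. fractional_ideal S \<omega> \<and> canonical_module S n (frac_module S \<omega>) \<and>
        to_frac S ` carrier S \<subseteq> \<omega> \<and> \<omega> \<subseteq> frac_colon S (to_frac S ` n) (to_frac S ` n)))"


section \<open>The rings \<open>R(I)\<^bsub>a,b\<^esub>\<close>\<close>

text \<open>The Rees algebra \<open>\<Oplus> I\<^sup>n t\<^sup>n\<close> as a subring of \<open>R[t]\<close>, and its quotient by the contraction
  of the ideal generated by \<open>t\<^sup>2 + a t + b\<close> in \<open>R[t]\<close>.\<close>

definition rees_algebra :: "('a, 'r) ring_scheme \<Rightarrow> 'a set \<Rightarrow> ('a, nat \<Rightarrow> 'a) up_ring" where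
  "rees_algebra R I =
     UP R\<lparr>carrier := {p \<in> carrier (UP R). \<forall>n. coeff (UP R) p n \<in> ideal_power R I n}\<rparr>"

definition rees_quadratic :: "('a, 'r) ring_scheme \<Rightarrow> 'a \<Rightarrow> 'a \<Rightarrow> nat \<Rightarrow> 'a" where
  "rees_quadratic R a b =
     monom (UP R) \<one>\<^bsub>R\<^esub> 2 \<oplus>\<^bsub>UP R\<^esub> monom (UP R) a 1 \<oplus>\<^bsub>UP R\<^esub> monom (UP R) b 0"

definition rees_quotient ::
    "('a, 'r) ring_scheme \<Rightarrow> 'a set \<Rightarrow> 'a \<Rightarrow> 'a \<Rightarrow> (nat \<Rightarrow> 'a) set ring" where
  "rees_quotient R I a b = rees_algebra R I Quot
     ((PIdl\<^bsub>UP R\<^esub> (rees_quadratic R a b)) \<inter> carrier (rees_algebra R I))"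

end

theory Submission
  imports Defs "HOL-Algebra.Subrings"
begin

no_notation times (infixl "*" 70)
notation monoid.mult (infixl "*\<index>" 70)
notation carrier ("|_|")
notation regular_elements ("Reg") and total_frac ("Frac")

text \<open>Let $Q$ be the total ring of fractions of $R$ and let $P$ be $Q \times Q$ with the multiplication of
$Q[t]/(t^2+at+b)$. Evaluation at $t$ identifies $S = R(I)_{a,b}$ with the subring $R \times I$ of $P$, and
$P$ is its total ring of fractions, because the norm of a regular element of $S$ is regular in $R$. The same
norm shows that $S$ is local, Noetherian, one-dimensional and Cohen-Macaulay, with maximal ideal
$\mathfrak n = \mathfrak m \times I$.

The canonical modules have to be recognised inside $Q$ and inside $P$. For a fractional ideal $w$ containing a
one-dimensional Cohen-Macaulay local ring $(A, n)$ with residue field $k$, all $\mathrm{Ext}^i(k, w)$ can be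
computed in the ring of fractions: $\mathrm{Ext}^1(k,w) = (w:n)/w$, and $\mathrm{Ext}^2(k,w) = \mathrm{Ext}^1(n,w)$
vanishes iff every homomorphism $n \to Q/w$ is multiplication by an element of $Q$. A Baer-type argument
(\<open>inj_vectors\<close>) shows that then all higher groups vanish as well. So $w$ is canonical iff it satisfies two
conditions free of resolutions, collected in the predicate \<open>dualizing\<close> (\<open>canonical_iff_dualizing\<close>). Dualizing
fractional ideals are reflexive duals, $w:(w:J) = J$ (\<open>colon_colon\<close>), and two of them differ by an
invertible element (\<open>dualizing_unique\<close>).

Put $D = \omega : I$. The second coordinate of the product of $P$ pairs $P$ with itself, and an element lies in
$D \times \omega$ iff its products with $S$ have second coordinate in $\omega$. Hence $D \times \omega$ is
$\mathrm{Hom}_R(S, \omega)$ and is dualizing for $S$ (\<open>canonical_dualizing\<close>). The ring $S$ is almost Gorenstein iff some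
dualizing $v \supseteq S$ satisfies $\mathfrak n v \subseteq \mathfrak n$ (\<open>almost_gorenstein_iff\<close>).

Since $z \in D$ is invertible, $v_0 = z^{-1}(D \times \omega)$ is dualizing and contains $S$. If
$\mathfrak m D = z \mathfrak m$ and $I D = z I$, multiplying out and using $I = \omega : D$ gives
$\mathfrak n v_0 \subseteq \mathfrak n$ (\<open>D_absorbs\<close>). Conversely let $\mathfrak n v \subseteq \mathfrak n$ and write
$v = c v_0$. Then $c \in v$ maps $\mathfrak n$ into itself, while $c^{-1} \in v_0$ is almost integral over $S$, because
$zR$ is a reduction of $D$. The ascending chain of the modules $c^{-i} \mathfrak n$ therefore stabilises, so
$c^{-1} \mathfrak n = \mathfrak n$ and $\mathfrak n v_0 \subseteq \mathfrak n$; read in coordinates, this gives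
$\mathfrak m D = z \mathfrak m$ and $I D = z I$ (\<open>D_absorbed\<close>). These two equations do not involve $a$ and $b$.\<close>

section \<open>Modules inside a ring of fractions\<close>

definition submod :: "('q, 'k) ring_scheme => 'q set => 'q set => bool" where
 "submod Q A J \<longleftrightarrow> J \<subseteq> |Q| \<and> \<zero>\<^bsub>Q\<^esub> \<in> J \<and> (\<forall>x\<in>J. \<forall>y\<in>J. x \<oplus>\<^bsub>Q\<^esub> y \<in> J) \<and>
  (\<forall>a\<in>A. \<forall>x\<in>J. a *\<^bsub>Q\<^esub> x \<in> J)"

definition colon :: "('q, 'k) ring_scheme => 'q set => 'q set => 'q set" where
 "colon Q X Y = {q \<in> carrier Q. \<forall>y\<in>Y. q *\<^bsub>Q\<^esub> y \<in> X}"

text \<open>A map \<open>J \<rightarrow> Q\<close> that is linear modulo $w$ stands for a homomorphism \<open>J \<rightarrow> Q / w\<close>. Calculating with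
representatives and congruences modulo $w$ avoids quotient modules.\<close>

definition hom_mod :: "('q, 'k) ring_scheme => 'q set => 'q set => 'q set => ('q => 'q) => bool" where
 "hom_mod Q A w J f \<longleftrightarrow> (\<forall>x\<in>J. f x \<in> |Q| ) \<and>
  (\<forall>x\<in>J. \<forall>y\<in>J. f (x \<oplus>\<^bsub>Q\<^esub> y) \<ominus>\<^bsub>Q\<^esub> (f x \<oplus>\<^bsub>Q\<^esub> f y) \<in> w) \<and>
  (\<forall>a\<in>A. \<forall>x\<in>J. f (a *\<^bsub>Q\<^esub> x) \<ominus>\<^bsub>Q\<^esub> a *\<^bsub>Q\<^esub> f x \<in> w)"

text \<open>With $k = A / n$, the last two conditions say that $(w : n) / w$, which is \<open>Ext\<^sup>1(k, w)\<close>, is one-dimensional over $k$,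
and that \<open>Ext\<^sup>1(n, w)\<close>, which is \<open>Ext\<^sup>2(k, w)\<close>, vanishes. The condition \<open>A \<subseteq> w\<close> is a normalisation.\<close>

definition dualizing :: "('q, 'k) ring_scheme => 'q set => 'q set => 'q set => bool" where
 "dualizing Q A n w \<longleftrightarrow> submod Q A w \<and> A \<subseteq> w \<and>
  (\<exists>d\<in>A \<inter> Units Q. \<forall>x\<in>w. d *\<^bsub>Q\<^esub> x \<in> A) \<and>
  (\<exists>s\<in>colon Q w n. s \<notin> w \<and> (\<forall>q\<in>colon Q w n. \<exists>a\<in>A. q \<ominus>\<^bsub>Q\<^esub> a *\<^bsub>Q\<^esub> s \<in> w)) \<and>
  (\<forall>f. hom_mod Q A w n f --> (\<exists>c\<in>carrier Q. \<forall>r\<in>n. f r \<ominus>\<^bsub>Q\<^esub> r *\<^bsub>Q\<^esub> c \<in> w))"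

text \<open>The properties of a one-dimensional Noetherian Cohen-Macaulay local ring $A$ with maximal ideal $n$ inside its total
ring of fractions $Q$ on which the duality theory rests. The assumption \<open>nilpotent\<close> expresses that $A / yA$ has
dimension 0 for regular $y$.\<close>

locale one_dim_frac = cring Q for Q (structure) +
 fixes A n :: "'a set"
 assumes subA: "submod Q A A" and one_A: "\<one> \<in> A" and neg_A: "\<ominus> \<one> \<in> A"
  and n_def: "n = {a \<in> A. \<not> (\<exists>b\<in>A. a * b = \<one>)}"
  and sub_n: "submod Q A n"
  and ex_regular: "\<exists>x. x \<in> n \<inter> Units Q"
  and nilpotent: "\<lbrakk>r \<in> n; y \<in> A \<inter> Units Q\<rbrakk> \<Longrightarrow> \<exists>k::nat. \<exists>a\<in>A. r [^] k = y * a"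
  and fractions: "q \<in> |Q| ==> \<exists>d\<in>A \<inter> Units Q. d * q \<in> A"
  and noetherian: "\<lbrakk>C \<noteq> {}; !!J. J \<in> C ==> submod Q A J \<and> J \<subseteq> A\<rbrakk> \<Longrightarrow>
   \<exists>M\<in>C. \<forall>J\<in>C. M \<subseteq> J --> J = M"
begin

lemma A_carr [simp, intro]: "a \<in> A ==> a \<in> |Q|"
 using subA by (auto simp: submod_def)

lemma n_A: "r \<in> n ==> r \<in> A" by (subst (asm) n_def) simp

lemma n_carr [simp]: "r \<in> n ==> r \<in> |Q|" using n_A by blast

lemma A_add: "a \<in> A ==> b \<in> A ==> a \<oplus> b \<in> A"
 and A_mult: "a \<in> A ==> b \<in> A ==> a * b \<in> A"
 and A_zero: "\<zero> \<in> A"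
 using subA by (auto simp: submod_def)

lemma A_pow: "a \<in> A ==> a [^] (k::nat) \<in> A"
 by (induction k) (auto simp: one_A A_mult)

lemma submodD:
 assumes "submod Q A J"
 shows "x \<in> J ==> x \<in> |Q|" "\<zero> \<in> J" "x \<in> J ==> y \<in> J ==> x \<oplus> y \<in> J"
  "a \<in> A ==> x \<in> J ==> a * x \<in> J"
 using assms by (auto simp: submod_def)

lemma submod_neg:
 assumes "submod Q A J" "x \<in> J" shows "\<ominus> x \<in> J"
proof -
 have "\<ominus> \<one> * x \<in> J" using assms neg_A by (auto simp: submod_def)
 then show ?thesis using assms by (simp add: l_minus submodD(1))
qed

lemma submod_minus:
 assumes "submod Q A J" "x \<in> J" "y \<in> J" shows "x \<ominus> y \<in> J"
 using assms submod_neg submodD(3) by (simp add: minus_eq)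

lemma A_minus: "a \<in> A ==> b \<in> A ==> a \<ominus> b \<in> A"
 using submod_minus[OF subA] by blast

lemma n_minus_unit:
 assumes "a \<in> A" "a \<notin> n" obtains b where "b \<in> A" "a * b = \<one>"
 using assms n_def by blast

lemma one_notin_n: "\<one> \<notin> n"
proof
 assume "\<one> \<in> n"
 then have "\<not> (\<exists>b\<in>A. \<one> * b = \<one>)" by (subst (asm) n_def) simp
 then show False using one_A by (simp add: bexI[of _ \<one>])
qed

subsection \<open>Congruence modulo a submodule\<close>

lemma cong_refl: "submod Q A w ==> u \<in> |Q| ==> u \<ominus> u \<in> w"
 by (simp add: submodD(2) r_neg minus_eq)

lemma cong_sym:
 assumes "submod Q A w" "u \<in> |Q|" "v \<in> |Q|" "u \<ominus> v \<in> w" shows "v \<ominus> u \<in> w"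
proof -
 have "v \<ominus> u = \<ominus> (u \<ominus> v)" using assms(2,3) by algebra
 then show ?thesis using submod_neg[OF assms(1,4)] by simp
qed

lemma cong_trans:
 assumes "submod Q A w" "u \<in> |Q|" "v \<in> |Q|" "t \<in> |Q|" "u \<ominus> v \<in> w" "v \<ominus> t \<in> w"
 shows "u \<ominus> t \<in> w"
proof -
 have "u \<ominus> t = (u \<ominus> v) \<oplus> (v \<ominus> t)" using assms(2-4) by algebra
 then show ?thesis using submodD(3)[OF assms(1,5,6)] by simp
qed

lemma cong_add:
 assumes "submod Q A w" "u \<in> |Q|" "v \<in> |Q|" "u' \<in> |Q|" "v' \<in> |Q|"
  "u \<ominus> v \<in> w" "u' \<ominus> v' \<in> w"
 shows "(u \<oplus> u') \<ominus> (v \<oplus> v') \<in> w"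
proof -
 have "(u \<oplus> u') \<ominus> (v \<oplus> v') = (u \<ominus> v) \<oplus> (u' \<ominus> v')" using assms(2-5) by algebra
 then show ?thesis using submodD(3)[OF assms(1,6,7)] by simp
qed

lemma cong_mult:
 assumes "submod Q A w" "u \<in> |Q|" "v \<in> |Q|" "a \<in> A" "u \<ominus> v \<in> w"
 shows "a * u \<ominus> a * v \<in> w"
proof -
 have "a \<in> |Q|" using assms by blast
 then have "a * u \<ominus> a * v = a * (u \<ominus> v)" using assms(2-3) by algebra
 then show ?thesis using submodD(4)[OF assms(1,4,5)] by simp
qed

lemma cong_mem:
 assumes "submod Q A w" "u \<in> |Q|" "v \<in> w" "u \<ominus> v \<in> w" shows "u \<in> w"
proof -
 have "v \<in> |Q|" using assms submodD(1) by blast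
 then have "u = (u \<ominus> v) \<oplus> v" using assms(2) by algebra
 then show ?thesis using submodD(3)[OF assms(1,4,3)] by simp
qed

lemma hom_modD:
 assumes "hom_mod Q A w J f"
 shows "x \<in> J ==> f x \<in> |Q|"
  "x \<in> J ==> y \<in> J ==> f (x \<oplus> y) \<ominus> (f x \<oplus> f y) \<in> w"
  "a \<in> A ==> x \<in> J ==> f (a * x) \<ominus> a * f x \<in> w"
 using assms by (auto simp: hom_mod_def)

lemma hom_mod_minus:
 assumes w: "submod Q A w" and J: "submod Q A J" and f: "hom_mod Q A w J f"
  and x: "x \<in> J" and y: "y \<in> J"
 shows "f (x \<ominus> y) \<ominus> (f x \<ominus> f y) \<in> w"
proof -
 have xy: "x \<ominus> y \<in> J" using submod_minus[OF J x y] .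
 have xc: "x \<in> |Q|" "y \<in> |Q|" using J x y submodD(1) by blast+
 have "f ((x \<ominus> y) \<oplus> y) \<ominus> (f (x \<ominus> y) \<oplus> f y) \<in> w" using hom_modD(2)[OF f xy y] .
 moreover have "(x \<ominus> y) \<oplus> y = x" using xc by algebra
 ultimately have "f x \<ominus> (f (x \<ominus> y) \<oplus> f y) \<in> w" by simp
 moreover have "f x \<ominus> (f (x \<ominus> y) \<oplus> f y) = (f x \<ominus> f y) \<ominus> f (x \<ominus> y)"
  using hom_modD(1)[OF f x] hom_modD(1)[OF f y] hom_modD(1)[OF f xy] by algebra
 ultimately show ?thesis using cong_sym[OF w] hom_modD(1)[OF f] x y xy by simp
qed

lemma submod_adjoin:
 assumes J: "submod Q A J" and y: "y \<in> |Q|" and B: "submod Q A B"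
 shows "submod Q A {j \<oplus> r * y |j r. j \<in> J \<and> r \<in> B}"
proof -
 have Jc: "j \<in> J ==> j \<in> |Q|" for j using submodD(1)[OF J] .
 have Bc: "j \<in> B ==> j \<in> |Q|" for j using submodD(1)[OF B] .
 show ?thesis unfolding submod_def
 proof (intro conjI ballI subsetI)
  fix x assume "x \<in> {j \<oplus> r * y |j r. j \<in> J \<and> r \<in> B}"
  then show "x \<in> |Q|" using Jc Bc y by auto
 next
  show "\<zero> \<in> {j \<oplus> r * y |j r. j \<in> J \<and> r \<in> B}"
   
   by (intro CollectI exI[of _ \<zero>] conjI) (use submodD(2)[OF J] submodD(2)[OF B] y in simp_all)
 next
  fix u v assume "u \<in> {j \<oplus> r * y |j r. j \<in> J \<and> r \<in> B}" "v \<in> {j \<oplus> r * y |j r. j \<in> J \<and> r \<in> B}"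
  then obtain j r j' r' where h: "j \<in> J" "r \<in> B" "j' \<in> J" "r' \<in> B" "u = j \<oplus> r * y" "v = j' \<oplus> r' * y"
   by blast
  have "j \<in> |Q|" "j' \<in> |Q|" "r \<in> |Q|" "r' \<in> |Q|" using h Jc Bc by auto
  then have "u \<oplus> v = (j \<oplus> j') \<oplus> (r \<oplus> r') * y" unfolding h using y by algebra
  then show "u \<oplus> v \<in> {j \<oplus> r * y |j r. j \<in> J \<and> r \<in> B}"
   using submodD(3)[OF J h(1,3)] submodD(3)[OF B h(2,4)] by blast
 next
  fix a v assume a: "a \<in> A" and "v \<in> {j \<oplus> r * y |j r. j \<in> J \<and> r \<in> B}"
  then obtain j r where h: "j \<in> J" "r \<in> B" "v = j \<oplus> r * y"
   by blast
  have "j \<in> |Q|" "r \<in> |Q|" "a \<in> |Q|" using h Jc Bc a by auto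
  then have "a * v = (a * j) \<oplus> (a * r) * y" unfolding h using y by algebra
  then show "a * v \<in> {j \<oplus> r * y |j r. j \<in> J \<and> r \<in> B}"
   using submodD(4)[OF J a h(1)] submodD(4)[OF B a h(2)] by blast
 qed
qed

lemma extend_adjoin:
 assumes w: "submod Q A w" and J: "submod Q A J" and f: "hom_mod Q A w J f"
  and y: "y \<in> |Q|" and c: "c \<in> |Q|"
  and comp: "!!r. r \<in> A ==> r * y \<in> J ==> f (r * y) \<ominus> r * c \<in> w"
 shows "\<exists>g. hom_mod Q A w {j \<oplus> r * y |j r. j \<in> J \<and> r \<in> A} g \<and>
  (\<forall>j\<in>J. \<forall>r\<in>A. g (j \<oplus> r * y) \<ominus> (f j \<oplus> r * c) \<in> w)"
proof -
 define g where "g x = (SOME e. \<exists>j r. j \<in> J \<and> r \<in> A \<and> x = j \<oplus> r * y \<and> e = f j \<oplus> r * c)" for x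
 have Jc: "j \<in> J ==> j \<in> |Q|" for j using submodD(1)[OF J] .
 have fc: "j \<in> J ==> f j \<in> |Q|" for j using hom_modD(1)[OF f] .
 have g_carr: "g (j \<oplus> r * y) \<in> |Q|"
  and g_eq: "g (j \<oplus> r * y) \<ominus> (f j \<oplus> r * c) \<in> w" if jr: "j \<in> J" "r \<in> A" for j r
 proof -
  have "\<exists>j' r'. j' \<in> J \<and> r' \<in> A \<and> j \<oplus> r * y = j' \<oplus> r' * y \<and> g (j \<oplus> r * y) = f j' \<oplus> r' * c"
   unfolding g_def by (rule someI_ex) (use jr in blast)
  then obtain j' r' where h: "j' \<in> J" "r' \<in> A" "j \<oplus> r * y = j' \<oplus> r' * y"
   "g (j \<oplus> r * y) = f j' \<oplus> r' * c" by blast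
  note carr = Jc[OF jr(1)] Jc[OF h(1)] A_carr[OF jr(2)] A_carr[OF h(2)] fc[OF jr(1)] fc[OF h(1)]
  show "g (j \<oplus> r * y) \<in> |Q|" using h carr c by simp
  have "j' \<ominus> j = (j' \<oplus> r' * y) \<ominus> r' * y \<ominus> j" using carr y by algebra
  also have "\<dots> = (j \<oplus> r * y) \<ominus> r' * y \<ominus> j" using h by simp
  also have "\<dots> = (r \<ominus> r') * y" using carr y by algebra
  finally have e: "j' \<ominus> j = (r \<ominus> r') * y" .
  have rr: "r \<ominus> r' \<in> A" using A_minus jr h by simp
  have jj: "j' \<ominus> j \<in> J" using submod_minus[OF J h(1) jr(1)] .
  have 1: "f (j' \<ominus> j) \<ominus> (r \<ominus> r') * c \<in> w" using comp[OF rr] jj e by simp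
  have 2: "f (j' \<ominus> j) \<ominus> (f j' \<ominus> f j) \<in> w" using hom_mod_minus[OF w J f h(1) jr(1)] .
  have "(f j' \<ominus> f j) \<ominus> (r \<ominus> r') * c \<in> w"
   using cong_trans[OF w _ _ _ cong_sym[OF w _ _ 2] 1] fc[OF jj] carr c by simp
  moreover have "(f j' \<ominus> f j) \<ominus> (r \<ominus> r') * c = (f j' \<oplus> r' * c) \<ominus> (f j \<oplus> r * c)"
   using carr c by algebra
  ultimately show "g (j \<oplus> r * y) \<ominus> (f j \<oplus> r * c) \<in> w" using h by simp
 qed
 have "hom_mod Q A w {j \<oplus> r * y |j r. j \<in> J \<and> r \<in> A} g"
  unfolding hom_mod_def
 proof (intro conjI ballI)
  fix x assume "x \<in> {j \<oplus> r * y |j r. j \<in> J \<and> r \<in> A}"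
  then show "g x \<in> |Q|" using g_carr by blast
 next
  fix u v assume "u \<in> {j \<oplus> r * y |j r. j \<in> J \<and> r \<in> A}" "v \<in> {j \<oplus> r * y |j r. j \<in> J \<and> r \<in> A}"
  then obtain j r j' r' where h: "j \<in> J" "r \<in> A" "j' \<in> J" "r' \<in> A" "u = j \<oplus> r * y" "v = j' \<oplus> r' * y"
   by blast
  note carr = Jc[OF h(1)] Jc[OF h(3)] A_carr[OF h(2)] A_carr[OF h(4)] fc[OF h(1)] fc[OF h(3)]
  have uv: "u \<oplus> v = (j \<oplus> j') \<oplus> (r \<oplus> r') * y" unfolding h using carr y by algebra
  have jj: "j \<oplus> j' \<in> J" using submodD(3)[OF J] h by blast
  have rr: "r \<oplus> r' \<in> A" using A_add h by blast
  have 1: "g (u \<oplus> v) \<ominus> (f (j \<oplus> j') \<oplus> (r \<oplus> r') * c) \<in> w" using g_eq[OF jj rr] uv by simp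
  have 2: "(f (j \<oplus> j') \<oplus> (r \<oplus> r') * c) \<ominus> ((f j \<oplus> f j') \<oplus> (r \<oplus> r') * c) \<in> w"
   using cong_add[OF w _ _ _ _ hom_modD(2)[OF f h(1,3)] cong_refl[OF w]] fc[OF jj] carr rr c by simp
  have 3: "(f j \<oplus> f j') \<oplus> (r \<oplus> r') * c = (f j \<oplus> r * c) \<oplus> (f j' \<oplus> r' * c)"
   using carr c by algebra
  have gg: "g u \<in> |Q|" "g v \<in> |Q|" "g (u \<oplus> v) \<in> |Q|"
   using g_carr[OF h(1,2)] g_carr[OF h(3,4)] g_carr[OF jj rr] uv h by simp_all
  have 4: "(g u \<oplus> g v) \<ominus> ((f j \<oplus> r * c) \<oplus> (f j' \<oplus> r' * c)) \<in> w"
   using cong_add[OF w _ _ _ _ g_eq[OF h(1,2)] g_eq[OF h(3,4)]] h(5,6) gg carr c by simp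
  have 5: "g (u \<oplus> v) \<ominus> ((f j \<oplus> f j') \<oplus> (r \<oplus> r') * c) \<in> w"
   by (rule cong_trans[OF w _ _ _ 1 2]) (use gg fc[OF jj] carr c in simp_all)
  show "g (u \<oplus> v) \<ominus> (g u \<oplus> g v) \<in> w"
   by (rule cong_trans[OF w _ _ _ 5 cong_sym[OF w _ _ 4[folded 3]]]) (use gg carr c in simp_all)
 next
  fix a v assume a: "a \<in> A" and "v \<in> {j \<oplus> r * y |j r. j \<in> J \<and> r \<in> A}"
  then obtain j r where h: "j \<in> J" "r \<in> A" "v = j \<oplus> r * y"
   by blast
  note carr = Jc[OF h(1)] A_carr[OF h(2)] A_carr[OF a] fc[OF h(1)]
  have uv: "a * v = (a * j) \<oplus> (a * r) * y" unfolding h using carr y by algebra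
  have jj: "a * j \<in> J" using submodD(4)[OF J] h a by blast
  have rr: "a * r \<in> A" using A_mult h a by blast
  have gg: "g v \<in> |Q|" "g (a * v) \<in> |Q|"
   using g_carr[OF h(1,2)] g_carr[OF jj rr] uv h by simp_all
  have 1: "g (a * v) \<ominus> (f (a * j) \<oplus> (a * r) * c) \<in> w" using g_eq[OF jj rr] uv by simp
  have 2: "(f (a * j) \<oplus> (a * r) * c) \<ominus> (a * f j \<oplus> (a * r) * c) \<in> w"
   using cong_add[OF w _ _ _ _ hom_modD(3)[OF f a h(1)] cong_refl[OF w]] fc[OF jj] carr rr c by simp
  have 3: "a * f j \<oplus> (a * r) * c = a * (f j \<oplus> r * c)"
   using carr c by (simp add: r_distr m_assoc)
  have 4: "a * g v \<ominus> a * (f j \<oplus> r * c) \<in> w"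
   using cong_mult[OF w _ _ a g_eq[OF h(1,2)]] h(3) gg carr c by simp
  have 5: "g (a * v) \<ominus> (a * f j \<oplus> (a * r) * c) \<in> w"
   by (rule cong_trans[OF w _ _ _ 1 2]) (use gg fc[OF jj] carr c in simp_all)
  show "g (a * v) \<ominus> a * g v \<in> w"
   by (rule cong_trans[OF w _ _ _ 5 cong_sym[OF w _ _ 4[folded 3]]]) (use gg carr c in simp_all)
 qed
 then show ?thesis using g_eq by blast
qed

end

definition dot :: "('q, 'k) ring_scheme => nat => (nat => 'q) => (nat => 'q) => 'q" where
 "dot Q p u v = finsum Q (%j. u j *\<^bsub>Q\<^esub> v j) {..<p}"

context cring
begin

lemma dot_0 [simp]: "dot R 0 u v = \<zero>"
 by (simp add: dot_def)

lemma dot_Suc: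
 assumes "!!j. j \<le> p ==> u j \<in> |R|" "!!j. j \<le> p ==> v j \<in> |R|"
 shows "dot R (Suc p) u v = u p * v p \<oplus> dot R p u v"
 unfolding dot_def lessThan_Suc
 by (rule finsum_insert) (use assms in auto)

lemma dot_closed:
 assumes "!!j. j < p ==> u j \<in> |R|" "!!j. j < p ==> v j \<in> |R|"
 shows "dot R p u v \<in> |R|"
 unfolding dot_def by (rule finsum_closed) (use assms in auto)

lemma dot_cong:
 assumes "!!j. j < p ==> u j \<in> |R|" "!!j. j < p ==> v j \<in> |R|"
  "!!j. j < p ==> u j = u' j" "!!j. j < p ==> v j = v' j"
 shows "dot R p u v = dot R p u' v'"
 unfolding dot_def by (rule finsum_cong') (use assms in auto)

end

context one_dim_frac
begin

lemma submod_scale: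
 assumes J: "submod Q A J" and d: "d \<in> |Q|"
 shows "submod Q A ((%x. d * x) ` J)"
 unfolding submod_def
proof (intro conjI ballI subsetI)
 show "\<zero> \<in> (%x. d * x) ` J" using submodD(2)[OF J] d by force
next
 fix x assume "x \<in> (%x. d * x) ` J" then show "x \<in> |Q|" using d submodD(1)[OF J] by auto
next
 fix x y assume "x \<in> (%x. d * x) ` J" "y \<in> (%x. d * x) ` J"
 then obtain x' y' where h: "x' \<in> J" "y' \<in> J" "x = d * x'" "y = d * y'" by blast
 have "x \<oplus> y = d * (x' \<oplus> y')" using h d submodD(1)[OF J] by (simp add: r_distr)
 then show "x \<oplus> y \<in> (%x. d * x) ` J" using submodD(3)[OF J h(1,2)] by blast
next
 fix a x assume a: "a \<in> A" "x \<in> (%x. d * x) ` J"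
 then obtain x' where h: "x' \<in> J" "x = d * x'" by blast
 have "a * x = d * (a * x')" using h d a submodD(1)[OF J] by (simp add: m_lcomm)
 then show "a * x \<in> (%x. d * x) ` J" using submodD(4)[OF J a(1) h(1)] by blast
qed

lemma noetherian_frac:
 assumes ne: "C \<noteq> {}" and d: "d \<in> Units Q"
  and C: "!!J. J \<in> C ==> submod Q A J \<and> (\<forall>x\<in>J. d * x \<in> A)"
 shows "\<exists>M\<in>C. \<forall>J\<in>C. M \<subseteq> J --> J = M"
proof -
 have dc: "d \<in> |Q|" using d by blast
 let ?s = "%J. (%x. d * x) ` J"
 have "\<exists>M\<in>?s ` C. \<forall>J\<in>?s ` C. M \<subseteq> J --> J = M"
  by (rule noetherian) (use ne C submod_scale dc in auto)
 then obtain M where M: "M \<in> C" "!!J. J \<in> C ==> ?s M \<subseteq> ?s J ==> ?s J = ?s M" by auto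
 have "J = M" if "J \<in> C" "M \<subseteq> J" for J
 proof -
  have e: "?s J = ?s M" using M(2)[OF that(1)] that(2) by blast
  have "J \<subseteq> M"
  proof
   fix x assume x: "x \<in> J"
   then obtain y where y: "y \<in> M" "d * x = d * y" using e by blast
   have "x \<in> |Q|" "y \<in> |Q|" using x y C that(1) M(1) submodD(1) by blast+
   then have "x = y" using y(2) d by simp
   then show "x \<in> M" using y by simp
  qed
  then show ?thesis using that by blast
 qed
 then show ?thesis using M(1) by blast
qed

lemma chain_stabilizes:
 assumes "!!i. submod Q A (F i)" "d \<in> Units Q" "!!i x. x \<in> F i ==> d * x \<in> A"
  "!!i::nat. F i \<subseteq> F (Suc i)"
 shows "\<exists>N. \<forall>i. F i \<subseteq> F N"
proof -
 have "\<exists>M\<in>range F. \<forall>J\<in>range F. M \<subseteq> J --> J = M"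
  by (rule noetherian_frac[OF _ assms(2)]) (use assms in auto)
 then obtain N where N: "!!i. F N \<subseteq> F i ==> F i = F N" by auto
 have mono: "i \<le> j ==> F i \<subseteq> F j" for i j
  using lift_Suc_mono_le[of F] assms(4) by blast
 have "F i \<subseteq> F N" for i
 proof (cases "i \<le> N")
  case False then show ?thesis using N[of i] mono[of N i] by auto
 qed (rule mono)
 then show ?thesis by blast
qed

lemma Units_pow: "x \<in> Units Q ==> x [^] (k::nat) \<in> Units Q"
 by (induction k) auto

text \<open>A maximal annihilator among the nonzero elements of $K / J$ contains $n$: since $d$ kills $K / J$, every element of $n$ acts
nilpotently on $K / J$.\<close>

lemma socle_element:
 assumes J: "submod Q A J" and K: "submod Q A K" and JK: "J \<subseteq> K"
  and y0: "y0 \<in> K" "y0 \<notin> J" and d: "d \<in> A \<inter> Units Q" and dK: "!!x. x \<in> K ==> d * x \<in> J"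
 shows "\<exists>y\<in>K. y \<notin> J \<and> (\<forall>r\<in>n. r * y \<in> J)"
proof -
 let ?an = "%y. {a \<in> A. a * y \<in> J}"
 note Kc = submodD(1)[OF K]
 have an: "submod Q A (?an y)" if "y \<in> K" for y
  unfolding submod_def using that Kc J A_add A_mult A_zero submodD(2,3,4)[OF J]
  by (auto simp: l_distr m_assoc)
 have "\<exists>M\<in>?an ` (K - J). \<forall>I\<in>?an ` (K - J). M \<subseteq> I --> I = M"
  by (rule noetherian) (use an y0 in auto)
 then obtain y where y: "y \<in> K" "y \<notin> J"
  and max: "!!z. z \<in> K ==> z \<notin> J ==> ?an y \<subseteq> ?an z ==> ?an z = ?an y" by auto
 have "r * y \<in> J" if r: "r \<in> n" for r
 proof -
  have rA: "r \<in> A" using n_A r .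
  obtain k a where k: "r [^] (k::nat) = d * a" "a \<in> A" using nilpotent[OF r d] by blast
  have "r [^] k * y = a * (d * y)" using k d y Kc by (simp add: m_ac)
  then have "r [^] k * y \<in> J" using submodD(4)[OF J k(2) dK[OF y(1)]] by simp
  then obtain k where k: "r [^] (k::nat) * y \<in> J" "!!i. i < k ==> r [^] i * y \<notin> J"
   using exists_least_iff[of "%k. r [^] (k::nat) * y \<in> J"] by blast
  have "k \<noteq> 0" using k(1) y Kc by (intro notI) simp
  then obtain i where i: "k = Suc i" using not0_implies_Suc by blast
  let ?z = "r [^] i * y"
  have z: "?z \<in> K" "?z \<notin> J" using submodD(4)[OF K A_pow[OF rA] y(1)] k(2) i by auto
  have "?an y \<subseteq> ?an ?z"
  proof
   fix a assume a: "a \<in> ?an y"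
   have "a * ?z = r [^] i * (a * y)" using a rA y Kc by (simp add: m_lcomm)
   then show "a \<in> ?an ?z" using a submodD(4)[OF J A_pow[OF rA]] by simp
  qed
  then have e: "?an ?z = ?an y" using max z by blast
  have "r * ?z = r [^] k * y" using rA y Kc by (simp add: i m_ac)
  then have "r \<in> ?an ?z" using k(1) rA by simp
  then show ?thesis using e by blast
 qed
 then show ?thesis using y by blast
qed

subsection \<open>Extension of homomorphisms\<close>

definition inj_on_ideal where
 "inj_on_ideal w J \<longleftrightarrow> (\<forall>f. hom_mod Q A w J f --> (\<exists>c\<in>carrier Q. \<forall>x\<in>J. f x \<ominus> x * c \<in> w))"

lemma mem_n_if_mult:
 assumes J: "submod Q A J" and y: "y \<in> |Q|" "y \<notin> J" and r: "r \<in> A" "r * y \<in> J"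
 shows "r \<in> n"
proof (rule ccontr)
 assume "r \<notin> n"
 then obtain b where b: "b \<in> A" "r * b = \<one>" using n_minus_unit r by blast
 have "b * (r * y) = (r * b) * y" using b(1) r y by (simp add: m_ac)
 then have "b * (r * y) = y" using b(2) y(1) by simp
 then show False using submodD(4)[OF J b(1) r(2)] y by simp
qed

lemma subset_adjoin:
 assumes "submod Q A J" "y \<in> |Q|" "submod Q A B"
 shows "J \<subseteq> {j \<oplus> r * y |j r. j \<in> J \<and> r \<in> B}"
proof
 fix x assume "x \<in> J"
 then show "x \<in> {j \<oplus> r * y |j r. j \<in> J \<and> r \<in> B}"
  by (intro CollectI exI[of _ x] exI[of _ \<zero>]) (use assms submodD in auto)
qed

lemma mem_adjoin:
 assumes "submod Q A J" "y \<in> |Q|"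
 shows "y \<in> {j \<oplus> r * y |j r. j \<in> J \<and> r \<in> A}"
 by (intro CollectI exI[of _ \<zero>] exI[of _ \<one>]) (use assms submodD one_A in auto)

text \<open>Zorn-type extension, with the Noetherian condition in place of Zorn: a maximal extension lives on an ideal \<open>M\<close>
containing the regular element $y0$. If $M$ were not $A$, there would be a socle element $y$ of $A / M$, and the
hypothesis on $n$ would provide a value at $y$.\<close>

lemma inj_regular:
 assumes w: "submod Q A w" and inj: "inj_on_ideal w n" and J: "submod Q A J" "J \<subseteq> A"
  and y0: "y0 \<in> J" "y0 \<in> Units Q"
 shows "inj_on_ideal w J"
 unfolding inj_on_ideal_def
proof (intro allI impI)
 fix f assume f: "hom_mod Q A w J f"
 (* Extensions may differ from f by values in w. *)
 define C where "C = {J'. submod Q A J' \<and> J \<subseteq> J' \<and> J' \<subseteq> A \<and>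
  (\<exists>f'. hom_mod Q A w J' f' \<and> (\<forall>x\<in>J. f x \<ominus> f' x \<in> w))}"
 have "J \<in> C" unfolding C_def using J f cong_refl[OF w] hom_modD(1)[OF f] by blast
 then have "\<exists>M\<in>C. \<forall>J\<in>C. M \<subseteq> J --> J = M"
  by (intro noetherian) (auto simp: C_def)
 then obtain M where MC: "M \<in> C" and max: "!!J. J \<in> C ==> M \<subseteq> J ==> J = M" by auto
 obtain f' where M: "submod Q A M" "J \<subseteq> M" "M \<subseteq> A" and f': "hom_mod Q A w M f'"
  "!!x. x \<in> J ==> f x \<ominus> f' x \<in> w" using MC unfolding C_def by blast
 have "M = A"
 proof (rule ccontr)
  assume "M \<noteq> A"
  then obtain y1 where y1: "y1 \<in> A" "y1 \<notin> M" using M by blast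
  have "y0 * x \<in> M" if "x \<in> A" for x
  proof -
   have "y0 * x = x * y0" using that y0(2) by (intro m_comm) auto
   then show ?thesis using submodD(4)[OF J(1) that y0(1)] M(2) by auto
  qed
  then have "\<exists>y\<in>A. y \<notin> M \<and> (\<forall>r\<in>n. r * y \<in> M)"
   using socle_element[OF M(1) subA M(3) y1, of y0] y0 J by blast
  then obtain y where y: "y \<in> A" "y \<notin> M" and ny: "!!r. r \<in> n ==> r * y \<in> M" by blast
  have yc: "y \<in> |Q|" using y by blast
  have "hom_mod Q A w n (%r. f' (r * y))"
   unfolding hom_mod_def
   using hom_modD[OF f'(1)] ny yc by (auto simp: l_distr m_assoc)
  then obtain c where c: "c \<in> |Q|" "!!r. r \<in> n ==> f' (r * y) \<ominus> r * c \<in> w"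
   using inj unfolding inj_on_ideal_def by blast
  let ?M = "{j \<oplus> r * y |j r. j \<in> M \<and> r \<in> A}"
  obtain g where g: "hom_mod Q A w ?M g"
   "!!j r. j \<in> M ==> r \<in> A ==> g (j \<oplus> r * y) \<ominus> (f' j \<oplus> r * c) \<in> w"
   using extend_adjoin[OF w M(1) f'(1) yc c(1)] c(2) mem_n_if_mult[OF M(1) yc y(2)] by blast
  have MM: "M \<subseteq> ?M" using subset_adjoin[OF M(1) yc subA] .
  have "f x \<ominus> g x \<in> w" if x: "x \<in> J" for x
  proof -
   have xM: "x \<in> M" using M x by blast
   have carr: "x \<in> |Q|" "f' x \<in> |Q|" "f x \<in> |Q|" "g x \<in> |Q|"
    using xM M hom_modD(1)[OF f'(1) xM] hom_modD(1)[OF f x] hom_modD(1)[OF g(1)] MM by auto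
   have "g x \<ominus> f' x \<in> w" using g(2)[OF xM A_zero] carr yc c by simp
   then show ?thesis
    using cong_trans[OF w _ _ _ f'(2)[OF x] cong_sym[OF w]] carr by blast
  qed
  moreover have "?M \<subseteq> A" using M(3) y(1) by (auto intro!: A_add A_mult)
  ultimately have "?M \<in> C" unfolding C_def
   using submod_adjoin[OF M(1) yc subA] MM M(2) g(1) by blast
  then have "?M = M" using max MM by blast
  then show False using mem_adjoin[OF M(1) yc] y by simp
 qed
 then have one: "\<one> \<in> M" using one_A by simp
 have "f x \<ominus> x * f' \<one> \<in> w" if x: "x \<in> J" for x
 proof -
  have xA: "x \<in> A" using x J by blast
  have xM: "x \<in> M" using x M by blast
  have "f' x \<ominus> x * f' \<one> \<in> w" using hom_modD(3)[OF f'(1) xA one] xA by simp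
  then show ?thesis using cong_trans[OF w _ _ _ f'(2)[OF x]] hom_modD(1)[OF f x]
    hom_modD(1)[OF f'(1) xM] hom_modD(1)[OF f'(1) one] xA by auto
 qed
 then show "\<exists>c\<in>carrier Q. \<forall>x\<in>J. f x \<ominus> x * c \<in> w" using hom_modD(1)[OF f'(1) one] by blast
qed

lemma hom_mod_zero:
 assumes J: "submod Q A J" and f: "hom_mod Q A w J f" shows "f \<zero> \<in> w"
 using hom_modD(3)[OF f A_zero submodD(2)[OF J]] hom_modD(1)[OF f submodD(2)[OF J]]
 by (simp add: minus_eq)

text \<open>An ideal $J$ need not contain a regular element. By the chain condition, a power of the regular element $x0$ moves
all values of $f$ into $w$; this allows an extension of $f$ to an ideal that contains a power of $x0$.\<close>

lemma inj_ideal: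
 assumes w: "submod Q A w" and Aw: "A \<subseteq> w" and inj: "inj_on_ideal w n"
  and J: "submod Q A J" "J \<subseteq> A"
 shows "inj_on_ideal w J"
 unfolding inj_on_ideal_def
proof (intro allI impI)
 fix f assume f: "hom_mod Q A w J f"
 obtain x0 where x0: "x0 \<in> n" "x0 \<in> Units Q" using ex_regular by blast
 have xA: "x0 \<in> A" using n_A x0 by blast
 note Jc = submodD(1)[OF J(1)] and fc = hom_modD(1)[OF f]
 have xp: "x0 [^] (k::nat) \<in> A" for k using A_pow[OF xA] .
 define F where "F k = {x \<in> J. x0 [^] k * f x \<in> w}" for k :: nat
 have F: "submod Q A (F k)" for k
  unfolding submod_def
 proof (intro conjI ballI subsetI)
  show "\<zero> \<in> F k" using submodD(2)[OF J(1)] submodD(4)[OF w xp hom_mod_zero[OF J(1) f]]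
   by (simp add: F_def)
 next
  fix x y assume "x \<in> F k" "y \<in> F k"
  then have h: "x \<in> J" "y \<in> J" "x0 [^] k * f x \<in> w" "x0 [^] k * f y \<in> w" by (auto simp: F_def)
  have xy: "x \<oplus> y \<in> J" using submodD(3)[OF J(1)] h by blast
  have "x0 [^] k * (f x \<oplus> f y) \<in> w"
   using submodD(3)[OF w h(3,4)] h xp fc by (simp add: r_distr)
  then have "x0 [^] k * f (x \<oplus> y) \<in> w"
   using cong_mem[OF w _ _ cong_mult[OF w _ _ xp hom_modD(2)[OF f h(1,2)]]] fc h xy xp by simp
  then show "x \<oplus> y \<in> F k" using xy by (simp add: F_def)
 next
  fix a x assume a: "a \<in> A" and "x \<in> F k"
  then have h: "x \<in> J" "x0 [^] k * f x \<in> w" by (auto simp: F_def)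
  have ax: "a * x \<in> J" using submodD(4)[OF J(1) a h(1)] .
  have "x0 [^] k * (a * f x) \<in> w"
   using submodD(4)[OF w a h(2)] a xp fc h by (simp add: m_lcomm)
  then have "x0 [^] k * f (a * x) \<in> w"
   using cong_mem[OF w _ _ cong_mult[OF w _ _ xp hom_modD(3)[OF f a h(1)]]] fc h a ax xp by simp
  then show "a * x \<in> F k" using ax by (simp add: F_def)
 qed (use Jc in \<open>auto simp: F_def\<close>)
 have step: "x0 [^] Suc k * z \<in> w" if "x0 [^] k * z \<in> w" "z \<in> |Q|" "submod Q A w" for k :: nat and z w
  using submodD(4)[OF that(3) xA that(1)] that(2) xA by (simp add: m_ac)
 have "\<exists>N. \<forall>i. F i \<subseteq> F N"
 proof (rule chain_stabilizes[OF F])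
  show "\<one> \<in> Units Q" by simp
  show "\<one> * x \<in> A" if "x \<in> F i" for i x using that J by (auto simp: F_def)
  show "F i \<subseteq> F (Suc i)" for i using step fc w by (auto simp: F_def simp del: nat_pow_Suc)
 qed
 then obtain K where K: "!!i. F i \<subseteq> F K" by blast
 have FK: "x0 [^] K * f x \<in> w" if x: "x \<in> J" for x
 proof -
  obtain d where d: "d \<in> A \<inter> Units Q" "d * f x \<in> A" using fractions[OF fc[OF x]] by blast
  obtain k a where k: "x0 [^] (k::nat) = d * a" "a \<in> A" using nilpotent[OF x0(1) d(1)] by blast
  have "x0 [^] k * f x = a * (d * f x)" using k d fc[OF x] by (simp add: m_ac)
  then have "x \<in> F k" using A_mult[OF k(2) d(2)] Aw x by (auto simp: F_def)
  then show ?thesis using K by (auto simp: F_def)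
 qed
 (* Bounds the exponent needed to bring a multiple of y into J, so 0 is a consistent value at y. *)
 define G where "G k = {a \<in> A. x0 [^] k * a \<in> J}" for k :: nat
 have G: "submod Q A (G k)" for k
  unfolding submod_def G_def using xp[of k] A_add A_mult A_zero submodD(2,3,4)[OF J(1)]
  by (auto simp: r_distr m_lcomm[of "x0 [^] k"])
 have "\<exists>N. \<forall>i. G i \<subseteq> G N"
 proof (rule chain_stabilizes[OF G])
  show "\<one> \<in> Units Q" by simp
  show "\<one> * x \<in> A" if "x \<in> G i" for i x using that by (auto simp: G_def)
  show "G i \<subseteq> G (Suc i)" for i using step J by (auto simp: G_def simp del: nat_pow_Suc)
 qed
 then obtain L where L: "!!i. G i \<subseteq> G L" by blast
 define y where "y = x0 [^] (K + L)"
 have yA: "y \<in> A" and yU: "y \<in> Units Q" using xp Units_pow[OF x0(2)] by (auto simp: y_def)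
 have yc: "y \<in> |Q|" using yA by blast
 have comp: "f (r * y) \<ominus> r * \<zero> \<in> w" if r: "r \<in> A" "r * y \<in> J" for r
 proof -
  have "r \<in> G (K + L)" using r m_comm[of r y] yc by (auto simp: G_def y_def)
  then have rL: "x0 [^] L * r \<in> J" using L by (auto simp: G_def)
  have e: "x0 [^] K * (x0 [^] L * r) = r * y"
  proof -
   have "x0 [^] K * (x0 [^] L * r) = (x0 [^] K * x0 [^] L) * r" using r xA by (simp add: m_assoc)
   also have "\<dots> = y * r" using xA by (simp add: y_def nat_pow_mult)
   finally show ?thesis using r yc by (simp add: m_comm)
  qed
  have "f (r * y) \<ominus> x0 [^] K * f (x0 [^] L * r) \<in> w"
   using hom_modD(3)[OF f xp[of K] rL] e by simp
  then have "f (r * y) \<in> w" using cong_mem[OF w _ FK[OF rL]] fc[OF r(2)] by blast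
  then show ?thesis using r fc[OF r(2)] by (simp add: minus_eq)
 qed
 let ?M = "{j \<oplus> r * y |j r. j \<in> J \<and> r \<in> A}"
 obtain g where g: "hom_mod Q A w ?M g"
  "!!j r. j \<in> J ==> r \<in> A ==> g (j \<oplus> r * y) \<ominus> (f j \<oplus> r * \<zero>) \<in> w"
  using extend_adjoin[OF w J(1) f yc zero_closed comp] by blast
 have MA: "?M \<subseteq> A" using J(2) yA by (auto intro!: A_add A_mult)
 define M where "M = ?M"
 have "submod Q A M" "M \<subseteq> A" "y \<in> M" and gM: "hom_mod Q A w M g"
  unfolding M_def using submod_adjoin[OF J(1) yc subA] MA mem_adjoin[OF J(1) yc] g(1) by simp_all
 then have "inj_on_ideal w M" using inj_regular[OF w inj _ _ _ yU] by blast
 then obtain c where c: "c \<in> |Q|" "!!x. x \<in> M ==> g x \<ominus> x * c \<in> w"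
  using gM unfolding inj_on_ideal_def by blast
 have "f x \<ominus> x * c \<in> w" if x: "x \<in> J" for x
 proof -
  have xM: "x \<in> M" using subset_adjoin[OF J(1) yc subA] x by (auto simp: M_def)
  have carr: "x \<in> |Q|" "f x \<in> |Q|" "g x \<in> |Q|" using Jc fc x hom_modD(1)[OF gM xM] by auto
  have "g x \<ominus> f x \<in> w" using g(2)[OF x A_zero] carr yc by simp
  then show ?thesis using cong_trans[OF w _ _ _ cong_sym[OF w] c(2)[OF xM]] carr c(1) by simp
 qed
 then show "\<exists>c\<in>carrier Q. \<forall>x\<in>J. f x \<ominus> x * c \<in> w" using c(1) by blast
qed

text \<open>Baer's criterion for submodules $K$ of \<open>A\<^sup>p\<close>, by induction on $p$: the vectors of $K$ with only the last coordinate
nonzero give an ideal, on which the homomorphism is multiplication by an element; subtract that multiplication.\<close>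

lemma inj_vectors:
 assumes w: "submod Q A w" and Aw: "A \<subseteq> w" and inj: "inj_on_ideal w n"
  and K0: "(%_. \<zero>) \<in> K" and Kadd: "!!u v. u \<in> K ==> v \<in> K ==> (%j. u j \<oplus> v j) \<in> K"
  and Ksm: "!!a v. a \<in> A ==> v \<in> K ==> (%j. a * v j) \<in> K"
 shows "\<lbrakk>!!v j. v \<in> K ==> j < p ==> v j \<in> A;
   !!v. v \<in> K ==> f v \<in> |Q|;
   !!u v. u \<in> K ==> v \<in> K ==> f (%j. u j \<oplus> v j) \<ominus> (f u \<oplus> f v) \<in> w;
   !!a v. a \<in> A ==> v \<in> K ==> f (%j. a * v j) \<ominus> a * f v \<in> w;
   !!v. v \<in> K ==> (\<forall>j<p. v j = \<zero>) ==> f v \<in> w\<rbrakk>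
  \<Longrightarrow> \<exists>u. (\<forall>j<p. u j \<in> |Q| ) \<and> (\<forall>v\<in>K. f v \<ominus> dot Q p v u \<in> w)"
proof (induction p arbitrary: f)
 case 0
 have "f v \<ominus> \<zero> \<in> w" if "v \<in> K" for v
  using 0(5)[OF that] 0(2)[OF that] by (simp add: minus_eq)
 then show ?case by simp
next
 case (Suc p)
 note KA = Suc.prems(1) and fc = Suc.prems(2) and fadd = Suc.prems(3) and fsm = Suc.prems(4)
  and fz = Suc.prems(5)
 define K' where "K' = {v \<in> K. \<forall>j<p. v j = \<zero>}"
 define J where "J = (%v. v p) ` K'"
 define sel where "sel a = (SOME v. v \<in> K' \<and> v p = a)" for a
 have sel: "sel a \<in> K'" "sel a p = a" if a: "a \<in> J" for a
 proof -
  obtain v where "v \<in> K' \<and> v p = a" using a by (auto simp: J_def)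
  then have "sel a \<in> K' \<and> sel a p = a" unfolding sel_def by (rule someI[of "%v. v \<in> K' \<and> v p = a"])
  then show "sel a \<in> K'" "sel a p = a" by auto
 qed
 have K'K: "v \<in> K' ==> v \<in> K" for v by (simp add: K'_def)
 have pc: "v p \<in> A" if "v \<in> K" for v using KA[OF that] by simp
 have K'0: "(%_. \<zero>) \<in> K'" and K'add: "!!u v. u \<in> K' ==> v \<in> K' ==> (%j. u j \<oplus> v j) \<in> K'"
  and K'sm: "!!a v. a \<in> A ==> v \<in> K' ==> (%j. a * v j) \<in> K'"
  using K0 Kadd Ksm by (auto simp: K'_def)
 have J: "submod Q A J" unfolding submod_def
 proof (intro conjI ballI subsetI)
  show "\<zero> \<in> J" unfolding J_def using K'0 by (rule rev_image_eqI) simp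
 next
  fix x assume "x \<in> J" then show "x \<in> |Q|" using pc K'K by (auto simp: J_def)
 next
  fix x y assume "x \<in> J" "y \<in> J"
  then show "x \<oplus> y \<in> J" unfolding J_def using K'add by (auto intro: rev_image_eqI)
 next
  fix a x assume "a \<in> A" "x \<in> J"
  then show "a * x \<in> J" unfolding J_def using K'sm by (auto intro: rev_image_eqI)
 qed
 have JA: "J \<subseteq> A" using pc K'K by (auto simp: J_def)
 define g where "g a = f (sel a)" for a
 have fg: "f v \<ominus> g (v p) \<in> w" if v: "v \<in> K'" for v
 proof -
  define s where "s = sel (v p)"
  have vp: "v p \<in> J" using v by (simp add: J_def)
  have s: "s \<in> K'" "s p = v p" using sel[OF vp] by (auto simp: s_def)
  define t where "t = (%j. v j \<oplus> \<ominus> \<one> * s j)"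
  have nsK: "(%j. \<ominus> \<one> * s j) \<in> K'" using K'sm[OF neg_A s(1)] .
  have tK: "t \<in> K'" using K'add[OF v nsK] by (simp add: t_def)
  have vc: "v p \<in> |Q|" using pc K'K v by blast
  have "t p = \<zero>" using vc s by (simp add: t_def l_minus r_neg)
  then have "\<forall>j<Suc p. t j = \<zero>" using tK by (auto simp: K'_def less_Suc_eq)
  then have ft: "f t \<in> w" using fz K'K tK by blast
  have carr: "f v \<in> |Q|" "f s \<in> |Q|" "f t \<in> |Q|" "f (%j. \<ominus> \<one> * s j) \<in> |Q|"
   using fc K'K v s tK nsK by auto
  have 1: "f t \<ominus> (f v \<oplus> f (%j. \<ominus> \<one> * s j)) \<in> w" using fadd K'K v nsK by (simp add: t_def)
  have 2: "f (%j. \<ominus> \<one> * s j) \<ominus> \<ominus> \<one> * f s \<in> w" using fsm neg_A K'K s by blast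
  have 3: "(f v \<oplus> f (%j. \<ominus> \<one> * s j)) \<ominus> (f v \<oplus> \<ominus> \<one> * f s) \<in> w"
   using cong_add[OF w _ _ _ _ cong_refl[OF w] 2] carr by simp
  have "f t \<ominus> (f v \<oplus> \<ominus> \<one> * f s) \<in> w" using cong_trans[OF w _ _ _ 1 3] carr by simp
  then have "f v \<oplus> \<ominus> \<one> * f s \<in> w"
   using cong_mem[OF w _ ft cong_sym[OF w]] carr by simp
  then show ?thesis using carr by (simp add: g_def s_def minus_eq l_minus)
 qed
 have gc: "g a \<in> |Q|" if "a \<in> J" for a using fc K'K sel that by (simp add: g_def)
 have "hom_mod Q A w J g" unfolding hom_mod_def
 proof (intro conjI ballI)
  fix a b assume ab: "a \<in> J" "b \<in> J"
  let ?s = "%j. sel a j \<oplus> sel b j"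
  have s: "?s \<in> K'" using K'add sel ab by blast
  have 1: "f ?s \<ominus> g (a \<oplus> b) \<in> w" using fg[OF s] sel ab by simp
  have 2: "f ?s \<ominus> (g a \<oplus> g b) \<in> w" using fadd K'K sel ab by (simp add: g_def)
  show "g (a \<oplus> b) \<ominus> (g a \<oplus> g b) \<in> w"
   using cong_trans[OF w _ _ _ cong_sym[OF w _ _ 1] 2] fc[OF K'K[OF s]] gc ab submodD(3)[OF J ab] by simp
 next
  fix a b assume ab: "a \<in> A" "b \<in> J"
  let ?s = "%j. a * sel b j"
  have s: "?s \<in> K'" using K'sm sel ab by blast
  have 1: "f ?s \<ominus> g (a * b) \<in> w" using fg[OF s] sel ab by simp
  have 2: "f ?s \<ominus> (a * g b) \<in> w" using fsm K'K sel ab by (simp add: g_def)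
  show "g (a * b) \<ominus> (a * g b) \<in> w"
   using cong_trans[OF w _ _ _ cong_sym[OF w _ _ 1] 2] fc[OF K'K[OF s]] gc ab submodD(4)[OF J ab] by simp
 qed (use gc in auto)
 then obtain c where c: "c \<in> |Q|" "!!x. x \<in> J ==> g x \<ominus> x * c \<in> w"
  using inj_ideal[OF w Aw inj J JA] unfolding inj_on_ideal_def by blast
 define f' where "f' v = f v \<ominus> v p * c" for v
 have "\<exists>u. (\<forall>j<p. u j \<in> |Q| ) \<and> (\<forall>v\<in>K. f' v \<ominus> dot Q p v u \<in> w)"
 proof (rule Suc.IH)
  show "!!v j. v \<in> K ==> j < p ==> v j \<in> A" using KA by simp
  show f'c: "f' v \<in> |Q|" if "v \<in> K" for v using that fc pc c by (simp add: f'_def)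
 next
  fix u v assume uv: "u \<in> K" "v \<in> K"
  have carr: "u p \<in> |Q|" "v p \<in> |Q|" "f u \<in> |Q|" "f v \<in> |Q|"
   "f (%j. u j \<oplus> v j) \<in> |Q|"
   using uv pc fc Kadd by auto
  have "e \<ominus> (x \<oplus> y) * c \<ominus> ((s \<ominus> x * c) \<oplus> (t \<ominus> y * c)) = e \<ominus> (s \<oplus> t)"
   if "e \<in> |Q|" "x \<in> |Q|" "y \<in> |Q|" "s \<in> |Q|" "t \<in> |Q|" for e x y s t
   using that c(1) by algebra
  then have "f' (%j. u j \<oplus> v j) \<ominus> (f' u \<oplus> f' v) = f (%j. u j \<oplus> v j) \<ominus> (f u \<oplus> f v)"
   unfolding f'_def using carr by simp
  then show "f' (%j. u j \<oplus> v j) \<ominus> (f' u \<oplus> f' v) \<in> w" using fadd uv by simp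
 next
  fix a v assume uv: "a \<in> A" "v \<in> K"
  have carr: "a \<in> |Q|" "v p \<in> |Q|" "f v \<in> |Q|"
   "f (%j. a * v j) \<in> |Q|"
   using uv pc fc Ksm by auto
  have "e \<ominus> (a * x) * c \<ominus> a * (s \<ominus> x * c) = e \<ominus> a * s"
   if "e \<in> |Q|" "x \<in> |Q|" "s \<in> |Q|" for e x s
   using that carr(1) c(1) by algebra
  then have "f' (%j. a * v j) \<ominus> a * f' v = f (%j. a * v j) \<ominus> a * f v"
   unfolding f'_def using carr by simp
  then show "f' (%j. a * v j) \<ominus> a * f' v \<in> w" using fsm uv by simp
 next
  fix v assume v: "v \<in> K" "\<forall>j<p. v j = \<zero>"
  then have vK: "v \<in> K'" by (simp add: K'_def)
  then have vp: "v p \<in> J" by (simp add: J_def)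
  show "f' v \<in> w" unfolding f'_def
   using cong_trans[OF w _ _ _ fg[OF vK] c(2)[OF vp]] fc[OF v(1)] gc[OF vp] pc[OF v(1)] c(1) by simp
 qed
 then obtain u where u: "!!j. j < p ==> u j \<in> |Q|" "!!v. v \<in> K ==> f' v \<ominus> dot Q p v u \<in> w" by blast
 define u' where "u' = u(p := c)"
 have "f v \<ominus> dot Q (Suc p) v u' \<in> w" if v: "v \<in> K" for v
 proof -
  have d: "dot Q p v u \<in> |Q|" by (rule dot_closed) (use u KA[OF v] in auto)
  have "dot Q (Suc p) v u' = v p * u' p \<oplus> dot Q p v u'"
   by (rule dot_Suc) (use u c KA[OF v] in \<open>auto simp: u'_def\<close>)
  also have "dot Q p v u' = dot Q p v u"
   by (rule dot_cong) (use u c KA[OF v] in \<open>auto simp: u'_def\<close>)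
  also have "u' p = c" by (simp add: u'_def)
  finally have "f v \<ominus> dot Q (Suc p) v u' = f v \<ominus> (v p * c \<oplus> dot Q p v u)" by simp
  also have "\<dots> = f' v \<ominus> dot Q p v u"
   unfolding f'_def using fc[OF v] A_carr[OF pc[OF v]] c(1) d by algebra
  finally show ?thesis using u(2)[OF v] by simp
 qed
 moreover have "\<forall>j<Suc p. u' j \<in> |Q|" using u c by (simp add: u'_def)
 ultimately show ?case by blast
qed

end

context one_dim_frac
begin

subsection \<open>Regular fractional ideals and duality\<close>

text \<open>The fractional ideals that contain an invertible element of $Q$; duality is perfect on them.\<close>

definition regfrac where
 "regfrac J \<longleftrightarrow> submod Q A J \<and> (\<exists>y\<in>J. y \<in> Units Q) \<and> (\<exists>d\<in>A \<inter> Units Q. \<forall>x\<in>J. d * x \<in> A)"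

lemma regfracD:
 assumes "regfrac J"
 shows "submod Q A J" "\<exists>y\<in>J. y \<in> Units Q" "\<exists>d\<in>A \<inter> Units Q. \<forall>x\<in>J. d * x \<in> A"
 using assms by (auto simp: regfrac_def)

lemma Units_carr: "x \<in> Units Q ==> x \<in> |Q|" by blast

lemma regfrac_common:
 assumes J: "regfrac J" and K: "regfrac K"
 shows "\<exists>d\<in>A \<inter> Units Q. \<forall>x\<in>K. d * x \<in> J"
proof -
 obtain y where y: "y \<in> J" "y \<in> Units Q" using regfracD(2)[OF J] by blast
 obtain e where e: "e \<in> A \<inter> Units Q" "e * y \<in> A" using fractions[OF Units_carr[OF y(2)]] by blast
 obtain d where d: "d \<in> A \<inter> Units Q" "!!x. x \<in> K ==> d * x \<in> A" using regfracD(3)[OF K] by blast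
 have carr: "y \<in> |Q|" "e \<in> |Q|" "d \<in> |Q|" using y e d by auto
 have "(e * y) * d \<in> A \<inter> Units Q" using e d y A_mult by auto
 moreover have "(e * y) * d * x \<in> J" if x: "x \<in> K" for x
 proof -
  have xc: "x \<in> |Q|" using x regfracD(1)[OF K] submodD(1) by blast
  have "(e * y) * d * x = (e * (d * x)) * y" using carr xc by (simp add: m_ac)
  then show ?thesis using submodD(4)[OF regfracD(1)[OF J] A_mult[OF _ d(2)[OF x]] y(1)] e by simp
 qed
 ultimately show ?thesis by blast
qed

lemma colon_submod: "submod Q A w ==> J \<subseteq> |Q| ==> submod Q A (colon Q w J)"
 unfolding submod_def colon_def by (auto simp: l_distr m_assoc subset_iff)

lemma colonD: "q \<in> colon Q w J ==> q \<in> |Q|" "q \<in> colon Q w J ==> y \<in> J ==> q * y \<in> w"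
 by (auto simp: colon_def)

lemma dualizingD:
 assumes "dualizing Q A n w"
 shows "submod Q A w" "A \<subseteq> w" "regfrac w" "inj_on_ideal w n"
  "\<exists>s\<in>colon Q w n. s \<notin> w \<and> (\<forall>q\<in>colon Q w n. \<exists>a\<in>A. q \<ominus> a * s \<in> w)"
proof -
 show w: "submod Q A w" "A \<subseteq> w" "inj_on_ideal w n"
  "\<exists>s\<in>colon Q w n. s \<notin> w \<and> (\<forall>q\<in>colon Q w n. \<exists>a\<in>A. q \<ominus> a * s \<in> w)"
  using assms unfolding dualizing_def inj_on_ideal_def by simp_all
 have "\<one> \<in> w" "\<one> \<in> Units Q" using w(2) one_A by auto
 then show "regfrac w" using assms unfolding dualizing_def regfrac_def by blast
qed

lemma colon_regfrac:
 assumes w: "regfrac w" and J: "regfrac J" shows "regfrac (colon Q w J)"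
proof -
 obtain d where d: "d \<in> A \<inter> Units Q" "!!x. x \<in> J ==> d * x \<in> w" using regfrac_common[OF w J] by blast
 obtain y where y: "y \<in> J" "y \<in> Units Q" using regfracD(2)[OF J] by blast
 obtain e where e: "e \<in> A \<inter> Units Q" "e * y \<in> A" using fractions[OF Units_carr[OF y(2)]] by blast
 obtain f where f: "f \<in> A \<inter> Units Q" "!!x. x \<in> w ==> f * x \<in> A" using regfracD(3)[OF w] by blast
 have Jc: "J \<subseteq> |Q|" using regfracD(1)[OF J] submodD(1) by blast
 have "d \<in> colon Q w J" using d by (auto simp: colon_def)
 moreover have "e * y * f \<in> A \<inter> Units Q" using e y f A_mult by auto
 moreover have "e * y * f * q \<in> A" if "q \<in> colon Q w J" for q
 proof -
  have q: "q \<in> |Q|" "q * y \<in> w" using that y by (auto simp: colon_def)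
  have "e * y * f * q = e * (f * (q * y))" using q e y f by (simp add: m_ac Units_carr)
  then show ?thesis using A_mult e f(2)[OF q(2)] by simp
 qed
 ultimately show ?thesis using colon_submod[OF regfracD(1)[OF w] Jc] d unfolding regfrac_def by blast
qed

text \<open>A socle element $y$ of $K / J$ spans a copy of the residue field. Sending it to the generator $s$ of $(w : n) / w$ and $J$ to
zero is a homomorphism modulo $w$; extended by injectivity, it is multiplication by some $q$ that lies in $w : J$ but
not in $w : K$.\<close>

lemma colon_strict:
 assumes D: "dualizing Q A n w" and J: "regfrac J" and K: "regfrac K" and JK: "J \<subseteq> K" "J \<noteq> K"
 shows "\<exists>q\<in>colon Q w J. q \<notin> colon Q w K"
proof -
 note w = dualizingD(1)[OF D] and Aw = dualizingD(2)[OF D] and inj = dualizingD(4)[OF D]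
 obtain s where s: "s \<in> colon Q w n" "s \<notin> w" using dualizingD(5)[OF D] by blast
 have sc: "s \<in> |Q|" using s colonD by blast
 note J' = regfracD(1)[OF J] and K' = regfracD(1)[OF K]
 obtain e where e: "e \<in> A \<inter> Units Q" "!!x. x \<in> K ==> e * x \<in> J" using regfrac_common[OF J K] by blast
 obtain y0 where y0: "y0 \<in> K" "y0 \<notin> J" using JK by blast
 have "\<exists>y\<in>K. y \<notin> J \<and> (\<forall>r\<in>n. r * y \<in> J)"
  using socle_element[OF J' K' JK(1) y0 e(1)] e(2) by blast
 then obtain y where y: "y \<in> K" "y \<notin> J" "!!r. r \<in> n ==> r * y \<in> J" by blast
 have yc: "y \<in> |Q|" using submodD(1)[OF K' y(1)] .
 have f0: "hom_mod Q A w J (%_. \<zero>)" unfolding hom_mod_def using submodD(2)[OF w] by (auto simp: minus_eq)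
 have comp: "\<zero> \<ominus> r * s \<in> w" if "r \<in> A" "r * y \<in> J" for r
 proof -
  have "r \<in> n" using mem_n_if_mult[OF J' yc y(2) that] .
  then have "s * r \<in> w" using s colonD by blast
  then show ?thesis using submod_neg[OF w] that sc by (simp add: minus_eq m_comm)
 qed
 define L where "L = {j \<oplus> r * y |j r. j \<in> J \<and> r \<in> A}"
 obtain g where g: "hom_mod Q A w L g"
  and g2: "!!j r. j \<in> J ==> r \<in> A ==> g (j \<oplus> r * y) \<ominus> (\<zero> \<oplus> r * s) \<in> w"
  using extend_adjoin[OF w J' f0 yc sc comp] unfolding L_def by blast
 have L: "submod Q A L" unfolding L_def by (rule submod_adjoin[OF J' yc subA])
 have JL: "J \<subseteq> L" unfolding L_def by (rule subset_adjoin[OF J' yc subA])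
 have yL: "y \<in> L" unfolding L_def by (rule mem_adjoin[OF J' yc])
 have LK: "L \<subseteq> K" unfolding L_def using submodD(3)[OF K'] submodD(4)[OF K' _ y(1)] JK(1) by auto
 obtain d where d: "d \<in> A \<inter> Units Q" "!!x. x \<in> K ==> d * x \<in> A" using regfracD(3)[OF K] by blast
 have dU: "d \<in> Units Q" and dc: "d \<in> |Q|" using d by auto
 note Lc = submodD(1)[OF L]
 define B where "B = (%x. d * x) ` L"
 define h where "h x = g (inv d * x)" for x
 have hd: "h (d * x) = g x" if "x \<in> L" for x
 proof -
  have "inv d * (d * x) = (inv d * d) * x" using Lc[OF that] dU by (intro m_assoc[symmetric]) auto
  then show ?thesis using Lc[OF that] dU by (simp add: h_def)
 qed
 have B: "submod Q A B" unfolding B_def using submod_scale[OF L dc] .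
 have "hom_mod Q A w B h"
  unfolding hom_mod_def
 proof (intro conjI ballI)
  fix x assume "x \<in> B" then show "h x \<in> |Q|" using hd hom_modD(1)[OF g] by (auto simp: B_def)
 next
  fix x y assume "x \<in> B" "y \<in> B"
  then obtain u v where uv: "u \<in> L" "v \<in> L" "x = d * u" "y = d * v" by (auto simp: B_def)
  have "x \<oplus> y = d * (u \<oplus> v)" using uv Lc dc by (simp add: r_distr)
  then show "h (x \<oplus> y) \<ominus> (h x \<oplus> h y) \<in> w"
   using hom_modD(2)[OF g uv(1,2)] hd uv submodD(3)[OF L uv(1,2)] by simp
 next
  fix a x assume a: "a \<in> A" "x \<in> B"
  then obtain u where uv: "u \<in> L" "x = d * u" by (auto simp: B_def)
  have "a * x = d * (a * u)" using uv a Lc dc by (simp add: m_lcomm)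
  then show "h (a * x) \<ominus> a * h x \<in> w"
   using hom_modD(3)[OF g a(1) uv(1)] hd uv submodD(4)[OF L a(1) uv(1)] by simp
 qed
 moreover have "B \<subseteq> A" using d LK by (auto simp: B_def)
 ultimately obtain c where c: "c \<in> |Q|" "!!x. x \<in> B ==> h x \<ominus> x * c \<in> w"
  using inj_ideal[OF w Aw inj B] unfolding inj_on_ideal_def by blast
 define q where "q = d * c"
 have qc: "q \<in> |Q|" using c dc by (simp add: q_def)
 have gq: "g x \<ominus> q * x \<in> w" if x: "x \<in> L" for x
 proof -
  have "d * x \<in> B" using x by (simp add: B_def)
  then have "g x \<ominus> (d * x) * c \<in> w" using c(2) hd[OF x] by metis
  moreover have "(d * x) * c = q * x" using Lc[OF x] dc c by (simp add: q_def m_ac)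
  ultimately show ?thesis by simp
 qed
 note gc = hom_modD(1)[OF g]
 have "q * j \<in> w" if j: "j \<in> J" for j
 proof -
  have jL: "j \<in> L" using j JL by blast
  have "g j \<in> w" using g2[OF j A_zero] Lc[OF jL] yc sc gc[OF jL] by (simp add: minus_eq)
  then show ?thesis using cong_mem[OF w _ _ cong_sym[OF w _ _ gq[OF jL]]] qc Lc[OF jL] gc[OF jL] by simp
 qed
 then have "q \<in> colon Q w J" using qc by (auto simp: colon_def)
 moreover have "q \<notin> colon Q w K"
 proof
  assume "q \<in> colon Q w K"
  then have qy: "q * y \<in> w" using y colonD by blast
  have "g y \<in> w" using cong_mem[OF w _ qy gq[OF yL]] gc[OF yL] by simp
  moreover have "g y \<ominus> s \<in> w" using g2[OF submodD(2)[OF J'] one_A] yc sc by simp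
  ultimately have "s \<in> w" using cong_mem[OF w sc _ cong_sym[OF w]] gc[OF yL] sc by simp
  then show False using s by blast
 qed
 ultimately show ?thesis by blast
qed

text \<open>Passing from $J$ to its bidual does not change the dual, so strictness of the duality forces equality.\<close>

lemma colon_colon:
 assumes D: "dualizing Q A n w" and J: "regfrac J" shows "colon Q w (colon Q w J) = J"
proof (rule ccontr)
 assume ne: "colon Q w (colon Q w J) \<noteq> J"
 note w = dualizingD(3)[OF D]
 have Jc: "x \<in> J ==> x \<in> |Q|" for x using submodD(1)[OF regfracD(1)[OF J]] .
 have sub: "J \<subseteq> colon Q w (colon Q w J)"
  using Jc by (auto simp: colon_def m_comm)
 obtain q where "q \<in> colon Q w J" "q \<notin> colon Q w (colon Q w (colon Q w J))"
  using colon_strict[OF D J colon_regfrac[OF w colon_regfrac[OF w J]] sub] ne by blast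
 then show False by (auto simp: colon_def m_comm)
qed

text \<open>The module $D = w1 : w2$ is cyclic. Its submodule $M = w1 : (w2 : n)$ is proper; take $u$ in $D$ outside $M$. If $u$ did not
generate $D$, a maximal proper submodule $E$ of $D$ containing $u$ would contain $nD$, hence its dual would lie between
$w2$ and $w2 : n$; as $(w2 : n) / w2$ is simple, the dual would be all of $w2 : n$, which puts $u$ into $M$. A generator
of $D$ is invertible because $D$ contains an invertible element.\<close>

lemma dualizing_unique:
 assumes D1: "dualizing Q A n w1" and D2: "dualizing Q A n w2"
 shows "\<exists>u\<in>Units Q. w2 = (%x. u * x) ` w1"
proof -
 note w1 = dualizingD(1)[OF D1] and r1 = dualizingD(3)[OF D1]
 note w2 = dualizingD(1)[OF D2] and r2 = dualizingD(3)[OF D2]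
 (* The isomorphisms of w1 and w2 are multiplications by generators of D. *)
 define D where "D = colon Q w1 w2"
 have rD: "regfrac D" unfolding D_def using colon_regfrac[OF r1 r2] .
 note sD = regfracD(1)[OF rD]
 note Dc = submodD(1)[OF sD]
 have DD: "colon Q w1 D = w2" unfolding D_def by (rule colon_colon[OF D1 r2])
 obtain x0 where x0: "x0 \<in> n" "x0 \<in> Units Q" using ex_regular by blast
 have rn: "regfrac n" unfolding regfrac_def
 proof (intro conjI)
  show "\<exists>d\<in>A \<inter> Units Q. \<forall>x\<in>n. d * x \<in> A"
   by (rule bexI[of _ \<one>]) (use n_A one_A in auto)
 qed (use sub_n x0 in auto)
 obtain s where s: "s \<in> colon Q w2 n" "s \<notin> w2" "!!q. q \<in> colon Q w2 n ==> \<exists>a\<in>A. q \<ominus> a * s \<in> w2"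
  using dualizingD(5)[OF D2] by blast
 define M where "M = colon Q w1 (colon Q w2 n)"
 have rc: "regfrac (colon Q w2 n)" using colon_regfrac[OF r2 rn] .
 have w2c: "w2 \<subseteq> colon Q w2 n"
 proof
  fix x assume x: "x \<in> w2"
  have "x * r \<in> w2" if "r \<in> n" for r
   using submodD(4)[OF w2 n_A[OF that] x] submodD(1)[OF w2 x] that by (simp add: m_comm)
  then show "x \<in> colon Q w2 n" using submodD(1)[OF w2 x] by (auto simp: colon_def)
 qed
 have MD: "M \<subseteq> D" unfolding M_def D_def using w2c by (auto simp: colon_def)
 have "M \<noteq> D"
 proof
  assume "M = D"
  then have "colon Q w2 n = w2" using DD colon_colon[OF D1 rc] by (simp add: M_def)
  then show False using s by blast
 qed
 then obtain u where u: "u \<in> D" "u \<notin> M" using MD by blast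
 have uc: "u \<in> |Q|" using Dc u by blast
 define U where "U = (%a. u * a) ` A"
 have sU: "submod Q A U" unfolding U_def by (rule submod_scale[OF subA uc])
 have uU: "u \<in> U" unfolding U_def using one_A uc by force
 have UD: "U \<subseteq> D" using submodD(4)[OF sD _ u(1)] uc by (auto simp: U_def m_comm)
 have "U = D"
 proof (rule ccontr)
  assume UD': "U \<noteq> D"
  (* A proper submodule of D that contains u, enlarged to a maximal one, E. *)
  define C where "C = {E. submod Q A E \<and> u \<in> E \<and> E \<subseteq> D \<and> E \<noteq> D}"
  obtain d where d: "d \<in> A \<inter> Units Q" "!!x. x \<in> D ==> d * x \<in> A" using regfracD(3)[OF rD] by blast
  have "\<exists>M\<in>C. \<forall>J\<in>C. M \<subseteq> J --> J = M"
   by (rule noetherian_frac[of _ d]) (use d sU uU UD UD' in \<open>auto simp: C_def\<close>)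
  then obtain E where EC: "E \<in> C" and max: "!!J. J \<in> C ==> E \<subseteq> J ==> J = E" by auto
  have E: "submod Q A E" "u \<in> E" "E \<subseteq> D" "E \<noteq> D" using EC by (auto simp: C_def)
  then obtain y where y: "y \<in> D" "y \<notin> E" by blast
  have yc: "y \<in> |Q|" using Dc y by blast
  have adj: "{j \<oplus> r * y |j r. j \<in> E \<and> r \<in> B} \<subseteq> D" if "B \<subseteq> A" for B
   using E(3) that by (auto intro!: submodD(3)[OF sD] submodD(4)[OF sD _ y(1)])
  have gen: "{j \<oplus> r * y |j r. j \<in> E \<and> r \<in> A} = D"
  proof (rule ccontr)
   define L where "L = {j \<oplus> r * y |j r. j \<in> E \<and> r \<in> A}"
   assume "{j \<oplus> r * y |j r. j \<in> E \<and> r \<in> A} \<noteq> D"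
   then have LD: "L \<noteq> D" by (simp add: L_def)
   have L: "submod Q A L" "L \<subseteq> D" "E \<subseteq> L" "y \<in> L"
    unfolding L_def using submod_adjoin[OF E(1) yc subA] adj[OF subset_refl]
     subset_adjoin[OF E(1) yc subA] mem_adjoin[OF E(1) yc] by simp_all
   then have "L \<in> C" using LD E(2) unfolding C_def by blast
   then show False using max L y by blast
  qed
  (* D / E is simple, so n kills it (Nakayama). *)
  have ny: "r * y \<in> E" if r: "r \<in> n" for r
  proof -
   define L where "L = {j \<oplus> r * y |j r. j \<in> E \<and> r \<in> n}"
   have nA: "n \<subseteq> A" using n_A by blast
   have rL: "r * y \<in> L" unfolding L_def
    by (intro CollectI exI[of _ \<zero>] exI[of _ r]) (use r yc submodD(2)[OF E(1)] in auto)
   have L: "submod Q A L" "L \<subseteq> D" "E \<subseteq> L"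
    unfolding L_def using submod_adjoin[OF E(1) yc sub_n] adj[OF nA]
     subset_adjoin[OF E(1) yc sub_n] by simp_all
   have LD: "L \<noteq> D"
   proof
    assume "L = D"
    then have "y \<in> L" using y by simp
    then obtain j t where jt: "j \<in> E" "t \<in> n" "y = j \<oplus> t * y" unfolding L_def by blast
    have jc: "j \<in> |Q|" using submodD(1)[OF E(1) jt(1)] .
    have tc: "t \<in> |Q|" using jt(2) by simp
    have "(\<one> \<ominus> t) * y = y \<ominus> t * y" using yc tc by algebra
    also have "\<dots> = (j \<oplus> t * y) \<ominus> t * y" using jt(3) by simp
    also have "\<dots> = j" using jc yc tc by algebra
    finally have "(\<one> \<ominus> t) * y \<in> E" using jt by simp
    then have 1: "\<one> \<ominus> t \<in> n" using mem_n_if_mult[OF E(1) yc y(2)] A_minus one_A n_A jt by blast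
    have "(\<one> \<ominus> t) \<oplus> t = \<one>" using tc by algebra
    then have "\<one> \<in> n" using submodD(3)[OF sub_n 1 jt(2)] by simp
    then show False using one_notin_n by blast
   qed
   then have "L \<in> C" using L E(2) unfolding C_def by blast
   then have "L = E" using max L by blast
   then show ?thesis using rL by simp
  qed
  have nD: "r * x \<in> E" if r: "r \<in> n" and x: "x \<in> D" for r x
  proof -
   obtain j t where jt: "j \<in> E" "t \<in> A" "x = j \<oplus> t * y" using x gen by blast
   have jc: "j \<in> |Q|" using submodD(1)[OF E(1) jt(1)] .
   have "r * x = r * j \<oplus> t * (r * y)" using jc yc r jt by (simp add: r_distr m_lcomm)
   then show ?thesis using submodD(3)[OF E(1) submodD(4)[OF E(1) n_A[OF r] jt(1)] submodD(4)[OF E(1) jt(2) ny[OF r]]]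
    by simp
  qed
  obtain z where z: "z \<in> D" "z \<in> Units Q" using regfracD(2)[OF rD] by blast
  have "x0 * z \<in> E" "x0 * z \<in> Units Q" using nD[OF x0(1) z(1)] x0 z by auto
  then have rE: "regfrac E" unfolding regfrac_def using E(1,3) d by blast
  (* q is in w2 : n outside w2, so it generates the same socle as s. *)
  obtain q where q: "q \<in> colon Q w1 E" "q \<notin> colon Q w1 D" using colon_strict[OF D1 rE rD E(3,4)] by blast
  have qc: "q \<in> |Q|" using q colonD by blast
  have qw: "q \<notin> w2" using q DD by simp
  have w2E: "w2 \<subseteq> colon Q w1 E" using DD E(3) by (auto simp: colon_def)
  have sE: "submod Q A (colon Q w1 E)" using colon_submod[OF w1] E(3) Dc by blast
  have qn: "q \<in> colon Q w2 n"
  proof -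
   have "q * r \<in> w2" if r: "r \<in> n" for r
   proof -
    have "(q * r) * x \<in> w1" if x: "x \<in> D" for x
     using colonD(2)[OF q(1) nD[OF r x]] qc r Dc[OF x] by (simp add: m_assoc)
    then have "q * r \<in> colon Q w1 D" using qc r by (auto simp: colon_def)
    then show ?thesis using DD by simp
   qed
   then show ?thesis using qc by (auto simp: colon_def)
  qed
  obtain a where a: "a \<in> A" "q \<ominus> a * s \<in> w2" using s(3)[OF qn] by blast
  have sc: "s \<in> |Q|" using s colonD by blast
  have ac: "a \<in> |Q|" using a by blast
  have "a \<notin> n"
  proof
   assume "a \<in> n"
   then have "a * s \<in> w2" using colonD(2)[OF s(1), of a] ac sc by (simp add: m_comm)
   then show False using cong_mem[OF w2 qc _ a(2)] qw by blast
  qed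
  then obtain b where b: "b \<in> A" "a * b = \<one>" using n_minus_unit a by blast
  have "a * s \<in> colon Q w1 E"
   using cong_mem[OF sE _ q(1) cong_sym[OF sE]] w2E a qc sc by auto
  then have "b * (a * s) \<in> colon Q w1 E" using submodD(4)[OF sE b(1)] by blast
  moreover have "b * (a * s) = (a * b) * s" using b(1) ac sc by (simp add: m_ac)
  ultimately have sE': "s \<in> colon Q w1 E" using b sc by simp
  have "colon Q w2 n \<subseteq> colon Q w1 E"
  proof
   fix p assume p: "p \<in> colon Q w2 n"
   obtain a where a: "a \<in> A" "p \<ominus> a * s \<in> w2" using s(3)[OF p] by blast
   show "p \<in> colon Q w1 E"
    using cong_mem[OF sE _ submodD(4)[OF sE a(1) sE']] w2E a colonD(1)[OF p] by blast
  qed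
  (* The left side is E, but u is in E and not in M. *)
  then have "colon Q w1 (colon Q w1 E) \<subseteq> M" unfolding M_def by (auto simp: colon_def)
  then show False using colon_colon[OF D1 rE] E(2) u(2) by blast
 qed
 obtain z where z: "z \<in> D" "z \<in> Units Q" using regfracD(2)[OF rD] by blast
 then obtain a where a: "a \<in> A" "z = u * a" using \<open>U = D\<close> by (auto simp: U_def)
 have zi: "inv z \<in> |Q|" using z by simp
 have "u * (a * inv z) = (u * a) * inv z" using a(1) zi uc by (simp add: m_assoc)
 also have "\<dots> = z * inv z" by (simp only: a(2)[symmetric])
 finally have "u * (a * inv z) = z * inv z" .
 then have "u * (a * inv z) = \<one>" using z by simp
 moreover from this have "(a * inv z) * u = \<one>" using uc a(1) zi by (simp add: m_comm)
 ultimately have uU: "u \<in> Units Q" using uc a(1) zi unfolding Units_def by blast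
 have "w2 = (%x. inv u * x) ` w1"
 proof
  show "w2 \<subseteq> (%x. inv u * x) ` w1"
  proof
   fix q assume q: "q \<in> w2"
   have qc: "q \<in> |Q|" using submodD(1)[OF w2 q] .
   have "q \<in> colon Q w1 D" using q DD by simp
   then have "q * u \<in> w1" using u(1) colonD by blast
   moreover have "q = inv u * (q * u)" using qc uU uc by (simp add: m_lcomm)
   ultimately show "q \<in> (%x. inv u * x) ` w1" by blast
  qed
 next
  show "(%x. inv u * x) ` w1 \<subseteq> w2"
  proof
   fix q assume "q \<in> (%x. inv u * x) ` w1"
   then obtain x where x: "x \<in> w1" "q = inv u * x" by blast
   have xc: "x \<in> |Q|" using submodD(1)[OF w1 x(1)] .
   have "q * y \<in> w1" if "y \<in> D" for y
   proof -
    obtain a where a: "a \<in> A" "y = u * a" using \<open>y \<in> D\<close> \<open>U = D\<close> by (auto simp: U_def)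
    have "q * y = (inv u * u) * (a * x)" using x a xc uc uU by (simp add: m_ac)
    then have "q * y = a * x" using uU xc a by simp
    then show ?thesis using submodD(4)[OF w1 a(1) x(1)] by simp
   qed
   then have "q \<in> colon Q w1 D" using x xc uU by (auto simp: colon_def)
   then show "q \<in> w2" using DD by simp
  qed
 qed
 then show ?thesis using uU by blast
qed

end

section \<open>Rings of fractions of Cohen-Macaulay rings\<close>

subsection \<open>The total ring of fractions\<close>

context cring
begin

lemma regularD:
 assumes "s \<in> Reg R"
 shows "s \<in> |R|" "r \<in> |R| ==> s * r = \<zero> ==> r = \<zero>"
 using assms by (auto simp: regular_elements_def)

lemma regular_one: "\<one> \<in> Reg R"
 by (auto simp: regular_elements_def)

lemma regular_mult:
 assumes s: "s \<in> Reg R" and t: "t \<in> Reg R"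
 shows "s * t \<in> Reg R"
proof -
 have "r = \<zero>" if "r \<in> |R|" "s * t * r = \<zero>" for r
 proof -
  have "s * (t * r) = \<zero>" using that regularD(1)[OF s] regularD(1)[OF t] by (simp add: m_assoc)
  then have "t * r = \<zero>" using regularD(2)[OF s, of "t * r"] regularD(1)[OF t] that(1) by blast
  then show ?thesis using regularD(2)[OF t that(1)] by blast
 qed
 moreover have "s * t \<in> |R|" using regularD(1)[OF s] regularD(1)[OF t] by simp
 ultimately show ?thesis unfolding regular_elements_def by blast
qed

lemma regular_cancel:
 assumes s: "s \<in> Reg R" and "a \<in> |R|" "b \<in> |R|" "s * a = s * b"
 shows "a = b"
proof -
 have "s * (a \<ominus> b) = s * a \<ominus> s * b" using assms(2,3) regularD(1)[OF s] by algebra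
 also have "\<dots> = \<zero>" using assms regularD(1)[OF s] by (simp add: minus_eq r_neg)
 finally have "a \<ominus> b = \<zero>" using regularD(2)[OF s, of "a \<ominus> b"] assms(2,3) by blast
 then show ?thesis using assms(2,3) by simp
qed

lemma regular_factor:
 assumes "s * t \<in> Reg R" "s \<in> |R|" "t \<in> |R|"
 shows "s \<in> Reg R"
proof -
 have "r = \<zero>" if "r \<in> |R|" "s * r = \<zero>" for r
 proof -
  have "s * t * r = t * (s * r)" using that(1) assms(2,3) by (simp add: m_ac)
  then have "s * t * r = \<zero>" using that(2) assms(3) by simp
  then show ?thesis using regularD(2)[OF assms(1) that(1)] by blast
 qed
 then show ?thesis using assms(2) unfolding regular_elements_def by blast
qed

lemma regular_pow: "s \<in> Reg R ==> s [^] (k::nat) \<in> Reg R"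
 by (induction k) (auto simp: regular_one intro: regular_mult)

lemma fraction_mem: "(p, q) \<in> fraction R r s \<longleftrightarrow> p \<in> |R| \<and> q \<in> Reg R \<and> r * q = p * s"
 by (auto simp: fraction_def)

lemma fraction_eq_iff:
 assumes r: "r \<in> |R|" "r' \<in> |R|" and s: "s \<in> Reg R" "s' \<in> Reg R"
 shows "fraction R r s = fraction R r' s' \<longleftrightarrow> r * s' = r' * s"
proof
 assume "fraction R r s = fraction R r' s'"
 moreover have "(r', s') \<in> fraction R r' s'" using r s by (simp add: fraction_mem)
 ultimately show "r * s' = r' * s" using fraction_mem by blast
next
 have sub: "fraction R r s \<subseteq> fraction R r' s'" if r: "r \<in> |R|" "r' \<in> |R|"
  and s: "s \<in> Reg R" "s' \<in> Reg R" and e: "r * s' = r' * s" for r r' s s'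
 proof
  fix x assume x: "x \<in> fraction R r s"
  obtain p q where pq: "x = (p, q)" by force
  have h: "p \<in> |R|" "q \<in> Reg R" "r * q = p * s" using x pq by (auto simp: fraction_mem)
  note c = regularD(1)[OF s(1)] regularD(1)[OF s(2)] regularD(1)[OF h(2)]
  have "s * (r' * q) = (r' * s) * q" using c r by (simp add: m_ac)
  also have "\<dots> = (r * q) * s'" using c r by (simp add: e[symmetric] m_ac)
  also have "\<dots> = s * (p * s')" using c r h by (simp add: m_ac)
  finally have "r' * q = p * s'" using regular_cancel[OF s(1)] c r h by simp
  then show "x \<in> fraction R r' s'" using h pq by (simp add: fraction_mem)
 qed
 assume "r * s' = r' * s"
 then show "fraction R r s = fraction R r' s'"
  using sub[OF r s] sub[OF r(2,1) s(2,1)] by simp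
qed

lemma total_frac_carrier: "|Frac R| = {fraction R r s | r s. r \<in> |R| \<and> s \<in> Reg R}"
 and total_frac_one: "\<one>\<^bsub>Frac R\<^esub> = to_frac R \<one>"
 and total_frac_zero: "\<zero>\<^bsub>Frac R\<^esub> = to_frac R \<zero>"
 by (simp_all add: total_frac_def to_frac_def)

lemma fraction_closed: "r \<in> |R| ==> s \<in> Reg R ==> fraction R r s \<in> |Frac R|"
 by (auto simp: total_frac_carrier)

lemma union_constant:
 assumes "a \<in> X" "!!x. x \<in> X ==> f x = c" shows "(\<Union>x\<in>X. f x) = c"
 using assms by auto

lemma fraction_mult:
 assumes r: "r \<in> |R|" "r' \<in> |R|" and s: "s \<in> Reg R" "s' \<in> Reg R"
 shows "fraction R r s *\<^bsub>Frac R\<^esub> fraction R r' s' = fraction R (r * r') (s * s')"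
proof -
 have *: "fraction R (p * p') (q * q') = fraction R (r * r') (s * s')"
  if h: "(p, q) \<in> fraction R r s" "(p', q') \<in> fraction R r' s'" for p q p' q'
 proof -
  have h: "p \<in> |R|" "q \<in> Reg R" "r * q = p * s"
   "p' \<in> |R|" "q' \<in> Reg R" "r' * q' = p' * s'"
   using that by (auto simp: fraction_mem)
  note c = regularD(1)[OF s(1)] regularD(1)[OF s(2)] regularD(1)[OF h(2)] regularD(1)[OF h(5)]
  have "(p * p') * (s * s') = (p * s) * (p' * s')" using c h(1,4) by (simp add: m_ac)
  also have "\<dots> = (r * r') * (q * q')" using c r by (simp add: h(3,6)[symmetric] m_ac)
  finally show ?thesis by (subst fraction_eq_iff) (use h r s in \<open>auto intro: regular_mult\<close>)
 qed
 have m: "(r, s) \<in> fraction R r s" "(r', s') \<in> fraction R r' s'" using r s by (auto simp: fraction_mem)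
 have 1: "(\<Union>y\<in>fraction R r' s'. case y of (p', q') => fraction R (p * p') (q * q')) = fraction R (r * r') (s * s')"
  if "(p, q) \<in> fraction R r s" for p q
  by (rule union_constant[OF m(2)]) (use * that in auto)
 have "(\<Union>x\<in>fraction R r s. case x of (p, q) =>
   \<Union>y\<in>fraction R r' s'. case y of (p', q') => fraction R (p * p') (q * q')) = fraction R (r * r') (s * s')"
  by (rule union_constant[OF m(1)]) (use 1 in auto)
 then show ?thesis by (simp add: total_frac_def)
qed

lemma fraction_add:
 assumes r: "r \<in> |R|" "r' \<in> |R|" and s: "s \<in> Reg R" "s' \<in> Reg R"
 shows "fraction R r s \<oplus>\<^bsub>Frac R\<^esub> fraction R r' s' = fraction R (r * s' \<oplus> r' * s) (s * s')"
proof -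
 have *: "fraction R (p * q' \<oplus> p' * q) (q * q') = fraction R (r * s' \<oplus> r' * s) (s * s')"
  if h: "(p, q) \<in> fraction R r s" "(p', q') \<in> fraction R r' s'" for p q p' q'
 proof -
  have h: "p \<in> |R|" "q \<in> Reg R" "r * q = p * s"
   "p' \<in> |R|" "q' \<in> Reg R" "r' * q' = p' * s'"
   using that by (auto simp: fraction_mem)
  note c = regularD(1)[OF s(1)] regularD(1)[OF s(2)] regularD(1)[OF h(2)] regularD(1)[OF h(5)]
  have "(p * q' \<oplus> p' * q) * (s * s') = (p * s) * (q' * s') \<oplus> (p' * s') * (q * s)"
   using c h(1,4) by (simp add: l_distr r_distr m_ac a_ac)
  also have "\<dots> = (r * q) * (q' * s') \<oplus> (r' * q') * (q * s)" by (simp add: h)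
  also have "\<dots> = (r * s' \<oplus> r' * s) * (q * q')" using c r by (simp add: l_distr r_distr m_ac a_ac)
  finally show ?thesis by (subst fraction_eq_iff) (use h r s c in \<open>auto intro: regular_mult\<close>)
 qed
 have m: "(r, s) \<in> fraction R r s" "(r', s') \<in> fraction R r' s'" using r s by (auto simp: fraction_mem)
 have 1: "(\<Union>y\<in>fraction R r' s'. case y of (p', q') => fraction R (p * q' \<oplus> p' * q) (q * q')) = fraction R (r * s' \<oplus> r' * s) (s * s')"
  if "(p, q) \<in> fraction R r s" for p q
  by (rule union_constant[OF m(2)]) (use * that in auto)
 have "(\<Union>x\<in>fraction R r s. case x of (p, q) =>
   \<Union>y\<in>fraction R r' s'. case y of (p', q') => fraction R (p * q' \<oplus> p' * q) (q * q')) = fraction R (r * s' \<oplus> r' * s) (s * s')"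
  by (rule union_constant[OF m(1)]) (use 1 in auto)
 then show ?thesis by (simp add: total_frac_def)
qed

lemma total_frac_cases:
 assumes "q \<in> |Frac R|"
 obtains r s where "r \<in> |R|" "s \<in> Reg R" "q = fraction R r s"
 using assms by (auto simp: total_frac_carrier)

lemma total_frac_cring: "cring (Frac R)"
proof -
 let ?K = "Frac R"
 have rep: "\<exists>r\<in>carrier R. \<exists>s\<in>carrier R. s \<in> Reg R \<and> x = fraction R r s" if "x \<in> |?K|" for x
  using that regularD(1) total_frac_cases by metis
 note fr = fraction_add fraction_mult fraction_eq_iff fraction_closed regular_mult regular_one
  total_frac_zero total_frac_one to_frac_def l_distr r_distr m_ac a_ac
 have 2: "x \<oplus>\<^bsub>?K\<^esub> y \<in> |?K|" "x *\<^bsub>?K\<^esub> y \<in> |?K|" "x \<oplus>\<^bsub>?K\<^esub> y = y \<oplus>\<^bsub>?K\<^esub> x" "x *\<^bsub>?K\<^esub> y = y *\<^bsub>?K\<^esub> x"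
  if "x \<in> |?K|" "y \<in> |?K|" for x y
  using rep[OF that(1)] rep[OF that(2)] by (elim bexE conjE; simp add: fr)+
 have 3: "x \<oplus>\<^bsub>?K\<^esub> y \<oplus>\<^bsub>?K\<^esub> z = x \<oplus>\<^bsub>?K\<^esub> (y \<oplus>\<^bsub>?K\<^esub> z)" "x *\<^bsub>?K\<^esub> y *\<^bsub>?K\<^esub> z = x *\<^bsub>?K\<^esub> (y *\<^bsub>?K\<^esub> z)"
  "(x \<oplus>\<^bsub>?K\<^esub> y) *\<^bsub>?K\<^esub> z = x *\<^bsub>?K\<^esub> z \<oplus>\<^bsub>?K\<^esub> y *\<^bsub>?K\<^esub> z"
  if "x \<in> |?K|" "y \<in> |?K|" "z \<in> |?K|" for x y z
  using rep[OF that(1)] rep[OF that(2)] rep[OF that(3)] by (elim bexE conjE; simp add: fr)+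
 have 1: "\<zero>\<^bsub>?K\<^esub> \<oplus>\<^bsub>?K\<^esub> x = x" "\<one>\<^bsub>?K\<^esub> *\<^bsub>?K\<^esub> x = x" "\<exists>y\<in>carrier ?K. y \<oplus>\<^bsub>?K\<^esub> x = \<zero>\<^bsub>?K\<^esub>" if x: "x \<in> |?K|" for x
 proof -
  obtain r s where h: "r \<in> |R|" "s \<in> |R|" "s \<in> Reg R" "x = fraction R r s" using rep[OF x] by blast
  show "\<zero>\<^bsub>?K\<^esub> \<oplus>\<^bsub>?K\<^esub> x = x" "\<one>\<^bsub>?K\<^esub> *\<^bsub>?K\<^esub> x = x" using h by (simp_all add: fr)
  have "fraction R (\<ominus> r) s \<oplus>\<^bsub>?K\<^esub> x = \<zero>\<^bsub>?K\<^esub>" using h by (simp add: fr l_minus r_minus l_neg r_neg)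
  then show "\<exists>y\<in>carrier ?K. y \<oplus>\<^bsub>?K\<^esub> x = \<zero>\<^bsub>?K\<^esub>" using fraction_closed[of "\<ominus> r" s] h by blast
 qed
 have 0: "\<zero>\<^bsub>?K\<^esub> \<in> |?K|" "\<one>\<^bsub>?K\<^esub> \<in> |?K|" by (simp_all add: fr)
 show ?thesis by (intro cringI abelian_groupI comm_monoidI 0 1 2 3)
qed

lemma to_frac_hom: "to_frac R \<in> ring_hom R (Frac R)"
 by (rule ring_hom_memI)
  (auto simp: to_frac_def fraction_closed regular_one fraction_mult fraction_add total_frac_one)

lemma to_frac_inj: "inj_on (to_frac R) |R|"
 by (rule inj_onI) (auto simp: to_frac_def fraction_eq_iff regular_one)

lemma to_frac_regular_Units:
 assumes "s \<in> Reg R" shows "to_frac R s \<in> Units (Frac R)"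
proof -
 interpret Q: cring "Frac R" by (rule total_frac_cring)
 have "fraction R \<one> s *\<^bsub>Frac R\<^esub> to_frac R s = \<one>\<^bsub>Frac R\<^esub>"
  unfolding to_frac_def total_frac_one
  using assms regularD(1)[OF assms] by (simp add: fraction_mult regular_one fraction_eq_iff)
 moreover have "fraction R \<one> s \<in> |Frac R|" "to_frac R s \<in> |Frac R|"
  using assms regularD(1)[OF assms] by (auto simp: fraction_closed to_frac_def regular_one)
 ultimately show ?thesis using Q.m_comm[of "fraction R \<one> s" "to_frac R s"] unfolding Units_def by auto
qed

lemma fraction_denominator:
 assumes "r \<in> |R|" "s \<in> Reg R"
 shows "to_frac R s *\<^bsub>Frac R\<^esub> fraction R r s = to_frac R r"
 unfolding to_frac_def
 using assms regularD(1)[OF assms(2)] by (simp add: fraction_mult regular_one fraction_eq_iff m_comm)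

end

text \<open>The ring $P$ is a total ring of fractions of $S$, up to isomorphism. This is applied to the pair ring that contains
\<open>R(I)\<^bsub>a,b\<^esub>\<close>, in which calculations are easier than with fractions.\<close>

locale fraction_embedding = S: cring S + P: cring P for S (structure) and P (structure) +
 fixes \<phi>
 assumes hom: "\<phi> \<in> ring_hom S P" and inj: "inj_on \<phi> |S|"
  and regular_Units: "s \<in> Reg S ==> \<phi> s \<in> Units P"
  and denominators: "p \<in> |P| ==> \<exists>s\<in>Reg S. \<phi> s *\<^bsub>P\<^esub> p \<in> \<phi> ` |S|"
begin

lemmas phi_hom = ring_hom_closed[OF hom] ring_hom_mult[OF hom] ring_hom_add[OF hom] ring_hom_one[OF hom]

lemma phi_zero: "\<phi> \<zero>\<^bsub>S\<^esub> = \<zero>\<^bsub>P\<^esub>"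
 using ring_hom_zero[OF hom S.ring_axioms P.ring_axioms] .

lemma phi_minus_one: "\<phi> (\<ominus>\<^bsub>S\<^esub> \<one>\<^bsub>S\<^esub>) = \<ominus>\<^bsub>P\<^esub> \<one>\<^bsub>P\<^esub>"
proof -
 have "\<phi> (\<ominus>\<^bsub>S\<^esub> \<one>\<^bsub>S\<^esub>) \<oplus>\<^bsub>P\<^esub> \<one>\<^bsub>P\<^esub> = \<phi> (\<ominus>\<^bsub>S\<^esub> \<one>\<^bsub>S\<^esub> \<oplus>\<^bsub>S\<^esub> \<one>\<^bsub>S\<^esub>)" by (simp add: phi_hom)
 also have "\<dots> = \<zero>\<^bsub>P\<^esub>" by (simp add: S.l_neg phi_zero)
 finally show ?thesis using P.minus_equality phi_hom by (metis P.one_closed S.a_inv_closed S.one_closed)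
qed

lemma phi_pow: "s \<in> |S| ==> \<phi> (s [^]\<^bsub>S\<^esub> (k::nat)) = \<phi> s [^]\<^bsub>P\<^esub> k"
 by (induction k) (auto simp: phi_hom)

definition lift where "lift q = (let (r, s) = (SOME rs. rs \<in> q) in \<phi> r *\<^bsub>P\<^esub> inv\<^bsub>P\<^esub> (\<phi> s))"

lemma lift_fraction:
 assumes r: "r \<in> |S|" and s: "s \<in> Reg S"
 shows "lift (fraction S r s) = \<phi> r *\<^bsub>P\<^esub> inv\<^bsub>P\<^esub> (\<phi> s)"
proof -
 have "(SOME rs. rs \<in> fraction S r s) \<in> fraction S r s"
  by (rule someI[of _ "(r, s)"]) (use assms in \<open>simp add: S.fraction_mem\<close>)
 moreover obtain p q where pq: "(SOME rs. rs \<in> fraction S r s) = (p, q)" by force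
 ultimately have h: "p \<in> |S|" "q \<in> Reg S" "r *\<^bsub>S\<^esub> q = p *\<^bsub>S\<^esub> s"
  by (auto simp: S.fraction_mem)
 have u: "\<phi> q \<in> Units P" "\<phi> s \<in> Units P" using h s regular_Units by auto
 have c: "\<phi> p \<in> |P|" "\<phi> r \<in> |P|" "\<phi> q \<in> |P|" "\<phi> s \<in> |P|" using h r u phi_hom by auto
 have "\<phi> r *\<^bsub>P\<^esub> \<phi> q = \<phi> p *\<^bsub>P\<^esub> \<phi> s"
  using h s r S.regularD(1) by (metis phi_hom(2))
 then have "(\<phi> r *\<^bsub>P\<^esub> \<phi> q) *\<^bsub>P\<^esub> (inv\<^bsub>P\<^esub> \<phi> q *\<^bsub>P\<^esub> inv\<^bsub>P\<^esub> \<phi> s)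
  = (\<phi> p *\<^bsub>P\<^esub> \<phi> s) *\<^bsub>P\<^esub> (inv\<^bsub>P\<^esub> \<phi> q *\<^bsub>P\<^esub> inv\<^bsub>P\<^esub> \<phi> s)" by simp
 moreover have "(\<phi> r *\<^bsub>P\<^esub> \<phi> q) *\<^bsub>P\<^esub> (inv\<^bsub>P\<^esub> \<phi> q *\<^bsub>P\<^esub> inv\<^bsub>P\<^esub> \<phi> s)
  = \<phi> r *\<^bsub>P\<^esub> inv\<^bsub>P\<^esub> \<phi> s *\<^bsub>P\<^esub> (\<phi> q *\<^bsub>P\<^esub> inv\<^bsub>P\<^esub> \<phi> q)" using c u by (simp add: P.m_ac del: P.Units_r_inv)
 moreover have "(\<phi> p *\<^bsub>P\<^esub> \<phi> s) *\<^bsub>P\<^esub> (inv\<^bsub>P\<^esub> \<phi> q *\<^bsub>P\<^esub> inv\<^bsub>P\<^esub> \<phi> s)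
  = \<phi> p *\<^bsub>P\<^esub> inv\<^bsub>P\<^esub> \<phi> q *\<^bsub>P\<^esub> (\<phi> s *\<^bsub>P\<^esub> inv\<^bsub>P\<^esub> \<phi> s)" using c u by (simp add: P.m_ac del: P.Units_r_inv)
 ultimately have "\<phi> r *\<^bsub>P\<^esub> inv\<^bsub>P\<^esub> \<phi> s = \<phi> p *\<^bsub>P\<^esub> inv\<^bsub>P\<^esub> \<phi> q" using c u by simp
 then show ?thesis by (simp add: lift_def pq)
qed

lemma Units_mult_eqI:
 assumes "s \<in> Units P" "x \<in> |P|" "y \<in> |P|" "s *\<^bsub>P\<^esub> x = s *\<^bsub>P\<^esub> y" shows "x = y"
 using assms by simp

lemma lift_fraction_eqI:
 assumes "r \<in> |S|" "s \<in> Reg S" "p \<in> |P|" "\<phi> s *\<^bsub>P\<^esub> p = \<phi> r"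
 shows "lift (fraction S r s) = p"
proof (rule Units_mult_eqI[of "\<phi> s"])
 have u: "\<phi> s \<in> Units P" using assms regular_Units by auto
 show "\<phi> s *\<^bsub>P\<^esub> lift (fraction S r s) = \<phi> s *\<^bsub>P\<^esub> p"
  using assms u phi_hom(1)[OF assms(1)]
  by (simp add: lift_fraction P.m_lcomm P.Units_closed)
 show "lift (fraction S r s) \<in> |P|" "\<phi> s \<in> Units P" "p \<in> |P|"
  using assms u phi_hom by (auto simp: lift_fraction)
qed

lemma lift_props:
 assumes "r \<in> |S|" "s \<in> Reg S"
 shows "lift (fraction S r s) \<in> |P|" "\<phi> s *\<^bsub>P\<^esub> lift (fraction S r s) = \<phi> r"
 using assms regular_Units[OF assms(2)] phi_hom(1)[OF assms(1)]
 by (simp_all add: lift_fraction P.m_lcomm P.Units_closed)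

lemma lift_iso: "lift \<in> ring_iso (Frac S) P"
proof (rule ring_iso_memI)
 note reg = S.regularD(1) S.regular_mult S.regular_one
 have L: "lift x \<in> |P|" if "x \<in> |Frac S|" for x
  using that lift_props(1) by (auto simp: S.total_frac_carrier)
 then show "!!x. x \<in> |Frac S| ==> lift x \<in> |P|" .
 fix x y assume xyz: "x \<in> |Frac S|" "y \<in> |Frac S|"
 obtain r s where h0: "r \<in> |S|" "s \<in> Reg S" "x = fraction S r s"
   using S.total_frac_cases[OF xyz(1)] .
 obtain r' s' where h1: "r' \<in> |S|" "s' \<in> Reg S" "y = fraction S r' s'"
   using S.total_frac_cases[OF xyz(2)] .
 note h = h0 h1
 have sc: "s \<in> |S|" "s' \<in> |S|" using h reg by auto
 define u v where "u = lift (fraction S r s)" and "v = lift (fraction S r' s')"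
 have uv: "u \<in> |P|" "v \<in> |P|" "\<phi> s *\<^bsub>P\<^esub> u = \<phi> r" "\<phi> s' *\<^bsub>P\<^esub> v = \<phi> r'"
  using lift_props h by (auto simp: u_def v_def)
 have c: "\<phi> s \<in> |P|" "\<phi> s' \<in> |P|" using phi_hom sc by auto
 show "lift (x *\<^bsub>Frac S\<^esub> y) = lift x *\<^bsub>P\<^esub> lift y"
  unfolding h(3,6) S.fraction_mult[OF h(1,4,2,5)] u_def[symmetric] v_def[symmetric]
 proof (rule lift_fraction_eqI)
  have "\<phi> (s *\<^bsub>S\<^esub> s') *\<^bsub>P\<^esub> (u *\<^bsub>P\<^esub> v) = (\<phi> s *\<^bsub>P\<^esub> u) *\<^bsub>P\<^esub> (\<phi> s' *\<^bsub>P\<^esub> v)"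
   using c uv(1,2) sc by (simp add: phi_hom P.m_ac)
  then show "\<phi> (s *\<^bsub>S\<^esub> s') *\<^bsub>P\<^esub> (u *\<^bsub>P\<^esub> v) = \<phi> (r *\<^bsub>S\<^esub> r')" using uv h by (simp add: phi_hom)
 qed (use h reg uv in auto)
 show "lift (x \<oplus>\<^bsub>Frac S\<^esub> y) = lift x \<oplus>\<^bsub>P\<^esub> lift y"
  unfolding h(3,6) S.fraction_add[OF h(1,4,2,5)] u_def[symmetric] v_def[symmetric]
 proof (rule lift_fraction_eqI)
  have "\<phi> (s *\<^bsub>S\<^esub> s') *\<^bsub>P\<^esub> (u \<oplus>\<^bsub>P\<^esub> v) = (\<phi> s *\<^bsub>P\<^esub> u) *\<^bsub>P\<^esub> \<phi> s' \<oplus>\<^bsub>P\<^esub> (\<phi> s' *\<^bsub>P\<^esub> v) *\<^bsub>P\<^esub> \<phi> s"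
   using c uv(1,2) sc by (simp add: phi_hom P.m_ac P.r_distr)
  then show "\<phi> (s *\<^bsub>S\<^esub> s') *\<^bsub>P\<^esub> (u \<oplus>\<^bsub>P\<^esub> v) = \<phi> (r *\<^bsub>S\<^esub> s' \<oplus>\<^bsub>S\<^esub> r' *\<^bsub>S\<^esub> s)"
   using uv h sc by (simp add: phi_hom)
 qed (use h reg uv in auto)
next
 show "lift \<one>\<^bsub>Frac S\<^esub> = \<one>\<^bsub>P\<^esub>"
  unfolding S.total_frac_one to_frac_def by (rule lift_fraction_eqI) (auto simp: S.regular_one phi_hom)
 show "bij_betw lift ( |Frac S| ) |P|"
 proof (rule bij_betwI')
  fix x y assume xyz: "x \<in> |Frac S|" "y \<in> |Frac S|"
  obtain r s where h0: "r \<in> |S|" "s \<in> Reg S" "x = fraction S r s"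
   using S.total_frac_cases[OF xyz(1)] .
  obtain r' s' where h1: "r' \<in> |S|" "s' \<in> Reg S" "y = fraction S r' s'"
   using S.total_frac_cases[OF xyz(2)] .
  note h = h0 h1
  note sc = S.regularD(1)[OF h(2)] S.regularD(1)[OF h(5)]
  have c: "\<phi> s \<in> |P|" "\<phi> s' \<in> |P|" using phi_hom sc by auto
  show "(lift x = lift y) = (x = y)"
  proof
   assume e: "lift x = lift y"
   define u where "u = lift (fraction S r s)"
   have u': "u = lift (fraction S r' s')" using e unfolding u_def h(3,6) .
   have uv: "u \<in> |P|" "\<phi> s *\<^bsub>P\<^esub> u = \<phi> r" "\<phi> s' *\<^bsub>P\<^esub> u = \<phi> r'"
    using lift_props[OF h(1,2)] lift_props(2)[OF h(4,5)] by (simp_all only: u_def u'[unfolded u_def])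
   have "\<phi> (r *\<^bsub>S\<^esub> s') = \<phi> (r' *\<^bsub>S\<^esub> s)"
    using uv(1) h c sc by (simp add: phi_hom uv(2,3)[symmetric] P.m_ac)
   then have "r *\<^bsub>S\<^esub> s' = r' *\<^bsub>S\<^esub> s" using inj h sc by (auto dest: inj_onD)
   then show "x = y" using h by (simp add: S.fraction_eq_iff)
  qed simp
 next
  fix x assume "x \<in> |Frac S|"
  then show "lift x \<in> |P|" using lift_props(1) by (auto simp: S.total_frac_carrier)
 next
  fix p assume p: "p \<in> |P|"
  obtain s r where "s \<in> Reg S" "r \<in> |S|" "\<phi> s *\<^bsub>P\<^esub> p = \<phi> r"
   using denominators[OF p] by auto
  then have "lift (fraction S r s) = p" "fraction S r s \<in> |Frac S|"
   using lift_fraction_eqI p S.fraction_closed by auto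
  then show "\<exists>x\<in>|Frac S|. p = lift x" by auto
 qed
qed

lemma lift_to_frac: "r \<in> |S| ==> lift (to_frac S r) = \<phi> r"
 unfolding to_frac_def by (rule lift_fraction_eqI) (auto simp: S.regular_one phi_hom)

end

lemma (in cring) total_frac_embedding: "fraction_embedding R (Frac R) (to_frac R)"
proof -
 interpret Q: cring "Frac R" by (rule total_frac_cring)
 show ?thesis
 proof unfold_locales
  fix p assume "p \<in> |Frac R|"
  then obtain r s where "r \<in> |R|" "s \<in> Reg R" "p = fraction R r s"
   by (auto simp: total_frac_carrier)
  then show "\<exists>s\<in>Reg R. to_frac R s *\<^bsub>Frac R\<^esub> p \<in> to_frac R ` |R|"
   using fraction_denominator by (intro bexI[of _ s]) auto
 qed (use to_frac_hom to_frac_inj to_frac_regular_Units in auto)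
qed

subsection \<open>One-dimensional Cohen-Macaulay local rings\<close>

lemma noetherian_maximal:
 assumes "noetherian_ring R" "C \<noteq> {}" "!!J. J \<in> C ==> ideal J R"
 shows "\<exists>M\<in>C. \<forall>J\<in>C. M \<subseteq> J --> J = M"
proof (rule subset_Zorn_nonempty[OF assms(2)])
 interpret noetherian_ring R by fact
 fix D assume D: "D \<noteq> {}" "subset.chain C D"
 then have "subset.chain {I. ideal I R} D" using assms(3) by (auto simp: subset_chain_def)
 then have "\<Union>D \<in> D" using ideal_chain_is_trivial D by blast
 then show "\<Union>D \<in> C" using D by (auto simp: subset_chain_def)
qed

context cring
begin

lemma ideal_iff_submod: "ideal J R \<longleftrightarrow> submod R |R| J"
proof
 assume "ideal J R"
 then interpret ideal J R .
 show "submod R |R| J"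
  unfolding submod_def using Icarr I_l_closed a_closed zero_closed by auto
next
 assume J: "submod R |R| J"
 have neg: "\<ominus> x \<in> J" if "x \<in> J" for x
 proof -
  have "\<ominus> \<one> * x \<in> J" using J that by (auto simp: submod_def)
  moreover have "x \<in> |R|" using J that by (auto simp: submod_def)
  ultimately show ?thesis by (simp add: l_minus)
 qed
 show "ideal J R"
 proof (rule idealI)
  show "subgroup J (add_monoid R)"
  proof
   show "inv\<^bsub>add_monoid R\<^esub> x \<in> J" if "x \<in> J" for x using neg[OF that] by (simp add: a_inv_def)
  qed (use J in \<open>auto simp: submod_def\<close>)
  show "a * x \<in> J" if "a \<in> J" "x \<in> |R|" for a x
  proof -
   have "a \<in> |R|" using J that by (auto simp: submod_def)
   then have "a * x = x * a" using that m_comm by blast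
   then show ?thesis using J that by (auto simp: submod_def)
  qed
  show "x * a \<in> J" if "a \<in> J" "x \<in> |R|" for a x using J that by (auto simp: submod_def)
 qed (rule ring_axioms)
qed

text \<open>An ideal maximal among those that contain $J$ and avoid the multiplicative set $T$ is prime.\<close>

lemma prime_avoiding:
 assumes N: "noetherian_ring R" and J: "ideal J R" and T: "T \<subseteq> |R|" "\<one> \<in> T"
  and Tm: "!!s t. s \<in> T ==> t \<in> T ==> s * t \<in> T" and JT: "J \<inter> T = {}"
 shows "\<exists>P. primeideal P R \<and> J \<subseteq> P \<and> P \<inter> T = {}"
proof -
 define C where "C = {K. ideal K R \<and> J \<subseteq> K \<and> K \<inter> T = {}}"
 have "\<exists>M\<in>C. \<forall>J\<in>C. M \<subseteq> J --> J = M"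
  by (rule noetherian_maximal[OF N]) (use J JT in \<open>auto simp: C_def\<close>)
 then obtain M where MC: "M \<in> C" and max: "!!K. K \<in> C ==> M \<subseteq> K ==> K = M" by blast
 have M: "ideal M R" "J \<subseteq> M" "M \<inter> T = {}" using MC by (auto simp: C_def)
 interpret M: ideal M R by (rule M(1))
 have meet: "\<exists>m\<in>M. \<exists>r\<in>carrier R. m \<oplus> r * a \<in> T" if a: "a \<in> |R|" "a \<notin> M" for a
 proof -
  let ?L = "M <+>\<^bsub>R\<^esub> PIdl a"
  have L: "ideal ?L R" using add_ideals[OF M(1) cgenideal_ideal[OF a(1)]] .
  have mem: "m \<oplus> x \<in> ?L" if "m \<in> M" "x \<in> PIdl a" for m x
   using that by (auto simp: set_add_def')
  have z: "\<zero> \<in> PIdl a" using cgenideal_ideal[OF a(1)] by (simp add: additive_subgroup.zero_closed ideal.axioms(1))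
  have MsubL: "M \<subseteq> ?L"
  proof
   fix x assume "x \<in> M" then show "x \<in> ?L" using mem[OF _ z, of x] M.Icarr by simp
  qed
  have aL: "a \<in> ?L" using mem[OF M.zero_closed cgenideal_self[OF a(1)]] a by simp
  have "?L \<notin> C" using max MsubL aL a by blast
  then obtain t where t: "t \<in> ?L" "t \<in> T" using L MsubL M(2) by (auto simp: C_def)
  then obtain m x where mx: "m \<in> M" "x \<in> PIdl a" "t = m \<oplus> x" by (auto simp: set_add_def')
  then obtain r where "r \<in> |R|" "x = r * a" by (auto simp: cgenideal_def)
  then show ?thesis using mx t by blast
 qed
 have "primeideal M R"
 proof (rule primeidealI[OF M(1) is_cring])
  show "|R| \<noteq> M" using M(3) T by auto
  fix a b assume ab: "a \<in> |R|" "b \<in> |R|" "a * b \<in> M"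
  show "a \<in> M \<or> b \<in> M"
  proof (rule ccontr)
   assume "\<not> (a \<in> M \<or> b \<in> M)"
   then obtain m r m' r' where h: "m \<in> M" "r \<in> |R|" "m \<oplus> r * a \<in> T"
    "m' \<in> M" "r' \<in> |R|" "m' \<oplus> r' * b \<in> T"
    using meet ab(1,2) by meson
   have c: "m \<in> |R|" "m' \<in> |R|" using h M.Icarr by auto
   have "(m \<oplus> r * a) * (m' \<oplus> r' * b) = (m' \<oplus> r' * b) * m \<oplus> (r * a * m' \<oplus> (r * r') * (a * b))"
    using c h(2,5) ab(1,2) by (simp add: l_distr r_distr m_ac a_ac)
   also have "\<dots> \<in> M"
    by (rule M.a_closed[OF M.I_l_closed[OF h(1)] M.a_closed[OF M.I_l_closed[OF h(4)] M.I_l_closed[OF ab(3)]]])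
     (use c h ab in auto)
   finally show False using Tm[OF h(3,6)] M(3) by blast
  qed
 qed
 then show ?thesis using M by blast
qed

lemma proper_ideal_local:
 assumes N: "noetherian_ring R" and L: "local_ring R n" and J: "ideal J R" "J \<noteq> |R|"
 shows "J \<subseteq> n"
proof -
 define C where "C = {K. ideal K R \<and> J \<subseteq> K \<and> K \<noteq> |R|}"
 have "\<exists>M\<in>C. \<forall>J\<in>C. M \<subseteq> J --> J = M"
  by (rule noetherian_maximal[OF N]) (use J in \<open>auto simp: C_def\<close>)
 then obtain M where MC: "M \<in> C" and max: "!!K. K \<in> C ==> M \<subseteq> K ==> K = M" by blast
 have "maximalideal M R"
 proof (rule maximalidealI)
  show "ideal M R" "|R| \<noteq> M" using MC by (auto simp: C_def)
  fix K assume K: "ideal K R" "M \<subseteq> K" "K \<subseteq> |R|"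
  have "K \<in> C" if "K \<noteq> |R|" using that K MC by (auto simp: C_def)
  then show "K = M \<or> K = |R|" using max K(2) by blast
 qed
 then have "M = n" using L by (auto simp: local_ring_def)
 then show ?thesis using MC by (auto simp: C_def)
qed

lemma local_unit:
 assumes N: "noetherian_ring R" and L: "local_ring R n" and a: "a \<in> |R|" "a \<notin> n"
 shows "\<exists>b\<in>carrier R. a * b = \<one>"
proof -
 have "PIdl a = |R|"
  using proper_ideal_local[OF N L cgenideal_ideal[OF a(1)]] cgenideal_self[OF a(1)] a(2) by blast
 then have "\<one> \<in> PIdl a" by simp
 then obtain b where "b \<in> |R|" "\<one> = b * a" by (auto simp: cgenideal_def)
 then show ?thesis using a m_comm by metis
qed

lemma local_ideal:
 assumes L: "local_ring R n" shows "ideal n R" "\<one> \<notin> n" "n \<subseteq> |R|" "primeideal n R"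
proof -
 have M: "maximalideal n R" using L by (auto simp: local_ring_def)
 then show I: "ideal n R" by (simp add: maximalideal.axioms(1))
 show "\<one> \<notin> n" using ideal.one_imp_carrier[OF I] maximalideal.I_notcarr[OF M] by metis
 show "n \<subseteq> |R|" using ideal.Icarr[OF I] by blast
 show "primeideal n R" using maximalideal_prime[OF M] .
qed

lemma krull_dim_one_no_chain:
 assumes "krull_dim R = 1" "primeideal P0 R" "primeideal P1 R" "primeideal P2 R" "P0 \<subset> P1" "P1 \<subset> P2"
 shows False
proof -
 have "\<exists>P :: nat => 'a set. (\<forall>i\<le>2. primeideal (P i) R) \<and> (\<forall>i<2. P i \<subset> P (Suc i))"
  by (rule exI[of _ "%i. if i = 0 then P0 else if i = 1 then P1 else P2"])
   (use assms(2-) in \<open>auto simp: less_2_cases_iff\<close>)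
 then have "enat 2 \<le> krull_dim R" unfolding krull_dim_def by (intro Sup_upper) blast
 then show False using assms(1) by (simp add: one_enat_def)
qed

text \<open>Otherwise some prime contains $y$ but no power of $r$, so it lies strictly below $n$; and since $y$ is regular, there is
a further prime strictly below that one. This contradicts dimension 1.\<close>

lemma power_in_principal:
 assumes N: "noetherian_ring R" and L: "local_ring R n" and d: "krull_dim R = 1"
  and r: "r \<in> n" and y: "y \<in> Reg R"
 shows "\<exists>k::nat. \<exists>a\<in>carrier R. r [^] k = y * a"
proof (rule ccontr)
 assume no: "\<not> ?thesis"
 note n = local_ideal[OF L]
 have rc: "r \<in> |R|" using r n by blast
 have yc: "y \<in> |R|" using y regularD by blast
 define T where "T = {r [^] (k::nat) | k. True}"
 have T: "T \<subseteq> |R|" "\<one> \<in> T" "!!s t. s \<in> T ==> t \<in> T ==> s * t \<in> T"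
 proof -
  show "T \<subseteq> |R|" using rc by (auto simp: T_def)
  show "\<one> \<in> T" unfolding T_def by (intro CollectI exI[of _ 0]) simp
  show "!!s t. s \<in> T ==> t \<in> T ==> s * t \<in> T" unfolding T_def using rc by (auto simp: nat_pow_mult)
 qed
 have "PIdl y \<inter> T = {}"
 proof (rule ccontr)
  assume "PIdl y \<inter> T \<noteq> {}"
  then obtain k a where "a \<in> |R|" "r [^] (k::nat) = a * y" by (auto simp: T_def cgenideal_def)
  then show False using no yc m_comm by metis
 qed
 then obtain P where P: "primeideal P R" "PIdl y \<subseteq> P" "P \<inter> T = {}"
  using prime_avoiding[OF N cgenideal_ideal[OF yc] T] by blast
 interpret P: primeideal P R by (rule P(1))
 have "r [^] (1::nat) \<in> T" unfolding T_def by blast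
 then have rP: "r \<notin> P" using P(3) rc by auto
 have Pn: "P \<subset> n" using proper_ideal_local[OF N L P.ideal_axioms] P.I_notcarr rP r by auto
 have yP: "y \<in> P" using P(2) cgenideal_self[OF yc] by blast
 define U where "U = {s * y [^] (k::nat) | s k. s \<in> |R| \<and> s \<notin> P}"
 have 1: "\<one> \<notin> P" using P.one_imp_carrier P.I_notcarr by metis
 have U: "U \<subseteq> |R|" "\<one> \<in> U" "!!s t. s \<in> U ==> t \<in> U ==> s * t \<in> U"
 proof -
  show "U \<subseteq> |R|" using yc by (auto simp: U_def)
  show "\<one> \<in> U" unfolding U_def by (intro CollectI exI[of _ \<one>] exI[of _ 0]) (use 1 in simp)
  fix s t assume "s \<in> U" "t \<in> U"
  then obtain s' k t' l where h: "s' \<in> |R|" "s' \<notin> P" "s = s' * y [^] (k::nat)"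
   "t' \<in> |R|" "t' \<notin> P" "t = t' * y [^] (l::nat)" by (auto simp: U_def)
  have "s * t = (s' * t') * (y [^] k * y [^] l)" using h yc by (simp add: m_ac)
  then have "s * t = (s' * t') * y [^] (k + l)" using yc by (simp add: nat_pow_mult)
  moreover have "s' * t' \<notin> P" using P.I_prime h by blast
  ultimately show "s * t \<in> U" unfolding U_def using h by auto
 qed
 have "{\<zero>} \<inter> U = {}"
 proof (rule ccontr)
  assume "{\<zero>} \<inter> U \<noteq> {}"
  then obtain s k where h: "s \<in> |R|" "s \<notin> P" "\<zero> = s * y [^] (k::nat)" by (auto simp: U_def)
  have "y [^] k * s = \<zero>" using h yc by (simp add: m_comm)
  then have "s = \<zero>" using regularD(2)[OF regular_pow[OF y]] h by blast
  then show False using h P.zero_closed by blast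
 qed
 then obtain P' where P': "primeideal P' R" "P' \<inter> U = {}"
  using prime_avoiding[OF N zeroideal U] by blast
 have P'c: "P' \<subseteq> |R|" using P' by (meson additive_subgroup.a_subset ideal.axioms(1) primeideal.axioms(1))
 have "P' \<subseteq> P"
 proof
  fix x assume x: "x \<in> P'"
  show "x \<in> P"
  proof (rule ccontr)
   assume "x \<notin> P"
   then have "x * y [^] (0::nat) \<in> U" unfolding U_def using x P'c by blast
   moreover have "x \<in> |R|" using x P'c by blast
   ultimately have "x \<in> U" by simp
   then show False using x P'(2) by blast
  qed
 qed
 moreover have "y \<notin> P'"
 proof -
  have "\<one> * y [^] (1::nat) \<in> U" unfolding U_def using 1 one_closed by blast
  then show ?thesis using P'(2) yc by auto
 qed
 ultimately have "P' \<subset> P" using yP by blast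
 then show False using krull_dim_one_no_chain[OF d P'(1) P(1) n(4) _ Pn] by blast
qed

lemma depth_pos_regular:
 assumes "depth R n = 1" shows "\<exists>x\<in>n. x \<in> Reg R"
proof (rule ccontr)
 assume no: "\<not> ?thesis"
 have "length xs = 0" if "regular_sequence R xs" "set xs \<subseteq> n" for xs
 proof (rule ccontr)
  assume "length xs \<noteq> 0"
  then have x: "xs ! 0 \<in> set xs" "0 < length xs" by auto
  have "Idl {} \<subseteq> {\<zero>}" using genideal_minimal[OF zeroideal] by blast
  moreover have "\<zero> \<in> Idl {}"
   using genideal_ideal[of "{}"] by (simp add: additive_subgroup.zero_closed ideal.axioms(1))
  ultimately have I: "Idl {} = {\<zero>}" by blast
  have "xs ! 0 \<in> Reg R"
   using that(1) x I unfolding regular_sequence_def regular_elements_def by fastforce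
  then show False using no that(2) x by blast
 qed
 then have "depth R n \<le> 0" unfolding depth_def by (intro Sup_least) (auto simp: zero_enat_def)
 then show False using assms by simp
qed

end

context fraction_embedding
begin

lemma phi_eqD: "\<phi> x = \<phi> y ==> x \<in> |S| ==> y \<in> |S| ==> x = y"
 using inj by (auto dest: inj_onD)

lemma regular_if_Unit:
 assumes "s \<in> |S|" "\<phi> s \<in> Units P" shows "s \<in> Reg S"
proof -
 have "r = \<zero>" if r: "r \<in> |S|" "s * r = \<zero>" for r
 proof -
  have "\<phi> s *\<^bsub>P\<^esub> \<phi> r = \<phi> s *\<^bsub>P\<^esub> \<zero>\<^bsub>P\<^esub>"
  proof -
   have "\<phi> s *\<^bsub>P\<^esub> \<phi> r = \<phi> (s * r)" using phi_hom(2)[OF assms(1) r(1)] by simp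
   also have "\<dots> = \<zero>\<^bsub>P\<^esub>" using r(2) phi_zero by simp
   also have "\<dots> = \<phi> s *\<^bsub>P\<^esub> \<zero>\<^bsub>P\<^esub>" using phi_hom(1)[OF assms(1)] by simp
   finally show ?thesis .
  qed
  then have "\<phi> r = \<zero>\<^bsub>P\<^esub>" using P.Units_l_cancel[OF assms(2)] phi_hom(1)[OF r(1)] by simp
  then show ?thesis using phi_eqD[of r "\<zero>"] r phi_zero by simp
 qed
 then show ?thesis using assms(1) unfolding regular_elements_def by blast
qed

lemma image_submod:
 assumes "ideal J S" shows "submod P (\<phi> ` |S| ) (\<phi> ` J)"
proof -
 interpret J: ideal J S by fact
 show ?thesis unfolding submod_def
 proof (intro conjI ballI subsetI)
  show "\<zero>\<^bsub>P\<^esub> \<in> \<phi> ` J" using phi_zero J.zero_closed by (metis imageI)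
 next
  fix x assume "x \<in> \<phi> ` J" then show "x \<in> |P|" using phi_hom J.Icarr by auto
 next
  fix x y assume "x \<in> \<phi> ` J" "y \<in> \<phi> ` J"
  then obtain u v where h: "u \<in> J" "v \<in> J" "x = \<phi> u" "y = \<phi> v" by blast
  have "x \<oplus>\<^bsub>P\<^esub> y = \<phi> (u \<oplus> v)" using h phi_hom(3) J.Icarr by simp
  then show "x \<oplus>\<^bsub>P\<^esub> y \<in> \<phi> ` J" using h J.a_closed by blast
 next
  fix x y assume "x \<in> \<phi> ` |S|" "y \<in> \<phi> ` J"
  then obtain u v where h: "u \<in> |S|" "v \<in> J" "x = \<phi> u" "y = \<phi> v" by blast
  have "x *\<^bsub>P\<^esub> y = \<phi> (u * v)" using h phi_hom(2) J.Icarr by simp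
  then show "x *\<^bsub>P\<^esub> y \<in> \<phi> ` J" using h J.I_l_closed by blast
 qed
qed

lemma preimage_ideal:
 assumes J: "submod P (\<phi> ` |S| ) J" shows "ideal {s \<in> carrier S. \<phi> s \<in> J} S"
 unfolding S.ideal_iff_submod
 using J phi_hom phi_zero unfolding submod_def by auto

lemma embedding_one_dim_frac:
 assumes CM: "cohen_macaulay_local S n" and d: "krull_dim S = 1"
 shows "one_dim_frac P (\<phi> ` |S| ) (\<phi> ` n)"
proof -
 have N: "noetherian_ring S" and L: "local_ring S n" and dep: "depth S n = 1"
  using CM d by (auto simp: cohen_macaulay_local_def)
 note n = S.local_ideal[OF L]
 show ?thesis
 proof unfold_locales
  show "submod P (\<phi> ` |S| ) (\<phi> ` |S| )" using image_submod[OF S.oneideal] .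
  show "\<one>\<^bsub>P\<^esub> \<in> \<phi> ` |S|" using phi_hom(4) by (metis S.one_closed imageI)
  show "\<ominus>\<^bsub>P\<^esub> \<one>\<^bsub>P\<^esub> \<in> \<phi> ` |S|" using phi_minus_one by (metis S.one_closed S.a_inv_closed imageI)
  show "submod P (\<phi> ` |S| ) (\<phi> ` n)" using image_submod[OF n(1)] .
  show "\<phi> ` n = {a \<in> \<phi> ` carrier S. \<not> (\<exists>b\<in>\<phi> ` carrier S. a *\<^bsub>P\<^esub> b = \<one>\<^bsub>P\<^esub>)}"
  proof (intro equalityI subsetI)
   fix x assume "x \<in> \<phi> ` n"
   then obtain r where r: "r \<in> n" "x = \<phi> r" by blast
   have rc: "r \<in> |S|" using r n by blast
   have "\<not> (\<exists>b\<in>\<phi> ` carrier S. x *\<^bsub>P\<^esub> b = \<one>\<^bsub>P\<^esub>)"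
   proof
    assume "\<exists>b\<in>\<phi> ` carrier S. x *\<^bsub>P\<^esub> b = \<one>\<^bsub>P\<^esub>"
    then obtain b where b: "b \<in> |S|" "\<phi> r *\<^bsub>P\<^esub> \<phi> b = \<one>\<^bsub>P\<^esub>" using r by blast
    then have "\<phi> (r * b) = \<phi> \<one>" using rc phi_hom by simp
    then have "r * b = \<one>" using phi_eqD rc b(1) by blast
    then show False using ideal.I_r_closed[OF n(1) r(1) b(1)] n(2) by simp
   qed
   then show "x \<in> {a \<in> \<phi> ` carrier S. \<not> (\<exists>b\<in>\<phi> ` carrier S. a *\<^bsub>P\<^esub> b = \<one>\<^bsub>P\<^esub>)}" using r rc by blast
  next
   fix x assume "x \<in> {a \<in> \<phi> ` carrier S. \<not> (\<exists>b\<in>\<phi> ` carrier S. a *\<^bsub>P\<^esub> b = \<one>\<^bsub>P\<^esub>)}"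
   then obtain r where r: "r \<in> |S|" "x = \<phi> r" and no: "!!b. b \<in> |S| ==> \<phi> r *\<^bsub>P\<^esub> \<phi> b \<noteq> \<one>\<^bsub>P\<^esub>" by blast
   have "r \<in> n"
   proof (rule ccontr)
    assume "r \<notin> n"
    then obtain b where b: "b \<in> |S|" "r * b = \<one>" using S.local_unit[OF N L r(1)] by blast
    then have "\<phi> r *\<^bsub>P\<^esub> \<phi> b = \<one>\<^bsub>P\<^esub>" using phi_hom(2)[OF r(1) b(1)] phi_hom(4) by simp
    then show False using no b by blast
   qed
   then show "x \<in> \<phi> ` n" using r by blast
  qed
  show "\<exists>x. x \<in> \<phi> ` n \<inter> Units P" using S.depth_pos_regular[OF dep] regular_Units by blast
 next
  fix r y assume "r \<in> \<phi> ` n" "y \<in> \<phi> ` |S| \<inter> Units P"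
  then obtain s t where h: "s \<in> n" "r = \<phi> s" "t \<in> |S|" "y = \<phi> t" "\<phi> t \<in> Units P" by blast
  have "t \<in> Reg S" using regular_if_Unit h by blast
  then obtain k a where k: "s [^] (k::nat) = t * a" "a \<in> |S|" using S.power_in_principal[OF N L d h(1)] by blast
  have "s \<in> |S|" using h n by blast
  then have "r [^]\<^bsub>P\<^esub> k = y *\<^bsub>P\<^esub> \<phi> a" using phi_pow[of s k] k h phi_hom(2)[OF h(3) k(2)] by simp
  then show "\<exists>k::nat. \<exists>a\<in>\<phi> ` carrier S. r [^]\<^bsub>P\<^esub> k = y *\<^bsub>P\<^esub> a" using k by blast
 next
  fix q assume "q \<in> |P|"
  then show "\<exists>d\<in>\<phi> ` |S| \<inter> Units P. d *\<^bsub>P\<^esub> q \<in> \<phi> ` |S|"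
   using denominators regular_Units S.regularD(1) by blast
 next
  fix C assume ne: "C \<noteq> {}" and C: "!!J. J \<in> C ==> submod P (\<phi> ` |S| ) J \<and> J \<subseteq> \<phi> ` |S|"
  let ?p = "%J. {s \<in> carrier S. \<phi> s \<in> J}"
  have "\<exists>M\<in>?p ` C. \<forall>J\<in>?p ` C. M \<subseteq> J --> J = M"
   by (rule noetherian_maximal[OF N]) (use ne C preimage_ideal in auto)
  then obtain M where M: "M \<in> C" "!!J. J \<in> C ==> ?p M \<subseteq> ?p J ==> ?p J = ?p M" by auto
  have "J = M" if J: "J \<in> C" "M \<subseteq> J" for J
  proof -
   have e: "?p J = ?p M" using M(2)[OF J(1)] J(2) by blast
   have im: "K = \<phi> ` ?p K" if "K \<in> C" for K using C[OF that] by blast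
   show ?thesis using im[OF J(1)] im[OF M(1)] e by simp
  qed
  then show "\<exists>M\<in>C. \<forall>J\<in>C. M \<subseteq> J --> J = M" using M(1) by blast
 qed
qed

end

subsection \<open>Transport and rescaling of dualizing modules\<close>

text \<open>Dualizing modules are transported along a bijection that is additive and semilinear over a ring homomorphism. The two
cases needed are a ring isomorphism and multiplication by an invertible element.\<close>

lemma dualizing_transport:
 assumes cQ: "cring Q" and cP: "cring P" and \<sigma>: "\<sigma> \<in> ring_hom Q P" and h: "bij_betw h |Q| |P|"
  and h_add: "!!x y. x \<in> |Q| ==> y \<in> |Q| ==> h (x \<oplus>\<^bsub>Q\<^esub> y) = h x \<oplus>\<^bsub>P\<^esub> h y"
  and h_mult: "!!x y. x \<in> |Q| ==> y \<in> |Q| ==> h (x *\<^bsub>Q\<^esub> y) = \<sigma> x *\<^bsub>P\<^esub> h y"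
  and A: "A \<subseteq> |Q|" and n: "n \<subseteq> A" and sn: "submod Q A n" and D: "dualizing Q A n w"
  and Aw: "\<sigma> ` A \<subseteq> h ` w" and bd: "\<exists>d\<in>\<sigma> ` A \<inter> Units P. \<forall>x\<in>h ` w. d *\<^bsub>P\<^esub> x \<in> \<sigma> ` A"
 shows "dualizing P (\<sigma> ` A) (\<sigma> ` n) (h ` w)"
proof -
 interpret Q: cring Q by fact
 interpret P: cring P by fact
 interpret H: ring_hom_cring Q P \<sigma> by unfold_locales (rule \<sigma>)
 have w: "submod Q A w" using D by (simp add: dualizing_def)
 have wc: "x \<in> w ==> x \<in> |Q|" for x using w by (auto simp: submod_def)
 have Ac: "x \<in> A ==> x \<in> |Q|" for x using A by blast
 have nc: "x \<in> n ==> x \<in> |Q|" for x using n A by blast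
 have hc: "h x \<in> |P|" if "x \<in> |Q|" for x using h that by (auto simp: bij_betw_def)
 define k where "k = inv_into |Q| h"
 have kc: "k p \<in> |Q|" and hk: "h (k p) = p" if "p \<in> |P|" for p
  using that h by (auto simp: k_def bij_betw_def inv_into_into f_inv_into_f)
 have kh: "k (h q) = q" if "q \<in> |Q|" for q using that h by (auto simp: k_def bij_betw_def)
 have mem: "h x \<in> h ` w \<longleftrightarrow> x \<in> w" if "x \<in> |Q|" for x
  using that kh wc by (metis imageE imageI)
 have hminus: "h (x \<ominus>\<^bsub>Q\<^esub> y) = h x \<ominus>\<^bsub>P\<^esub> h y" if "x \<in> |Q|" "y \<in> |Q|" for x y
 proof -
  have "h (\<ominus>\<^bsub>Q\<^esub> y) = h ((\<ominus>\<^bsub>Q\<^esub> \<one>\<^bsub>Q\<^esub>) *\<^bsub>Q\<^esub> y)" using that by (simp add: Q.l_minus)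
  also have "\<dots> = \<ominus>\<^bsub>P\<^esub> h y" using that hc by (subst h_mult) (auto simp: P.l_minus)
  finally show ?thesis using that h_add by (simp add: Q.minus_eq P.minus_eq)
 qed
 have colon: "p \<in> colon P (h ` w) (\<sigma> ` n) \<longleftrightarrow> p \<in> |P| \<and> k p \<in> colon Q w n" for p
 proof -
  have "p *\<^bsub>P\<^esub> \<sigma> y \<in> h ` w \<longleftrightarrow> k p *\<^bsub>Q\<^esub> y \<in> w" if "p \<in> |P|" "y \<in> n" for y
  proof -
   have "h (y *\<^bsub>Q\<^esub> k p) = \<sigma> y *\<^bsub>P\<^esub> p" using h_mult that kc hk nc by simp
   then have e: "p *\<^bsub>P\<^esub> \<sigma> y = h (k p *\<^bsub>Q\<^esub> y)" using that kc nc by (simp add: P.m_comm Q.m_comm)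
   show ?thesis unfolding e by (rule mem) (use kc that nc in simp)
  qed
  then show ?thesis using kc by (auto simp: colon_def)
 qed
 show ?thesis unfolding dualizing_def
 proof (intro conjI Aw bd)
  show "submod P (\<sigma> ` A) (h ` w)" unfolding submod_def
  proof (intro conjI ballI subsetI)
   have "h \<zero>\<^bsub>Q\<^esub> = \<zero>\<^bsub>P\<^esub>" using h_mult[of "\<zero>\<^bsub>Q\<^esub>" "\<zero>\<^bsub>Q\<^esub>"] hc by simp
   then show "\<zero>\<^bsub>P\<^esub> \<in> h ` w" using w by (auto simp: submod_def intro!: rev_image_eqI)
  next
   fix x assume "x \<in> h ` w" then show "x \<in> |P|" using wc hc by auto
  next
   fix x y assume "x \<in> h ` w" "y \<in> h ` w"
   then obtain u v where uv: "u \<in> w" "v \<in> w" "x = h u" "y = h v" by blast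
   have "x \<oplus>\<^bsub>P\<^esub> y = h (u \<oplus>\<^bsub>Q\<^esub> v)" using uv wc h_add by simp
   then show "x \<oplus>\<^bsub>P\<^esub> y \<in> h ` w" using w uv by (auto simp: submod_def)
  next
   fix x y assume "x \<in> \<sigma> ` A" "y \<in> h ` w"
   then obtain u v where uv: "u \<in> A" "v \<in> w" "x = \<sigma> u" "y = h v" by blast
   have "x *\<^bsub>P\<^esub> y = h (u *\<^bsub>Q\<^esub> v)" using uv wc Ac h_mult by simp
   then show "x *\<^bsub>P\<^esub> y \<in> h ` w" using w uv by (auto simp: submod_def)
  qed
  obtain s where s: "s \<in> colon Q w n" "s \<notin> w" "!!q. q \<in> colon Q w n ==> \<exists>a\<in>A. q \<ominus>\<^bsub>Q\<^esub> a *\<^bsub>Q\<^esub> s \<in> w"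
   using D unfolding dualizing_def by blast
  have sc: "s \<in> |Q|" using s by (auto simp: colon_def)
  show "\<exists>s\<in>colon P (h ` w) (\<sigma> ` n). s \<notin> h ` w \<and>
   (\<forall>q\<in>colon P (h ` w) (\<sigma> ` n). \<exists>a\<in>\<sigma> ` A. q \<ominus>\<^bsub>P\<^esub> a *\<^bsub>P\<^esub> s \<in> h ` w)"
  proof (rule bexI[of _ "h s"], intro conjI ballI)
   show "h s \<in> colon P (h ` w) (\<sigma> ` n)" using colon s(1) sc kh hc by simp
   show "h s \<notin> h ` w" using mem sc s by blast
   fix q assume "q \<in> colon P (h ` w) (\<sigma> ` n)"
   then have q: "q \<in> |P|" "k q \<in> colon Q w n" using colon by auto
   obtain a where a: "a \<in> A" "k q \<ominus>\<^bsub>Q\<^esub> a *\<^bsub>Q\<^esub> s \<in> w" using s(3)[OF q(2)] by blast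
   have "h (k q \<ominus>\<^bsub>Q\<^esub> a *\<^bsub>Q\<^esub> s) = q \<ominus>\<^bsub>P\<^esub> \<sigma> a *\<^bsub>P\<^esub> h s" using hminus h_mult kc hk q a Ac sc by simp
   then show "\<exists>a\<in>\<sigma> ` A. q \<ominus>\<^bsub>P\<^esub> a *\<^bsub>P\<^esub> h s \<in> h ` w" using a by (metis imageI)
  qed
  show "\<forall>f. hom_mod P (\<sigma> ` A) (h ` w) (\<sigma> ` n) f --> (\<exists>c\<in>carrier P. \<forall>r\<in>\<sigma> ` n. f r \<ominus>\<^bsub>P\<^esub> r *\<^bsub>P\<^esub> c \<in> h ` w)"
  proof (intro allI impI)
   fix f assume f: "hom_mod P (\<sigma> ` A) (h ` w) (\<sigma> ` n) f"
   have fc: "f (\<sigma> r) \<in> |P|" if "r \<in> n" for r using f that by (auto simp: hom_mod_def)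
   define g where "g r = k (f (\<sigma> r))" for r
   have gc: "g r \<in> |Q|" and hg: "h (g r) = f (\<sigma> r)" if "r \<in> n" for r using fc kc hk that by (simp_all add: g_def)
   have "hom_mod Q A w n g" unfolding hom_mod_def
   proof (intro conjI ballI)
    fix x assume "x \<in> n" then show "g x \<in> |Q|" by (rule gc)
   next
    fix x y assume xy: "x \<in> n" "y \<in> n"
    then have xyn: "x \<oplus>\<^bsub>Q\<^esub> y \<in> n" using sn by (auto simp: submod_def)
    have "f (\<sigma> x \<oplus>\<^bsub>P\<^esub> \<sigma> y) \<ominus>\<^bsub>P\<^esub> (f (\<sigma> x) \<oplus>\<^bsub>P\<^esub> f (\<sigma> y)) \<in> h ` w"
     using f xy by (auto simp: hom_mod_def)
    moreover have "h (g (x \<oplus>\<^bsub>Q\<^esub> y) \<ominus>\<^bsub>Q\<^esub> (g x \<oplus>\<^bsub>Q\<^esub> g y))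
     = f (\<sigma> x \<oplus>\<^bsub>P\<^esub> \<sigma> y) \<ominus>\<^bsub>P\<^esub> (f (\<sigma> x) \<oplus>\<^bsub>P\<^esub> f (\<sigma> y))"
     using xy xyn gc hg hminus h_add nc by simp
    ultimately show "g (x \<oplus>\<^bsub>Q\<^esub> y) \<ominus>\<^bsub>Q\<^esub> (g x \<oplus>\<^bsub>Q\<^esub> g y) \<in> w"
     using mem[of "g (x \<oplus>\<^bsub>Q\<^esub> y) \<ominus>\<^bsub>Q\<^esub> (g x \<oplus>\<^bsub>Q\<^esub> g y)"] gc[OF xy(1)] gc[OF xy(2)] gc[OF xyn] by simp
   next
    fix a y assume xy: "a \<in> A" "y \<in> n"
    then have xyn: "a *\<^bsub>Q\<^esub> y \<in> n" using sn by (auto simp: submod_def)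
    have "f (\<sigma> a *\<^bsub>P\<^esub> \<sigma> y) \<ominus>\<^bsub>P\<^esub> \<sigma> a *\<^bsub>P\<^esub> f (\<sigma> y) \<in> h ` w"
     using f xy by (auto simp: hom_mod_def)
    moreover have "h (g (a *\<^bsub>Q\<^esub> y) \<ominus>\<^bsub>Q\<^esub> a *\<^bsub>Q\<^esub> g y)
     = f (\<sigma> a *\<^bsub>P\<^esub> \<sigma> y) \<ominus>\<^bsub>P\<^esub> \<sigma> a *\<^bsub>P\<^esub> f (\<sigma> y)"
     using xy xyn gc hg hminus h_mult nc Ac by simp
    ultimately show "g (a *\<^bsub>Q\<^esub> y) \<ominus>\<^bsub>Q\<^esub> a *\<^bsub>Q\<^esub> g y \<in> w"
     using mem[of "g (a *\<^bsub>Q\<^esub> y) \<ominus>\<^bsub>Q\<^esub> a *\<^bsub>Q\<^esub> g y"] Ac[OF xy(1)] gc[OF xy(2)] gc[OF xyn] by simp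
   qed
   then obtain c where c: "c \<in> |Q|" "!!r. r \<in> n ==> g r \<ominus>\<^bsub>Q\<^esub> r *\<^bsub>Q\<^esub> c \<in> w"
    using D unfolding dualizing_def by blast
   have "f (\<sigma> r) \<ominus>\<^bsub>P\<^esub> \<sigma> r *\<^bsub>P\<^esub> h c \<in> h ` w" if r: "r \<in> n" for r
   proof -
    have "h (g r \<ominus>\<^bsub>Q\<^esub> r *\<^bsub>Q\<^esub> c) = f (\<sigma> r) \<ominus>\<^bsub>P\<^esub> \<sigma> r *\<^bsub>P\<^esub> h c"
     using r gc hg hminus h_mult nc c by simp
    then show ?thesis using c(2)[OF r] by (metis imageI)
   qed
   then show "\<exists>c\<in>carrier P. \<forall>r\<in>\<sigma> ` n. f r \<ominus>\<^bsub>P\<^esub> r *\<^bsub>P\<^esub> c \<in> h ` w" using c(1) hc by blast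
  qed
 qed
qed

lemma dualizing_iso:
 assumes cQ: "cring Q" and cP: "cring P" and h: "h \<in> ring_iso Q P"
  and A: "A \<subseteq> |Q|" and n: "n \<subseteq> A" and sn: "submod Q A n" and D: "dualizing Q A n w"
 shows "dualizing P (h ` A) (h ` n) (h ` w)"
proof (rule dualizing_transport[OF cQ cP _ _ _ _ A n sn D])
 note hm = ring_iso_memE[OF h]
 show hh: "h \<in> ring_hom Q P" using h by (simp add: ring_iso_def)
 interpret H: ring_hom_ring Q P h by (rule ring_hom_ringI2) (use cQ cP hh cring.axioms(1) in auto)
 show "bij_betw h |Q| |P|" by (rule hm(5))
 show "h ` A \<subseteq> h ` w" using D by (auto simp: dualizing_def)
 obtain d where d: "d \<in> A" "d \<in> Units Q" "!!x. x \<in> w ==> d *\<^bsub>Q\<^esub> x \<in> A" using D unfolding dualizing_def by blast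
 have "h d *\<^bsub>P\<^esub> h x \<in> h ` A" if x: "x \<in> w" for x
 proof -
  have "x \<in> |Q|" "d \<in> |Q|" using x d(1) A D by (auto simp: dualizing_def submod_def)
  then have "h d *\<^bsub>P\<^esub> h x = h (d *\<^bsub>Q\<^esub> x)" using hm(2) by simp
  then show ?thesis using d(3)[OF x] by simp
 qed
 moreover have "h d \<in> Units P"
 proof -
  obtain e where "e \<in> |Q|" "d \<in> |Q|" "e *\<^bsub>Q\<^esub> d = \<one>\<^bsub>Q\<^esub>" "d *\<^bsub>Q\<^esub> e = \<one>\<^bsub>Q\<^esub>" using d(2) by (auto simp: Units_def)
  then show ?thesis unfolding Units_def using hm(1,4) hm(2)[of e d] hm(2)[of d e] by (auto intro!: bexI[of _ "h e"])
 qed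
 ultimately show "\<exists>d\<in>h ` A \<inter> Units P. \<forall>x\<in>h ` w. d *\<^bsub>P\<^esub> x \<in> h ` A" using d(1) by blast
qed (use ring_iso_memE[OF h] in auto)

lemma (in one_dim_frac) dualizing_scale:
 assumes D: "dualizing Q A n w" and u: "u \<in> Units Q" and Aw: "A \<subseteq> (%x. u * x) ` w"
 shows "dualizing Q A n ((%x. u * x) ` w)"
proof -
 have uc: "u \<in> |Q|" "inv u \<in> |Q|" using u by auto
 have ui: "inv u * (u * x) = x" "u * (inv u * x) = x" if "x \<in> |Q|" for x
  using that uc u by (simp_all add: m_assoc[symmetric])
 obtain d where d: "d \<in> A \<inter> Units Q" "!!x. x \<in> w ==> d * x \<in> A" using D unfolding dualizing_def by blast
 obtain e where e: "e \<in> A \<inter> Units Q" "e * u \<in> A" using fractions[OF uc(1)] by blast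
 have "dualizing Q ((%x. x) ` A) ((%x. x) ` n) ((%x. u * x) ` w)"
 proof (rule dualizing_transport[OF cring_axioms cring_axioms _ _ _ _ _ _ sub_n D])
  show "bij_betw (%x. u * x) |Q| |Q|"
   by (rule bij_betw_byWitness[of _ "%x. inv u * x"]) (use ui uc in auto)
  have "e * d * (u * y) \<in> A" if y: "y \<in> w" for y
  proof -
   have "e * d * (u * y) = (e * u) * (d * y)"
    using submodD(1)[OF dualizingD(1)[OF D] y] uc d e by (simp add: m_ac)
   then show ?thesis using A_mult[OF e(2) d(2)[OF y]] by simp
  qed
  then show "\<exists>d\<in>(%x. x) ` A \<inter> Units Q. \<forall>x\<in>(%x. u * x) ` w. d * x \<in> (%x. x) ` A"
   using d e A_mult by (intro bexI[of _ "e * d"]) auto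
 qed (use Aw uc n_A in \<open>auto simp: ring_hom_def r_distr m_lcomm\<close>)
 then show ?thesis by simp
qed

section \<open>Ext of the residue field in a ring of fractions\<close>

subsection \<open>Vectors and matrices\<close>

definition vec :: "'q set => nat => (nat => 'q) => bool" where
 "vec X p v \<longleftrightarrow> (\<forall>j<p. v j \<in> X)"

lemma vecI: "(!!j. j < p ==> v j \<in> X) ==> vec X p v"
 by (simp add: vec_def)

lemma vecD: "vec X p v ==> j < p ==> v j \<in> X"
 by (simp add: vec_def)

context cring
begin

abbreviation cvec where "cvec \<equiv> vec |R|"

definition unit_vec :: "nat => nat => 'a" where "unit_vec l j = (if j = l then \<one> else \<zero>)"

lemma unit_vec_closed [simp]: "unit_vec l j \<in> |R|"
 by (simp add: unit_vec_def)

lemma cdot_Suc: "cvec (Suc p) u ==> cvec (Suc p) v ==> dot R (Suc p) u v = u p * v p \<oplus> dot R p u v"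
 by (rule dot_Suc) (auto simp: vec_def)

lemma cvec_Suc: "cvec (Suc p) u ==> cvec p u"
 by (auto simp: vec_def)

lemma cdot_closed [simp]: "cvec p u ==> cvec p v ==> dot R p u v \<in> |R|"
 by (rule dot_closed) (auto simp: vec_def)

lemma cdot_cong:
 assumes "cvec p u" "cvec p v" "!!j. j < p ==> u j = u' j" "!!j. j < p ==> v j = v' j"
 shows "dot R p u v = dot R p u' v'"
 by (rule dot_cong) (use assms in \<open>auto simp: vec_def\<close>)

lemma cdot_add_right:
 "cvec p u ==> cvec p v ==> cvec p v' ==> dot R p u (%j. v j \<oplus> v' j) = dot R p u v \<oplus> dot R p u v'"
proof (induction p)
 case (Suc p)
 have c: "cvec (Suc p) (%j. v j \<oplus> v' j)" using Suc.prems by (auto simp: vec_def)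
 have "u p \<in> |R|" "v p \<in> |R|" "v' p \<in> |R|" using Suc.prems by (auto simp: vec_def)
 then show ?case using Suc.prems Suc.IH c cvec_Suc
  by (simp add: cdot_Suc r_distr a_ac)
qed simp

lemma cdot_scale_right:
 "cvec p u ==> cvec p v ==> a \<in> |R| ==> dot R p u (%j. a * v j) = a * dot R p u v"
proof (induction p)
 case (Suc p)
 have c: "cvec (Suc p) (%j. a * v j)" using Suc.prems by (auto simp: vec_def)
 have "u p \<in> |R|" "v p \<in> |R|" using Suc.prems by (auto simp: vec_def)
 then show ?case using Suc.prems Suc.IH c cvec_Suc
  by (simp add: cdot_Suc r_distr m_lcomm)
qed simp

lemma cdot_comm: "cvec p u ==> cvec p v ==> dot R p u v = dot R p v u"
 unfolding dot_def by (rule finsum_cong') (auto simp: vec_def m_comm)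

lemma cdot_zero_right: "cvec p u ==> (!!j. j < p ==> v j = \<zero>) ==> dot R p u v = \<zero>"
 unfolding dot_def by (rule add.finprod_one_eqI) (auto simp: vec_def)

lemma cdot_minus_right:
 assumes u: "cvec p u" and v: "cvec p v" and v': "cvec p v'"
 shows "dot R p u (%j. v j \<ominus> v' j) = dot R p u v \<ominus> dot R p u v'"
proof -
 have n: "cvec p (%j. \<ominus> \<one> * v' j)" using v' by (auto simp: vec_def)
 have "dot R p u (%j. v j \<ominus> v' j) = dot R p u (%j. v j \<oplus> \<ominus> \<one> * v' j)"
  by (rule cdot_cong) (use u v v' in \<open>auto simp: vec_def minus_eq l_minus\<close>)
 also have "\<dots> = dot R p u v \<oplus> \<ominus> \<one> * dot R p u v'"
  using cdot_add_right[OF u v n] cdot_scale_right[OF u v'] by simp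
 finally show ?thesis using u v v' by (simp add: minus_eq l_minus)
qed

lemma cdot_unit_right: "cvec p u ==> l < p ==> dot R p u (unit_vec l) = u l"
proof (induction p)
 case (Suc p)
 have c: "cvec (Suc p) (unit_vec l)" by (auto simp: vec_def)
 have up: "u p \<in> |R|" using Suc.prems by (auto simp: vec_def)
 show ?case
 proof (cases "l = p")
  case True
  have "dot R p u (unit_vec l) = \<zero>"
   by (rule cdot_zero_right) (use Suc.prems True in \<open>auto simp: unit_vec_def vec_def\<close>)
  moreover have "unit_vec l p = \<one>" using True by (simp add: unit_vec_def)
  ultimately show ?thesis using True up cdot_Suc[OF Suc.prems(1) c] by simp
 next
  case False
  then have l: "l < p" using Suc.prems by simp
  have "u l \<in> |R|" using l Suc.prems by (auto simp: vec_def)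
  moreover have "unit_vec l p = \<zero>" using False by (simp add: unit_vec_def)
  ultimately show ?thesis using up cdot_Suc[OF Suc.prems(1) c] Suc.IH[OF cvec_Suc[OF Suc.prems(1)] l] by simp
 qed
qed simp

lemma cdot_swap:
 "(!!j k. j < p ==> k < q ==> M j k \<in> |R| ) ==> cvec p v ==> cvec q c ==>
  dot R q (%k. dot R p (%j. M j k) v) c = dot R p v (%j. dot R q (M j) c)"
proof (induction p)
 case 0
 have "dot R q (%k. dot R 0 (%j. M j k) v) c = dot R q c (%k. \<zero>)"
  using cdot_comm[of q "%k. \<zero>" c] 0 by (simp add: vec_def)
 then show ?case using cdot_zero_right[OF 0(3)] by simp
next
 case (Suc p)
 have Mc: "cvec q (%k. M j k)" if "j < Suc p" for j using Suc.prems(1) that by (auto simp: vec_def)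
 have Mr: "cvec (Suc p) (%j. M j k)" if "k < q" for k using Suc.prems(1) that by (auto simp: vec_def)
 have vp: "v p \<in> |R|" "cvec p v" using Suc.prems by (auto simp: vec_def)
 have d: "cvec q (%k. dot R p (%j. M j k) v)"
  by (rule vecI, rule cdot_closed) (use Mr cvec_Suc vp in auto)
 have e: "cvec q (%k. v p * M p k)" using Mc[of p] vp by (auto simp: vec_def)
 have "dot R q (%k. dot R (Suc p) (%j. M j k) v) c = dot R q (%k. v p * M p k \<oplus> dot R p (%j. M j k) v) c"
 proof (rule cdot_cong)
  show "cvec q (%k. dot R (Suc p) (%j. M j k) v)"
   by (rule vecI, rule cdot_closed) (use Mr Suc.prems in auto)
  show "dot R (Suc p) (%j. M j k) v = v p * M p k \<oplus> dot R p (%j. M j k) v" if "k < q" for k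
   using cdot_Suc[OF Mr[OF that] Suc.prems(2)] Mc[of p] that vp by (auto simp: vec_def m_comm)
 qed (use Suc.prems in auto)
 also have "\<dots> = dot R q c (%k. v p * M p k \<oplus> dot R p (%j. M j k) v)"
  by (rule cdot_comm) (use Suc.prems d e in \<open>auto simp: vec_def\<close>)
 also have "\<dots> = v p * dot R q c (M p) \<oplus> dot R q c (%k. dot R p (%j. M j k) v)"
  using cdot_add_right[OF Suc.prems(3) e d] cdot_scale_right[OF Suc.prems(3), of "M p" "v p"] vp Mc[of p] by simp
 also have "dot R q c (M p) = dot R q (M p) c" using cdot_comm Suc.prems(3) Mc[of p] by simp
 also have "dot R q c (%k. dot R p (%j. M j k) v) = dot R q (%k. dot R p (%j. M j k) v) c"
  using cdot_comm Suc.prems(3) d by simp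
 also have "\<dots> = dot R p v (%j. dot R q (M j) c)"
  by (rule Suc.IH) (use Suc.prems in \<open>auto simp: vec_def\<close>)
 also have "v p * dot R q (M p) c \<oplus> dot R p v (%j. dot R q (M j) c) = dot R (Suc p) v (%j. dot R q (M j) c)"
  by (rule cdot_Suc[symmetric]) (use Suc.prems Mc in \<open>auto simp: vec_def intro!: dot_closed\<close>)
 finally show ?case .
qed

end

context one_dim_frac
begin

lemma vec_A: "vec A p v ==> cvec p v"
 by (auto simp: vec_def)

lemma dot_mem:
 assumes w: "submod Q A w" shows "vec A p u ==> vec w p v ==> dot Q p u v \<in> w"
proof (induction p)
 case 0 then show ?case using submodD(2)[OF w] by simp
next
 case (Suc p)
 have c: "cvec (Suc p) u" "cvec (Suc p) v" using Suc.prems submodD(1)[OF w] by (auto simp: vec_def)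
 have "u p * v p \<in> w" using submodD(4)[OF w] Suc.prems by (auto simp: vec_def)
 moreover have "dot Q p u v \<in> w" using Suc by (auto simp: vec_def)
 ultimately show ?case using cdot_Suc[OF c] submodD(3)[OF w] by simp
qed

lemma dot_A: "vec A p u ==> vec A p v ==> dot Q p u v \<in> A"
 by (rule dot_mem[OF subA])

lemma unit_vec_A: "unit_vec l j \<in> A"
 by (simp add: unit_vec_def one_A A_zero)

subsection \<open>Free resolutions of the residue field\<close>

text \<open>A resolution of $A / n$ by finite free $A$-modules, given by matrices $a i$ over $A$ and a row \<open>\<epsilon>\<close> that generates
$A / n$.\<close>

definition resolution :: "(nat => nat) => (nat => nat => nat => 'a) => (nat => 'a) => bool" where
 "resolution p a eps \<longleftrightarrow>
  (\<forall>i. \<forall>j<p i. \<forall>k<p (Suc i). a i j k \<in> A) \<and> vec A (p 0) eps \<and>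
  (\<exists>c. vec A (p 0) c \<and> dot Q (p 0) c eps = \<one>) \<and>
  (\<forall>c. vec A (p 0) c --> (dot Q (p 0) c eps \<in> n \<longleftrightarrow>
    (\<exists>c'. vec A (p 1) c' \<and> (\<forall>j<p 0. c j = dot Q (p 1) (a 0 j) c')))) \<and>
  (\<forall>i c. vec A (p (Suc i)) c --> ((\<forall>j<p i. dot Q (p (Suc i)) (a i j) c = \<zero>) \<longleftrightarrow>
    (\<exists>c'. vec A (p (Suc (Suc i))) c' \<and>
     (\<forall>k<p (Suc i). c k = dot Q (p (Suc (Suc i))) (a (Suc i) k) c'))))"

definition cocycle where
 "cocycle p a w i v \<longleftrightarrow> vec w (p i) v \<and> (\<forall>k<p (Suc i). dot Q (p i) (%j. a i j k) v = \<zero>)"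

definition coboundary where
 "coboundary p a w i v \<longleftrightarrow> (\<exists>u. vec w (p i) u \<and> (\<forall>k<p (Suc i). v k = dot Q (p i) (%j. a i j k) u))"

context
 fixes p a eps assumes res: "resolution p a eps"
begin

lemma mat_A: "j < p i ==> k < p (Suc i) ==> a i j k \<in> A"
 using res by (simp add: resolution_def)

lemma row_A: "j < p i ==> vec A (p (Suc i)) (a i j)"
 and col_A: "k < p (Suc i) ==> vec A (p i) (%j. a i j k)"
 using mat_A by (auto simp: vec_def)

lemma row_c: "j < p i ==> cvec (p (Suc i)) (a i j)"
 and col_c: "k < p (Suc i) ==> cvec (p i) (%j. a i j k)"
 using row_A col_A vec_A by blast+

lemma eps_A: "vec A (p 0) eps"
 using res by (simp add: resolution_def)

lemma eps_one: "\<exists>c. vec A (p 0) c \<and> dot Q (p 0) c eps = \<one>"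
 using res by (simp add: resolution_def)

lemma exact0: "vec A (p 0) c ==> dot Q (p 0) c eps \<in> n \<longleftrightarrow>
  (\<exists>c'. vec A (p 1) c' \<and> (\<forall>j<p 0. c j = dot Q (p 1) (a 0 j) c'))"
 using res by (simp add: resolution_def)

lemma exact: "vec A (p (Suc i)) c ==> (\<forall>j<p i. dot Q (p (Suc i)) (a i j) c = \<zero>) \<longleftrightarrow>
  (\<exists>c'. vec A (p (Suc (Suc i))) c' \<and> (\<forall>k<p (Suc i). c k = dot Q (p (Suc (Suc i))) (a (Suc i) k) c'))"
 using res by (simp add: resolution_def)

lemma mv_A: "j < p i ==> vec A (p (Suc i)) c ==> dot Q (p (Suc i)) (a i j) c \<in> A"
 using dot_A row_A by blast

lemma adjoint:
 assumes "cvec (p i) v" "cvec (p (Suc i)) c"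
 shows "dot Q (p (Suc i)) (%k. dot Q (p i) (%j. a i j k) v) c = dot Q (p i) v (%j. dot Q (p (Suc i)) (a i j) c)"
 by (rule cdot_swap) (use assms mat_A in auto)

lemma mv_unit: "j < p i ==> k < p (Suc i) ==> dot Q (p (Suc i)) (a i j) (unit_vec k) = a i j k"
 by (rule cdot_unit_right[OF row_c])

lemma mat_mat_zero:
 assumes "j < p i" "vec A (p (Suc (Suc i))) c"
 shows "dot Q (p (Suc i)) (a i j) (%k. dot Q (p (Suc (Suc i))) (a (Suc i) k) c) = \<zero>"
proof -
 have "vec A (p (Suc i)) (%k. dot Q (p (Suc (Suc i))) (a (Suc i) k) c)"
  using mv_A assms(2) by (auto simp: vec_def)
 from exact[OF this] show ?thesis using assms by blast
qed

lemma codiff_codiff: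
 assumes v: "cvec (p i) v" and k: "k < p (Suc (Suc i))"
 shows "dot Q (p (Suc i)) (%j. a (Suc i) j k) (%l. dot Q (p i) (%j. a i j l) v) = \<zero>"
proof -
 have 1: "cvec (p (Suc i)) (%l. dot Q (p i) (%j. a i j l) v)"
  using v col_c by (auto simp: vec_def intro!: cdot_closed)
 have "dot Q (p (Suc i)) (%j. a (Suc i) j k) (%l. dot Q (p i) (%j. a i j l) v)
  = dot Q (p (Suc i)) (%l. dot Q (p i) (%j. a i j l) v) (%j. a (Suc i) j k)"
  using cdot_comm[OF 1 col_c[OF k]] by simp
 also have "\<dots> = dot Q (p i) v (%j. dot Q (p (Suc i)) (a i j) (%l. a (Suc i) l k))"
  by (rule adjoint[OF v col_c[OF k]])
 also have "\<dots> = \<zero>"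
 proof (rule cdot_zero_right[OF v])
  fix j assume j: "j < p i"
  have u: "vec A (p (Suc (Suc i))) (unit_vec k)" by (simp add: vec_def unit_vec_A)
  have "dot Q (p (Suc i)) (a i j) (%l. a (Suc i) l k)
   = dot Q (p (Suc i)) (a i j) (%l. dot Q (p (Suc (Suc i))) (a (Suc i) l) (unit_vec k))"
   by (rule cdot_cong) (use row_c[OF j] col_c[OF k] mv_unit[OF _ k] in auto)
  then show "dot Q (p (Suc i)) (a i j) (%l. a (Suc i) l k) = \<zero>" using mat_mat_zero[OF j u] by simp
 qed
 finally show ?thesis .
qed

text \<open>Multiplication by $x$ in $n$ is zero on $A / n$, hence null-homotopic on the resolution. The homotopy is constructed
degree by degree; only its consequence \<open>d \<rho> d = x d\<close> is recorded, which is what the induction needs.\<close>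

lemma contraction:
 assumes x: "x \<in> n"
 shows "\<exists>\<rho>. (\<forall>l<p i. vec A (p (Suc i)) (\<rho> l)) \<and>
  (\<forall>c. vec A (p (Suc i)) c --> (\<forall>j<p i.
   dot Q (p (Suc i)) (a i j) (%k. dot Q (p i) (%l. \<rho> l k) (%l. dot Q (p (Suc i)) (a i l) c))
   = x * dot Q (p (Suc i)) (a i j) c))"
proof (induction i)
 case 0
 have xA: "x \<in> A" using n_A x .
 have xc: "x \<in> |Q|" using xA by blast
 have "\<exists>c'. vec A (p 1) c' \<and> (\<forall>j<p 0. x * unit_vec l j = dot Q (p 1) (a 0 j) c')" if l: "l < p 0" for l
 proof -
  have v: "vec A (p 0) (%j. x * unit_vec l j)" using A_mult[OF xA unit_vec_A] by (simp add: vec_def)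
  have u: "cvec (p 0) (unit_vec l)" by (simp add: vec_def)
  have e: "cvec (p 0) eps" using vec_A eps_A by blast
  have "dot Q (p 0) (%j. x * unit_vec l j) eps = x * eps l"
   using cdot_comm[OF vec_A[OF v] e] cdot_scale_right[OF e u xc] cdot_unit_right[OF e l] by simp
  also have "\<dots> \<in> n" using submodD(4)[OF sub_n vecD[OF eps_A l] x] xc vecD[OF e l] by (simp add: m_comm)
  finally show ?thesis using exact0[OF v] by simp
 qed
 then obtain \<rho> where \<rho>: "!!l. l < p 0 ==> vec A (p 1) (\<rho> l)"
  "!!l j. l < p 0 ==> j < p 0 ==> dot Q (p 1) (a 0 j) (\<rho> l) = x * unit_vec l j" by metis
 have "dot Q (p 1) (a 0 j) (%k. dot Q (p 0) (%l. \<rho> l k) y) = x * y j" if y: "cvec (p 0) y" and j: "j < p 0" for y j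
 proof -
  have r: "cvec (p 1) (a 0 j)" using row_c[OF j] by simp
  have rc: "cvec (p 1) (\<rho> l)" if "l < p 0" for l using vec_A \<rho>(1)[OF that] .
  have t: "cvec (p 1) (%k. dot Q (p 0) (%l. \<rho> l k) y)"
   using rc y by (auto simp: vec_def intro!: dot_closed)
  have "dot Q (p 1) (a 0 j) (%k. dot Q (p 0) (%l. \<rho> l k) y) = dot Q (p 1) (%k. dot Q (p 0) (%l. \<rho> l k) y) (a 0 j)"
   by (rule cdot_comm[OF r t])
  also have "\<dots> = dot Q (p 0) y (%l. dot Q (p 1) (\<rho> l) (a 0 j))"
   by (rule cdot_swap) (use rc y r in \<open>auto simp: vec_def\<close>)
  also have "\<dots> = dot Q (p 0) y (%l. x * unit_vec j l)"
  proof (rule cdot_cong[OF y])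
   show "cvec (p 0) (%l. dot Q (p 1) (\<rho> l) (a 0 j))" using rc r by (auto simp: vec_def intro!: dot_closed)
   fix l assume l: "l < p 0"
   show "dot Q (p 1) (\<rho> l) (a 0 j) = x * unit_vec j l"
    using cdot_comm[OF rc[OF l] r] \<rho>(2)[OF l j] by (simp add: unit_vec_def)
  qed simp
  also have "\<dots> = x * y j" using cdot_scale_right[OF y _ xc] cdot_unit_right[OF y j] by (simp add: vec_def)
  finally show ?thesis .
 qed
 moreover have "cvec (p 0) (%l. dot Q (p 1) (a 0 l) c)" if "vec A (p 1) c" for c
  using mv_A[of _ 0] that by (auto simp: vec_def)
 ultimately show ?case using \<rho>(1) by (intro exI[of _ \<rho>]) simp
next
 case (Suc i)
 have xA: "x \<in> A" using n_A x .
 have xc: "x \<in> |Q|" using xA by blast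
 obtain \<rho> where \<rho>: "!!l. l < p i ==> vec A (p (Suc i)) (\<rho> l)"
  "!!c j. vec A (p (Suc i)) c ==> j < p i ==>
   dot Q (p (Suc i)) (a i j) (%k. dot Q (p i) (%l. \<rho> l k) (%l. dot Q (p (Suc i)) (a i l) c))
   = x * dot Q (p (Suc i)) (a i j) c" using Suc.IH by blast
 have rc: "cvec (p (Suc i)) (\<rho> l)" if "l < p i" for l using vec_A \<rho>(1)[OF that] .
 have rk: "vec A (p i) (%l. \<rho> l k)" if "k < p (Suc i)" for k using \<rho>(1) that by (auto simp: vec_def)
 define y where "y l k = x * unit_vec l k \<ominus> dot Q (p i) (%l'. \<rho> l' k) (%l'. a i l' l)" for l k
 have yA: "vec A (p (Suc i)) (y l)" if "l < p (Suc i)" for l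
  unfolding y_def using xA unit_vec_A dot_A[OF rk col_A[OF that]] by (auto simp: vec_def intro!: A_minus A_mult)
 have "\<exists>c'. vec A (p (Suc (Suc i))) c' \<and> (\<forall>k<p (Suc i). y l k = dot Q (p (Suc (Suc i))) (a (Suc i) k) c')"
  if l: "l < p (Suc i)" for l
 proof -
  have u: "vec A (p (Suc i)) (unit_vec l)" by (simp add: vec_def unit_vec_A)
  have "dot Q (p (Suc i)) (a i j) (y l) = \<zero>" if j: "j < p i" for j
  proof -
   have 1: "cvec (p (Suc i)) (%k. x * unit_vec l k)" using xc by (simp add: vec_def)
   have 2: "cvec (p (Suc i)) (%k. dot Q (p i) (%l'. \<rho> l' k) (%l'. a i l' l))"
    using rk col_A[OF l] dot_A by (auto simp: vec_def)
   have "dot Q (p (Suc i)) (a i j) (%k. dot Q (p i) (%l'. \<rho> l' k) (%l'. a i l' l))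
    = dot Q (p (Suc i)) (a i j) (%k. dot Q (p i) (%l. \<rho> l k) (%l'. dot Q (p (Suc i)) (a i l') (unit_vec l)))"
   proof (rule cdot_cong[OF row_c[OF j] 2])
    fix k assume k: "k < p (Suc i)"
    show "dot Q (p i) (%l'. \<rho> l' k) (%l'. a i l' l) = dot Q (p i) (%l. \<rho> l k) (%l'. dot Q (p (Suc i)) (a i l') (unit_vec l))"
     by (rule cdot_cong) (use vec_A[OF rk[OF k]] col_c[OF l] mv_unit[OF _ l] in auto)
   qed simp
   also have "\<dots> = x * a i j l" using \<rho>(2)[OF u j] mv_unit[OF j l] by simp
   finally have 3: "dot Q (p (Suc i)) (a i j) (%k. dot Q (p i) (%l'. \<rho> l' k) (%l'. a i l' l)) = x * a i j l" .
   have "dot Q (p (Suc i)) (a i j) (y l) = dot Q (p (Suc i)) (a i j) (%k. x * unit_vec l k) \<ominus> x * a i j l"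
    unfolding y_def using cdot_minus_right[OF row_c[OF j] 1 2] 3 by simp
   also have "dot Q (p (Suc i)) (a i j) (%k. x * unit_vec l k) = x * a i j l"
    using cdot_scale_right[OF row_c[OF j] vec_A[OF u] xc] mv_unit[OF j l] by simp
   finally show ?thesis using xc vecD[OF row_c[OF j] l] by (simp add: minus_eq r_neg)
  qed
  then show ?thesis using exact[OF yA[OF l]] by blast
 qed
 then obtain \<sigma> where \<sigma>: "!!l. l < p (Suc i) ==> vec A (p (Suc (Suc i))) (\<sigma> l)"
  "!!l k. l < p (Suc i) ==> k < p (Suc i) ==> y l k = dot Q (p (Suc (Suc i))) (a (Suc i) k) (\<sigma> l)" by metis
 have sc: "cvec (p (Suc (Suc i))) (\<sigma> l)" if "l < p (Suc i)" for l using vec_A \<sigma>(1)[OF that] .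
 have "dot Q (p (Suc (Suc i))) (a (Suc i) j) (%k. dot Q (p (Suc i)) (%l. \<sigma> l k) z) = x * z j"
  if z: "cvec (p (Suc i)) z" and z0: "!!j. j < p i ==> dot Q (p (Suc i)) (a i j) z = \<zero>" and j: "j < p (Suc i)" for z j
 proof -
  note r = row_c[OF j]
  have t: "cvec (p (Suc (Suc i))) (%k. dot Q (p (Suc i)) (%l. \<sigma> l k) z)"
   using sc z by (auto simp: vec_def intro!: dot_closed)
  have 1: "cvec (p (Suc i)) (%l. x * unit_vec j l)" using xc by (simp add: vec_def)
  have 2: "cvec (p (Suc i)) (%l. dot Q (p i) (%l'. a i l' l) (%l'. \<rho> l' j))"
   using rk[OF j] col_A dot_A by (auto simp: vec_def)
  have "dot Q (p (Suc (Suc i))) (a (Suc i) j) (%k. dot Q (p (Suc i)) (%l. \<sigma> l k) z)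
   = dot Q (p (Suc (Suc i))) (%k. dot Q (p (Suc i)) (%l. \<sigma> l k) z) (a (Suc i) j)"
   by (rule cdot_comm[OF r t])
  also have "\<dots> = dot Q (p (Suc i)) z (%l. dot Q (p (Suc (Suc i))) (\<sigma> l) (a (Suc i) j))"
   by (rule cdot_swap) (use sc z r in \<open>auto simp: vec_def\<close>)
  also have "\<dots> = dot Q (p (Suc i)) z (%l. x * unit_vec j l \<ominus> dot Q (p i) (%l'. a i l' l) (%l'. \<rho> l' j))"
  proof (rule cdot_cong[OF z])
   show "cvec (p (Suc i)) (%l. dot Q (p (Suc (Suc i))) (\<sigma> l) (a (Suc i) j))" using sc r by (auto simp: vec_def intro!: dot_closed)
   fix l assume l: "l < p (Suc i)"
   have "dot Q (p (Suc (Suc i))) (\<sigma> l) (a (Suc i) j) = y l j"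
    using cdot_comm[OF sc[OF l] r] \<sigma>(2)[OF l j] by simp
   also have "\<dots> = x * unit_vec j l \<ominus> dot Q (p i) (%l'. a i l' l) (%l'. \<rho> l' j)"
    unfolding y_def using cdot_comm[OF vec_A[OF rk[OF j]] col_c[OF l]] by (simp add: unit_vec_def)
   finally show "dot Q (p (Suc (Suc i))) (\<sigma> l) (a (Suc i) j) = x * unit_vec j l \<ominus> dot Q (p i) (%l'. a i l' l) (%l'. \<rho> l' j)" .
  qed simp
  also have "\<dots> = dot Q (p (Suc i)) z (%l. x * unit_vec j l) \<ominus> dot Q (p (Suc i)) z (%l. dot Q (p i) (%l'. a i l' l) (%l'. \<rho> l' j))"
   by (rule cdot_minus_right[OF z 1 2])
  also have "dot Q (p (Suc i)) z (%l. x * unit_vec j l) = x * z j"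
   using cdot_scale_right[OF z _ xc] cdot_unit_right[OF z j] by (simp add: vec_def)
  also have "dot Q (p (Suc i)) z (%l. dot Q (p i) (%l'. a i l' l) (%l'. \<rho> l' j))
   = dot Q (p (Suc i)) (%l. dot Q (p i) (%l'. a i l' l) (%l'. \<rho> l' j)) z" by (rule cdot_comm[OF z 2])
  also have "\<dots> = dot Q (p i) (%l'. \<rho> l' j) (%l'. dot Q (p (Suc i)) (a i l') z)"
   by (rule adjoint[OF vec_A[OF rk[OF j]] z])
  also have "\<dots> = \<zero>" by (rule cdot_zero_right[OF vec_A[OF rk[OF j]]]) (use z0 in auto)
  finally show ?thesis using xc vecD[OF z j] by (simp add: minus_eq)
 qed
 moreover have "cvec (p (Suc i)) (%l. dot Q (p (Suc (Suc i))) (a (Suc i) l) c)" if "vec A (p (Suc (Suc i))) c" for c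
  using mv_A[of _ "Suc i"] that by (auto simp: vec_def)
 ultimately show ?case using \<sigma>(1) mat_mat_zero by (intro exI[of _ \<sigma>]) simp
qed

text \<open>An invertible $x$ in $n$ makes the homotopy of \<open>contraction\<close> an honest contraction over $Q$. So $Ext(A / n, Q)$ vanishes,
and cocycles with values in $w$ become coboundaries over $Q$.\<close>

lemma codiff_exact:
 assumes w: "cvec (p (Suc i)) w"
  and z: "!!k. k < p (Suc (Suc i)) ==> dot Q (p (Suc i)) (%j. a (Suc i) j k) w = \<zero>"
 shows "\<exists>v. cvec (p i) v \<and> (\<forall>k<p (Suc i). w k = dot Q (p i) (%j. a i j k) v)"
proof -
 obtain x where x: "x \<in> n" "x \<in> Units Q" using ex_regular by blast
 have xc: "x \<in> |Q|" "inv x \<in> |Q|" using x by auto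
 obtain \<rho> where \<rho>: "!!l. l < p i ==> vec A (p (Suc i)) (\<rho> l)"
  "!!c j. vec A (p (Suc i)) c ==> j < p i ==>
   dot Q (p (Suc i)) (a i j) (%k. dot Q (p i) (%l. \<rho> l k) (%l. dot Q (p (Suc i)) (a i l) c))
   = x * dot Q (p (Suc i)) (a i j) c" using contraction[OF x(1), of i] by blast
 have rc: "cvec (p (Suc i)) (\<rho> l)" if "l < p i" for l using vec_A \<rho>(1)[OF that] .
 have rk: "vec A (p i) (%l. \<rho> l k)" if "k < p (Suc i)" for k using \<rho>(1) that by (auto simp: vec_def)
 define u where "u j = dot Q (p (Suc i)) (\<rho> j) w" for j
 have uc: "cvec (p i) u" using rc w by (auto simp: vec_def u_def intro!: dot_closed)
 have main: "dot Q (p i) (%j. a i j k) u = x * w k" if k: "k < p (Suc i)" for k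
 proof -
  define t where "t = (%k'. dot Q (p i) (%l. \<rho> l k') (%l. a i l k))"
  have tA: "vec A (p (Suc i)) t" unfolding t_def using dot_A rk col_A[OF k] by (auto simp: vec_def)
  have eu: "vec A (p (Suc i)) (unit_vec k)" by (simp add: vec_def unit_vec_A)
  have xA: "x \<in> A" using n_A x by blast
  have xe: "vec A (p (Suc i)) (%l. x * unit_vec k l)" using eu xA A_mult by (auto simp: vec_def)
  define d where "d = (%l. t l \<ominus> x * unit_vec k l)"
  have dA: "vec A (p (Suc i)) d" unfolding d_def using tA xe A_minus by (auto simp: vec_def)
  have "dot Q (p (Suc i)) (a i j) d = \<zero>" if j: "j < p i" for j
  proof -
   have "dot Q (p (Suc i)) (a i j) t
    = dot Q (p (Suc i)) (a i j) (%k'. dot Q (p i) (%l. \<rho> l k') (%l'. dot Q (p (Suc i)) (a i l') (unit_vec k)))"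
   proof (rule cdot_cong[OF row_c[OF j] vec_A[OF tA]])
    fix k' assume k': "k' < p (Suc i)"
    show "t k' = dot Q (p i) (%l. \<rho> l k') (%l'. dot Q (p (Suc i)) (a i l') (unit_vec k))"
     unfolding t_def by (rule cdot_cong) (use vec_A[OF rk[OF k']] col_c[OF k] mv_unit[OF _ k] in auto)
   qed simp
   also have "\<dots> = x * a i j k" using \<rho>(2)[OF eu j] mv_unit[OF j k] by simp
   finally have 1: "dot Q (p (Suc i)) (a i j) t = x * a i j k" .
   have "dot Q (p (Suc i)) (a i j) d = x * a i j k \<ominus> dot Q (p (Suc i)) (a i j) (%l. x * unit_vec k l)"
    unfolding d_def using cdot_minus_right[OF row_c[OF j] vec_A[OF tA] vec_A[OF xe]] 1 by simp
   also have "dot Q (p (Suc i)) (a i j) (%l. x * unit_vec k l) = x * a i j k"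
    using cdot_scale_right[OF row_c[OF j] vec_A[OF eu] xc(1)] mv_unit[OF j k] by simp
   finally show ?thesis using xc vecD[OF row_c[OF j] k] by (simp add: minus_eq r_neg)
  qed
  then obtain c where c: "vec A (p (Suc (Suc i))) c"
   "!!k. k < p (Suc i) ==> d k = dot Q (p (Suc (Suc i))) (a (Suc i) k) c" using exact[OF dA] by blast
  have "dot Q (p (Suc i)) w d = dot Q (p (Suc i)) w (%k. dot Q (p (Suc (Suc i))) (a (Suc i) k) c)"
   by (rule cdot_cong[OF w vec_A[OF dA]]) (use c in auto)
  also have "\<dots> = dot Q (p (Suc (Suc i))) (%k. dot Q (p (Suc i)) (%j. a (Suc i) j k) w) c"
   by (rule adjoint[OF w vec_A[OF c(1)], symmetric])
  also have "\<dots> = dot Q (p (Suc (Suc i))) c (%k. dot Q (p (Suc i)) (%j. a (Suc i) j k) w)"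
   by (rule cdot_comm) (use z vec_A[OF c(1)] in \<open>auto simp: vec_def\<close>)
  also have "\<dots> = \<zero>" by (rule cdot_zero_right[OF vec_A[OF c(1)]]) (use z in auto)
  finally have "dot Q (p (Suc i)) w d = \<zero>" .
  moreover have "dot Q (p (Suc i)) w d = dot Q (p (Suc i)) w t \<ominus> x * w k"
   unfolding d_def using cdot_minus_right[OF w vec_A[OF tA] vec_A[OF xe]]
    cdot_scale_right[OF w vec_A[OF eu] xc(1)] cdot_unit_right[OF w k] by simp
  ultimately have wt: "dot Q (p (Suc i)) w t = x * w k"
   using w vec_A[OF tA] xc vecD[OF w k] by simp
  have "dot Q (p i) (%j. a i j k) u = dot Q (p i) (%j. a i j k) (%j. dot Q (p (Suc i)) (\<rho> j) w)" unfolding u_def ..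
  also have "\<dots> = dot Q (p (Suc i)) (%k'. dot Q (p i) (%j. \<rho> j k') (%j. a i j k)) w"
   by (rule cdot_swap[symmetric]) (use rc w col_c[OF k] in \<open>auto simp: vec_def\<close>)
  also have "\<dots> = dot Q (p (Suc i)) w t" unfolding t_def
   by (rule cdot_comm) (use w vec_A[OF tA] in \<open>auto simp: t_def\<close>)
  finally show ?thesis using wt by simp
 qed
 define v where "v j = inv x * u j" for j
 have vc: "cvec (p i) v" using uc xc by (auto simp: vec_def v_def)
 have "w k = dot Q (p i) (%j. a i j k) v" if k: "k < p (Suc i)" for k
 proof -
  have wk: "w k \<in> |Q|" using vecD[OF w k] .
  have "dot Q (p i) (%j. a i j k) v = inv x * (x * w k)"
   unfolding v_def using cdot_scale_right[OF col_c[OF k] uc xc(2)] main[OF k] by simp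
  also have "\<dots> = (inv x * x) * w k" using xc wk by (simp add: m_assoc)
  finally show ?thesis using x(2) wk by simp
 qed
 then show ?thesis using vc by blast
qed

lemma codiff_inj0:
 assumes v: "cvec (p 0) v" and z: "!!k. k < p 1 ==> dot Q (p 0) (%j. a 0 j k) v = \<zero>" and j: "j < p 0"
 shows "v j = \<zero>"
proof -
 obtain x where x: "x \<in> n" "x \<in> Units Q" using ex_regular by blast
 have xA: "x \<in> A" using n_A x by blast
 have xc: "x \<in> |Q|" using xA by blast
 have xe: "vec A (p 0) (%l. x * unit_vec j l)" using xA unit_vec_A A_mult by (auto simp: vec_def)
 have e: "cvec (p 0) eps" using vec_A eps_A by blast
 have u: "cvec (p 0) (unit_vec j)" by (simp add: vec_def)
 have "dot Q (p 0) (%l. x * unit_vec j l) eps = x * eps j"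
  using cdot_comm[OF vec_A[OF xe] e] cdot_scale_right[OF e u xc] cdot_unit_right[OF e j] by simp
 also have "\<dots> \<in> n" using submodD(4)[OF sub_n vecD[OF eps_A j] x(1)] xc vecD[OF e j] by (simp add: m_comm)
 finally obtain c where c: "vec A (p 1) c" "!!l. l < p 0 ==> x * unit_vec j l = dot Q (p 1) (a 0 l) c"
  using exact0[OF xe] by blast
 have c1: "cvec (p (Suc 0)) c" using vec_A[OF c(1)] by simp
 have "x * v j = dot Q (p 0) v (%l. x * unit_vec j l)"
  using cdot_scale_right[OF v u xc] cdot_unit_right[OF v j] by simp
 also have "\<dots> = dot Q (p 0) v (%l. dot Q (p 1) (a 0 l) c)"
  by (rule cdot_cong[OF v vec_A[OF xe]]) (use c in auto)
 also have "\<dots> = dot Q (p 1) (%k. dot Q (p 0) (%j. a 0 j k) v) c"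
  using adjoint[OF v c1] by simp
 also have "\<dots> = dot Q (p 1) c (%k. dot Q (p 0) (%j. a 0 j k) v)"
  by (rule cdot_comm) (use z vec_A[OF c(1)] in \<open>auto simp: vec_def\<close>)
 also have "\<dots> = \<zero>" by (rule cdot_zero_right[OF vec_A[OF c(1)]]) (use z in auto)
 finally have "x * v j = x * \<zero>" using xc by simp
 then show ?thesis using Units_l_cancel[OF x(2) vecD[OF v j] zero_closed] by blast
qed

end

end

context one_dim_frac
begin

lemma hom_mod_dot:
 assumes w: "submod Q A w" and J: "submod Q A J" and f: "hom_mod Q A w J f"
 shows "vec A q c ==> vec J q y ==> f (dot Q q c y) \<ominus> dot Q q c (%k. f (y k)) \<in> w"
proof (induction q)
 case 0
 then show ?case using hom_mod_zero[OF J f] hom_modD(1)[OF f submodD(2)[OF J]] by (simp add: minus_eq)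
next
 case (Suc q)
 have c: "vec A q c" "vec J q y" "c q \<in> A" "y q \<in> J" using Suc.prems by (auto simp: vec_def)
 have cc: "cvec (Suc q) c" using vec_A Suc.prems by blast
 have yc: "cvec (Suc q) y" using Suc.prems submodD(1)[OF J] by (auto simp: vec_def)
 have fy: "cvec (Suc q) (%k. f (y k))" using Suc.prems hom_modD(1)[OF f] by (auto simp: vec_def)
 have dJ: "dot Q q c y \<in> J" using dot_mem[OF J c(1,2)] .
 have cy: "c q * y q \<in> J" using submodD(4)[OF J c(3,4)] .
 note fc = hom_modD(1)[OF f]
 have s: "c q * y q \<oplus> dot Q q c y \<in> J" using submodD(3)[OF J cy dJ] .
 have dd: "dot Q q c (%k. f (y k)) \<in> |Q|" using cvec_Suc[OF cc] cvec_Suc[OF fy] by simp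
 have cq: "c q \<in> |Q|" using c(3) by blast
 have 1: "f (c q * y q \<oplus> dot Q q c y) \<ominus> (f (c q * y q) \<oplus> f (dot Q q c y)) \<in> w"
  using hom_modD(2)[OF f cy dJ] .
 have 2: "(f (c q * y q) \<oplus> f (dot Q q c y)) \<ominus> (c q * f (y q) \<oplus> dot Q q c (%k. f (y k))) \<in> w"
  by (rule cong_add[OF w _ _ _ _ hom_modD(3)[OF f c(3,4)] Suc.IH[OF c(1,2)]]) (use fc cy dJ c cq dd in auto)
 have "f (c q * y q \<oplus> dot Q q c y) \<ominus> (c q * f (y q) \<oplus> dot Q q c (%k. f (y k))) \<in> w"
  by (rule cong_trans[OF w _ _ _ 1 2]) (use fc[OF s] fc[OF cy] fc[OF dJ] fc[OF c(4)] cq dd in auto)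
 then show ?case using cdot_Suc[OF cc yc] cdot_Suc[OF cc fy] by simp
qed

context
 fixes p a eps w assumes res: "resolution p a eps" and w: "submod Q A w"
begin

lemma vec_w: "vec w q v ==> cvec q v"
 using submodD(1)[OF w] by (auto simp: vec_def)

lemmas mat_A' = mat_A[OF res] and row_A' = row_A[OF res] and col_A' = col_A[OF res]
 and row_c' = row_c[OF res] and col_c' = col_c[OF res] and eps_A' = eps_A[OF res]

lemma col_c0: "k < p 1 ==> cvec (p 0) (%j. a 0 j k)"
 and row_c0: "j < p 0 ==> cvec (p 1) (a 0 j)"
 and col_A0: "k < p 1 ==> vec A (p 0) (%j. a 0 j k)"
 using col_c'[of k 0] row_c'[of j 0] col_A'[of k 0] by simp_all

lemma adjoint0:
 assumes "cvec (p 0) v" "cvec (p 1) c"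
 shows "dot Q (p 1) (%k. dot Q (p 0) (%j. a 0 j k) v) c = dot Q (p 0) v (%j. dot Q (p 1) (a 0 j) c)"
 using adjoint[OF res, of 0 v c] assms by simp

lemma eps_c: "cvec (p 0) eps"
 using vec_A eps_A' by blast

text \<open>The generators of $n$ given by the resolution. The cocycles \<open>q * gen\<close> with $q$ in $w : n$ represent all of
\<open>Ext\<^sup>1(A / n, w)\<close>.\<close>

definition gen where "gen k = dot Q (p 0) (%j. a 0 j k) eps"

lemma unit_vec_A': "vec A q (unit_vec k)"
 by (simp add: vec_def unit_vec_A)

lemma gen_n:
 assumes k: "k < p 1" shows "gen k \<in> n"
proof -
 have "\<exists>c'. vec A (p 1) c' \<and> (\<forall>j<p 0. a 0 j k = dot Q (p 1) (a 0 j) c')"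
  using mv_unit[OF res, of _ 0 k] k unit_vec_A' by (intro exI[of _ "unit_vec k"]) auto
 then show ?thesis unfolding gen_def using exact0[OF res col_A0[OF k]] by blast
qed

lemma gen_vec: "vec n (p 1) gen"
 using gen_n by (simp add: vec_def)

lemma gen_cvec: "cvec (p 1) gen"
 using gen_n by (simp add: vec_def)

lemma codiff_eps:
 assumes q: "q \<in> |Q|" and k: "k < p 1"
 shows "dot Q (p 0) (%j. a 0 j k) (%j. q * eps j) = q * gen k"
 unfolding gen_def by (rule cdot_scale_right[OF col_c0[OF k] eps_c q])

lemma coboundary_cong: "coboundary p a w i v ==> (!!k. k < p (Suc i) ==> v k = v' k) ==> coboundary p a w i v'"
 by (auto simp: coboundary_def)

lemma codiff_add:
 assumes "cvec (p i) u" "cvec (p i) v" "k < p (Suc i)"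
 shows "dot Q (p i) (%j. a i j k) (%j. u j \<oplus> v j) = dot Q (p i) (%j. a i j k) u \<oplus> dot Q (p i) (%j. a i j k) v"
 by (rule cdot_add_right) (use assms col_c' in auto)

lemma coboundary_add:
 assumes "coboundary p a w i v" "coboundary p a w i v'"
 shows "coboundary p a w i (%k. v k \<oplus> v' k)"
proof -
 obtain u u' where u: "vec w (p i) u" "!!k. k < p (Suc i) ==> v k = dot Q (p i) (%j. a i j k) u"
  "vec w (p i) u'" "!!k. k < p (Suc i) ==> v' k = dot Q (p i) (%j. a i j k) u'"
  using assms unfolding coboundary_def by blast
 have "vec w (p i) (%j. u j \<oplus> u' j)" using u submodD(3)[OF w] by (auto simp: vec_def)
 moreover have "v k \<oplus> v' k = dot Q (p i) (%j. a i j k) (%j. u j \<oplus> u' j)" if "k < p (Suc i)" for k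
  using codiff_add[OF vec_w[OF u(1)] vec_w[OF u(3)] that] u(2,4)[OF that] by simp
 ultimately show ?thesis unfolding coboundary_def by blast
qed

lemma coboundary_scale:
 assumes "coboundary p a w i v" and r: "r \<in> A"
 shows "coboundary p a w i (%k. r * v k)"
proof -
 obtain u where u: "vec w (p i) u" "!!k. k < p (Suc i) ==> v k = dot Q (p i) (%j. a i j k) u"
  using assms unfolding coboundary_def by blast
 have "vec w (p i) (%j. r * u j)" using u submodD(4)[OF w r] by (auto simp: vec_def)
 moreover have "r * v k = dot Q (p i) (%j. a i j k) (%j. r * u j)" if "k < p (Suc i)" for k
  using cdot_scale_right[OF col_c'[OF that] vec_w[OF u(1)] A_carr[OF r]] u(2)[OF that] by simp
 ultimately show ?thesis unfolding coboundary_def by blast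
qed

lemma coboundary_gen:
 assumes "q \<in> w" shows "coboundary p a w 0 (%k. q * gen k)"
proof -
 have qc: "q \<in> |Q|" using assms submodD(1)[OF w] by blast
 have "vec w (p 0) (%j. q * eps j)"
 proof (rule vecI)
  fix j assume "j < p 0"
  then have e: "eps j \<in> A" using eps_A' by (simp add: vec_def)
  then have "q * eps j = eps j * q" using qc by (simp add: m_comm)
  then show "q * eps j \<in> w" using submodD(4)[OF w e assms] by simp
 qed
 then show ?thesis unfolding coboundary_def using codiff_eps[OF qc] by (intro exI[of _ "%j. q * eps j"]) simp
qed

lemma coboundary_genD:
 assumes q: "q \<in> |Q|" and cb: "coboundary p a w 0 (%k. q * gen k)" shows "q \<in> w"
proof -
 obtain u where u: "vec w (p 0) u" "!!k. k < p 1 ==> q * gen k = dot Q (p 0) (%j. a 0 j k) u"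
  using cb unfolding coboundary_def by auto
 have qe: "cvec (p 0) (%j. q * eps j)" using q eps_c by (simp add: vec_def)
 note uc = vec_w[OF u(1)]
 have "q * eps j \<ominus> u j = \<zero>" if j: "j < p 0" for j
 proof (rule codiff_inj0[OF res _ _ j])
  show "cvec (p 0) (%j. q * eps j \<ominus> u j)" using qe uc by (simp add: vec_def)
  fix k assume k: "k < p 1"
  have "dot Q (p 0) (%j. a 0 j k) u \<in> |Q|" using col_c0[OF k] uc by simp
  then show "dot Q (p 0) (%j. a 0 j k) (%j. q * eps j \<ominus> u j) = \<zero>"
   using cdot_minus_right[OF col_c0[OF k] qe uc] codiff_eps[OF q k] u(2)[OF k] by (simp add: minus_eq r_neg)
 qed
 then have e: "q * eps j \<in> w" if "j < p 0" for j
  using that qe uc u(1) by (auto simp: vec_def)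
 obtain c where c: "vec A (p 0) c" "dot Q (p 0) c eps = \<one>" using eps_one[OF res] by blast
 have "dot Q (p 0) c (%j. q * eps j) \<in> w" by (rule dot_mem[OF w c(1)]) (simp add: vec_def e)
 then show ?thesis using cdot_scale_right[OF vec_A[OF c(1)] eps_c q] c(2) q by simp
qed

lemma cocycle_gen:
 assumes q: "q \<in> colon Q w n" shows "cocycle p a w 1 (%k. q * gen k)"
proof -
 have qc: "q \<in> |Q|" using q colonD by blast
 have "vec w (p 1) (%k. q * gen k)" using q gen_n colonD by (simp add: vec_def)
 moreover have "dot Q (p 1) (%j. a 1 j k) (%k. q * gen k) = \<zero>" if k: "k < p (Suc 1)" for k
 proof -
  have qe: "cvec (p 0) (%j. q * eps j)" using qc eps_c by (simp add: vec_def)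
  have "dot Q (p 1) (%j. a 1 j k) (%k. q * gen k)
   = dot Q (p 1) (%j. a 1 j k) (%l. dot Q (p 0) (%j. a 0 j l) (%j. q * eps j))"
  proof (rule cdot_cong)
   show "cvec (p 1) (%j. a 1 j k)" using col_c'[OF k] .
   show "cvec (p 1) (%k. q * gen k)" using qc gen_cvec by (simp add: vec_def)
  qed (use codiff_eps[OF qc] in auto)
  then show ?thesis using codiff_codiff[OF res qe, of k] k by simp
 qed
 ultimately show ?thesis by (simp add: cocycle_def)
qed

text \<open>Over $Q$ the cocycle bounds a vector $u$, a linear form that maps the vectors with augmentation in $n$ into $w$. Its
value $q$ at a vector with augmentation 1 lies in $w : n$ and determines the class.\<close>

lemma cocycle1_gen:
 assumes v: "cocycle p a w 1 v"
 shows "\<exists>q\<in>colon Q w n. coboundary p a w 0 (%k. v k \<ominus> q * gen k)"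
proof -
 have vw: "vec w (p 1) v" using v by (simp add: cocycle_def)
 obtain u where u: "cvec (p 0) u" "!!k. k < p 1 ==> v k = dot Q (p 0) (%j. a 0 j k) u"
  using codiff_exact[OF res, of 0 v] v vec_w[OF vw] by (auto simp: cocycle_def)
 obtain c where c: "vec A (p 0) c" "dot Q (p 0) c eps = \<one>" using eps_one[OF res] by blast
 note cc = vec_A[OF c(1)]
 have key: "dot Q (p 0) u y \<in> w" if y: "vec A (p 0) y" "dot Q (p 0) y eps \<in> n" for y
 proof -
  obtain c' where c': "vec A (p 1) c'" "!!j. j < p 0 ==> y j = dot Q (p 1) (a 0 j) c'"
   using exact0[OF res y(1)] y(2) by blast
  have "dot Q (p 0) u y = dot Q (p 0) u (%j. dot Q (p 1) (a 0 j) c')"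
   by (rule cdot_cong[OF u(1) vec_A[OF y(1)]]) (use c' in auto)
  also have "\<dots> = dot Q (p 1) (%k. dot Q (p 0) (%j. a 0 j k) u) c'"
   by (rule adjoint0[OF u(1) vec_A[OF c'(1)], symmetric])
  also have "\<dots> = dot Q (p 1) v c'"
  proof (rule cdot_cong[OF _ vec_A[OF c'(1)]])
   show "cvec (p 1) (%k. dot Q (p 0) (%j. a 0 j k) u)"
    by (rule vecI, rule cdot_closed[OF col_c0 u(1)])
  qed (use u(2) in auto)
  also have "\<dots> = dot Q (p 1) c' v" by (rule cdot_comm[OF vec_w[OF vw] vec_A[OF c'(1)]])
  also have "\<dots> \<in> w" by (rule dot_mem[OF w c'(1) vw])
  finally show ?thesis .
 qed
 define q where "q = dot Q (p 0) u c"
 have qc: "q \<in> |Q|" using u(1) cc by (simp add: q_def)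
 have "q * r \<in> w" if r: "r \<in> n" for r
 proof -
  have rA: "r \<in> A" using n_A r .
  have rc: "r \<in> |Q|" using rA by blast
  have y: "vec A (p 0) (%j. r * c j)" using c(1) A_mult[OF rA] by (simp add: vec_def)
  have "dot Q (p 0) (%j. r * c j) eps = dot Q (p 0) eps (%j. r * c j)" by (rule cdot_comm[OF vec_A[OF y] eps_c])
  also have "\<dots> = r * dot Q (p 0) eps c" by (rule cdot_scale_right[OF eps_c cc rc])
  also have "\<dots> = r" using cdot_comm[OF eps_c cc] c(2) rc by simp
  finally have "dot Q (p 0) u (%j. r * c j) \<in> w" using key[OF y] r by simp
  then show ?thesis using cdot_scale_right[OF u(1) cc rc] qc rc by (simp add: q_def m_comm)
 qed
 then have q: "q \<in> colon Q w n" using qc by (auto simp: colon_def)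
 have "u j \<ominus> q * eps j \<in> w" if j: "j < p 0" for j
 proof -
  have eA: "eps j \<in> A" using eps_A' j by (simp add: vec_def)
  have ec: "eps j \<in> |Q|" using eA by blast
  have m: "vec A (p 0) (%l. eps j * c l)" using c(1) A_mult[OF eA] by (simp add: vec_def)
  define y where "y = (%l. unit_vec j l \<ominus> eps j * c l)"
  have y: "vec A (p 0) y" using m unit_vec_A A_minus by (simp add: vec_def y_def)
  note uv = vec_A[OF unit_vec_A'[of "p 0" j]]
  have "dot Q (p 0) y eps = dot Q (p 0) eps y" by (rule cdot_comm[OF vec_A[OF y] eps_c])
  also have "\<dots> = dot Q (p 0) eps (unit_vec j) \<ominus> eps j * dot Q (p 0) eps c"
   unfolding y_def using cdot_minus_right[OF eps_c uv vec_A[OF m]] cdot_scale_right[OF eps_c cc ec] by simp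
  also have "\<dots> = \<zero>" using cdot_unit_right[OF eps_c j] cdot_comm[OF eps_c cc] c(2) ec by (simp add: minus_eq r_neg)
  finally have "dot Q (p 0) u y \<in> w" using key[OF y] submodD(2)[OF sub_n] by simp
  moreover have "dot Q (p 0) u y = u j \<ominus> q * eps j"
   unfolding y_def using cdot_minus_right[OF u(1) uv vec_A[OF m]] cdot_scale_right[OF u(1) cc ec]
    cdot_unit_right[OF u(1) j] qc ec by (simp add: q_def m_comm)
  ultimately show ?thesis by simp
 qed
 then have "vec w (p 0) (%j. u j \<ominus> q * eps j)" by (simp add: vec_def)
 moreover have "v k \<ominus> q * gen k = dot Q (p 0) (%j. a 0 j k) (%j. u j \<ominus> q * eps j)" if k: "k < p (Suc 0)" for k
 proof -
  have k: "k < p 1" using k by simp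
  have qe: "cvec (p 0) (%j. q * eps j)" using qc eps_c by (simp add: vec_def)
  show ?thesis using cdot_minus_right[OF col_c0[OF k] u(1) qe] codiff_eps[OF qc k] u(2)[OF k] by simp
 qed
 ultimately show ?thesis using q unfolding coboundary_def by blast
qed

text \<open>A homomorphism \<open>n \<rightarrow> Q / w\<close> is evaluated at the generators of $n$. The coboundary of the resulting vector is a 2-cocycle
in $w$. Subtracting a vector over $w$ with the same coboundary leaves a cocycle over $Q$, which bounds a vector $u$ over $Q$;
the homomorphism is multiplication by the value of $u$ at a vector with augmentation 1.\<close>

lemma inj_from_ext2:
 assumes ext: "!!v. cocycle p a w 2 v ==> coboundary p a w 1 v"
 shows "inj_on_ideal w n"
 unfolding inj_on_ideal_def
proof (intro allI impI)
 fix f assume f: "hom_mod Q A w n f"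
 note fc = hom_modD(1)[OF f]
 obtain c where c: "vec A (p 0) c" "dot Q (p 0) c eps = \<one>" using eps_one[OF res] by blast
 note cc = vec_A[OF c(1)]
 define v where "v = (%k. f (gen k))"
 have vc: "cvec (p 1) v" using fc gen_n by (simp add: vec_def v_def)
 define z where "z = (%k. dot Q (p 1) (%j. a 1 j k) v)"
 have zw: "z k \<in> w" if k: "k < p 2" for k
 proof -
  have k': "k < p (Suc (Suc 0))" "k < p (Suc 1)" using k by (simp_all add: numeral_2_eq_2)
  have col: "vec A (p 1) (%j. a 1 j k)" using col_A'[OF k'(2)] .
  have e: "cvec (p 0) eps" by (rule eps_c)
  have "dot Q (p 1) (%j. a 1 j k) gen = \<zero>"
   using codiff_codiff[OF res e k'(1)] unfolding gen_def[abs_def] by simp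
  then have 1: "f \<zero> \<ominus> z k \<in> w"
   using hom_mod_dot[OF w sub_n f col gen_vec] by (simp add: v_def z_def)
  have zc: "z k \<in> |Q|" unfolding z_def using vc vec_A[OF col] by simp
  have f0: "f \<zero> \<in> w" by (rule hom_mod_zero[OF sub_n f])
  then show ?thesis using cong_mem[OF w zc f0 cong_sym[OF w _ zc 1]] submodD(1)[OF w f0] by blast
 qed
 have "cocycle p a w 2 z"
 proof -
  have "vec w (p 2) z" using zw by (simp add: vec_def)
  moreover have "dot Q (p 2) (%j. a 2 j k) z = \<zero>" if "k < p (Suc 2)" for k
   using codiff_codiff[OF res, of 1 v k] vc that unfolding z_def by (simp add: numeral_2_eq_2)
  ultimately show ?thesis by (simp add: cocycle_def)
 qed
 then obtain v' where v': "vec w (p 1) v'" "!!k. k < p 2 ==> z k = dot Q (p 1) (%j. a 1 j k) v'"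
  using ext[of z] unfolding coboundary_def by (auto simp: numeral_2_eq_2)
 note v'c = vec_w[OF v'(1)]
 have dc: "cvec (p 1) (%k. v k \<ominus> v' k)" using vc v'c by (simp add: vec_def)
 have "\<exists>u. cvec (p 0) u \<and> (\<forall>k<p (Suc 0). v k \<ominus> v' k = dot Q (p 0) (%j. a 0 j k) u)"
 proof (rule codiff_exact[OF res])
  show "cvec (p (Suc 0)) (%k. v k \<ominus> v' k)" using dc by simp
  fix k assume k: "k < p (Suc (Suc 0))"
  have col: "cvec (p 1) (%j. a 1 j k)" using col_c'[of k 1] k by simp
  have "dot Q (p 1) (%j. a 1 j k) (%k. v k \<ominus> v' k) = z k \<ominus> dot Q (p 1) (%j. a 1 j k) v'"
   unfolding z_def by (rule cdot_minus_right[OF col vc v'c])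
  also have "\<dots> = \<zero>" using v'(2)[of k] k col v'c by (simp add: numeral_2_eq_2 minus_eq r_neg)
  finally show "dot Q (p (Suc 0)) (%j. a (Suc 0) j k) (%k. v k \<ominus> v' k) = \<zero>" by simp
 qed
 then obtain u where u: "cvec (p 0) u" "!!k. k < p 1 ==> v k \<ominus> v' k = dot Q (p 0) (%j. a 0 j k) u" by auto
 define d where "d = dot Q (p 0) u c"
 have dcar: "d \<in> |Q|" using u(1) cc by (simp add: d_def)
 have "f r \<ominus> r * d \<in> w" if r: "r \<in> n" for r
 proof -
  have rA: "r \<in> A" using n_A r .
  have rc: "r \<in> |Q|" using rA by blast
  have y: "vec A (p 0) (%j. r * c j)" using c(1) A_mult[OF rA] by (simp add: vec_def)
  have pr: "dot Q (p 0) (%j. r * c j) eps = r"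
   using cdot_comm[OF vec_A[OF y] eps_c] cdot_scale_right[OF eps_c cc rc] cdot_comm[OF eps_c cc] c(2) rc by simp
  then obtain c' where c': "vec A (p 1) c'" "!!j. j < p 0 ==> r * c j = dot Q (p 1) (a 0 j) c'"
   using exact0[OF res y] r by auto
  note c'c = vec_A[OF c'(1)]
  have yc: "cvec (p 0) (%j. dot Q (p 1) (a 0 j) c')" by (rule vecI, rule cdot_closed[OF row_c0 c'c])
  have "r = dot Q (p 0) (%j. r * c j) eps" by (rule pr[symmetric])
  also have "\<dots> = dot Q (p 0) (%j. dot Q (p 1) (a 0 j) c') eps"
   by (rule cdot_cong[OF vec_A[OF y] eps_c]) (use c' in auto)
  also have "\<dots> = dot Q (p 0) eps (%j. dot Q (p 1) (a 0 j) c')" by (rule cdot_comm[OF yc eps_c])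
  also have "\<dots> = dot Q (p 1) gen c'" unfolding gen_def[abs_def] by (rule adjoint0[OF eps_c c'c, symmetric])
  also have "\<dots> = dot Q (p 1) c' gen" by (rule cdot_comm[OF gen_cvec c'c])
  finally have "f r \<ominus> dot Q (p 1) c' v \<in> w" unfolding v_def using hom_mod_dot[OF w sub_n f c'(1) gen_vec] by simp
  moreover have "dot Q (p 1) c' v \<ominus> r * d \<in> w"
  proof -
   have "dot Q (p 1) c' v \<ominus> dot Q (p 1) c' v' = dot Q (p 1) c' (%k. v k \<ominus> v' k)"
    by (rule cdot_minus_right[OF c'c vc v'c, symmetric])
   also have "\<dots> = dot Q (p 1) (%k. v k \<ominus> v' k) c'" by (rule cdot_comm[OF c'c dc])
   also have "\<dots> = dot Q (p 1) (%k. dot Q (p 0) (%j. a 0 j k) u) c'"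
    by (rule cdot_cong[OF dc c'c]) (use u in auto)
   also have "\<dots> = dot Q (p 0) u (%j. dot Q (p 1) (a 0 j) c')" by (rule adjoint0[OF u(1) c'c])
   also have "\<dots> = dot Q (p 0) u (%j. r * c j)" by (rule cdot_cong[OF u(1) yc]) (use c' in auto)
   also have "\<dots> = r * d" unfolding d_def by (rule cdot_scale_right[OF u(1) cc rc])
   finally have e: "dot Q (p 1) c' v \<ominus> dot Q (p 1) c' v' = r * d" .
   have cw: "dot Q (p 1) c' v' \<in> w" by (rule dot_mem[OF w c'(1) v'(1)])
   have c1: "dot Q (p 1) c' v \<in> |Q|" "dot Q (p 1) c' v' \<in> |Q|" using c'c vc v'c by auto
   have "dot Q (p 1) c' v \<ominus> r * d = dot Q (p 1) c' v'"
    unfolding e[symmetric] using c1 by algebra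
   then show ?thesis using cw by simp
  qed
  ultimately show ?thesis
   using cong_trans[OF w fc[OF r] _ _ , of "dot Q (p 1) c' v" "r * d"] c'c vc rc dcar by simp
 qed
 then show "\<exists>c\<in>carrier Q. \<forall>r\<in>n. f r \<ominus> r * c \<in> w" using dcar by blast
qed

text \<open>Over $Q$ the cocycle bounds a vector $u$. Modulo $w$, $u$ is a homomorphism on the image $K$ of the differential in a
free module, and \<open>inj_vectors\<close> extends it to the free module. This corrects $u$ to a vector over $w$.\<close>

lemma ext_higher:
 assumes Aw: "A \<subseteq> w" and inj: "inj_on_ideal w n" and v: "cocycle p a w (Suc (Suc i)) v"
 shows "coboundary p a w (Suc i) v"
proof -
 have vw: "vec w (p (Suc (Suc i))) v" using v by (simp add: cocycle_def)
 obtain u where u: "cvec (p (Suc i)) u" "!!k. k < p (Suc (Suc i)) ==> v k = dot Q (p (Suc i)) (%j. a (Suc i) j k) u"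
  using codiff_exact[OF res, of "Suc i" v] v vec_w[OF vw] by (auto simp: cocycle_def)
 define im where "im c = (%j. if j < p i then dot Q (p (Suc i)) (a i j) c else \<zero>)" for c
 define K where "K = im ` {c. vec A (p (Suc i)) c}"
 have im_add: "im (%k. c k \<oplus> c' k) = (%j. im c j \<oplus> im c' j)" if "vec A (p (Suc i)) c" "vec A (p (Suc i)) c'" for c c'
  by (rule ext) (use cdot_add_right[OF row_c' vec_A[OF that(1)] vec_A[OF that(2)]] in \<open>simp add: im_def\<close>)
 have im_scale: "im (%k. r * c k) = (%j. r * im c j)" if "vec A (p (Suc i)) c" "r \<in> A" for c r
  by (rule ext) (use cdot_scale_right[OF row_c' vec_A[OF that(1)] A_carr[OF that(2)]] that in \<open>simp add: im_def\<close>)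
 define sel where "sel y = (SOME c. vec A (p (Suc i)) c \<and> im c = y)" for y
 have sel: "vec A (p (Suc i)) (sel y)" "im (sel y) = y" if y: "y \<in> K" for y
 proof -
  obtain c where "vec A (p (Suc i)) c \<and> im c = y" using y by (auto simp: K_def)
  then have "vec A (p (Suc i)) (sel y) \<and> im (sel y) = y"
   unfolding sel_def by (rule someI[of "%c. vec A (p (Suc i)) c \<and> im c = y"])
  then show "vec A (p (Suc i)) (sel y)" "im (sel y) = y" by auto
 qed
 have zero: "dot Q (p (Suc i)) u c \<in> w" if c: "vec A (p (Suc i)) c" "!!j. j < p i ==> dot Q (p (Suc i)) (a i j) c = \<zero>" for c
 proof -
  obtain c' where c': "vec A (p (Suc (Suc i))) c'" "!!k. k < p (Suc i) ==> c k = dot Q (p (Suc (Suc i))) (a (Suc i) k) c'"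
   using exact[OF res c(1)] c(2) by blast
  have "dot Q (p (Suc i)) u c = dot Q (p (Suc i)) u (%k. dot Q (p (Suc (Suc i))) (a (Suc i) k) c')"
   by (rule cdot_cong[OF u(1) vec_A[OF c(1)]]) (use c' in auto)
  also have "\<dots> = dot Q (p (Suc (Suc i))) (%k. dot Q (p (Suc i)) (%j. a (Suc i) j k) u) c'"
   by (rule adjoint[OF res u(1) vec_A[OF c'(1)], symmetric])
  also have "\<dots> = dot Q (p (Suc (Suc i))) v c'"
  proof (rule cdot_cong[OF _ vec_A[OF c'(1)]])
   show "cvec (p (Suc (Suc i))) (%k. dot Q (p (Suc i)) (%j. a (Suc i) j k) u)"
    by (rule vecI, rule cdot_closed[OF col_c' u(1)])
  qed (use u(2) in auto)
  also have "\<dots> = dot Q (p (Suc (Suc i))) c' v" by (rule cdot_comm[OF vec_w[OF vw] vec_A[OF c'(1)]])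
  also have "\<dots> \<in> w" by (rule dot_mem[OF w c'(1) vw])
  finally show ?thesis .
 qed
 define f where "f y = dot Q (p (Suc i)) u (sel y)" for y
 have f_im: "f (im c) \<ominus> dot Q (p (Suc i)) u c \<in> w" if c: "vec A (p (Suc i)) c" for c
 proof -
  have K: "im c \<in> K" using c by (simp add: K_def)
  note s = sel[OF K]
  have d: "vec A (p (Suc i)) (%k. sel (im c) k \<ominus> c k)" using s(1) c A_minus by (simp add: vec_def)
  have "dot Q (p (Suc i)) u (%k. sel (im c) k \<ominus> c k) \<in> w"
  proof (rule zero[OF d])
   fix j assume j: "j < p i"
   have e: "dot Q (p (Suc i)) (a i j) (sel (im c)) = dot Q (p (Suc i)) (a i j) c"
    using s(2) j by (auto simp: im_def dest: fun_cong[of _ _ j])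
   show "dot Q (p (Suc i)) (a i j) (%k. sel (im c) k \<ominus> c k) = \<zero>"
    using cdot_minus_right[OF row_c'[OF j] vec_A[OF s(1)] vec_A[OF c]] e row_c'[OF j] vec_A[OF c]
    by (simp add: minus_eq r_neg)
  qed
  then show ?thesis unfolding f_def using cdot_minus_right[OF u(1) vec_A[OF s(1)] vec_A[OF c]] by simp
 qed
 have fc: "f y \<in> |Q|" if "y \<in> K" for y unfolding f_def using u(1) vec_A[OF sel(1)[OF that]] by simp
 have "\<exists>u'. (\<forall>j<p i. u' j \<in> |Q| ) \<and> (\<forall>y\<in>K. f y \<ominus> dot Q (p i) y u' \<in> w)"
 proof (rule inj_vectors[OF w Aw inj])
  show "(%_. \<zero>) \<in> K"
  proof -
   have "im (%_. \<zero>) = (%_. \<zero>)"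
    by (rule ext) (use cdot_zero_right[OF row_c'] in \<open>simp add: im_def\<close>)
   moreover have "vec A (p (Suc i)) (%_. \<zero>)" by (simp add: vec_def A_zero)
   ultimately show ?thesis unfolding K_def by (metis (mono_tags, lifting) image_eqI mem_Collect_eq)
  qed
 next
  fix y y' assume y: "y \<in> K" "y' \<in> K"
  have s: "vec A (p (Suc i)) (%k. sel y k \<oplus> sel y' k)" using sel(1)[OF y(1)] sel(1)[OF y(2)] A_add by (simp add: vec_def)
  have e: "im (%k. sel y k \<oplus> sel y' k) = (%j. y j \<oplus> y' j)"
   using im_add[OF sel(1)[OF y(1)] sel(1)[OF y(2)]] sel(2)[OF y(1)] sel(2)[OF y(2)] by simp
  show K: "(%j. y j \<oplus> y' j) \<in> K" unfolding e[symmetric] K_def using s by blast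
  have "f (%j. y j \<oplus> y' j) \<ominus> dot Q (p (Suc i)) u (%k. sel y k \<oplus> sel y' k) \<in> w"
   using f_im[OF s] e by simp
  then show "f (%j. y j \<oplus> y' j) \<ominus> (f y \<oplus> f y') \<in> w"
   using cdot_add_right[OF u(1) vec_A[OF sel(1)[OF y(1)]] vec_A[OF sel(1)[OF y(2)]]] by (simp add: f_def)
 next
  fix r y assume r: "r \<in> A" and y: "y \<in> K"
  have s: "vec A (p (Suc i)) (%k. r * sel y k)" using sel(1)[OF y(1)] A_mult[OF r] by (simp add: vec_def)
  have e: "im (%k. r * sel y k) = (%j. r * y j)"
   using im_scale[OF sel(1)[OF y(1)] r] sel(2)[OF y(1)] by simp
  show K: "(%j. r * y j) \<in> K" unfolding e[symmetric] K_def using s by blast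
  have "f (%j. r * y j) \<ominus> dot Q (p (Suc i)) u (%k. r * sel y k) \<in> w"
   using f_im[OF s] e by simp
  then show "f (%j. r * y j) \<ominus> r * f y \<in> w"
   using cdot_scale_right[OF u(1) vec_A[OF sel(1)[OF y]] A_carr[OF r]] by (simp add: f_def)
 next
  show "y j \<in> A" if "y \<in> K" "j < p i" for y j
   using that mv_A[OF res] by (auto simp: K_def im_def)
  show "f y \<in> |Q|" if "y \<in> K" for y using fc that .
  fix y assume y: "y \<in> K" "\<forall>j<p i. y j = \<zero>"
  show "f y \<in> w" unfolding f_def
  proof (rule zero[OF sel(1)[OF y(1)]])
   fix j assume j: "j < p i"
   show "dot Q (p (Suc i)) (a i j) (sel y) = \<zero>"
    using sel(2)[OF y(1)] y(2) j by (auto simp: im_def dest: fun_cong[of _ _ j])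
  qed
 qed
 then obtain u' where u': "cvec (p i) u'" "!!y. y \<in> K ==> f y \<ominus> dot Q (p i) y u' \<in> w"
  by (auto simp: vec_def)
 define v' where "v' = (%l. u l \<ominus> dot Q (p i) (%j. a i j l) u')"
 have du: "cvec (p (Suc i)) (%l. dot Q (p i) (%j. a i j l) u')" by (rule vecI, rule cdot_closed[OF col_c' u'(1)])
 have "v' l \<in> w" if l: "l < p (Suc i)" for l
 proof -
  have uv: "vec A (p (Suc i)) (unit_vec l)" by (rule unit_vec_A')
  have K: "im (unit_vec l) \<in> K" using uv by (simp add: K_def)
  have imc: "cvec (p i) (im (unit_vec l))" using mv_A[OF res _ uv] by (auto simp: vec_def im_def)
  have 1: "f (im (unit_vec l)) \<ominus> u l \<in> w" using f_im[OF uv] cdot_unit_right[OF u(1) l] by simp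
  have "dot Q (p i) (im (unit_vec l)) u' = dot Q (p i) (%j. a i j l) u'"
   by (rule cdot_cong[OF imc u'(1)]) (use mv_unit[OF res _ l] in \<open>auto simp: im_def\<close>)
  then have 2: "f (im (unit_vec l)) \<ominus> dot Q (p i) (%j. a i j l) u' \<in> w" using u'(2)[OF K] by simp
  show ?thesis unfolding v'_def
   using cong_trans[OF w _ _ _ cong_sym[OF w _ _ 1] 2] fc[OF K] vecD[OF u(1) l] vecD[OF du l] by simp
 qed
 then have "vec w (p (Suc i)) v'" by (simp add: vec_def)
 moreover have "v k = dot Q (p (Suc i)) (%j. a (Suc i) j k) v'" if k: "k < p (Suc (Suc i))" for k
 proof -
  have "dot Q (p (Suc i)) (%j. a (Suc i) j k) v' = v k \<ominus> \<zero>"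
   unfolding v'_def using cdot_minus_right[OF col_c'[OF k] u(1) du] codiff_codiff[OF res u'(1) k] u(2)[OF k] by simp
  then show ?thesis using vecD[OF vec_w[OF vw] k] by (simp add: minus_eq)
 qed
 ultimately show ?thesis unfolding coboundary_def by blast
qed

lemma cocycle_zero:
 assumes "cocycle p a w 0 v" "j < p 0" shows "v j = \<zero>"
 using assms codiff_inj0[OF res, of v j] vec_w by (auto simp: cocycle_def)

lemma dualizing_iff_ext:
 assumes Aw: "A \<subseteq> w" and fr: "\<exists>d\<in>A \<inter> Units Q. \<forall>x\<in>w. d * x \<in> A"
 shows "dualizing Q A n w \<longleftrightarrow>
  (\<exists>z. cocycle p a w 1 z \<and>
   (\<forall>r\<in>n. \<forall>v. cocycle p a w 1 v --> coboundary p a w 0 (%k. r * v k)) \<and>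
   (\<forall>v. cocycle p a w 1 v --> (\<exists>c\<in>A. coboundary p a w 0 (%k. v k \<ominus> c * z k))) \<and>
   (\<forall>c\<in>A. coboundary p a w 0 (%k. c * z k) --> c \<in> n)) \<and>
  (\<forall>i v. cocycle p a w (Suc (Suc i)) v --> coboundary p a w (Suc i) v)"
  (is "_ \<longleftrightarrow> ?E1 \<and> ?E2")
proof
 assume D: "dualizing Q A n w"
 note inj = dualizingD(4)[OF D]
 obtain s where s: "s \<in> colon Q w n" "s \<notin> w" "!!q. q \<in> colon Q w n ==> \<exists>a\<in>A. q \<ominus> a * s \<in> w"
  using dualizingD(5)[OF D] by blast
 have sc: "s \<in> |Q|" using s colonD by blast
 have gc: "gen k \<in> |Q|" if "k < p (Suc 0)" for k using that gen_n by simp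
 have ?E1
 proof (intro exI[of _ "%k. s * gen k"] conjI ballI allI impI)
  show "cocycle p a w 1 (%k. s * gen k)" by (rule cocycle_gen[OF s(1)])
 next
  fix r v assume r: "r \<in> n" and v: "cocycle p a w 1 v"
  have vc: "v k \<in> |Q|" if "k < p (Suc 0)" for k using v that vec_w by (auto simp: cocycle_def vec_def)
  have rA: "r \<in> A" using n_A r .
  obtain q where q: "q \<in> colon Q w n" "coboundary p a w 0 (%k. v k \<ominus> q * gen k)"
   using cocycle1_gen[OF v] by blast
  have qc: "q \<in> |Q|" using q colonD by blast
  have "coboundary p a w 0 (%k. r * (v k \<ominus> q * gen k) \<oplus> (q * r) * gen k)"
   by (rule coboundary_add[OF coboundary_scale[OF q(2) rA] coboundary_gen]) (use colonD[OF q(1)] r in blast)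
  then show "coboundary p a w 0 (%k. r * v k)"
  proof (rule coboundary_cong)
   fix k assume k: "k < p (Suc 0)"
   show "r * (v k \<ominus> q * gen k) \<oplus> (q * r) * gen k = r * v k"
    using vc[OF k] gc[OF k] qc A_carr[OF rA] by algebra
  qed
 next
  fix v assume v: "cocycle p a w 1 v"
  have vc: "v k \<in> |Q|" if "k < p (Suc 0)" for k using v that vec_w by (auto simp: cocycle_def vec_def)
  obtain q where q: "q \<in> colon Q w n" "coboundary p a w 0 (%k. v k \<ominus> q * gen k)"
   using cocycle1_gen[OF v] by blast
  have qc: "q \<in> |Q|" using q colonD by blast
  obtain c where c: "c \<in> A" "q \<ominus> c * s \<in> w" using s(3)[OF q(1)] by blast
  have "coboundary p a w 0 (%k. (v k \<ominus> q * gen k) \<oplus> (q \<ominus> c * s) * gen k)"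
   by (rule coboundary_add[OF q(2) coboundary_gen[OF c(2)]])
  then have "coboundary p a w 0 (%k. v k \<ominus> c * (s * gen k))"
  proof (rule coboundary_cong)
   fix k assume k: "k < p (Suc 0)"
   show "(v k \<ominus> q * gen k) \<oplus> (q \<ominus> c * s) * gen k = v k \<ominus> c * (s * gen k)"
    using vc[OF k] gc[OF k] qc sc A_carr[OF c(1)] by algebra
  qed
  then show "\<exists>c\<in>A. coboundary p a w 0 (%k. v k \<ominus> c * (s * gen k))" using c(1) by blast
 next
  fix c assume c: "c \<in> A" "coboundary p a w 0 (%k. c * (s * gen k))"
  have "coboundary p a w 0 (%k. (c * s) * gen k)"
   by (rule coboundary_cong[OF c(2)]) (use gc c(1) sc in \<open>simp add: m_assoc\<close>)
  then have cs: "c * s \<in> w" using coboundary_genD c(1) sc by simp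
  show "c \<in> n" by (rule mem_n_if_mult[OF w sc s(2) c(1) cs])
 qed
 moreover have ?E2 using ext_higher[OF Aw inj] by blast
 ultimately show "?E1 \<and> ?E2" by blast
next
 assume E: "?E1 \<and> ?E2"
 then obtain z where z: "cocycle p a w 1 z"
  "!!v. cocycle p a w 1 v ==> \<exists>c\<in>A. coboundary p a w 0 (%k. v k \<ominus> c * z k)"
  "!!c. c \<in> A ==> coboundary p a w 0 (%k. c * z k) ==> c \<in> n" by blast
 have gc: "gen k \<in> |Q|" if "k < p (Suc 0)" for k using that gen_n by simp
 have zc: "z k \<in> |Q|" if "k < p (Suc 0)" for k using z(1) that vec_w by (auto simp: cocycle_def vec_def)
 have "cocycle p a w 2 v ==> coboundary p a w 1 v" for v
  using E[THEN conjunct2, rule_format, of 0 v] by (simp add: numeral_2_eq_2)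
 then have inj: "inj_on_ideal w n" by (rule inj_from_ext2)
 obtain s where s: "s \<in> colon Q w n" "coboundary p a w 0 (%k. z k \<ominus> s * gen k)"
  using cocycle1_gen[OF z(1)] by blast
 have sc: "s \<in> |Q|" using s colonD by blast
 have "s \<notin> w"
 proof
  assume "s \<in> w"
  have "coboundary p a w 0 (%k. (z k \<ominus> s * gen k) \<oplus> s * gen k)"
   by (rule coboundary_add[OF s(2) coboundary_gen[OF \<open>s \<in> w\<close>]])
  then have "coboundary p a w 0 (%k. \<one> * z k)"
  proof (rule coboundary_cong)
   fix k assume k: "k < p (Suc 0)"
   show "(z k \<ominus> s * gen k) \<oplus> s * gen k = \<one> * z k"
    using zc[OF k] gc[OF k] sc by algebra
  qed
  then show False using z(3)[OF one_A] one_notin_n by blast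
 qed
 moreover have "\<exists>c\<in>A. q \<ominus> c * s \<in> w" if q: "q \<in> colon Q w n" for q
 proof -
  have qc: "q \<in> |Q|" using q colonD by blast
  obtain c where c: "c \<in> A" "coboundary p a w 0 (%k. q * gen k \<ominus> c * z k)"
   using z(2)[OF cocycle_gen[OF q]] by blast
  have "coboundary p a w 0 (%k. (q * gen k \<ominus> c * z k) \<oplus> c * (z k \<ominus> s * gen k))"
   by (rule coboundary_add[OF c(2) coboundary_scale[OF s(2) c(1)]])
  then have "coboundary p a w 0 (%k. (q \<ominus> c * s) * gen k)"
  proof (rule coboundary_cong)
   fix k assume k: "k < p (Suc 0)"
   show "(q * gen k \<ominus> c * z k) \<oplus> c * (z k \<ominus> s * gen k) = (q \<ominus> c * s) * gen k"
    using zc[OF k] gc[OF k] sc qc A_carr[OF c(1)] by algebra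
  qed
  then have "q \<ominus> c * s \<in> w" using coboundary_genD qc sc c(1) by simp
  then show ?thesis using c(1) by blast
 qed
 ultimately show "dualizing Q A n w"
  unfolding dualizing_def using w Aw fr s(1) inj unfolding inj_on_ideal_def by blast
qed

end

end

section \<open>Ext modules over the ring\<close>

subsection \<open>Quotient modules\<close>

locale quotient_setting = S: cring S + abelian_subgroup B G
 for S :: "('a, 'b) ring_scheme" and B and G :: "('a, 'm, 'k) module_scheme" (structure) +
 assumes smult_closed: "r \<in> |S| ==> x \<in> |G| ==> r \<odot> x \<in> |G|"
  and smult_add: "r \<in> |S| ==> x \<in> |G| ==> y \<in> |G| ==> r \<odot> (x \<oplus> y) = r \<odot> x \<oplus> r \<odot> y"
  and smult_B: "r \<in> |S| ==> b \<in> B ==> r \<odot> b \<in> B"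
begin

abbreviation V where "V \<equiv> quotient_module G B"

lemma V_carrier: "|V| = (%x. B +> x) ` |G|"
 unfolding quotient_module_def by (auto simp: A_RCOSETS_def')

lemma V_zero: "\<zero>\<^bsub>V\<^esub> = B"
 by (simp add: quotient_module_def)

lemma coset_mem: "x \<in> |G| ==> y \<in> B +> x \<longleftrightarrow> (\<exists>b\<in>B. y = b \<oplus> x)"
 by (auto simp: a_r_coset_def')

lemma coset_eqI: "y \<in> B +> x ==> x \<in> |G| ==> B +> y = B +> x"
 using a_repr_independence'[of y x] by simp

lemma coset_eq_iff: "x \<in> |G| ==> y \<in> |G| ==> B +> y = B +> x \<longleftrightarrow> (\<exists>b\<in>B. y = b \<oplus> x)"
 using a_rcos_self[of y] coset_eqI[of y x] coset_mem[of x y] by auto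

lemma coset_zero: "B +> \<zero> = B"
 using a_rcos_const[of \<zero>] by simp

lemma coset_eq_B: "x \<in> |G| ==> B +> x = B \<longleftrightarrow> x \<in> B"
 using a_rcos_self[of x] a_rcos_const[of x] by auto

lemma V_smult:
 assumes r: "r \<in> |S|" and x: "x \<in> |G|"
 shows "r \<odot>\<^bsub>V\<^esub> (B +> x) = B +> (r \<odot> x)"
proof -
 have "B +> (r \<odot> y) = B +> (r \<odot> x)" if y: "y \<in> B +> x" for y
 proof -
  obtain b where b: "b \<in> B" "y = b \<oplus> x" using y coset_mem[OF x] by blast
  have "r \<odot> y = r \<odot> b \<oplus> r \<odot> x" using b r x by (simp add: smult_add)
  then have "r \<odot> y \<in> B +> (r \<odot> x)" using coset_mem smult_closed[OF r x] smult_B[OF r b(1)] by blast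
  then show ?thesis using coset_eqI smult_closed[OF r x] by blast
 qed
 moreover have "x \<in> B +> x" using a_rcos_self[OF x] .
 ultimately have "(\<Union>y\<in>B +> x. B +> (r \<odot> y)) = B +> (r \<odot> x)" by blast
 then show ?thesis by (simp add: quotient_module_def)
qed

lemma V_add: "x \<in> |G| ==> y \<in> |G| ==> (B +> x) \<oplus>\<^bsub>V\<^esub> (B +> y) = B +> (x \<oplus> y)"
 using a_rcos_sum by (simp add: quotient_module_def)

lemma V_group: "abelian_group V"
proof (rule abelian_groupI)
 fix u assume "u \<in> |V|"
 then obtain x where x: "x \<in> |G|" "u = B +> x" using V_carrier by blast
 show "\<zero>\<^bsub>V\<^esub> \<oplus>\<^bsub>V\<^esub> u = u" using x V_add[of \<zero> x] by (simp add: V_zero coset_zero)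
 show "\<exists>v\<in>carrier V. v \<oplus>\<^bsub>V\<^esub> u = \<zero>\<^bsub>V\<^esub>"
  using x V_add[of "\<ominus> x" x] V_carrier by (intro bexI[of _ "B +> (\<ominus> x)"]) (auto simp: V_zero coset_zero l_neg)
 fix v assume "v \<in> |V|"
 then obtain y where y: "y \<in> |G|" "v = B +> y" using V_carrier by blast
 show "u \<oplus>\<^bsub>V\<^esub> v \<in> |V|" using x y V_add V_carrier by simp
 show "u \<oplus>\<^bsub>V\<^esub> v = v \<oplus>\<^bsub>V\<^esub> u" using x y V_add by (simp add: a_comm)
 fix t assume "t \<in> |V|"
 then obtain z where z: "z \<in> |G|" "t = B +> z" using V_carrier by blast
 show "u \<oplus>\<^bsub>V\<^esub> v \<oplus>\<^bsub>V\<^esub> t = u \<oplus>\<^bsub>V\<^esub> (v \<oplus>\<^bsub>V\<^esub> t)" using x y z V_add by (simp add: a_assoc)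
next
 show "\<zero>\<^bsub>V\<^esub> \<in> |V|" using V_carrier coset_zero V_zero by (metis imageI zero_closed)
qed

lemma V_finsum:
 "(!!j. j < (q::nat) ==> f j \<in> |G| ) ==>
  finsum V (%j. B +> f j) {..<q} = B +> (finsum G f {..<q}) \<and> finsum G f {..<q} \<in> |G|"
proof (induction q)
 case 0
 interpret V: abelian_group V by (rule V_group)
 show ?case using V.finsum_empty by (simp add: coset_zero V_zero)
next
 case (Suc q)
 interpret V: abelian_group V by (rule V_group)
 have f: "f j \<in> |G|" if "j < Suc q" for j using Suc.prems that by blast
 have 1: "finsum G f {..<Suc q} = f q \<oplus> finsum G f {..<q}"
  unfolding lessThan_Suc by (rule finsum_insert) (use f in auto)
 have "finsum V (%j. B +> f j) {..<Suc q} = (B +> f q) \<oplus>\<^bsub>V\<^esub> finsum V (%j. B +> f j) {..<q}"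
  unfolding lessThan_Suc by (rule V.finsum_insert) (use f V_carrier in auto)
 then show ?case using Suc.IH f V_add 1 by simp
qed

lemma V_lin_comb:
 assumes "!!j. j < q ==> eps j \<in> |G|" "!!j. j < q ==> e j = B +> eps j" "!!j. j < q ==> c j \<in> |S|"
 shows "lin_comb V q c e = B +> (\<Oplus>j\<in>{..<q}. c j \<odot> eps j)"
proof -
 interpret V: abelian_group V by (rule V_group)
 have "lin_comb V q c e = finsum V (%j. B +> (c j \<odot> eps j)) {..<q}"
  unfolding lin_comb_def
  by (rule V.finsum_cong') (use assms V_smult V_carrier smult_closed in auto)
 then show ?thesis using V_finsum[of q "%j. c j \<odot> eps j"] assms smult_closed by simp
qed

lemma residue_dim_0:
 assumes m: "m \<subseteq> |S|" shows "residue_dim S m V 0 \<longleftrightarrow> |G| \<subseteq> B"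
proof
 interpret V: abelian_group V by (rule V_group)
 assume "residue_dim S m V 0"
 then have "\<exists>b. (%c. lin_comb V 0 c b) ` |free_module S 0| = |V|"
  unfolding residue_dim_def by (elim conjE exE) (rule exI)
 then obtain b where b: "(%c. lin_comb V 0 c b) ` |free_module S 0| = |V|" ..
 have "lin_comb V 0 c b = B" for c unfolding lin_comb_def using V.finsum_empty V_zero by simp
 then have V: "|V| \<subseteq> {B}" unfolding b[symmetric] by blast
 show "|G| \<subseteq> B"
 proof
  fix x assume x: "x \<in> |G|"
  then have "B +> x \<in> |V|" unfolding V_carrier by blast
  then have "B +> x = B" using V by blast
  then show "x \<in> B" using coset_eq_B[OF x] by blast
 qed
next
 interpret V: abelian_group V by (rule V_group)
 assume GB: "|G| \<subseteq> B"
 have "B +> x = B" if "x \<in> |G|" for x using coset_eq_B[OF that] GB that by blast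
 then have c: "|V| = {B}" unfolding V_carrier using zero_closed by blast
 have "r \<odot>\<^bsub>V\<^esub> v = \<zero>\<^bsub>V\<^esub>" if r: "r \<in> m" and v: "v \<in> |V|" for r v
 proof -
  have rS: "r \<in> |S|" using m r by blast
  have "v = B +> \<zero>" using c v coset_zero by simp
  then have "r \<odot>\<^bsub>V\<^esub> v = B +> (r \<odot> \<zero>)" using V_smult[OF rS] by simp
  also have "\<dots> = B"
   using coset_eq_B[OF smult_closed[OF rS zero_closed]] smult_B[OF rS additive_subgroup.zero_closed[OF is_additive_subgroup]] by blast
  finally show ?thesis unfolding V_zero .
 qed
 moreover have "lin_comb V 0 c b = B" for c b unfolding lin_comb_def using V.finsum_empty V_zero by simp
 moreover have "|free_module S 0| \<noteq> {}" by (simp add: power_module_def)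
 ultimately show "residue_dim S m V 0" unfolding residue_dim_def c by (simp add: image_constant_conv)
qed

lemma residue_dim_1:
 assumes m: "m \<subseteq> |S|"
 shows "residue_dim S m V 1 \<longleftrightarrow> (\<forall>r\<in>m. \<forall>x\<in>carrier G. r \<odot> x \<in> B) \<and>
  (\<exists>z\<in>carrier G. (\<forall>x\<in>carrier G. \<exists>c\<in>carrier S. \<exists>b\<in>B. x = b \<oplus> c \<odot> z) \<and>
   (\<forall>c\<in>carrier S. c \<odot> z \<in> B --> c \<in> m))"
proof -
 interpret V: abelian_group V by (rule V_group)
 have 1: "(\<forall>r\<in>m. \<forall>v\<in>carrier V. r \<odot>\<^bsub>V\<^esub> v = \<zero>\<^bsub>V\<^esub>) \<longleftrightarrow> (\<forall>r\<in>m. \<forall>x\<in>carrier G. r \<odot> x \<in> B)"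
 proof -
  have "r \<odot>\<^bsub>V\<^esub> (B +> x) = \<zero>\<^bsub>V\<^esub> \<longleftrightarrow> r \<odot> x \<in> B" if "r \<in> m" "x \<in> |G|" for r x
  proof -
   have r: "r \<in> |S|" using m that(1) by blast
   show ?thesis unfolding V_zero V_smult[OF r that(2)] by (rule coset_eq_B[OF smult_closed[OF r that(2)]])
  qed
  then show ?thesis unfolding V_carrier by blast
 qed
 have free: "c \<in> |free_module S 1| ==> c 0 \<in> |S|" for c
  by (auto simp: power_module_def self_module_def)
 have free': "\<exists>c\<in>|free_module S 1|. c 0 = s" if "s \<in> |S|" for s
  by (rule bexI[of _ "\<lambda>j\<in>{..<1}. s"]) (use that in \<open>auto simp: power_module_def self_module_def\<close>)
 have lc: "lin_comb V 1 c b = B +> (c 0 \<odot> z)"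
  if "z \<in> |G|" "b 0 = B +> z" "c 0 \<in> |S|" for c b z
 proof -
  have "lin_comb V 1 c b = B +> (\<Oplus>j\<in>{..<1}. c j \<odot> z)"
   by (rule V_lin_comb) (use that in auto)
  also have "(\<Oplus>j\<in>{..<1::nat}. c j \<odot> z) = c 0 \<odot> z"
   using finsum_insert[of "{}" "0::nat" "%j. c j \<odot> z"] that smult_closed by (simp add: lessThan_Suc)
  finally show ?thesis .
 qed
 have 2: "(\<exists>b. (\<forall>j<1::nat. b j \<in> |V| ) \<and>
    (%c. lin_comb V 1 c b) ` |free_module S 1| = |V| \<and>
    (\<forall>c\<in>|free_module S 1|. lin_comb V 1 c b = \<zero>\<^bsub>V\<^esub> --> (\<forall>j<1. c j \<in> m)))
  \<longleftrightarrow> (\<exists>z\<in>carrier G. (\<forall>x\<in>carrier G. \<exists>c\<in>carrier S. \<exists>b\<in>B. x = b \<oplus> c \<odot> z) \<and>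
   (\<forall>c\<in>carrier S. c \<odot> z \<in> B --> c \<in> m))" (is "?L \<longleftrightarrow> ?R")
 proof
  assume ?L
  then obtain b where b: "b 0 \<in> |V|" "(%c. lin_comb V 1 c b) ` |free_module S 1| = |V|"
   "!!c. c \<in> |free_module S 1| ==> lin_comb V 1 c b = \<zero>\<^bsub>V\<^esub> ==> c 0 \<in> m" by auto
  obtain z where z: "z \<in> |G|" "b 0 = B +> z" using b(1) V_carrier by auto
  show ?R
  proof (intro bexI[OF _ z(1)] conjI ballI impI)
   fix x assume x: "x \<in> |G|"
   then have "B +> x \<in> |V|" using V_carrier by blast
   then obtain c where c: "c \<in> |free_module S 1|" "lin_comb V 1 c b = B +> x" using b(2) by (metis imageE)
   have "B +> x = B +> (c 0 \<odot> z)" using lc[of z b c, OF z free[OF c(1)]] c(2) by simp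
   then have "\<exists>b\<in>B. x = b \<oplus> c 0 \<odot> z" using coset_eq_iff x smult_closed[OF free[OF c(1)] z(1)] by blast
   then show "\<exists>c\<in>carrier S. \<exists>b\<in>B. x = b \<oplus> c \<odot> z" using free[OF c(1)] by blast
  next
   fix s assume s: "s \<in> |S|" "s \<odot> z \<in> B"
   obtain c where c: "c \<in> |free_module S 1|" "c 0 = s" using free'[OF s(1)] by blast
   have "lin_comb V 1 c b = B +> (s \<odot> z)" using lc[of z b c, OF z] c s(1) by simp
   also have "\<dots> = \<zero>\<^bsub>V\<^esub>" using V_zero coset_eq_B smult_closed[OF s(1) z(1)] s(2) by simp
   finally show "s \<in> m" using b(3)[OF c(1)] c(2) by simp
  qed
 next
  assume ?R
  then obtain z where z: "z \<in> |G|" "!!x. x \<in> |G| ==> \<exists>c\<in>carrier S. \<exists>b\<in>B. x = b \<oplus> c \<odot> z"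
   "!!c. c \<in> |S| ==> c \<odot> z \<in> B ==> c \<in> m" by blast
  define b where "b = (%j::nat. B +> z)"
  have b0: "b 0 = B +> z" by (simp add: b_def)
  show ?L
  proof (intro exI[of _ b] conjI)
   show "\<forall>j<1::nat. b j \<in> |V|" using z(1) V_carrier by (simp add: b_def)
   show "(%c. lin_comb V 1 c b) ` |free_module S 1| = |V|"
   proof (intro equalityI subsetI)
    fix v assume "v \<in> (%c. lin_comb V 1 c b) ` |free_module S 1|"
    then obtain c where c: "c \<in> |free_module S 1|" "v = lin_comb V 1 c b" by blast
    then show "v \<in> |V|" using lc[of z b c, OF z(1) b0 free[OF c(1)]] V_carrier smult_closed[OF free[OF c(1)] z(1)] by simp
   next
    fix v assume "v \<in> |V|"
    then obtain x where x: "x \<in> |G|" "v = B +> x" using V_carrier by blast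
    obtain s b' where s: "s \<in> |S|" "b' \<in> B" "x = b' \<oplus> s \<odot> z" using z(2)[OF x(1)] by blast
    obtain c where c: "c \<in> |free_module S 1|" "c 0 = s" using free'[OF s(1)] by blast
    have "lin_comb V 1 c b = B +> (s \<odot> z)" using lc[of z b c, OF z(1) b0] c s(1) by simp
    also have "\<dots> = v" using coset_eq_iff[OF smult_closed[OF s(1) z(1)] x(1)] s x(2) by blast
    finally show "v \<in> (%c. lin_comb V 1 c b) ` |free_module S 1|" using c(1) by blast
   qed
   show "\<forall>c\<in>|free_module S 1|. lin_comb V 1 c b = \<zero>\<^bsub>V\<^esub> --> (\<forall>j<1. c j \<in> m)"
   proof (intro ballI impI allI)
    fix c j assume c: "c \<in> |free_module S 1|" "lin_comb V 1 c b = \<zero>\<^bsub>V\<^esub>" and j: "j < (1::nat)"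
    have "B +> (c 0 \<odot> z) = B" using lc[of z b c, OF z(1) b0 free[OF c(1)]] c(2) V_zero by simp
    then have "c 0 \<odot> z \<in> B" using coset_eq_B smult_closed[OF free[OF c(1)] z(1)] by blast
    then show "c j \<in> m" using z(3)[OF free[OF c(1)]] j by simp
   qed
  qed
 qed
 show ?thesis unfolding residue_dim_def using 1 2 by simp
qed

end

subsection \<open>Ext modules of submodules of a ring of fractions\<close>

lemma PiE_less: "v \<in> {..<q} \<rightarrow>\<^sub>E W ==> j < q ==> v j \<in> W"
 by auto

text \<open>A module $N$ over $S$ that is a submodule $w$ of the ring of fractions $P$. Its cochains are vectors over $P$, so the
$Ext$ modules can be expressed by cocycles and coboundaries in $P$.\<close>

locale embedded_module = fraction_embedding S P \<phi> + F: one_dim_frac P "\<phi> ` |S|" "\<phi> ` m"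
 for S :: "('a, 'b) ring_scheme" (structure) and P :: "('c, 'd) ring_scheme" (structure) and \<phi> and m +
 fixes w and N :: "('a, 'c, 'k) module_scheme"
 assumes m_sub: "m \<subseteq> |S|" and w: "submod P (\<phi> ` |S| ) w"
  and N_carrier: "|N| = w" and N_add: "!!x y. x \<oplus>\<^bsub>N\<^esub> y = x \<oplus>\<^bsub>P\<^esub> y"
  and N_zero: "\<zero>\<^bsub>N\<^esub> = \<zero>\<^bsub>P\<^esub>" and N_smult: "!!r x. r \<odot>\<^bsub>N\<^esub> x = \<phi> r *\<^bsub>P\<^esub> x"
begin

lemma wc: "x \<in> w ==> x \<in> |P|"
 and w0: "\<zero>\<^bsub>P\<^esub> \<in> w"
 and w_add: "x \<in> w ==> y \<in> w ==> x \<oplus>\<^bsub>P\<^esub> y \<in> w"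
 and w_smult: "r \<in> |S| ==> x \<in> w ==> \<phi> r *\<^bsub>P\<^esub> x \<in> w"
 using F.submodD[OF w] by auto

lemma N_group: "abelian_group N"
proof (rule abelian_groupI)
 fix x assume x: "x \<in> |N|"
 have "\<ominus>\<^bsub>P\<^esub> x \<in> w" using F.submod_neg[OF w] x N_carrier by simp
 then show "\<exists>y\<in>carrier N. y \<oplus>\<^bsub>N\<^esub> x = \<zero>\<^bsub>N\<^esub>"
  using x wc by (intro bexI[of _ "\<ominus>\<^bsub>P\<^esub> x"]) (auto simp: N_add N_zero N_carrier P.l_neg)
qed (use wc w0 w_add in \<open>auto simp: N_carrier N_add N_zero P.a_ac\<close>)

lemma N_finsum: "(!!j. j < (q::nat) ==> f j \<in> w) ==> finsum N f {..<q} = finsum P f {..<q}"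
proof (induction q)
 case 0
 interpret N: abelian_group N by (rule N_group)
 show ?case using N.finsum_empty N_zero by simp
next
 case (Suc q)
 interpret N: abelian_group N by (rule N_group)
 have f: "f j \<in> w" if "j < Suc q" for j using Suc.prems that by blast
 have "finsum N f {..<Suc q} = f q \<oplus>\<^bsub>N\<^esub> finsum N f {..<q}"
  unfolding lessThan_Suc by (rule N.finsum_insert) (use f N_carrier in auto)
 moreover have "finsum P f {..<Suc q} = f q \<oplus>\<^bsub>P\<^esub> finsum P f {..<q}"
  unfolding lessThan_Suc by (rule P.finsum_insert) (use f wc in auto)
 ultimately show ?case using Suc.IH f by (simp add: N_add)
qed

lemma N_module: "module S N"
 by (rule moduleI)
  (use S.cring_axioms N_group wc w_smult in \<open>auto simp: S.is_cring N_carrier N_add N_smult phi_hom P.l_distr P.r_distr P.m_assoc\<close>)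

lemma N_lin_comb:
 assumes "!!j. j < q ==> c j \<in> |S|" "!!j. j < q ==> v j \<in> w"
 shows "(\<Oplus>\<^bsub>N\<^esub>j\<in>{..<q}. c j \<odot>\<^bsub>N\<^esub> v j) = dot P q (%j. \<phi> (c j)) v"
 unfolding dot_def using N_finsum[of q "%j. \<phi> (c j) *\<^bsub>P\<^esub> v j"] assms w_smult by (simp add: N_smult)

text \<open>Cochain groups are sets of functions that are undefined outside their index range, hence the restrictions.\<close>

definition linear_set where
 "linear_set q Z \<longleftrightarrow> Z \<subseteq> {..<q} \<rightarrow>\<^sub>E w \<and> (\<lambda>j\<in>{..<q}. \<zero>\<^bsub>P\<^esub>) \<in> Z \<and>
  (\<forall>u\<in>Z. \<forall>v\<in>Z. (\<lambda>j\<in>{..<q}. u j \<oplus>\<^bsub>P\<^esub> v j) \<in> Z) \<and>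
  (\<forall>r\<in>carrier S. \<forall>v\<in>Z. (\<lambda>j\<in>{..<q}. \<phi> r *\<^bsub>P\<^esub> v j) \<in> Z)"

lemma quotient_of_linear_sets:
 assumes Z: "linear_set q Z" and B: "linear_set q B" and BZ: "B \<subseteq> Z"
 shows "quotient_setting S B (power_module N q\<lparr>carrier := Z\<rparr>)"
proof -
 let ?G = "power_module N q\<lparr>carrier := Z\<rparr>"
 have Gadd: "u \<oplus>\<^bsub>?G\<^esub> v = (\<lambda>j\<in>{..<q}. u j \<oplus>\<^bsub>P\<^esub> v j)" for u v by (simp add: power_module_def N_add)
 have Gzero: "\<zero>\<^bsub>?G\<^esub> = (\<lambda>j\<in>{..<q}. \<zero>\<^bsub>P\<^esub>)" by (simp add: power_module_def N_zero)
 have Gsm: "r \<odot>\<^bsub>?G\<^esub> v = (\<lambda>j\<in>{..<q}. \<phi> r *\<^bsub>P\<^esub> v j)" for r v by (simp add: power_module_def N_smult)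
 have Gc: "|?G| = Z" by simp
 have Zc: "v j \<in> |P|" if "v \<in> Z" "j < q" for v j using Z that wc by (auto simp: linear_set_def)
 have Zx: "v j = undefined" if "v \<in> Z" "\<not> j < q" for v j
  using Z that by (auto simp: linear_set_def PiE_def extensional_def)
 have G: "abelian_group ?G"
 proof (rule abelian_groupI; unfold Gadd Gzero Gc)
  fix v assume v: "v \<in> Z"
  have "(\<lambda>j\<in>{..<q}. \<phi> (\<ominus> \<one>) *\<^bsub>P\<^esub> v j) \<in> Z" using Z v by (auto simp: linear_set_def)
  moreover have "(\<lambda>j\<in>{..<q}. (\<lambda>j\<in>{..<q}. \<phi> (\<ominus> \<one>) *\<^bsub>P\<^esub> v j) j \<oplus>\<^bsub>P\<^esub> v j) = (\<lambda>j\<in>{..<q}. \<zero>\<^bsub>P\<^esub>)"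
   by (rule restrict_ext) (use Zc[OF v] in \<open>auto simp: phi_minus_one P.l_minus P.l_neg\<close>)
  ultimately show "\<exists>y\<in>Z. (\<lambda>j\<in>{..<q}. y j \<oplus>\<^bsub>P\<^esub> v j) = (\<lambda>j\<in>{..<q}. \<zero>\<^bsub>P\<^esub>)" by blast
  show "(\<lambda>j\<in>{..<q}. (\<lambda>j\<in>{..<q}. \<zero>\<^bsub>P\<^esub>) j \<oplus>\<^bsub>P\<^esub> v j) = v"
   by (rule ext) (use Zc[OF v] Zx[OF v] in \<open>auto simp: restrict_def\<close>)
 next
  fix u v assume "u \<in> Z" "v \<in> Z"
  then show "(\<lambda>j\<in>{..<q}. u j \<oplus>\<^bsub>P\<^esub> v j) = (\<lambda>j\<in>{..<q}. v j \<oplus>\<^bsub>P\<^esub> u j)"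
   using Zc by (intro restrict_ext) (auto simp: P.a_comm)
 next
  fix u v t assume "u \<in> Z" "v \<in> Z" "t \<in> Z"
  then show "(\<lambda>j\<in>{..<q}. (\<lambda>j\<in>{..<q}. u j \<oplus>\<^bsub>P\<^esub> v j) j \<oplus>\<^bsub>P\<^esub> t j) = (\<lambda>j\<in>{..<q}. u j \<oplus>\<^bsub>P\<^esub> (\<lambda>j\<in>{..<q}. v j \<oplus>\<^bsub>P\<^esub> t j) j)"
   using Zc by (intro restrict_ext) (auto simp: P.a_assoc)
 qed (use Z in \<open>auto simp: linear_set_def\<close>)
 interpret G: abelian_group ?G by (rule G)
 have neg: "\<ominus>\<^bsub>?G\<^esub> v = (\<lambda>j\<in>{..<q}. \<phi> (\<ominus> \<one>) *\<^bsub>P\<^esub> v j)" if v: "v \<in> Z" for v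
 proof (rule G.minus_equality)
  show "(\<lambda>j\<in>{..<q}. \<phi> (\<ominus> \<one>) *\<^bsub>P\<^esub> v j) \<oplus>\<^bsub>?G\<^esub> v = \<zero>\<^bsub>?G\<^esub>" unfolding Gadd Gzero
   by (rule restrict_ext) (use Zc[OF v] in \<open>auto simp: phi_minus_one P.l_minus P.l_neg\<close>)
  show "v \<in> |?G|" "(\<lambda>j\<in>{..<q}. \<phi> (\<ominus> \<one>) *\<^bsub>P\<^esub> v j) \<in> |?G|"
   unfolding Gc using Z v by (auto simp: linear_set_def)
 qed
 have "subgroup B (add_monoid ?G)"
 proof
  show "B \<subseteq> |add_monoid ?G|" using BZ by simp
  show "x *\<^bsub>add_monoid ?G\<^esub> y \<in> B" if "x \<in> B" "y \<in> B" for x y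
  proof -
   have "x \<oplus>\<^bsub>?G\<^esub> y \<in> B" unfolding Gadd using B that by (auto simp: linear_set_def)
   then show ?thesis by simp
  qed
  have "\<zero>\<^bsub>?G\<^esub> \<in> B" unfolding Gzero using B by (auto simp: linear_set_def)
  then show "\<one>\<^bsub>add_monoid ?G\<^esub> \<in> B" by simp
  show "inv\<^bsub>add_monoid ?G\<^esub> x \<in> B" if x: "x \<in> B" for x
  proof -
   have "\<ominus>\<^bsub>?G\<^esub> x \<in> B" using neg[of x] x BZ B by (auto simp: linear_set_def)
   then show ?thesis by (simp add: a_inv_def)
  qed
 qed
 then interpret B: abelian_subgroup B ?G
  by (intro abelian_subgroupI3 additive_subgroup.intro G)
 show ?thesis
 proof unfold_locales
  fix r x assume r: "r \<in> |S|" "x \<in> |?G|"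
  then show "r \<odot>\<^bsub>?G\<^esub> x \<in> |?G|" unfolding Gsm Gc using Z by (auto simp: linear_set_def)
  fix y assume y: "y \<in> |?G|"
  show "r \<odot>\<^bsub>?G\<^esub> (x \<oplus>\<^bsub>?G\<^esub> y) = r \<odot>\<^bsub>?G\<^esub> x \<oplus>\<^bsub>?G\<^esub> r \<odot>\<^bsub>?G\<^esub> y"
   unfolding Gsm Gadd using r y Zc phi_hom by (intro restrict_ext) (auto simp: P.r_distr)
 next
  fix r b assume r: "r \<in> |S|" "b \<in> B"
  then show "r \<odot>\<^bsub>?G\<^esub> b \<in> B" unfolding Gsm using B by (auto simp: linear_set_def)
 qed
qed

lemma matrix_map_N:
 assumes "!!j k. j < p ==> k < q ==> M j k \<in> |S|" "!!k. k < q ==> v k \<in> w"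
 shows "matrix_map N p q M v = (\<lambda>j\<in>{..<p}. dot P q (%k. \<phi> (M j k)) v)"
 unfolding matrix_map_def by (rule restrict_ext) (use N_lin_comb[of q] assms in auto)

context
 fixes p A eps
 assumes A: "!!i j k. j < p i ==> k < p (Suc i) ==> A i j k \<in> |S|"
  and res: "F.resolution p (%i j k. \<phi> (A i j k)) eps"
begin

abbreviation a where "a \<equiv> %i j k. \<phi> (A i j k)"

lemma restrict_eq_iff: "(\<lambda>j\<in>X. f j) = (\<lambda>j\<in>X. g j) \<longleftrightarrow> (\<forall>j\<in>X. f j = g j)"
 by (metis restrict_apply' restrict_ext)

lemma codiff_eq:
 assumes "v \<in> {..<p i} \<rightarrow>\<^sub>E w"
 shows "codiff p A N i v = (\<lambda>k\<in>{..<p (Suc i)}. dot P (p i) (%j. a i j k) v)"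
 unfolding codiff_def by (rule matrix_map_N) (use A assms in auto)

lemma cocycles_iff: "v \<in> cocycles p A N i \<longleftrightarrow> v \<in> {..<p i} \<rightarrow>\<^sub>E w \<and> F.cocycle p a w i v"
proof (cases "v \<in> {..<p i} \<rightarrow>\<^sub>E w")
 case True
 have z: "\<zero>\<^bsub>power_module N (p (Suc i))\<^esub> = (\<lambda>j\<in>{..<p (Suc i)}. \<zero>\<^bsub>P\<^esub>)" by (simp add: power_module_def N_zero)
 have c: "|power_module N (p i)| = {..<p i} \<rightarrow>\<^sub>E w" by (simp add: power_module_def N_carrier)
 show ?thesis unfolding cocycles_def c z using codiff_eq[OF True] True
  by (auto simp: restrict_eq_iff F.cocycle_def vec_def)
qed (simp add: cocycles_def power_module_def N_carrier)

lemma coboundaries_iff: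
 "v \<in> coboundaries p A N (Suc i) \<longleftrightarrow> v \<in> {..<p (Suc i)} \<rightarrow>\<^sub>E w \<and> F.coboundary p a w i v"
proof
 assume "v \<in> coboundaries p A N (Suc i)"
 then obtain u where u: "u \<in> {..<p i} \<rightarrow>\<^sub>E w" "v = codiff p A N i u"
  by (auto simp: coboundaries_def power_module_def N_carrier)
 have uw: "vec w (p i) u" using u(1) by (auto simp: vec_def)
 have "dot P (p i) (%j. a i j k) u \<in> w" if "k < p (Suc i)" for k
  by (rule F.dot_mem[OF w _ uw]) (use A that in \<open>auto simp: vec_def\<close>)
 then show "v \<in> {..<p (Suc i)} \<rightarrow>\<^sub>E w \<and> F.coboundary p a w i v"
  using u(2) codiff_eq[OF u(1)] uw by (auto simp: F.coboundary_def)
next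
 assume v: "v \<in> {..<p (Suc i)} \<rightarrow>\<^sub>E w \<and> F.coboundary p a w i v"
 then obtain u where u: "vec w (p i) u" "!!k. k < p (Suc i) ==> v k = dot P (p i) (%j. a i j k) u"
  unfolding F.coboundary_def by blast
 define u' where "u' = (\<lambda>j\<in>{..<p i}. u j)"
 have u': "u' \<in> {..<p i} \<rightarrow>\<^sub>E w" using u(1) by (auto simp: u'_def vec_def)
 have "v = codiff p A N i u'"
 proof (rule ext)
  fix k
  show "v k = codiff p A N i u' k"
  proof (cases "k < p (Suc i)")
   case True
   have "dot P (p i) (%j. a i j k) u = dot P (p i) (%j. a i j k) u'"
    by (rule P.cdot_cong) (use A True u(1) wc phi_hom in \<open>auto simp: vec_def u'_def\<close>)
   then show ?thesis using True u(2) codiff_eq[OF u'] by simp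
  next
   case False
   then show ?thesis using v codiff_eq[OF u'] by (auto simp: PiE_def extensional_def)
  qed
 qed
 then show "v \<in> coboundaries p A N (Suc i)" using u' by (auto simp: coboundaries_def power_module_def N_carrier)
qed

lemma col_c: "k < p (Suc i) ==> P.cvec (p i) (%j. a i j k)"
 using A phi_hom by (auto simp: vec_def)

lemma cocycles_linear: "linear_set (p i) (cocycles p A N i)"
 unfolding linear_set_def
proof (intro conjI subsetI ballI)
 fix v assume "v \<in> cocycles p A N i" then show "v \<in> {..<p i} \<rightarrow>\<^sub>E w" using cocycles_iff by blast
next
 show "(\<lambda>j\<in>{..<p i}. \<zero>\<^bsub>P\<^esub>) \<in> cocycles p A N i"
  unfolding cocycles_iff F.cocycle_def using w0 P.cdot_zero_right[OF col_c] by (auto simp: vec_def)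
next
 fix u v assume "u \<in> cocycles p A N i" "v \<in> cocycles p A N i"
 then have h: "u \<in> {..<p i} \<rightarrow>\<^sub>E w" "v \<in> {..<p i} \<rightarrow>\<^sub>E w" "F.cocycle p a w i u" "F.cocycle p a w i v"
  using cocycles_iff by auto
 have c: "P.cvec (p i) u" "P.cvec (p i) v" using h(1,2) wc by (auto simp: vec_def)
 have c': "P.cvec (p i) (%j. u j \<oplus>\<^bsub>P\<^esub> v j)" using c by (auto simp: vec_def)
 have "dot P (p i) (%j. a i j k) (\<lambda>j\<in>{..<p i}. u j \<oplus>\<^bsub>P\<^esub> v j) = \<zero>\<^bsub>P\<^esub>" if k: "k < p (Suc i)" for k
 proof -
  have "dot P (p i) (%j. a i j k) (\<lambda>j\<in>{..<p i}. u j \<oplus>\<^bsub>P\<^esub> v j) = dot P (p i) (%j. a i j k) (%j. u j \<oplus>\<^bsub>P\<^esub> v j)"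
   by (rule P.cdot_cong[symmetric, OF col_c[OF k] c']) auto
  then show ?thesis using P.cdot_add_right[OF col_c[OF k] c] h(3,4) k by (simp add: F.cocycle_def)
 qed
 then show "(\<lambda>j\<in>{..<p i}. u j \<oplus>\<^bsub>P\<^esub> v j) \<in> cocycles p A N i"
  unfolding cocycles_iff F.cocycle_def using h(1,2) by (auto simp: vec_def intro!: w_add intro: PiE_less)
next
 fix r v assume r: "r \<in> |S|" and "v \<in> cocycles p A N i"
 then have h: "v \<in> {..<p i} \<rightarrow>\<^sub>E w" "F.cocycle p a w i v"
  using cocycles_iff by auto
 have c: "P.cvec (p i) v" using h(1) wc by (auto simp: vec_def)
 have c': "P.cvec (p i) (%j. \<phi> r *\<^bsub>P\<^esub> v j)" using c phi_hom(1)[OF r] by (auto simp: vec_def)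
 have "dot P (p i) (%j. a i j k) (\<lambda>j\<in>{..<p i}. \<phi> r *\<^bsub>P\<^esub> v j) = \<zero>\<^bsub>P\<^esub>" if k: "k < p (Suc i)" for k
 proof -
  have "dot P (p i) (%j. a i j k) (\<lambda>j\<in>{..<p i}. \<phi> r *\<^bsub>P\<^esub> v j) = dot P (p i) (%j. a i j k) (%j. \<phi> r *\<^bsub>P\<^esub> v j)"
   by (rule P.cdot_cong[symmetric, OF col_c[OF k] c']) auto
  then show ?thesis using P.cdot_scale_right[OF col_c[OF k] c phi_hom(1)[OF r]] h(2) k phi_hom(1)[OF r] by (simp add: F.cocycle_def)
 qed
 then show "(\<lambda>j\<in>{..<p i}. \<phi> r *\<^bsub>P\<^esub> v j) \<in> cocycles p A N i"
  unfolding cocycles_iff F.cocycle_def using h(1) r by (auto simp: vec_def intro!: w_smult intro: PiE_less)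
qed

lemma coboundary_restrict:
 "F.coboundary p a w i v ==> F.coboundary p a w i (\<lambda>j\<in>{..<p (Suc i)}. v j)"
 by (auto simp: F.coboundary_def)

lemma coboundaries_linear: "linear_set (p (Suc i)) (coboundaries p A N (Suc i))"
 unfolding linear_set_def
proof (intro conjI subsetI ballI)
 fix v assume "v \<in> coboundaries p A N (Suc i)" then show "v \<in> {..<p (Suc i)} \<rightarrow>\<^sub>E w" using coboundaries_iff by blast
next
 have "F.coboundary p a w i (%k. \<zero>\<^bsub>P\<^esub>)"
  unfolding F.coboundary_def using w0 P.cdot_zero_right[OF col_c] by (intro exI[of _ "%j. \<zero>\<^bsub>P\<^esub>"]) (auto simp: vec_def)
 then show "(\<lambda>j\<in>{..<p (Suc i)}. \<zero>\<^bsub>P\<^esub>) \<in> coboundaries p A N (Suc i)"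
  unfolding coboundaries_iff using coboundary_restrict w0 by auto
next
 fix u v assume "u \<in> coboundaries p A N (Suc i)" "v \<in> coboundaries p A N (Suc i)"
 then have h: "u \<in> {..<p (Suc i)} \<rightarrow>\<^sub>E w" "v \<in> {..<p (Suc i)} \<rightarrow>\<^sub>E w" "F.coboundary p a w i u" "F.coboundary p a w i v"
  using coboundaries_iff by auto
 show "(\<lambda>j\<in>{..<p (Suc i)}. u j \<oplus>\<^bsub>P\<^esub> v j) \<in> coboundaries p A N (Suc i)"
  unfolding coboundaries_iff using coboundary_restrict[OF F.coboundary_add[OF res w h(3,4)]] h(1,2) by (auto intro!: w_add intro: PiE_less)
next
 fix r v assume r: "r \<in> |S|" and "v \<in> coboundaries p A N (Suc i)"
 then have h: "v \<in> {..<p (Suc i)} \<rightarrow>\<^sub>E w" "F.coboundary p a w i v"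
  using coboundaries_iff by auto
 show "(\<lambda>j\<in>{..<p (Suc i)}. \<phi> r *\<^bsub>P\<^esub> v j) \<in> coboundaries p A N (Suc i)"
  unfolding coboundaries_iff using coboundary_restrict[OF F.coboundary_scale[OF res w h(2)]] h(1) r by (auto intro!: w_smult intro: PiE_less)
qed

lemma coboundaries_sub: "coboundaries p A N (Suc i) \<subseteq> cocycles p A N (Suc i)"
proof
 fix v assume "v \<in> coboundaries p A N (Suc i)"
 then have h: "v \<in> {..<p (Suc i)} \<rightarrow>\<^sub>E w" "F.coboundary p a w i v"
  using coboundaries_iff by auto
 obtain u where u: "vec w (p i) u" "!!k. k < p (Suc i) ==> v k = dot P (p i) (%j. a i j k) u"
  using h(2) unfolding F.coboundary_def by blast
 have uc: "P.cvec (p i) u" using u(1) wc by (auto simp: vec_def)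
 have vc: "P.cvec (p (Suc i)) v" using h(1) wc by (auto simp: vec_def)
 have "dot P (p (Suc i)) (%j. a (Suc i) j k) v = \<zero>\<^bsub>P\<^esub>" if k: "k < p (Suc (Suc i))" for k
 proof -
  have "dot P (p (Suc i)) (%j. a (Suc i) j k) v = dot P (p (Suc i)) (%j. a (Suc i) j k) (%l. dot P (p i) (%j. a i j l) u)"
   by (rule P.cdot_cong[OF col_c[OF k] vc]) (use u(2) in auto)
  then show ?thesis using F.codiff_codiff[OF res uc k] by simp
 qed
 then show "v \<in> cocycles p A N (Suc i)" unfolding cocycles_iff F.cocycle_def using h(1) by (auto simp: vec_def)
qed

lemma ext_dim_0: "residue_dim S m (ext_module p A N 0) 0"
proof -
 have lz: "linear_set (p 0) (coboundaries p A N 0)"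
  using w0 wc phi_hom by (auto simp: linear_set_def coboundaries_def power_module_def N_zero restrict_eq_iff)
 have z: "v = (\<lambda>j\<in>{..<p 0}. \<zero>\<^bsub>P\<^esub>)" if "v \<in> cocycles p A N 0" for v
 proof (rule ext)
  fix j
  have v: "v \<in> {..<p 0} \<rightarrow>\<^sub>E w" "F.cocycle p a w 0 v" using that cocycles_iff by auto
  show "v j = (\<lambda>j\<in>{..<p 0}. \<zero>\<^bsub>P\<^esub>) j"
   using F.cocycle_zero[OF res w v(2), of j] v(1) by (auto simp: restrict_def PiE_def extensional_def)
 qed
 have zb: "coboundaries p A N 0 = {\<lambda>j\<in>{..<p 0}. \<zero>\<^bsub>P\<^esub>}" by (simp add: coboundaries_def power_module_def N_zero)
 have sub: "coboundaries p A N 0 \<subseteq> cocycles p A N 0"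
  using cocycles_linear[of 0] unfolding zb linear_set_def by blast
 interpret E: quotient_setting S "coboundaries p A N 0" "power_module N (p 0)\<lparr>carrier := cocycles p A N 0\<rparr>"
  by (rule quotient_of_linear_sets[OF cocycles_linear lz sub])
 show ?thesis unfolding ext_module_def E.residue_dim_0[OF m_sub] using z zb by auto
qed

lemma cocycle_restrict:
 assumes "F.cocycle p a w i v" shows "(\<lambda>j\<in>{..<p i}. v j) \<in> cocycles p A N i"
proof -
 have vw: "vec w (p i) v" using assms by (simp add: F.cocycle_def)
 have vc: "P.cvec (p i) v" using vw wc by (auto simp: vec_def)
 have "dot P (p i) (%j. a i j k) (\<lambda>j\<in>{..<p i}. v j) = \<zero>\<^bsub>P\<^esub>" if k: "k < p (Suc i)" for k
 proof -
  have "dot P (p i) (%j. a i j k) (\<lambda>j\<in>{..<p i}. v j) = dot P (p i) (%j. a i j k) v"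
   by (rule P.cdot_cong[symmetric, OF col_c[OF k] vc]) auto
  then show ?thesis using assms k by (simp add: F.cocycle_def)
 qed
 then show ?thesis unfolding cocycles_iff F.cocycle_def using vw by (auto simp: vec_def)
qed

lemma ext_dim_higher:
 "residue_dim S m (ext_module p A N (Suc i)) 0 \<longleftrightarrow> (\<forall>v. F.cocycle p a w (Suc i) v --> F.coboundary p a w i v)"
proof -
 interpret E: quotient_setting S "coboundaries p A N (Suc i)" "power_module N (p (Suc i))\<lparr>carrier := cocycles p A N (Suc i)\<rparr>"
  by (rule quotient_of_linear_sets[OF cocycles_linear coboundaries_linear coboundaries_sub])
 have "cocycles p A N (Suc i) \<subseteq> coboundaries p A N (Suc i) \<longleftrightarrow> (\<forall>v. F.cocycle p a w (Suc i) v --> F.coboundary p a w i v)"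
 proof (intro iffI allI impI)
  fix v assume s: "cocycles p A N (Suc i) \<subseteq> coboundaries p A N (Suc i)" and v: "F.cocycle p a w (Suc i) v"
  have "F.coboundary p a w i (\<lambda>j\<in>{..<p (Suc i)}. v j)" using cocycle_restrict[OF v] s coboundaries_iff by blast
  then show "F.coboundary p a w i v" by (rule F.coboundary_cong[OF res w]) simp
 next
  assume "\<forall>v. F.cocycle p a w (Suc i) v --> F.coboundary p a w i v"
  then show "cocycles p A N (Suc i) \<subseteq> coboundaries p A N (Suc i)" using cocycles_iff coboundaries_iff by blast
 qed
 then show ?thesis unfolding ext_module_def E.residue_dim_0[OF m_sub] by simp
qed

lemma ext_dim_1:
 "residue_dim S m (ext_module p A N 1) 1 \<longleftrightarrow>
  (\<exists>z. F.cocycle p a w 1 z \<and>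
   (\<forall>r\<in>\<phi> ` m. \<forall>v. F.cocycle p a w 1 v --> F.coboundary p a w 0 (%k. r *\<^bsub>P\<^esub> v k)) \<and>
   (\<forall>v. F.cocycle p a w 1 v --> (\<exists>c\<in>\<phi> ` carrier S. F.coboundary p a w 0 (%k. v k \<ominus>\<^bsub>P\<^esub> c *\<^bsub>P\<^esub> z k))) \<and>
   (\<forall>c\<in>\<phi> ` carrier S. F.coboundary p a w 0 (%k. c *\<^bsub>P\<^esub> z k) --> c \<in> \<phi> ` m))" (is "_ \<longleftrightarrow> ?R")
proof -
 let ?Z = "cocycles p A N (Suc 0)" and ?B = "coboundaries p A N (Suc 0)"
 let ?G = "power_module N (p (Suc 0))\<lparr>carrier := ?Z\<rparr>"
 let ?q = "p (Suc 0)"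
 interpret E: quotient_setting S ?B ?G
  by (rule quotient_of_linear_sets[OF cocycles_linear coboundaries_linear coboundaries_sub])
 have Gadd: "u \<oplus>\<^bsub>?G\<^esub> v = (\<lambda>j\<in>{..<?q}. u j \<oplus>\<^bsub>P\<^esub> v j)" for u v by (simp add: power_module_def N_add)
 have Gsm: "r \<odot>\<^bsub>?G\<^esub> v = (\<lambda>j\<in>{..<?q}. \<phi> r *\<^bsub>P\<^esub> v j)" for r v by (simp add: power_module_def N_smult)
 have Gc: "|?G| = ?Z" by simp
 have cocD: "v \<in> {..<?q} \<rightarrow>\<^sub>E w" "F.cocycle p a w 1 v" if "v \<in> ?Z" for v using that cocycles_iff by auto
 have cocI: "(\<lambda>j\<in>{..<?q}. v j) \<in> ?Z" if "F.cocycle p a w 1 v" for v using cocycle_restrict[of 1 v] that by simp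
 have cobR: "F.coboundary p a w 0 v ==> (!!k. k < ?q ==> v k = v' k) ==> F.coboundary p a w 0 v'" for v v'
  using F.coboundary_cong[OF res w] by blast
 have smB: "r \<odot>\<^bsub>?G\<^esub> v \<in> ?B \<longleftrightarrow> F.coboundary p a w 0 (%k. \<phi> r *\<^bsub>P\<^esub> v k)"
  if r: "r \<in> |S|" and v: "v \<in> {..<?q} \<rightarrow>\<^sub>E w" for r v
 proof -
  have "(\<lambda>j\<in>{..<?q}. \<phi> r *\<^bsub>P\<^esub> v j) \<in> {..<?q} \<rightarrow>\<^sub>E w" using v r by (auto intro!: w_smult intro: PiE_less)
  then show ?thesis unfolding Gsm coboundaries_iff
   using cobR[of "\<lambda>j\<in>{..<?q}. \<phi> r *\<^bsub>P\<^esub> v j" "%k. \<phi> r *\<^bsub>P\<^esub> v k"] coboundary_restrict[of 0 "%k. \<phi> r *\<^bsub>P\<^esub> v k"] by auto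
 qed
 have gen: "(\<exists>b\<in>?B. x = b \<oplus>\<^bsub>?G\<^esub> c \<odot>\<^bsub>?G\<^esub> z) \<longleftrightarrow> F.coboundary p a w 0 (%k. x k \<ominus>\<^bsub>P\<^esub> \<phi> c *\<^bsub>P\<^esub> z k)"
  if c: "c \<in> |S|" and z: "z \<in> {..<?q} \<rightarrow>\<^sub>E w" and x: "x \<in> {..<?q} \<rightarrow>\<^sub>E w" for c x z
 proof
  assume "\<exists>b\<in>?B. x = b \<oplus>\<^bsub>?G\<^esub> c \<odot>\<^bsub>?G\<^esub> z"
  then obtain b where b: "b \<in> ?B" "x = b \<oplus>\<^bsub>?G\<^esub> c \<odot>\<^bsub>?G\<^esub> z" by blast
  have bb: "b \<in> {..<?q} \<rightarrow>\<^sub>E w" "F.coboundary p a w 0 b" using b(1) coboundaries_iff by auto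
  show "F.coboundary p a w 0 (%k. x k \<ominus>\<^bsub>P\<^esub> \<phi> c *\<^bsub>P\<^esub> z k)"
  proof (rule cobR[OF bb(2)])
   fix k assume k: "k < ?q"
   have cc: "b k \<in> |P|" "z k \<in> |P|" "\<phi> c \<in> |P|" using bb(1) z k wc phi_hom(1)[OF c] by auto
   have "x k = b k \<oplus>\<^bsub>P\<^esub> \<phi> c *\<^bsub>P\<^esub> z k" using k unfolding b(2) Gadd Gsm by simp
   then show "b k = x k \<ominus>\<^bsub>P\<^esub> \<phi> c *\<^bsub>P\<^esub> z k" using cc by (simp add: P.minus_eq P.a_assoc P.r_neg)
  qed
 next
  assume cb: "F.coboundary p a w 0 (%k. x k \<ominus>\<^bsub>P\<^esub> \<phi> c *\<^bsub>P\<^esub> z k)"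
  define b where "b = (\<lambda>k\<in>{..<?q}. x k \<ominus>\<^bsub>P\<^esub> \<phi> c *\<^bsub>P\<^esub> z k)"
  have "b \<in> {..<?q} \<rightarrow>\<^sub>E w" unfolding b_def using x z c by (auto intro!: w_smult F.submod_minus[OF w] intro: PiE_less)
  then have bB: "b \<in> ?B" unfolding coboundaries_iff using coboundary_restrict[OF cb] by (simp add: b_def)
  have "x = b \<oplus>\<^bsub>?G\<^esub> c \<odot>\<^bsub>?G\<^esub> z" unfolding Gadd Gsm
  proof (rule ext)
   fix k
   show "x k = (\<lambda>j\<in>{..<?q}. b j \<oplus>\<^bsub>P\<^esub> (\<lambda>j\<in>{..<?q}. \<phi> c *\<^bsub>P\<^esub> z j) j) k"
   proof (cases "k < ?q")
    case True
    have cc: "x k \<in> |P|" "z k \<in> |P|" "\<phi> c \<in> |P|" using x z True wc phi_hom(1)[OF c] by auto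
    then show ?thesis using True by (simp add: b_def P.minus_eq P.a_assoc P.l_neg)
   qed (use x in \<open>auto simp: PiE_def extensional_def\<close>)
  qed
  then show "\<exists>b\<in>?B. x = b \<oplus>\<^bsub>?G\<^esub> c \<odot>\<^bsub>?G\<^esub> z" using bB by blast
 qed
 have "residue_dim S m (ext_module p A N 1) 1 \<longleftrightarrow> (\<forall>r\<in>m. \<forall>x\<in>?Z. r \<odot>\<^bsub>?G\<^esub> x \<in> ?B) \<and>
  (\<exists>z\<in>?Z. (\<forall>x\<in>?Z. \<exists>c\<in>carrier S. \<exists>b\<in>?B. x = b \<oplus>\<^bsub>?G\<^esub> c \<odot>\<^bsub>?G\<^esub> z) \<and>
   (\<forall>c\<in>carrier S. c \<odot>\<^bsub>?G\<^esub> z \<in> ?B --> c \<in> m))" (is "_ \<longleftrightarrow> ?L")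
  unfolding ext_module_def One_nat_def using E.residue_dim_1[OF m_sub] unfolding Gc One_nat_def .
 moreover have "?L \<longleftrightarrow> ?R"
 proof
  assume L: ?L
  then obtain z where z: "z \<in> ?Z" "!!x. x \<in> ?Z ==> \<exists>c\<in>carrier S. \<exists>b\<in>?B. x = b \<oplus>\<^bsub>?G\<^esub> c \<odot>\<^bsub>?G\<^esub> z"
   "!!c. c \<in> |S| ==> c \<odot>\<^bsub>?G\<^esub> z \<in> ?B ==> c \<in> m" by blast
  note zz = cocD[OF z(1)]
  show ?R
  proof (intro exI[of _ z] conjI ballI allI impI)
   show "F.cocycle p a w 1 z" by (rule zz(2))
  next
   fix r v assume "r \<in> \<phi> ` m" and v: "F.cocycle p a w 1 v"
   then obtain s where s: "s \<in> m" "r = \<phi> s" by blast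
   have sS: "s \<in> |S|" using m_sub s by blast
   note v' = cocI[OF v]
   have "F.coboundary p a w 0 (%k. \<phi> s *\<^bsub>P\<^esub> (\<lambda>j\<in>{..<?q}. v j) k)"
    using L s(1) v' smB[OF sS cocD(1)[OF v']] by blast
   then show "F.coboundary p a w 0 (%k. r *\<^bsub>P\<^esub> v k)" by (rule cobR) (simp add: s(2))
  next
   fix v assume v: "F.cocycle p a w 1 v"
   note v' = cocI[OF v]
   obtain c where c: "c \<in> |S|" "F.coboundary p a w 0 (%k. (\<lambda>j\<in>{..<?q}. v j) k \<ominus>\<^bsub>P\<^esub> \<phi> c *\<^bsub>P\<^esub> z k)"
    using z(2)[OF v'] gen[OF _ zz(1) cocD(1)[OF v']] by blast
   have "F.coboundary p a w 0 (%k. v k \<ominus>\<^bsub>P\<^esub> \<phi> c *\<^bsub>P\<^esub> z k)" by (rule cobR[OF c(2)]) simp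
   then show "\<exists>c\<in>\<phi> ` carrier S. F.coboundary p a w 0 (%k. v k \<ominus>\<^bsub>P\<^esub> c *\<^bsub>P\<^esub> z k)" using c(1) by blast
  next
   fix c assume "c \<in> \<phi> ` |S|" and cb: "F.coboundary p a w 0 (%k. c *\<^bsub>P\<^esub> z k)"
   then obtain s where s: "s \<in> |S|" "c = \<phi> s" by blast
   then show "c \<in> \<phi> ` m" using z(3)[OF s(1)] smB[OF s(1) zz(1)] cb by blast
  qed
 next
  assume ?R
  then obtain z where z: "F.cocycle p a w 1 z"
   "!!r v. r \<in> \<phi> ` m ==> F.cocycle p a w 1 v ==> F.coboundary p a w 0 (%k. r *\<^bsub>P\<^esub> v k)"
   "!!v. F.cocycle p a w 1 v ==> \<exists>c\<in>\<phi> ` carrier S. F.coboundary p a w 0 (%k. v k \<ominus>\<^bsub>P\<^esub> c *\<^bsub>P\<^esub> z k)"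
   "!!c. c \<in> \<phi> ` |S| ==> F.coboundary p a w 0 (%k. c *\<^bsub>P\<^esub> z k) ==> c \<in> \<phi> ` m" by blast
  define z' where "z' = (\<lambda>j\<in>{..<?q}. z j)"
  have z': "z' \<in> ?Z" unfolding z'_def by (rule cocI[OF z(1)])
  note zz = cocD[OF z']
  show ?L
  proof (intro conjI ballI bexI[OF _ z'] impI)
   fix r x assume r: "r \<in> m" and x: "x \<in> ?Z"
   have rS: "r \<in> |S|" using m_sub r by blast
   show "r \<odot>\<^bsub>?G\<^esub> x \<in> ?B" unfolding smB[OF rS cocD(1)[OF x]] using z(2)[OF _ cocD(2)[OF x]] r by blast
  next
   fix x assume x: "x \<in> ?Z"
   obtain c where c: "c \<in> |S|" "F.coboundary p a w 0 (%k. x k \<ominus>\<^bsub>P\<^esub> \<phi> c *\<^bsub>P\<^esub> z k)"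
    using z(3)[OF cocD(2)[OF x]] by blast
   have "F.coboundary p a w 0 (%k. x k \<ominus>\<^bsub>P\<^esub> \<phi> c *\<^bsub>P\<^esub> z' k)" by (rule cobR[OF c(2)]) (simp add: z'_def)
   then show "\<exists>c\<in>carrier S. \<exists>b\<in>?B. x = b \<oplus>\<^bsub>?G\<^esub> c \<odot>\<^bsub>?G\<^esub> z'" using gen[OF c(1) zz(1) cocD(1)[OF x]] c(1) by blast
  next
   fix c assume c: "c \<in> |S|" "c \<odot>\<^bsub>?G\<^esub> z' \<in> ?B"
   have "F.coboundary p a w 0 (%k. \<phi> c *\<^bsub>P\<^esub> z' k)" using smB[OF c(1) zz(1)] c(2) by blast
   then have "F.coboundary p a w 0 (%k. \<phi> c *\<^bsub>P\<^esub> z k)" by (rule cobR) (simp add: z'_def)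
   then have "\<phi> c \<in> \<phi> ` m" using z(4) c(1) by blast
   then show "c \<in> m" using c(1) m_sub phi_eqD by blast
  qed
 qed
 ultimately show ?thesis by blast
qed

end

end

subsection \<open>Existence of free resolutions\<close>

context cring
begin

lemma finitely_generated_ideal:
 assumes N: "noetherian_ring R" and J: "ideal J R"
 shows "\<exists>g b. (\<forall>l<g. b l \<in> J) \<and> (\<forall>x\<in>J. \<exists>c. cvec g c \<and> x = dot R g b c)"
proof -
 obtain X where X: "X \<subseteq> |R|" "finite X" "J = Idl X"
  using noetherian_ring.finetely_gen[OF N J] by blast
 obtain b where b: "bij_betw b {0..<card X} X" using ex_bij_betw_nat_finite[OF X(2)] by blast
 define g where "g = card X"
 have bX: "b ` {0..<g} = X" using b by (simp add: bij_betw_def g_def)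
 have bc: "cvec g b" using bX X(1) by (auto simp: vec_def)
 define L where "L = {dot R g b c | c. cvec g c}"
 have "submod R |R| L" unfolding submod_def
 proof (intro conjI ballI subsetI)
  show "\<zero> \<in> L" unfolding L_def using cdot_zero_right[OF bc, of "%_. \<zero>"] by (intro CollectI exI[of _ "%_. \<zero>"]) (auto simp: vec_def)
 next
  fix x assume "x \<in> L" then show "x \<in> |R|" using bc by (auto simp: L_def)
 next
  fix x y assume "x \<in> L" "y \<in> L"
  then obtain c c' where c: "cvec g c" "cvec g c'" "x = dot R g b c" "y = dot R g b c'" by (auto simp: L_def)
  have "x \<oplus> y = dot R g b (%j. c j \<oplus> c' j)" using cdot_add_right[OF bc c(1,2)] c(3,4) by simp
  moreover have "cvec g (%j. c j \<oplus> c' j)" using c by (simp add: vec_def)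
  ultimately show "x \<oplus> y \<in> L" unfolding L_def by blast
 next
  fix a x assume a: "a \<in> |R|" and "x \<in> L"
  then obtain c where c: "cvec g c" "x = dot R g b c" by (auto simp: L_def)
  have "a * x = dot R g b (%j. a * c j)" using cdot_scale_right[OF bc c(1) a] c(2) by simp
  moreover have "cvec g (%j. a * c j)" using c a by (simp add: vec_def)
  ultimately show "a * x \<in> L" unfolding L_def by blast
 qed
 then have L: "ideal L R" using ideal_iff_submod by blast
 have "X \<subseteq> L"
 proof
  fix x assume "x \<in> X"
  then obtain l where l: "l < g" "x = b l" using bX by auto
  have "x = dot R g b (unit_vec l)" using cdot_unit_right[OF bc l(1)] l(2) by simp
  then show "x \<in> L" unfolding L_def using l by (auto simp: vec_def)
 qed
 then have "J \<subseteq> L" unfolding X(3) by (rule genideal_minimal[OF L])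
 moreover have "b l \<in> J" if "l < g" for l using genideal_self[OF X(1)] X(3) bX that by auto
 ultimately show ?thesis unfolding L_def by blast
qed

definition linear_closed where
 "linear_closed K \<longleftrightarrow> (%_. \<zero>) \<in> K \<and> (\<forall>u\<in>K. \<forall>v\<in>K. (%j. u j \<oplus> v j) \<in> K) \<and>
  (\<forall>r\<in>carrier R. \<forall>v\<in>K. (%j. r * v j) \<in> K)"

lemma linear_closedD:
 assumes "linear_closed K"
 shows "(%_. \<zero>) \<in> K" "u \<in> K ==> v \<in> K ==> (%j. u j \<oplus> v j) \<in> K"
  "r \<in> |R| ==> v \<in> K ==> (%j. r * v j) \<in> K"
 using assms by (auto simp: linear_closed_def)

lemma linear_closed_dot:
 fixes K :: "(nat => 'a) set"
 assumes K: "linear_closed K" and Kc: "!!v. v \<in> K ==> cvec q v"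
 shows "(!!l. l < g ==> B l \<in> K) ==> cvec g c ==> \<exists>v\<in>K. \<forall>j<q. v j = dot R g (%l. B l j) c"
proof (induction g)
 case 0 then show ?case using K by (auto simp: linear_closed_def)
next
 case (Suc g)
 obtain v where v: "v \<in> K" "!!j. j < q ==> v j = dot R g (%l. B l j) c"
  using Suc.IH Suc.prems cvec_Suc by force
 have cg: "c g \<in> |R|" using Suc.prems by (simp add: vec_def)
 have Bg: "B g \<in> K" using Suc.prems by simp
 have "(%j. c g * B g j \<oplus> v j) \<in> K"
  by (rule linear_closedD(2)[OF K linear_closedD(3)[OF K cg Bg] v(1)])
 moreover have "c g * B g j \<oplus> v j = dot R (Suc g) (%l. B l j) c" if j: "j < q" for j
 proof -
  have Bc: "cvec (Suc g) (%l. B l j)" using Kc Suc.prems(1) j by (auto simp: vec_def)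
  have "B g j \<in> |R|" using Kc[OF Bg] j by (simp add: vec_def)
  then show ?thesis using cdot_Suc[OF Bc Suc.prems(2)] v(2)[OF j] cg by (simp add: m_comm)
 qed
 ultimately show ?case by (intro bexI[of _ "%j. c g * B g j \<oplus> v j"]) auto
qed

lemma dot_append:
 "cvec g u ==> cvec g c ==> cvec h u' ==> cvec h c' ==>
 dot R (g + h) (%l. if l < g then u l else u' (l - g)) (%l. if l < g then c l else c' (l - g))
 = dot R g u c \<oplus> dot R h u' c'"
proof (induction h)
 case 0
 have "dot R g (%l. if l < g then u l else u' (l - g)) (%l. if l < g then c l else c' (l - g)) = dot R g u c"
  by (rule cdot_cong[symmetric]) (use 0 in auto)
 then show ?case using 0 by simp
next
 case (Suc h)
 have 1: "cvec (Suc (g + h)) (%l. if l < g then u l else u' (l - g))"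
  "cvec (Suc (g + h)) (%l. if l < g then c l else c' (l - g))" using Suc.prems by (auto simp: vec_def)
 have h: "u' h \<in> |R|" "c' h \<in> |R|" using Suc.prems by (auto simp: vec_def)
 have "dot R g u c \<in> |R|" "dot R h u' c' \<in> |R|" using Suc.prems cvec_Suc by auto
 then show ?case using cdot_Suc[OF 1] cdot_Suc[OF Suc.prems(3,4)] Suc.IH Suc.prems cvec_Suc h by (simp add: a_lcomm)
qed

text \<open>Submodules of \<open>R\<^sup>q\<close> are finitely generated, by induction on $q$: generators of the ideal of last coordinates are lifted
and joined with generators of the submodule where the last coordinate vanishes.\<close>

lemma finitely_generated_vectors:
 assumes N: "noetherian_ring R"
 shows "linear_closed K ==> (!!v. v \<in> K ==> cvec q v) ==>
  \<exists>g B. (\<forall>l<g. B l \<in> K) \<and> (\<forall>v\<in>K. \<exists>c. cvec g c \<and> (\<forall>j<q. v j = dot R g (%l. B l j) c))"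
proof (induction q arbitrary: K)
 case 0
 show ?case by (intro exI[of _ 0]) (auto simp: vec_def)
next
 case (Suc q)
 note K = Suc.prems(1) and Kc = Suc.prems(2)
 have K': "(%_. \<zero>) \<in> K" "!!u v. u \<in> K ==> v \<in> K ==> (%j. u j \<oplus> v j) \<in> K"
  "!!r v. r \<in> |R| ==> v \<in> K ==> (%j. r * v j) \<in> K"
  using K by (auto simp: linear_closed_def)
 have vq: "v q \<in> |R|" if "v \<in> K" for v using Kc[OF that] by (simp add: vec_def)
 define J where "J = (%v. v q) ` K"
 have "submod R |R| J" unfolding submod_def
 proof (intro conjI ballI subsetI)
  show "\<zero> \<in> J" unfolding J_def using K'(1) by (rule rev_image_eqI) simp
 next
  fix x assume "x \<in> J" then show "x \<in> |R|" using vq by (auto simp: J_def)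
 next
  fix x y assume "x \<in> J" "y \<in> J"
  then show "x \<oplus> y \<in> J" unfolding J_def using K'(2) by (auto intro: rev_image_eqI)
 next
  fix a x assume "a \<in> |R|" "x \<in> J"
  then show "a * x \<in> J" unfolding J_def using K'(3) by (auto intro: rev_image_eqI)
 qed
 then have "ideal J R" using ideal_iff_submod by blast
 then obtain g b where b: "!!l. l < g ==> b l \<in> J" "!!x. x \<in> J ==> \<exists>c. cvec g c \<and> x = dot R g b c"
  using finitely_generated_ideal[OF N] by blast
 have "\<forall>l. \<exists>v. l < g --> v \<in> K \<and> v q = b l"
 proof
  fix l
  show "\<exists>v. l < g --> v \<in> K \<and> v q = b l" using b(1)[of l] unfolding J_def image_iff by metis
 qed
 then obtain B where B: "!!l. l < g ==> B l \<in> K" "!!l. l < g ==> B l q = b l" by metis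
 define K0 where "K0 = {v \<in> K. v q = \<zero>}"
 have "linear_closed K0" using K' by (auto simp: linear_closed_def K0_def)
 moreover have "cvec q v" if "v \<in> K0" for v using Kc that by (auto simp: K0_def vec_def)
 ultimately obtain h C where C: "!!l. l < h ==> C l \<in> K0"
  "!!v. v \<in> K0 ==> \<exists>c. cvec h c \<and> (\<forall>j<q. v j = dot R h (%l. C l j) c)"
  using Suc.IH[of K0] by blast
 have CK: "C l \<in> K" "C l q = \<zero>" if "l < h" for l using C(1)[OF that] by (auto simp: K0_def)
 have Bj: "cvec g (%l. B l j)" if "j < Suc q" for j using B(1) Kc that by (auto simp: vec_def)
 have Cj: "cvec h (%l. C l j)" if "j < Suc q" for j using CK(1) Kc that by (auto simp: vec_def)
 define D where "D l = (if l < g then B l else C (l - g))" for l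
 have "D l \<in> K" if "l < g + h" for l using B(1) CK(1) that by (auto simp: D_def)
 moreover have "\<exists>c. cvec (g + h) c \<and> (\<forall>j<Suc q. v j = dot R (g + h) (%l. D l j) c)" if v: "v \<in> K" for v
 proof -
  obtain c1 where c1: "cvec g c1" "v q = dot R g b c1" using b(2)[of "v q"] v by (auto simp: J_def)
  obtain t where t: "t \<in> K" "!!j. j < Suc q ==> t j = dot R g (%l. B l j) c1"
   using linear_closed_dot[of K "Suc q" g B c1, OF K Kc B(1) c1(1)] by blast
  have tq: "t q = v q" unfolding c1(2) t(2)[OF lessI]
   by (rule cdot_cong[OF Bj c1(1)]) (use B(2) in auto)
  define v' where "v' = (%j. v j \<oplus> \<ominus> \<one> * t j)"
  have "v' \<in> K" unfolding v'_def using K'(2)[OF v K'(3)[OF _ t(1)]] by simp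
  moreover have "v' q = \<zero>" unfolding v'_def tq using vq[OF v] by (simp add: l_minus r_neg)
  ultimately have "v' \<in> K0" by (simp add: K0_def)
  then obtain c2 where c2: "cvec h c2" "!!j. j < q ==> v' j = dot R h (%l. C l j) c2" using C(2) by blast
  define c where "c = (%l. if l < g then c1 l else c2 (l - g))"
  have cc: "cvec (g + h) c" using c1(1) c2(1) by (auto simp: vec_def c_def)
  have "v j = dot R (g + h) (%l. D l j) c" if j: "j < Suc q" for j
  proof -
   have vj: "v j \<in> |R|" "t j \<in> |R|" using Kc v t(1) j by (auto simp: vec_def)
   have e: "(%l. D l j) = (%l. if l < g then B l j else C (l - g) j)" by (auto simp: D_def)
   have "dot R (g + h) (%l. D l j) c = t j \<oplus> dot R h (%l. C l j) c2"
    unfolding e c_def using dot_append[OF Bj[OF j] c1(1) Cj[OF j] c2(1)] t(2)[OF j] by simp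
   also have "\<dots> = v j"
   proof (cases "j < q")
    case True
    have "t j \<oplus> (v j \<oplus> \<ominus> \<one> * t j) = v j" using vj by algebra
    then show ?thesis using c2(2)[OF True, symmetric] by (simp add: v'_def)
   next
    case False
    then have jq: "j = q" using j by simp
    have "dot R h (%l. C l j) c2 = dot R h c2 (%l. C l j)" by (rule cdot_comm[OF Cj[OF j] c2(1)])
    also have "\<dots> = \<zero>" by (rule cdot_zero_right[OF c2(1)]) (use CK(2) jq in auto)
    finally show ?thesis using tq jq vj by simp
   qed
   finally show ?thesis by simp
  qed
  then show ?thesis using cc by (intro exI[of _ c]) simp
 qed
 ultimately show ?case by (intro exI[of _ "g + h"] exI[of _ D]) blast
qed

abbreviation spanned where
 "spanned q p M c \<equiv> \<exists>c'. cvec q c' \<and> (\<forall>j<p. c j = dot R q (M j) c')"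

lemma kernel_generators:
 fixes p q :: nat
 assumes N: "noetherian_ring R" and M: "!!j k. j < p ==> k < q ==> M j k \<in> |R|"
 shows "\<exists>g M'. (\<forall>k<q. \<forall>l<g. M' k l \<in> |R| ) \<and>
  (\<forall>c. cvec q c --> ((\<forall>j<p. dot R q (M j) c = \<zero>) \<longleftrightarrow> spanned g q M' c))"
proof -
 have Mj: "cvec q (M j)" if "j < p" for j using M that by (simp add: vec_def)
 define K where "K = {c. cvec q c \<and> (\<forall>j<p. dot R q (M j) c = \<zero>)}"
 have lin: "linear_closed K" unfolding linear_closed_def
 proof (intro conjI ballI)
  show "(%_. \<zero>) \<in> K" using cdot_zero_right[OF Mj] by (auto simp: K_def vec_def)
  show "(%j. u j \<oplus> v j) \<in> K" if "u \<in> K" "v \<in> K" for u v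
   using that cdot_add_right[OF Mj] by (auto simp: K_def vec_def)
  show "(%j. r * v j) \<in> K" if "r \<in> |R|" "v \<in> K" for r v
   using that cdot_scale_right[OF Mj] by (auto simp: K_def vec_def)
 qed
 have Kc: "cvec q v" if "v \<in> K" for v using that by (simp add: K_def)
 obtain g B where B: "!!l. l < g ==> B l \<in> K"
  "!!v. v \<in> K ==> \<exists>c. cvec g c \<and> (\<forall>j<q. v j = dot R g (%l. B l j) c)"
  using finitely_generated_vectors[of K q, OF N lin Kc] by blast
 have "(\<forall>j<p. dot R q (M j) c = \<zero>) \<longleftrightarrow> (\<exists>c'. cvec g c' \<and> (\<forall>k<q. c k = dot R g (%l. B l k) c'))" if c: "cvec q c" for c
 proof
  assume "\<forall>j<p. dot R q (M j) c = \<zero>"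
  then have "c \<in> K" using c by (simp add: K_def)
  then show "\<exists>c'. cvec g c' \<and> (\<forall>k<q. c k = dot R g (%l. B l k) c')" using B(2) by blast
 next
  assume "\<exists>c'. cvec g c' \<and> (\<forall>k<q. c k = dot R g (%l. B l k) c')"
  then obtain c' where c': "cvec g c'" "!!k. k < q ==> c k = dot R g (%l. B l k) c'" by blast
  obtain v where v: "v \<in> K" "!!k. k < q ==> v k = dot R g (%l. B l k) c'"
   using linear_closed_dot[of K q g B c', OF lin Kc B(1) c'(1)] by blast
  have "dot R q (M j) c = dot R q (M j) v" if "j < p" for j
   by (rule cdot_cong[OF Mj[OF that] c]) (use v(2) c'(2) in auto)
  then show "\<forall>j<p. dot R q (M j) c = \<zero>" using v(1) by (simp add: K_def)
 qed
 moreover have "B l k \<in> |R|" if "k < q" "l < g" for k l using Kc[OF B(1)[OF that(2)]] that(1) by (simp add: vec_def)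
 ultimately show ?thesis by (intro exI[of _ g] exI[of _ "%k l. B l k"]) blast
qed

text \<open>The conditions of a resolution of $R / m$, with elements of $R$ in place of cosets.\<close>

definition matrix_resolution :: "'a set => (nat => nat) => (nat => nat => nat => 'a) => (nat => 'a) => bool" where
 "matrix_resolution m p A eps \<longleftrightarrow>
  (\<forall>i. \<forall>j<p i. \<forall>k<p (Suc i). A i j k \<in> |R| ) \<and> cvec (p 0) eps \<and>
  (\<exists>c. cvec (p 0) c \<and> dot R (p 0) c eps = \<one>) \<and>
  (\<forall>c. cvec (p 0) c --> (dot R (p 0) c eps \<in> m \<longleftrightarrow>
    spanned (p 1) (p 0) (A 0) c)) \<and>
  (\<forall>i c. cvec (p (Suc i)) c --> ((\<forall>j<p i. dot R (p (Suc i)) (A i j) c = \<zero>) \<longleftrightarrow>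
    spanned (p (Suc (Suc i))) (p (Suc i)) (A (Suc i)) c))"

text \<open>The matrices are chosen successively; each one has generators of the kernel of the previous one as columns.\<close>

lemma matrix_resolution_exists:
 assumes N: "noetherian_ring R" and m: "ideal m R"
 shows "\<exists>p A eps. matrix_resolution m p A eps"
proof -
 obtain g b where b: "!!l. l < g ==> b l \<in> m" "!!x. x \<in> m ==> \<exists>c. cvec g c \<and> x = dot R g b c"
  using finitely_generated_ideal[OF N m] by blast
 have mc: "m \<subseteq> |R|" using ideal.Icarr[OF m] by blast
 have bc: "cvec g b" using b(1) mc by (auto simp: vec_def)
 have bm: "dot R g b c \<in> m" if "cvec g c" for c
 proof -
  have "linear_closed ((%x (j::nat). x) ` m)" unfolding linear_closed_def
   using m[unfolded ideal_iff_submod] by (auto simp: submod_def)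
  moreover have "cvec 1 v" if "v \<in> (%x (j::nat). x) ` m" for v using that mc by (auto simp: vec_def)
  ultimately have "\<exists>v\<in>(%x (j::nat). x) ` m. \<forall>j<1. v j = dot R g (%l. (%x (j::nat). x) (b l) j) c"
   using linear_closed_dot[of "(%x (j::nat). x) ` m" 1 g "%l. (%x (j::nat). x) (b l)" c] b(1) \<open>cvec g c\<close> by blast
  then show ?thesis by auto
 qed
 define good where "good x \<longleftrightarrow> (\<forall>j<fst x. \<forall>k<fst (snd x). snd (snd x) j k \<in> |R| )" for x :: "nat \<times> nat \<times> (nat => nat => 'a)"
 define step where "step x y \<longleftrightarrow> fst y = fst (snd x) \<and>
  (\<forall>c. cvec (fst y) c --> ((\<forall>j<fst x. dot R (fst y) (snd (snd x) j) c = \<zero>) \<longleftrightarrow>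
   (\<exists>c'. cvec (fst (snd y)) c' \<and> (\<forall>k<fst y. c k = dot R (fst (snd y)) (snd (snd y) k) c'))))"
  for x y :: "nat \<times> nat \<times> (nat => nat => 'a)"
 have start: "good (1, g, %j k. b k)" using bc by (auto simp: good_def vec_def)
 have next_step: "\<exists>y. good y \<and> step x y" if "good x" for x
 proof -
  have prem: "snd (snd x) j k \<in> |R|" if "j < fst x" "k < fst (snd x)" for j k
   using \<open>good x\<close> that by (simp add: good_def)
  obtain h M' where "\<forall>k<fst (snd x). \<forall>l<h. M' k l \<in> |R|"
   "\<forall>c. cvec (fst (snd x)) c --> ((\<forall>j<fst x. dot R (fst (snd x)) (snd (snd x) j) c = \<zero>) \<longleftrightarrow>
    (\<exists>c'. cvec h c' \<and> (\<forall>k<fst (snd x). c k = dot R h (M' k) c')))"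
   using kernel_generators[of "fst x" "fst (snd x)" "snd (snd x)", OF N prem] by blast
  then have "good (fst (snd x), h, M') \<and> step x (fst (snd x), h, M')" by (simp add: good_def step_def)
  then show ?thesis by blast
 qed
 have "\<exists>f. \<forall>i. (good (f i) \<and> (i = 0 --> f i = (1, g, %j k. b k))) \<and> step (f i) (f (Suc i))"
  by (rule dependent_nat_choice) (use start next_step in auto)
 then obtain f where f: "f 0 = (1, g, %j k. b k)" "!!i. good (f i)" "!!i. step (f i) (f (Suc i))"
  by blast
 define p where "p i = fst (f i)" for i
 define A where "A i = snd (snd (f i))" for i
 have pS: "fst (snd (f i)) = p (Suc i)" for i using f(3)[of i] by (simp add: step_def p_def)
 have p0: "p 0 = 1" "p (Suc 0) = g" "A 0 = (%j k. b k)" using f(1) pS[of 0] by (simp_all add: p_def A_def)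
 have "matrix_resolution m p A (%_. \<one>)" unfolding matrix_resolution_def
 proof (intro conjI allI impI)
  show "A i j k \<in> |R|" if "j < p i" "k < p (Suc i)" for i j k
   using f(2)[of i] that unfolding good_def pS by (simp add: p_def A_def)
  show "cvec (p 0) (%_. \<one>)" by (simp add: vec_def)
  have d1: "dot R 1 c (%_. \<one>) = c 0" if "cvec 1 c" for c
   using cdot_Suc[of 0 c "%_. \<one>"] that by (simp add: vec_def)
  show "\<exists>c. cvec (p 0) c \<and> dot R (p 0) c (%_. \<one>) = \<one>"
   using d1[of "%_. \<one>"] p0 by (intro exI[of _ "%_. \<one>"]) (simp add: vec_def)
  show "dot R (p 0) c (%_. \<one>) \<in> m \<longleftrightarrow> spanned (p 1) (p 0) (A 0) c"
   if "cvec (p 0) c" for c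
   using d1[of c] that p0 b(2) bm by auto
  show "(\<forall>j<p i. dot R (p (Suc i)) (A i j) c = \<zero>) \<longleftrightarrow>
    spanned (p (Suc (Suc i))) (p (Suc i)) (A (Suc i)) c"
   if "cvec (p (Suc i)) c" for i c
   using f(3)[of i] that unfolding step_def pS by (simp add: p_def A_def)
 qed
 then show ?thesis by blast
qed

subsection \<open>Resolutions by matrices and free resolutions\<close>

lemma self_module_sel:
 "|self_module R| = |R|" "\<zero>\<^bsub>self_module R\<^esub> = \<zero>" "x \<oplus>\<^bsub>self_module R\<^esub> y = x \<oplus> y"
 "r \<odot>\<^bsub>self_module R\<^esub> x = r * x"
 by (simp_all add: self_module_def)

lemma self_module_group: "abelian_group (self_module R)"
proof (rule abelian_groupI)
 fix x assume "x \<in> |self_module R|"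
 then show "\<exists>y\<in>|self_module R|. y \<oplus>\<^bsub>self_module R\<^esub> x = \<zero>\<^bsub>self_module R\<^esub>"
  by (intro bexI[of _ "\<ominus> x"]) (auto simp: self_module_sel l_neg)
qed (auto simp: self_module_sel a_ac)

lemma self_module_finsum:
 "(!!j. j < (q::nat) ==> f j \<in> |R| ) ==> finsum (self_module R) f {..<q} = finsum R f {..<q}"
proof (induction q)
 case 0
 interpret M: abelian_group "self_module R" by (rule self_module_group)
 show ?case using M.finsum_empty by (simp add: self_module_sel)
next
 case (Suc q)
 interpret M: abelian_group "self_module R" by (rule self_module_group)
 have f: "f j \<in> |R|" if "j < Suc q" for j using Suc.prems that by blast
 have "finsum (self_module R) f {..<Suc q} = f q \<oplus>\<^bsub>self_module R\<^esub> finsum (self_module R) f {..<q}"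
  unfolding lessThan_Suc by (rule M.finsum_insert) (use f in \<open>auto simp: self_module_sel\<close>)
 moreover have "finsum R f {..<Suc q} = f q \<oplus> finsum R f {..<q}"
  unfolding lessThan_Suc by (rule finsum_insert) (use f in auto)
 ultimately show ?case using Suc.IH f by (simp add: self_module_sel)
qed

lemma self_module_dot:
 assumes "cvec q u" "cvec q v" shows "(\<Oplus>\<^bsub>self_module R\<^esub>j\<in>{..<q}. u j \<odot>\<^bsub>self_module R\<^esub> v j) = dot R q u v"
 unfolding dot_def self_module_sel by (rule self_module_finsum) (use assms in \<open>auto simp: vec_def\<close>)

lemma self_module_quotient:
 assumes m: "ideal m R" shows "quotient_setting R m (self_module R)"
proof -
 interpret I: ideal m R by (rule m)
 interpret M: abelian_group "self_module R" by (rule self_module_group)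
 have neg: "\<ominus>\<^bsub>self_module R\<^esub> x = \<ominus> x" if "x \<in> |R|" for x
  by (rule M.minus_equality) (use that in \<open>auto simp: self_module_sel l_neg\<close>)
 have "subgroup m (add_monoid (self_module R))"
 proof
  show "m \<subseteq> |add_monoid (self_module R)|" using I.a_subset by (simp add: self_module_sel)
  show "x *\<^bsub>add_monoid (self_module R)\<^esub> y \<in> m" if "x \<in> m" "y \<in> m" for x y
   using that by (simp add: self_module_sel)
  show "\<one>\<^bsub>add_monoid (self_module R)\<^esub> \<in> m" by (simp add: self_module_sel)
  show "inv\<^bsub>add_monoid (self_module R)\<^esub> x \<in> m" if "x \<in> m" for x
   using neg[of x] that I.Icarr[OF that] I.a_inv_closed[OF that] by (simp add: a_inv_def)
 qed
 then interpret B: abelian_subgroup m "self_module R"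
  by (intro abelian_subgroupI3 additive_subgroup.intro self_module_group)
 show ?thesis
  by unfold_locales (auto simp: self_module_sel r_distr I.I_l_closed)
qed

lemma free_carrier: "c \<in> |free_module R q| \<longleftrightarrow> c \<in> {..<q} \<rightarrow>\<^sub>E |R|"
 by (simp add: power_module_def self_module_sel)

lemma free_cvec: "c \<in> |free_module R q| ==> cvec q c"
 by (auto simp: free_carrier vec_def)

lemma restrict_free: "cvec q c ==> (\<lambda>j\<in>{..<q}. c j) \<in> |free_module R q|"
 by (auto simp: free_carrier vec_def)

lemma matrix_map_self:
 assumes "!!j k. j < p ==> k < q ==> M j k \<in> |R|" "cvec q c"
 shows "matrix_map (self_module R) p q M c = (\<lambda>j\<in>{..<p}. dot R q (M j) c)"
 unfolding matrix_map_def by (rule restrict_ext) (use assms in \<open>auto intro!: self_module_dot simp: vec_def\<close>)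

lemma image_matrix_map:
 assumes M: "!!j k. j < p ==> k < q ==> M j k \<in> |R|" and c: "c \<in> |free_module R p|"
 shows "c \<in> matrix_map (self_module R) p q M ` |free_module R q| \<longleftrightarrow>
  spanned q p M c"
proof
 assume "c \<in> matrix_map (self_module R) p q M ` |free_module R q|"
 then obtain c' where c': "c' \<in> |free_module R q|" "c = matrix_map (self_module R) p q M c'" by blast
 then show "\<exists>c'. cvec q c' \<and> (\<forall>j<p. c j = dot R q (M j) c')"
  using matrix_map_self[OF M free_cvec[OF c'(1)]] free_cvec[OF c'(1)] by auto
next
 assume "\<exists>c'. cvec q c' \<and> (\<forall>j<p. c j = dot R q (M j) c')"
 then obtain c' where c': "cvec q c'" "!!j. j < p ==> c j = dot R q (M j) c'" by blast
 let ?d = "\<lambda>j\<in>{..<q}. c' j"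
 have d: "?d \<in> |free_module R q|" by (rule restrict_free[OF c'(1)])
 have "c = matrix_map (self_module R) p q M ?d"
 proof (rule ext)
  fix j
  show "c j = matrix_map (self_module R) p q M ?d j"
  proof (cases "j < p")
   case True
   have "dot R q (M j) c' = dot R q (M j) ?d"
    by (rule cdot_cong) (use M True c'(1) in \<open>auto simp: vec_def\<close>)
   then show ?thesis using True c'(2) matrix_map_self[OF M free_cvec[OF d]] by simp
  next
   case False
   then show ?thesis using c matrix_map_self[OF M free_cvec[OF d]] by (auto simp: free_carrier PiE_def extensional_def)
  qed
 qed
 then show "c \<in> matrix_map (self_module R) p q M ` |free_module R q|" using d by blast
qed

lemma dot_restrict: "cvec q u ==> cvec q c ==> dot R q u (\<lambda>j\<in>{..<q}. c j) = dot R q u c"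
 by (rule cdot_cong[symmetric]) auto

lemma matrix_map_zero:
 assumes M: "!!j k. j < p ==> k < q ==> M j k \<in> |R|" and c: "cvec q c"
 shows "matrix_map (self_module R) p q M c = \<zero>\<^bsub>free_module R p\<^esub> \<longleftrightarrow> (\<forall>j<p. dot R q (M j) c = \<zero>)"
proof -
 have "\<zero>\<^bsub>free_module R p\<^esub> = (\<lambda>j\<in>{..<p}. \<zero>)" by (simp add: power_module_def self_module_sel)
 moreover have "(\<lambda>j\<in>{..<p}. dot R q (M j) c) = (\<lambda>j\<in>{..<p}. \<zero>) \<longleftrightarrow> (\<forall>j<p. dot R q (M j) c = \<zero>)"
  by (auto simp: restrict_def fun_eq_iff)
 ultimately show ?thesis using matrix_map_self[OF M c] by simp
qed

lemma kernel_eq_image_iff: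
 assumes M: "!!j k. j < p ==> k < q ==> M j k \<in> |R|"
  and Z: "!!c. cvec p c ==> Z (\<lambda>j\<in>{..<p}. c j) \<longleftrightarrow> Z c"
 shows "{c \<in> |free_module R p|. Z c} = matrix_map (self_module R) p q M ` |free_module R q| \<longleftrightarrow>
  (\<forall>c. cvec p c --> (Z c \<longleftrightarrow> spanned q p M c))" (is "_ = ?I \<longleftrightarrow> (\<forall>c. _ --> (_ \<longleftrightarrow> ?S c))")
proof -
 have "x \<in> |free_module R p|" if x: "x \<in> ?I" for x
 proof -
  obtain c where c: "c \<in> |free_module R q|" "x = matrix_map (self_module R) p q M c" using x by blast
  have "x = (\<lambda>j\<in>{..<p}. dot R q (M j) c)"
   unfolding c(2) by (rule matrix_map_self) (use M free_cvec[OF c(1)] in auto)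
  then show ?thesis
   by (simp only:) (rule restrict_free, use M free_cvec[OF c(1)] in \<open>auto simp: vec_def intro!: dot_closed\<close>)
 qed
 then have "{c \<in> |free_module R p|. Z c} = ?I \<longleftrightarrow> (\<forall>c\<in>|free_module R p|. Z c \<longleftrightarrow> c \<in> ?I)" by blast
 also have "\<dots> \<longleftrightarrow> (\<forall>c\<in>|free_module R p|. Z c \<longleftrightarrow> ?S c)"
  by (rule ball_cong[OF refl]) (use image_matrix_map[of p q M, OF M] in simp)
 also have "\<dots> \<longleftrightarrow> (\<forall>c. cvec p c --> (Z c \<longleftrightarrow> ?S c))"
 proof
  assume h: "\<forall>c\<in>|free_module R p|. Z c \<longleftrightarrow> ?S c"
  show "\<forall>c. cvec p c --> (Z c \<longleftrightarrow> ?S c)"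
  proof (intro allI impI)
   fix c assume c: "cvec p c"
   show "Z c \<longleftrightarrow> ?S c" using bspec[OF h restrict_free[OF c]] Z[OF c] by simp
  qed
 qed (use free_cvec in blast)
 finally show ?thesis .
qed

lemma free_resolution_iff:
 assumes m: "ideal m R" and e: "!!j. j < p 0 ==> e j = m +>\<^bsub>self_module R\<^esub> eps j" and eps: "cvec (p 0) eps"
  and unit: "!!a. a \<in> |R| ==> a \<ominus> \<one> \<in> m ==> \<exists>b\<in>carrier R. a * b = \<one>"
 shows "free_resolution R (quotient_module (self_module R) m) p A e \<longleftrightarrow> matrix_resolution m p A eps"
proof -
 interpret K: quotient_setting R m "self_module R" by (rule self_module_quotient[OF m])
 interpret I: ideal m R by (rule m)
 let ?K = "quotient_module (self_module R) m"
 have lc: "lin_comb ?K (p 0) c e = m +>\<^bsub>self_module R\<^esub> (dot R (p 0) c eps)" if c: "cvec (p 0) c" for c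
 proof -
  have "lin_comb ?K (p 0) c e = m +>\<^bsub>self_module R\<^esub> (\<Oplus>\<^bsub>self_module R\<^esub>j\<in>{..<p 0}. c j \<odot>\<^bsub>self_module R\<^esub> eps j)"
   by (rule K.V_lin_comb) (use e eps c in \<open>auto simp: vec_def self_module_sel\<close>)
  then show ?thesis using self_module_dot[OF c eps] by simp
 qed
 have eK: "e j \<in> |?K|" if "j < p 0" for j
  using K.V_carrier e[OF that] eps that by (auto simp: vec_def self_module_sel)
 have zero: "lin_comb ?K (p 0) c e = \<zero>\<^bsub>?K\<^esub> \<longleftrightarrow> dot R (p 0) c eps \<in> m" if c: "cvec (p 0) c" for c
  unfolding lc[OF c] K.V_zero by (rule K.coset_eq_B) (use c eps in \<open>simp add: self_module_sel\<close>)
 have surj: "(%c. lin_comb ?K (p 0) c e) ` |free_module R (p 0)| = |?K| \<longleftrightarrow>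
  (\<exists>c. cvec (p 0) c \<and> dot R (p 0) c eps = \<one>)"
 proof
  assume im: "(%c. lin_comb ?K (p 0) c e) ` |free_module R (p 0)| = |?K|"
  have "m +>\<^bsub>self_module R\<^esub> \<one> \<in> |?K|" unfolding K.V_carrier self_module_sel by blast
  then obtain c where c: "c \<in> |free_module R (p 0)|" "m +>\<^bsub>self_module R\<^esub> \<one> = lin_comb ?K (p 0) c e"
   unfolding im[symmetric] by blast
  note cc = free_cvec[OF c(1)]
  have d: "dot R (p 0) c eps \<in> |R|" using cc eps by simp
  have "m +>\<^bsub>self_module R\<^esub> (dot R (p 0) c eps) = m +>\<^bsub>self_module R\<^esub> \<one>" using lc[OF cc] c(2) by simp
  then obtain b where b: "b \<in> m" "dot R (p 0) c eps = b \<oplus> \<one>"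
   using K.coset_eq_iff[of \<one> "dot R (p 0) c eps"] d by (auto simp: self_module_sel)
  have bc: "b \<in> |R|" using b I.Icarr by blast
  have "dot R (p 0) c eps \<ominus> \<one> = b" unfolding b(2) using bc by (simp add: minus_eq a_assoc r_neg)
  then obtain a where a: "a \<in> |R|" "dot R (p 0) c eps * a = \<one>" using unit[OF d] b(1) by auto
  have "dot R (p 0) (%j. a * c j) eps = dot R (p 0) eps (%j. a * c j)"
   by (rule cdot_comm) (use cc a(1) eps in \<open>auto simp: vec_def\<close>)
  also have "\<dots> = a * dot R (p 0) c eps" using cdot_scale_right[OF eps cc a(1)] cdot_comm[OF eps cc] by simp
  finally have "dot R (p 0) (%j. a * c j) eps = \<one>" using a d by (simp add: m_comm)
  moreover have "cvec (p 0) (%j. a * c j)" using cc a(1) by (simp add: vec_def)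
  ultimately show "\<exists>c. cvec (p 0) c \<and> dot R (p 0) c eps = \<one>" by blast
 next
  assume "\<exists>c. cvec (p 0) c \<and> dot R (p 0) c eps = \<one>"
  then obtain c where c: "cvec (p 0) c" "dot R (p 0) c eps = \<one>" by blast
  show "(%c. lin_comb ?K (p 0) c e) ` |free_module R (p 0)| = |?K|"
  proof (intro equalityI subsetI)
   fix x assume "x \<in> (%c. lin_comb ?K (p 0) c e) ` |free_module R (p 0)|"
   then obtain c where c: "c \<in> |free_module R (p 0)|" "x = lin_comb ?K (p 0) c e" by blast
   show "x \<in> |?K|" unfolding c(2) lc[OF free_cvec[OF c(1)]] K.V_carrier self_module_sel
    using cdot_closed[OF free_cvec[OF c(1)] eps] by blast
  next
   fix x assume "x \<in> |?K|"
   then obtain r where r: "r \<in> |R|" "x = m +>\<^bsub>self_module R\<^esub> r"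
    unfolding K.V_carrier self_module_sel by blast
   let ?c = "\<lambda>j\<in>{..<p 0}. r * c j"
   have rc: "cvec (p 0) (%j. r * c j)" using r(1) c(1) by (simp add: vec_def)
   have f: "?c \<in> |free_module R (p 0)|" by (rule restrict_free[OF rc])
   have "dot R (p 0) ?c eps = dot R (p 0) eps ?c" by (rule cdot_comm[OF free_cvec[OF f] eps])
   also have "\<dots> = dot R (p 0) eps (%j. r * c j)" by (rule dot_restrict[OF eps rc])
   also have "\<dots> = r" using cdot_scale_right[OF eps c(1) r(1)] cdot_comm[OF eps c(1)] c(2) r(1) by simp
   finally have "lin_comb ?K (p 0) ?c e = x" using lc[OF free_cvec[OF f]] r(2) by simp
   then show "x \<in> (%c. lin_comb ?K (p 0) c e) ` |free_module R (p 0)|" using f by blast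
  qed
 qed
 show ?thesis
 proof (cases "\<forall>i. \<forall>j<p i. \<forall>k<p (Suc i). A i j k \<in> |R|")
  case False
  then show ?thesis unfolding free_resolution_def matrix_resolution_def by blast
 next
  case True
  then have A: "A i j k \<in> |R|" if "j < p i" "k < p (Suc i)" for i j k using that by blast
  have row: "cvec (p (Suc i)) (A i j)" if "j < p i" for i j using A that by (simp add: vec_def)
  have A0: "A 0 j k \<in> |R|" if "j < p 0" "k < p 1" for j k using A[of j 0 k] that by simp
  have r0: "dot R (p 0) (\<lambda>j\<in>{..<p 0}. c j) eps = dot R (p 0) c eps" if c: "cvec (p 0) c" for c
   using cdot_comm[OF c eps] cdot_comm[OF free_cvec[OF restrict_free[OF c]] eps] dot_restrict[OF eps c] by simp
  have "{c \<in> |free_module R (p 0)|. lin_comb ?K (p 0) c e = \<zero>\<^bsub>?K\<^esub>} =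
    {c \<in> |free_module R (p 0)|. dot R (p 0) c eps \<in> m}" using zero[OF free_cvec] by blast
  moreover note kernel_eq_image_iff[of "p 0" "p 1" "A 0" "%c. dot R (p 0) c eps \<in> m", OF A0]
  ultimately have E0: "{c \<in> |free_module R (p 0)|. lin_comb ?K (p 0) c e = \<zero>\<^bsub>?K\<^esub>}
   = matrix_map (self_module R) (p 0) (p 1) (A 0) ` |free_module R (p 1)| \<longleftrightarrow>
   (\<forall>c. cvec (p 0) c --> (dot R (p 0) c eps \<in> m \<longleftrightarrow>
    spanned (p 1) (p 0) (A 0) c))" using r0 by simp
  have Ei: "{c \<in> |free_module R (p (Suc i))|.
      matrix_map (self_module R) (p i) (p (Suc i)) (A i) c = \<zero>\<^bsub>free_module R (p i)\<^esub>}
   = matrix_map (self_module R) (p (Suc i)) (p (Suc (Suc i))) (A (Suc i)) ` |free_module R (p (Suc (Suc i)))| \<longleftrightarrow>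
   (\<forall>c. cvec (p (Suc i)) c --> ((\<forall>j<p i. dot R (p (Suc i)) (A i j) c = \<zero>) \<longleftrightarrow>
    spanned (p (Suc (Suc i))) (p (Suc i)) (A (Suc i)) c))" for i
  proof -
   have "{c \<in> |free_module R (p (Suc i))|. matrix_map (self_module R) (p i) (p (Suc i)) (A i) c = \<zero>\<^bsub>free_module R (p i)\<^esub>}
    = {c \<in> |free_module R (p (Suc i))|. \<forall>j<p i. dot R (p (Suc i)) (A i j) c = \<zero>}"
    using matrix_map_zero[of "p i" "p (Suc i)" "A i", OF A free_cvec] by blast
   moreover note kernel_eq_image_iff[of "p (Suc i)" "p (Suc (Suc i))" "A (Suc i)" "%c. \<forall>j<p i. dot R (p (Suc i)) (A i j) c = \<zero>", OF A]
   ultimately show ?thesis using dot_restrict[OF row] by simp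
  qed
  have eK': "\<forall>j<p 0. e j \<in> |?K|" using eK by blast
  show ?thesis unfolding free_resolution_def matrix_resolution_def surj E0 Ei
   by (simp only: eqTrueI[OF eK'] eps simp_thms)
 qed
qed

end

context embedded_module
begin

lemma phi_dot: "S.cvec q u ==> S.cvec q v ==> \<phi> (dot S q u v) = dot P q (%j. \<phi> (u j)) (%j. \<phi> (v j))"
proof (induction q)
 case 0 then show ?case by (simp add: phi_zero)
next
 case (Suc q)
 have c: "P.cvec (Suc q) (%j. \<phi> (u j))" "P.cvec (Suc q) (%j. \<phi> (v j))" using Suc.prems phi_hom by (auto simp: vec_def)
 have uq: "u q \<in> |S|" "v q \<in> |S|" using Suc.prems by (auto simp: vec_def)
 have d: "dot S q u v \<in> |S|" using Suc.prems S.cvec_Suc by simp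
 show ?case using S.cdot_Suc[OF Suc.prems] P.cdot_Suc[OF c] Suc.IH S.cvec_Suc Suc.prems uq d by (simp add: phi_hom)
qed

lemma vec_lift:
 assumes "vec (\<phi> ` |S| ) q c" obtains d where "S.cvec q d" "!!j. j < q ==> c j = \<phi> (d j)"
proof -
 have "\<forall>j. \<exists>s. j < q --> s \<in> |S| \<and> c j = \<phi> s" using assms by (auto simp: vec_def)
 then obtain d where "!!j. j < q ==> d j \<in> |S| \<and> c j = \<phi> (d j)" by metis
 then show ?thesis using that[of d] by (simp add: vec_def)
qed

lemma phi_vec: "S.cvec q d ==> vec (\<phi> ` |S| ) q (%j. \<phi> (d j))"
 by (auto simp: vec_def)

lemma phi_cvec: "S.cvec q d ==> P.cvec q (%j. \<phi> (d j))"
 using phi_hom by (auto simp: vec_def)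

lemma resolution_phi:
 assumes res: "S.matrix_resolution m p A eps"
 shows "F.resolution p (%i j k. \<phi> (A i j k)) (%j. \<phi> (eps j))"
proof -
 have A: "A i j k \<in> |S|" if "j < p i" "k < p (Suc i)" for i j k
  using res that by (simp add: S.matrix_resolution_def)
 have row: "S.cvec (p (Suc i)) (A i j)" if "j < p i" for i j using A that by (simp add: vec_def)
 have row0: "S.cvec (p 1) (A 0 j)" if "j < p 0" for j using row[of j 0] that by simp
 have eps: "S.cvec (p 0) eps" using res by (simp add: S.matrix_resolution_def)
 have image: "(\<exists>c'. vec (\<phi> ` |S| ) q c' \<and> (\<forall>j<r. c j = dot P q (%k. \<phi> (M j k)) c')) \<longleftrightarrow>
  (\<exists>d'. S.cvec q d' \<and> (\<forall>j<r. d j = dot S q (M j) d'))"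
  if c: "!!j. j < r ==> c j = \<phi> (d j)" and d: "S.cvec r d" and M: "!!j. j < r ==> S.cvec q (M j)" for c d q M and r :: nat
 proof
  assume "\<exists>c'. vec (\<phi> ` |S| ) q c' \<and> (\<forall>j<r. c j = dot P q (%k. \<phi> (M j k)) c')"
  then obtain c' where c': "vec (\<phi> ` |S| ) q c'" "!!j. j < r ==> c j = dot P q (%k. \<phi> (M j k)) c'" by blast
  obtain d' where d': "S.cvec q d'" "!!j. j < q ==> c' j = \<phi> (d' j)" by (rule vec_lift[OF c'(1)]) blast
  have "d j = dot S q (M j) d'" if j: "j < r" for j
  proof -
   have "\<phi> (d j) = dot P q (%k. \<phi> (M j k)) c'" using c[OF j] c'(2)[OF j] by simp
   also have "\<dots> = dot P q (%k. \<phi> (M j k)) (%j. \<phi> (d' j))"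
    by (rule P.cdot_cong[OF phi_cvec[OF M[OF j]] F.vec_A[OF c'(1)]]) (use d' in auto)
   also have "\<dots> = \<phi> (dot S q (M j) d')" using phi_dot[OF M[OF j] d'(1)] by simp
   finally show ?thesis using phi_eqD S.cdot_closed[OF M[OF j] d'(1)] d j by (simp add: vec_def)
  qed
  then show "\<exists>d'. S.cvec q d' \<and> (\<forall>j<r. d j = dot S q (M j) d')" using d'(1) by blast
 next
  assume "\<exists>d'. S.cvec q d' \<and> (\<forall>j<r. d j = dot S q (M j) d')"
  then obtain d' where d': "S.cvec q d'" "!!j. j < r ==> d j = dot S q (M j) d'" by blast
  have "c j = dot P q (%k. \<phi> (M j k)) (%j. \<phi> (d' j))" if "j < r" for j
   using c[OF that] d'(2)[OF that] phi_dot[OF M[OF that] d'(1)] by simp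
  then show "\<exists>c'. vec (\<phi> ` |S| ) q c' \<and> (\<forall>j<r. c j = dot P q (%k. \<phi> (M j k)) c')"
   using phi_vec[OF d'(1)] by blast
 qed
 have dotP: "dot P q (%k. \<phi> (u k)) c = \<phi> (dot S q u d)" "dot P q c (%k. \<phi> (u k)) = \<phi> (dot S q d u)"
  if "S.cvec q u" "S.cvec q d" "vec (\<phi> ` |S| ) q c" "!!j. j < q ==> c j = \<phi> (d j)" for q u c d
  using phi_dot[OF that(1,2)] phi_dot[OF that(2,1)]
   P.cdot_cong[OF phi_cvec[OF that(1)] F.vec_A[OF that(3)], of "%k. \<phi> (u k)" "%j. \<phi> (d j)"]
   P.cdot_cong[OF F.vec_A[OF that(3)] phi_cvec[OF that(1)], of "%j. \<phi> (d j)" "%k. \<phi> (u k)"] that(4) by auto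
 show ?thesis unfolding F.resolution_def
 proof (intro conjI allI impI)
  show "\<phi> (A i j k) \<in> \<phi> ` |S|" if "j < p i" "k < p (Suc i)" for i j k using A that by blast
  show "vec (\<phi> ` |S| ) (p 0) (%j. \<phi> (eps j))" using phi_vec[OF eps] .
  obtain c where c: "S.cvec (p 0) c" "dot S (p 0) c eps = \<one>" using res by (auto simp: S.matrix_resolution_def)
  show "\<exists>c. vec (\<phi> ` |S| ) (p 0) c \<and> dot P (p 0) c (%j. \<phi> (eps j)) = \<one>\<^bsub>P\<^esub>"
   using phi_vec[OF c(1)] phi_dot[OF c(1) eps] c(2) phi_hom(4) by (intro exI[of _ "%j. \<phi> (c j)"]) simp
 next
  fix c assume c: "vec (\<phi> ` |S| ) (p 0) c"
  obtain d where d: "S.cvec (p 0) d" "!!j. j < p 0 ==> c j = \<phi> (d j)" by (rule vec_lift[OF c]) blast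
  have e: "dot P (p 0) c (%j. \<phi> (eps j)) = \<phi> (dot S (p 0) d eps)"
   by (rule dotP(2)[OF eps d(1) c]) (rule d(2))
  have "dot P (p 0) c (%j. \<phi> (eps j)) \<in> \<phi> ` m \<longleftrightarrow> dot S (p 0) d eps \<in> m"
   unfolding e by (rule inj_on_image_mem_iff[OF inj S.cdot_closed[OF d(1) eps] m_sub])
  also have "\<dots> \<longleftrightarrow> (\<exists>d'. S.cvec (p 1) d' \<and> (\<forall>j<p 0. d j = dot S (p 1) (A 0 j) d'))"
   using res d(1) by (simp add: S.matrix_resolution_def)
  also have "\<dots> \<longleftrightarrow> (\<exists>c'. vec (\<phi> ` |S| ) (p 1) c' \<and> (\<forall>j<p 0. c j = dot P (p 1) (%k. \<phi> (A 0 j k)) c'))"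
   by (rule image[symmetric]) (use d row0 in auto)
  finally show "dot P (p 0) c (%j. \<phi> (eps j)) \<in> \<phi> ` m \<longleftrightarrow>
   (\<exists>c'. vec (\<phi> ` |S| ) (p 1) c' \<and> (\<forall>j<p 0. c j = dot P (p 1) (%k. \<phi> (A 0 j k)) c'))" .
 next
  fix i c assume c: "vec (\<phi> ` |S| ) (p (Suc i)) c"
  obtain d where d: "S.cvec (p (Suc i)) d" "!!j. j < p (Suc i) ==> c j = \<phi> (d j)" by (rule vec_lift[OF c]) blast
  have "dot P (p (Suc i)) (%k. \<phi> (A i j k)) c = \<zero>\<^bsub>P\<^esub> \<longleftrightarrow> dot S (p (Suc i)) (A i j) d = \<zero>" if j: "j < p i" for j
  proof -
   have e: "dot P (p (Suc i)) (%k. \<phi> (A i j k)) c = \<phi> (dot S (p (Suc i)) (A i j) d)"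
    by (rule dotP(1)[OF row[OF j] d(1) c]) (rule d(2))
   show ?thesis unfolding e phi_zero[symmetric]
   by (rule inj_on_eq_iff[OF inj S.cdot_closed[OF row[OF j] d(1)] S.zero_closed])
  qed
  then have "(\<forall>j<p i. dot P (p (Suc i)) (%k. \<phi> (A i j k)) c = \<zero>\<^bsub>P\<^esub>) \<longleftrightarrow> (\<forall>j<p i. dot S (p (Suc i)) (A i j) d = \<zero>)" by simp
  also have "\<dots> \<longleftrightarrow> (\<exists>d'. S.cvec (p (Suc (Suc i))) d' \<and> (\<forall>k<p (Suc i). d k = dot S (p (Suc (Suc i))) (A (Suc i) k) d'))"
   using res d(1) by (simp add: S.matrix_resolution_def)
  also have "\<dots> \<longleftrightarrow> (\<exists>c'. vec (\<phi> ` |S| ) (p (Suc (Suc i))) c' \<and> (\<forall>k<p (Suc i). c k = dot P (p (Suc (Suc i))) (%l. \<phi> (A (Suc i) k l)) c'))"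
   by (rule image[symmetric]) (use d row in auto)
  finally show "(\<forall>j<p i. dot P (p (Suc i)) (%k. \<phi> (A i j k)) c = \<zero>\<^bsub>P\<^esub>) \<longleftrightarrow>
   (\<exists>c'. vec (\<phi> ` |S| ) (p (Suc (Suc i))) c' \<and> (\<forall>k<p (Suc i). c k = dot P (p (Suc (Suc i))) (%l. \<phi> (A (Suc i) k l)) c'))" .
 qed
qed

end

subsection \<open>Canonical modules are the dualizing fractional ideals\<close>

context cring
begin

lemma frac_module_sel:
 "|frac_module R H| = H" "\<zero>\<^bsub>frac_module R H\<^esub> = \<zero>\<^bsub>Frac R\<^esub>"
 "x \<oplus>\<^bsub>frac_module R H\<^esub> y = x \<oplus>\<^bsub>Frac R\<^esub> y"
 "r \<odot>\<^bsub>frac_module R H\<^esub> x = to_frac R r *\<^bsub>Frac R\<^esub> x"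
 by (simp_all add: frac_module_def)

lemma fractional_ideal_iff:
 "fractional_ideal R H \<longleftrightarrow> submod (Frac R) (to_frac R ` |R| ) H \<and>
  (\<exists>y\<in>Reg R. \<forall>x\<in>H. to_frac R y *\<^bsub>Frac R\<^esub> x \<in> to_frac R ` |R| )"
proof -
 interpret Q: cring "Frac R" by (rule total_frac_cring)
 interpret E: fraction_embedding R "Frac R" "to_frac R" by (rule total_frac_embedding)
 let ?M = "frac_module R ( |Frac R| )"
 have M: "abelian_group ?M"
 proof (rule abelian_groupI)
  fix x assume "x \<in> |?M|"
  then show "\<exists>y\<in>carrier ?M. y \<oplus>\<^bsub>?M\<^esub> x = \<zero>\<^bsub>?M\<^esub>"
   by (intro bexI[of _ "\<ominus>\<^bsub>Frac R\<^esub> x"]) (auto simp: frac_module_sel Q.l_neg)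
 qed (auto simp: frac_module_sel Q.a_ac)
 interpret M: abelian_group ?M by (rule M)
 have neg: "\<ominus>\<^bsub>?M\<^esub> x = \<ominus>\<^bsub>Frac R\<^esub> x" if "x \<in> |Frac R|" for x
  by (rule M.minus_equality) (use that in \<open>auto simp: frac_module_sel Q.l_neg\<close>)
 have "submodule H R ?M \<longleftrightarrow> submod (Frac R) (to_frac R ` |R| ) H"
 proof
  assume "submodule H R ?M"
  then interpret H: submodule H R ?M .
  show "submod (Frac R) (to_frac R ` |R| ) H" unfolding submod_def
   using H.subset H.one_closed H.m_closed H.smult_closed by (auto simp: frac_module_sel)
 next
  assume H: "submod (Frac R) (to_frac R ` |R| ) H"
  have n: "\<ominus>\<^bsub>Frac R\<^esub> x \<in> H" if x: "x \<in> H" for x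
  proof -
   have xc: "x \<in> |Frac R|" using H x by (auto simp: submod_def)
   have "to_frac R (\<ominus> \<one>) *\<^bsub>Frac R\<^esub> x \<in> H" using H x by (auto simp: submod_def)
   then show ?thesis using xc by (simp add: E.phi_minus_one Q.l_minus)
  qed
  show "submodule H R ?M"
  proof
   show "H \<subseteq> |add_monoid ?M|" using H by (auto simp: submod_def frac_module_sel)
   show "\<one>\<^bsub>add_monoid ?M\<^esub> \<in> H" using H by (auto simp: submod_def frac_module_sel)
   show "x *\<^bsub>add_monoid ?M\<^esub> y \<in> H" if "x \<in> H" "y \<in> H" for x y
    using H that by (auto simp: submod_def frac_module_sel)
   show "inv\<^bsub>add_monoid ?M\<^esub> x \<in> H" if x: "x \<in> H" for x
   proof -
    have "x \<in> |Frac R|" using H x by (auto simp: submod_def)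
    then show ?thesis using neg[of x] n[OF x] by (simp add: a_inv_def)
   qed
   show "a \<odot>\<^bsub>?M\<^esub> x \<in> H" if "a \<in> |R|" "x \<in> H" for a x
    using H that by (auto simp: submod_def frac_module_sel)
  qed
 qed
 moreover have "to_frac R y <#\<^bsub>Frac R\<^esub> H \<subseteq> to_frac R ` |R| \<longleftrightarrow>
  (\<forall>x\<in>H. to_frac R y *\<^bsub>Frac R\<^esub> x \<in> to_frac R ` |R| )" for y
  by (auto simp: l_coset_def)
 ultimately show ?thesis unfolding fractional_ideal_def by simp
qed

text \<open>One direction uses the given resolution, the other one an arbitrary resolution, which exists since $R$ is Noetherian.\<close>

theorem canonical_iff_dualizing:
 assumes CM: "cohen_macaulay_local R m" and dim: "krull_dim R = 1"
  and frac: "fractional_ideal R w" and Rw: "to_frac R ` |R| \<subseteq> w"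
 shows "canonical_module R m (frac_module R w) \<longleftrightarrow>
  dualizing (Frac R) (to_frac R ` |R| ) (to_frac R ` m) w"
proof -
 let ?Q = "Frac R" and ?N = "frac_module R w"
 have N: "noetherian_ring R" and L: "local_ring R m" using CM by (auto simp: cohen_macaulay_local_def)
 note m = local_ideal[OF L]
 interpret Q: cring ?Q by (rule total_frac_cring)
 interpret E: fraction_embedding R ?Q "to_frac R" by (rule total_frac_embedding)
 interpret F: one_dim_frac ?Q "to_frac R ` |R|" "to_frac R ` m"
  by (rule E.embedding_one_dim_frac[OF CM dim])
 have w: "submod ?Q (to_frac R ` |R| ) w" using frac[unfolded fractional_ideal_iff] by blast
 obtain y where y: "y \<in> Reg R" "!!x. x \<in> w ==> to_frac R y *\<^bsub>?Q\<^esub> x \<in> to_frac R ` |R|"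
  using frac[unfolded fractional_ideal_iff] by blast
 have yU: "to_frac R y \<in> Units ?Q" using E.regular_Units[OF y(1)] .
 have fr: "\<exists>d\<in>to_frac R ` |R| \<inter> Units ?Q. \<forall>x\<in>w. d *\<^bsub>?Q\<^esub> x \<in> to_frac R ` |R|"
  by (rule bexI[of _ "to_frac R y"]) (use y(2) yU regularD(1)[OF y(1)] in auto)
 interpret W: embedded_module R ?Q "to_frac R" m w ?N
  by unfold_locales (use m(3) w in \<open>auto simp: frac_module_sel\<close>)
 interpret K: quotient_setting R m "self_module R" by (rule self_module_quotient[OF m(1)])
 have unit: "\<exists>b\<in>carrier R. a * b = \<one>" if a: "a \<in> |R|" "a \<ominus> \<one> \<in> m" for a
 proof (rule local_unit[OF N L a(1)])
  show "a \<notin> m"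
  proof
   assume am: "a \<in> m"
   interpret I: ideal m R by (rule m(1))
   have "a \<oplus> \<ominus> (a \<ominus> \<one>) \<in> m" using am a(2) I.a_closed I.a_inv_closed by simp
   moreover have "a \<oplus> \<ominus> (a \<ominus> \<one>) = \<one>" using a(1) by algebra
   ultimately show False using m(2) by simp
  qed
 qed
 have ext: "(\<forall>i. residue_dim R m (ext_module p A ?N i) (if enat i = krull_dim R then 1 else 0)) \<longleftrightarrow>
   dualizing ?Q (to_frac R ` |R| ) (to_frac R ` m) w"
  if res: "matrix_resolution m p A eps" for p A eps
 proof -
  have A: "A i j k \<in> |R|" if "j < p i" "k < p (Suc i)" for i j k
   using res that by (simp add: matrix_resolution_def)
  note res' = W.resolution_phi[OF res]
  have "(\<forall>i. residue_dim R m (ext_module p A ?N i) (if enat i = krull_dim R then 1 else 0)) \<longleftrightarrow>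
   residue_dim R m (ext_module p A ?N 0) 0 \<and> residue_dim R m (ext_module p A ?N 1) 1 \<and>
   (\<forall>i. residue_dim R m (ext_module p A ?N (Suc (Suc i))) 0)" (is "(\<forall>i. ?P i) \<longleftrightarrow> _")
  proof -
   have "(\<forall>i. ?P i) \<longleftrightarrow> ?P 0 \<and> ?P 1 \<and> (\<forall>i. ?P (Suc (Suc i)))"
    by (metis One_nat_def not0_implies_Suc)
   then show ?thesis by (simp add: dim one_enat_def)
  qed
  also have "\<dots> \<longleftrightarrow> dualizing ?Q (to_frac R ` |R| ) (to_frac R ` m) w"
  proof -
   have e0: "residue_dim R m (ext_module p A ?N 0) 0" by (rule W.ext_dim_0[OF _ res']) (rule A)
   note e1 = W.ext_dim_1[of p A, OF _ res']
   note eh = W.ext_dim_higher[of p A, OF _ res']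
   show ?thesis
    apply (subst F.dualizing_iff_ext[OF res' w Rw fr])
    apply (subst e1, rule A, assumption, assumption)
    apply (subst eh, rule A, assumption, assumption)
    apply (simp only: eqTrueI[OF e0] simp_thms)
    done
  qed
  finally show ?thesis .
 qed
 have fg: "finitely_generated R ?N"
 proof -
  define J where "J = {s \<in> carrier R. to_frac R s \<in> (%x. to_frac R y *\<^bsub>?Q\<^esub> x) ` w}"
  have "ideal J R" unfolding J_def by (rule E.preimage_ideal[OF F.submod_scale[OF w]]) (use yU in auto)
  then obtain g b where b: "!!l. l < g ==> b l \<in> J" "!!x. x \<in> J ==> \<exists>c. cvec g c \<and> x = dot R g b c"
   using finitely_generated_ideal[OF N] by blast
  have bc: "cvec g b" using b(1) by (auto simp: vec_def J_def)
  have "\<forall>l. \<exists>x. l < g --> x \<in> w \<and> to_frac R (b l) = to_frac R y *\<^bsub>?Q\<^esub> x"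
  proof
   fix l show "\<exists>x. l < g --> x \<in> w \<and> to_frac R (b l) = to_frac R y *\<^bsub>?Q\<^esub> x"
    using b(1)[of l] unfolding J_def by blast
  qed
  then obtain e where e: "!!l. l < g ==> e l \<in> w" "!!l. l < g ==> to_frac R (b l) = to_frac R y *\<^bsub>?Q\<^esub> e l" by metis
  have ec: "Q.cvec g e" using e(1) W.wc by (auto simp: vec_def)
  have lc: "lin_comb ?N g c e = dot ?Q g (%j. to_frac R (c j)) e" if "cvec g c" for c
   unfolding lin_comb_def by (rule W.N_lin_comb) (use e that in \<open>auto simp: vec_def\<close>)
  have "w = (%c. lin_comb ?N g c e) ` |free_module R g|"
  proof (intro equalityI subsetI)
   fix x assume x: "x \<in> w"
   have xc: "x \<in> |?Q|" using W.wc x by blast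
   obtain s where s: "s \<in> |R|" "to_frac R y *\<^bsub>?Q\<^esub> x = to_frac R s" using y(2)[OF x] by blast
   have "s \<in> J" unfolding J_def using s x by force
   then obtain c where c: "cvec g c" "s = dot R g b c" using b(2) by blast
   let ?c = "\<lambda>j\<in>{..<g}. c j"
   have f: "?c \<in> |free_module R g|" by (rule restrict_free[OF c(1)])
   note cc = W.phi_cvec[OF free_cvec[OF f]]
   have "to_frac R s = to_frac R (dot R g b ?c)" using c dot_restrict[OF bc c(1)] by simp
   also have "\<dots> = dot ?Q g (%l. to_frac R (b l)) (%j. to_frac R (?c j))" by (rule W.phi_dot[OF bc free_cvec[OF f]])
   also have "\<dots> = dot ?Q g (%j. to_frac R (?c j)) (%l. to_frac R (b l))" by (rule Q.cdot_comm[OF W.phi_cvec[OF bc] cc])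
   also have "\<dots> = dot ?Q g (%j. to_frac R (?c j)) (%l. to_frac R y *\<^bsub>?Q\<^esub> e l)"
    by (rule Q.cdot_cong[OF cc W.phi_cvec[OF bc]]) (use e in auto)
   also have "\<dots> = to_frac R y *\<^bsub>?Q\<^esub> dot ?Q g (%j. to_frac R (?c j)) e"
    by (rule Q.cdot_scale_right[OF cc ec]) (use yU in auto)
   finally have "to_frac R y *\<^bsub>?Q\<^esub> x = to_frac R y *\<^bsub>?Q\<^esub> dot ?Q g (%j. to_frac R (?c j)) e" using s by simp
   then have "x = lin_comb ?N g ?c e"
    using lc[OF free_cvec[OF f]] Q.Units_l_cancel[OF yU xc Q.cdot_closed[OF cc ec]] by simp
   then show "x \<in> (%c. lin_comb ?N g c e) ` |free_module R g|" using f by blast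
  next
   fix x assume "x \<in> (%c. lin_comb ?N g c e) ` |free_module R g|"
   then obtain c where c: "c \<in> |free_module R g|" "x = lin_comb ?N g c e" by blast
   have "dot ?Q g (%j. to_frac R (c j)) e \<in> w"
    by (rule F.dot_mem[OF w W.phi_vec[OF free_cvec[OF c(1)]]]) (use e in \<open>simp add: vec_def\<close>)
   then show "x \<in> w" using c(2) lc[OF free_cvec[OF c(1)]] by simp
  qed
  then show ?thesis unfolding finitely_generated_def frac_module_sel using e(1) by (intro exI[of _ g] exI[of _ e]) blast
 qed
 show ?thesis
 proof
  assume "canonical_module R m ?N"
  then obtain p A e where res: "free_resolution R (quotient_module (self_module R) m) p A e"
   "\<forall>i. residue_dim R m (ext_module p A ?N i) (if enat i = krull_dim R then 1 else 0)"
   unfolding canonical_module_def by blast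
  have "e j \<in> |quotient_module (self_module R) m|" if "j < p 0" for j
   using res(1) that unfolding free_resolution_def by blast
  then have "\<forall>j. \<exists>r. j < p 0 --> r \<in> |R| \<and> e j = m +>\<^bsub>self_module R\<^esub> r"
   unfolding K.V_carrier self_module_sel by blast
  then obtain eps where eps: "!!j. j < p 0 ==> eps j \<in> |R|" "!!j. j < p 0 ==> e j = m +>\<^bsub>self_module R\<^esub> eps j" by metis
  have epsc: "cvec (p 0) eps" using eps(1) by (simp add: vec_def)
  have "matrix_resolution m p A eps"
   using free_resolution_iff[of m p e eps A, OF m(1) eps(2) epsc unit] res(1) by blast
  then show "dualizing ?Q (to_frac R ` |R| ) (to_frac R ` m) w" using ext res(2) by blast
 next
  assume D: "dualizing ?Q (to_frac R ` |R| ) (to_frac R ` m) w"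
  obtain p A eps where res: "matrix_resolution m p A eps" using matrix_resolution_exists[OF N m(1)] by blast
  have epsc: "cvec (p 0) eps" using res by (simp add: matrix_resolution_def)
  have "free_resolution R (quotient_module (self_module R) m) p A (%j. m +>\<^bsub>self_module R\<^esub> eps j)"
   using free_resolution_iff[of m p "%j. m +>\<^bsub>self_module R\<^esub> eps j" eps A, OF m(1) refl epsc unit] res by blast
  then show "canonical_module R m ?N" unfolding canonical_module_def
   using CM W.N_module fg ext[OF res] D by blast
 qed
qed

end

section \<open>Quadratic extensions\<close>

text \<open>The ring \<open>R[t] / (t\<^sup>2 + a t + b)\<close>, where $(r, i)$ stands for $r + i t$.\<close>

definition quadratic :: "('a, 'r) ring_scheme => 'a => 'a => ('a \<times> 'a) ring" where
 "quadratic R a b = \<lparr>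
  carrier = |R| \<times> |R|,
  monoid.mult = (%(r, i) (s, j).
   (r *\<^bsub>R\<^esub> s \<ominus>\<^bsub>R\<^esub> b *\<^bsub>R\<^esub> (i *\<^bsub>R\<^esub> j), (r *\<^bsub>R\<^esub> j \<oplus>\<^bsub>R\<^esub> i *\<^bsub>R\<^esub> s) \<ominus>\<^bsub>R\<^esub> a *\<^bsub>R\<^esub> (i *\<^bsub>R\<^esub> j))),
  one = (\<one>\<^bsub>R\<^esub>, \<zero>\<^bsub>R\<^esub>),
  ring.zero = (\<zero>\<^bsub>R\<^esub>, \<zero>\<^bsub>R\<^esub>),
  add = (%(r, i) (s, j). (r \<oplus>\<^bsub>R\<^esub> s, i \<oplus>\<^bsub>R\<^esub> j))\<rparr>"

lemma quadratic_sel: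
 "|quadratic R a b| = |R| \<times> |R|"
 "(r, i) *\<^bsub>quadratic R a b\<^esub> (s, j) =
  (r *\<^bsub>R\<^esub> s \<ominus>\<^bsub>R\<^esub> b *\<^bsub>R\<^esub> (i *\<^bsub>R\<^esub> j), (r *\<^bsub>R\<^esub> j \<oplus>\<^bsub>R\<^esub> i *\<^bsub>R\<^esub> s) \<ominus>\<^bsub>R\<^esub> a *\<^bsub>R\<^esub> (i *\<^bsub>R\<^esub> j))"
 "\<one>\<^bsub>quadratic R a b\<^esub> = (\<one>\<^bsub>R\<^esub>, \<zero>\<^bsub>R\<^esub>)"
 "\<zero>\<^bsub>quadratic R a b\<^esub> = (\<zero>\<^bsub>R\<^esub>, \<zero>\<^bsub>R\<^esub>)"
 "(r, i) \<oplus>\<^bsub>quadratic R a b\<^esub> (s, j) = (r \<oplus>\<^bsub>R\<^esub> s, i \<oplus>\<^bsub>R\<^esub> j)"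
 by (simp_all add: quadratic_def)

lemma (in cring) quadratic_cring:
 assumes a: "a \<in> |R|" and b: "b \<in> |R|"
 shows "cring (quadratic R a b)"
proof (rule cringI)
 show "abelian_group (quadratic R a b)"
 proof (rule abelian_groupI)
  fix x assume "x \<in> |quadratic R a b|"
  then obtain r i where x: "x = (r, i)" "r \<in> |R|" "i \<in> |R|" by (auto simp: quadratic_sel)
  then show "\<exists>y\<in>|quadratic R a b|. y \<oplus>\<^bsub>quadratic R a b\<^esub> x = \<zero>\<^bsub>quadratic R a b\<^esub>"
   by (intro bexI[of _ "(\<ominus> r, \<ominus> i)"]) (auto simp: quadratic_sel l_neg)
 qed (auto simp: quadratic_sel a_ac)
 show "comm_monoid (quadratic R a b)"
 proof (rule comm_monoidI)
  fix x y z assume "x \<in> |quadratic R a b|" "y \<in> |quadratic R a b|" "z \<in> |quadratic R a b|"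
  then obtain r i s j t k where x: "x = (r, i)" "r \<in> |R|" "i \<in> |R|"
   and y: "y = (s, j)" "s \<in> |R|" "j \<in> |R|"
   and z: "z = (t, k)" "t \<in> |R|" "k \<in> |R|" by (auto simp: quadratic_sel)
  show "(x *\<^bsub>quadratic R a b\<^esub> y) *\<^bsub>quadratic R a b\<^esub> z = x *\<^bsub>quadratic R a b\<^esub> (y *\<^bsub>quadratic R a b\<^esub> z)"
   unfolding x(1) y(1) z(1) quadratic_sel
  proof (intro arg_cong2[where f=Pair])
   show "(r * s \<ominus> b * (i * j)) * t \<ominus> b * (((r * j \<oplus> i * s) \<ominus> a * (i * j)) * k) =
    r * (s * t \<ominus> b * (j * k)) \<ominus> b * (i * ((s * k \<oplus> j * t) \<ominus> a * (j * k)))"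
    using x(2,3) y(2,3) z(2,3) a b by algebra
   show "((r * s \<ominus> b * (i * j)) * k \<oplus> (r * j \<oplus> i * s \<ominus> a * (i * j)) * t) \<ominus> a * ((r * j \<oplus> i * s \<ominus> a * (i * j)) * k) =
   (r * (s * k \<oplus> j * t \<ominus> a * (j * k)) \<oplus> i * (s * t \<ominus> b * (j * k))) \<ominus> a * (i * (s * k \<oplus> j * t \<ominus> a * (j * k)))"
    using x(2,3) y(2,3) z(2,3) a b by algebra
  qed
  show "x *\<^bsub>quadratic R a b\<^esub> y = y *\<^bsub>quadratic R a b\<^esub> x"
   unfolding x(1) y(1) quadratic_sel using x y a b by (simp add: m_comm a_comm)
 qed (use a b in \<open>auto simp: quadratic_sel minus_eq\<close>)
 fix x y z assume "x \<in> |quadratic R a b|" "y \<in> |quadratic R a b|" "z \<in> |quadratic R a b|"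
 then obtain r i s j t k where x: "x = (r, i)" "r \<in> |R|" "i \<in> |R|"
  and y: "y = (s, j)" "s \<in> |R|" "j \<in> |R|"
  and z: "z = (t, k)" "t \<in> |R|" "k \<in> |R|" by (auto simp: quadratic_sel)
 show "(x \<oplus>\<^bsub>quadratic R a b\<^esub> y) *\<^bsub>quadratic R a b\<^esub> z =
   x *\<^bsub>quadratic R a b\<^esub> z \<oplus>\<^bsub>quadratic R a b\<^esub> y *\<^bsub>quadratic R a b\<^esub> z"
  unfolding x(1) y(1) z(1) quadratic_sel
 proof (intro arg_cong2[where f=Pair])
  show "(r \<oplus> s) * t \<ominus> b * ((i \<oplus> j) * k) = (r * t \<ominus> b * (i * k)) \<oplus> (s * t \<ominus> b * (j * k))"
   using x(2,3) y(2,3) z(2,3) a b by algebra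
  show "((r \<oplus> s) * k \<oplus> (i \<oplus> j) * t) \<ominus> a * ((i \<oplus> j) * k) =
   ((r * k \<oplus> i * t) \<ominus> a * (i * k)) \<oplus> ((s * k \<oplus> j * t) \<ominus> a * (j * k))"
   using x(2,3) y(2,3) z(2,3) a b by algebra
 qed
qed

text \<open>The order $R \<times> I$ enters only through an injective homomorphism $h$ onto it, so that the quotient of the Rees
algebra, whose elements are cosets, is an instance without change of carrier.\<close>

locale quadratic_order = R: cring R + S: cring S for R (structure) and S :: "'c ring" +
 fixes I :: "'a set" and a b :: 'a and h :: "'c => 'a \<times> 'a"
 assumes I: "ideal I R" and a: "a \<in> |R|" and b: "b \<in> |R|"
  and h_hom: "h \<in> ring_hom S (quadratic R a b)" and h_inj: "inj_on h |S|"
  and h_image: "h ` |S| = |R| \<times> I"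
begin

sublocale I: ideal I R by (rule I)

definition el where "el r i = inv_into |S| h (r, i)"

lemma el:
 assumes "r \<in> |R|" "i \<in> I"
 shows "el r i \<in> |S|" "h (el r i) = (r, i)"
proof -
 have "(r, i) \<in> h ` |S|" using h_image assms by auto
 then show "el r i \<in> |S|" "h (el r i) = (r, i)"
  unfolding el_def by (auto intro: inv_into_into f_inv_into_f)
qed

lemma I_carr: "i \<in> I ==> i \<in> |R|" by (rule I.Icarr)

lemma S_cases:
 assumes "s \<in> |S|" obtains r i where "r \<in> |R|" "i \<in> I" "s = el r i"
proof -
 have "h s \<in> |R| \<times> I" using h_image assms by blast
 then have ri: "fst (h s) \<in> |R|" "snd (h s) \<in> I" by (auto simp: mem_Times_iff)
 have "h (el (fst (h s)) (snd (h s))) = h s" using el(2)[OF ri] by simp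
 then have "s = el (fst (h s)) (snd (h s))"
  using inj_onD[OF h_inj] el(1)[OF ri] assms by metis
 then show ?thesis using that ri by blast
qed

lemma el_eqI: "s \<in> |S| ==> r \<in> |R| ==> i \<in> I ==> h s = (r, i) ==> s = el r i"
 using inj_onD[OF h_inj, of s "el r i"] el[of r i] by simp

lemma el_eq_iff:
 assumes "r \<in> |R|" "i \<in> I" "s \<in> |R|" "j \<in> I"
 shows "el r i = el s j \<longleftrightarrow> r = s \<and> i = j"
proof
 assume "el r i = el s j"
 then have "h (el r i) = h (el s j)" by simp
 then show "r = s \<and> i = j" unfolding el(2)[OF assms(1,2)] el(2)[OF assms(3,4)] by simp
qed simp

lemma I_minus: "i \<in> I ==> j \<in> I ==> i \<ominus> j \<in> I"
 unfolding R.minus_eq by (rule I.a_closed[OF _ I.a_inv_closed])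

lemma el_add:
 assumes "r \<in> |R|" "i \<in> I" "s \<in> |R|" "j \<in> I"
 shows "el r i \<oplus>\<^bsub>S\<^esub> el s j = el (r \<oplus> s) (i \<oplus> j)"
 by (rule el_eqI) (use assms el[OF assms(1,2)] el[OF assms(3,4)] in
  \<open>simp_all add: ring_hom_add[OF h_hom] quadratic_sel\<close>)

lemma el_mult:
 assumes "r \<in> |R|" "i \<in> I" "s \<in> |R|" "j \<in> I"
 shows "el r i *\<^bsub>S\<^esub> el s j = el (r * s \<ominus> b * (i * j)) ((r * j \<oplus> i * s) \<ominus> a * (i * j))"
proof (rule el_eqI)
 have "r * j \<in> I" "i * s \<in> I" "a * (i * j) \<in> I"
  using assms a I_carr I.I_l_closed I.I_r_closed by auto
 then show "(r * j \<oplus> i * s) \<ominus> a * (i * j) \<in> I" by (intro I_minus I.a_closed)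
qed (use assms el[OF assms(1,2)] el[OF assms(3,4)] a b I_carr in
  \<open>simp_all add: ring_hom_mult[OF h_hom] quadratic_sel\<close>)

lemma zero_I: "\<zero> \<in> I" by (rule additive_subgroup.zero_closed[OF I.additive_subgroup_axioms])

lemma el_one: "\<one>\<^bsub>S\<^esub> = el \<one> \<zero>"
 by (rule el_eqI) (use zero_I ring_hom_one[OF h_hom] in \<open>auto simp: quadratic_sel\<close>)

lemma el_zero: "\<zero>\<^bsub>S\<^esub> = el \<zero> \<zero>"
proof -
 have "el \<zero> \<zero> \<oplus>\<^bsub>S\<^esub> el \<zero> \<zero> = el \<zero> \<zero>" using zero_I by (simp add: el_add)
 then show ?thesis using el[OF R.zero_closed zero_I] S.l_zero S.add.r_cancel_one by metis
qed

lemma el_minus: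
 assumes "r \<in> |R|" "i \<in> I" shows "\<ominus>\<^bsub>S\<^esub> el r i = el (\<ominus> r) (\<ominus> i)"
 by (rule sym, rule S.sum_zero_eq_neg)
  (use assms el I.a_inv_closed I_carr in \<open>auto simp: el_add el_zero R.l_neg\<close>)

abbreviation sc where "sc r \<equiv> el r \<zero>"

lemma sc_hom: "sc \<in> ring_hom R S"
 by (rule ring_hom_memI) (use el zero_I a b in \<open>auto simp: el_mult el_add el_one R.minus_eq\<close>)

lemma sc_closed: "r \<in> |R| ==> sc r \<in> |S|" using el zero_I by blast

lemma sc_mult_el:
 assumes "r \<in> |R|" "s \<in> |R|" "i \<in> I" shows "sc r *\<^bsub>S\<^esub> el s i = el (r * s) (r * i)"
 using assms zero_I a b I_carr by (simp add: el_mult R.minus_eq)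

lemma sc_regular:
 assumes "r \<in> Reg R" shows "sc r \<in> Reg S"
 unfolding regular_elements_def
proof safe
 note r = R.regularD[OF assms]
 show "sc r \<in> |S|" using r sc_closed by blast
 fix s assume s: "s \<in> |S|" "sc r *\<^bsub>S\<^esub> s = \<zero>\<^bsub>S\<^esub>"
 obtain t i where t: "t \<in> |R|" "i \<in> I" "s = el t i" by (rule S_cases[OF s(1)])
 have "r * t = \<zero> \<and> r * i = \<zero>" using s(2) t r(1) zero_I I.I_l_closed
  by (simp add: sc_mult_el el_zero el_eq_iff)
 then have "t = \<zero>" "i = \<zero>" using r(2) t I_carr by blast+
 then show "s = \<zero>\<^bsub>S\<^esub>" using t(3) el_zero by simp
qed

subsection \<open>Conjugation\<close>

text \<open>Conjugate, trace and norm: for $s = r + i t$ the conjugate is $r - a i - i t$, which lies in the order again.\<close>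

definition conj where "conj s = (case h s of (r, i) => el (r \<ominus> a * i) (\<ominus> i))"
definition tr where "tr s = (case h s of (r, i) => r \<oplus> (r \<ominus> a * i))"
definition nm where "nm s = (case h s of (r, i) => r * (r \<ominus> a * i) \<oplus> b * (i * i))"

lemma conj_tr_nm:
 assumes s: "s \<in> |S|"
 shows "conj s \<in> |S|" "tr s \<in> |R|" "nm s \<in> |R|"
  "s \<oplus>\<^bsub>S\<^esub> conj s = sc (tr s)" "s *\<^bsub>S\<^esub> conj s = sc (nm s)"
proof -
 obtain r i where t: "r \<in> |R|" "i \<in> I" "s = el r i" by (rule S_cases[OF s(1)])
 have ic: "i \<in> |R|" "\<ominus> i \<in> I" using t I_carr I.a_inv_closed by auto
 note h = el(2)[OF t(1,2)]
 show "conj s \<in> |S|" "tr s \<in> |R|" "nm s \<in> |R|"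
  unfolding conj_def tr_def nm_def t(3) h using t ic a b el by auto
 show "s \<oplus>\<^bsub>S\<^esub> conj s = sc (tr s)"
  unfolding conj_def tr_def t(3) h using t ic a by (simp add: el_add R.r_neg)
 have "r * (r \<ominus> a * i) \<ominus> b * (i * \<ominus> i) = r * (r \<ominus> a * i) \<oplus> b * (i * i)"
  using t ic(1) a b by algebra
 moreover have "(r * \<ominus> i \<oplus> i * (r \<ominus> a * i)) \<ominus> a * (i * \<ominus> i) = \<zero>"
  using t ic(1) a b by algebra
 ultimately show "s *\<^bsub>S\<^esub> conj s = sc (nm s)"
  unfolding conj_def nm_def t(3) using t ic a by (simp only: el_mult h prod.case R.minus_closed R.m_closed)
qed

text \<open>If \<open>nm s * q = 0\<close>, regularity of $s$ gives \<open>conj s * q = 0\<close>, so $q$ kills both coordinates of \<open>conj s\<close> and therefore \<open>s\<close>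
itself.\<close>

lemma nm_regular:
 assumes s: "s \<in> Reg S" shows "nm s \<in> Reg R"
 unfolding regular_elements_def
proof safe
 note sr = S.regularD[OF s]
 note c = conj_tr_nm[OF sr(1)]
 obtain r i where t: "r \<in> |R|" "i \<in> I" "s = el r i" by (rule S_cases[OF sr(1)])
 have ic: "i \<in> |R|" "\<ominus> i \<in> I" using t I_carr I.a_inv_closed by auto
 show "nm s \<in> |R|" by (rule c)
 fix q assume q: "q \<in> |R|" "nm s * q = \<zero>"
 have "s *\<^bsub>S\<^esub> (conj s *\<^bsub>S\<^esub> sc q) = sc (nm s * q)"
  using sr(1) c(1) sc_closed[OF q(1)] ring_hom_mult[OF sc_hom c(3) q(1)]
  by (simp add: S.m_assoc[symmetric] c(5))
 then have "conj s *\<^bsub>S\<^esub> sc q = \<zero>\<^bsub>S\<^esub>" using sr c q sc_closed el_zero by simp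
 then have "sc q *\<^bsub>S\<^esub> el (r \<ominus> a * i) (\<ominus> i) = el \<zero> \<zero>"
  using c(1) sc_closed[OF q(1)] el(2)[OF t(1,2)] el_zero t(3) unfolding conj_def by (simp add: S.m_comm)
 moreover have "sc q *\<^bsub>S\<^esub> el (r \<ominus> a * i) (\<ominus> i) = el (q * (r \<ominus> a * i)) (q * \<ominus> i)"
  by (rule sc_mult_el) (use q t ic a in auto)
 ultimately have e: "q * (r \<ominus> a * i) = \<zero>" "q * \<ominus> i = \<zero>"
  using el_eq_iff[of "q * (r \<ominus> a * i)" "q * \<ominus> i" \<zero> \<zero>] q t ic a zero_I I.I_l_closed by auto
 have qi: "q * i = \<zero>"
 proof -
  have "q * i = \<ominus> (q * \<ominus> i)" using q t ic by algebra
  then show ?thesis using e by simp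
 qed
 have "q * r = q * (r \<ominus> a * i) \<oplus> a * (q * i)" using q(1) t(1) ic(1) a by algebra
 then have "q * r = \<zero>" using e qi a by simp
 then have "s *\<^bsub>S\<^esub> sc q = \<zero>\<^bsub>S\<^esub>"
  using qi sc_mult_el[OF q(1) t(1,2)] el_zero t(3) sr(1) sc_closed[OF q(1)] by (simp add: S.m_comm)
 then have "sc q = \<zero>\<^bsub>S\<^esub>" using sr(2) sc_closed q by blast
 then show "q = \<zero>" using el_zero el_eq_iff q zero_I by simp
qed

subsection \<open>Noetherian, local, one-dimensional\<close>

lemma contract_ideal:
 assumes J: "ideal J S" shows "ideal {r \<in> carrier R. sc r \<in> J} R"
proof -
 interpret H: ring_hom_ring R S sc
  by (rule ring_hom_ringI2) (use R.ring_axioms S.ring_axioms sc_hom in auto)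
 show ?thesis by (rule H.ideal_vimage[OF J])
qed

lemma coordinate_ideal:
 assumes J: "ideal J S" shows "ideal {r \<in> carrier R. \<exists>s\<in>J. snd (h s) = r} R" (is "ideal ?K R")
proof -
 interpret J: ideal J S by (rule J)
 have sub: "s \<in> |S|" if "s \<in> J" for s using that J.Icarr by blast
 have "submod R |R| ?K" unfolding submod_def
 proof (intro conjI ballI)
  show "?K \<subseteq> |R|" by blast
  have "snd (h (sc \<zero>)) = \<zero>" using el(2)[OF R.zero_closed zero_I] by simp
  moreover have "sc \<zero> \<in> J" unfolding el_zero[symmetric] by (rule additive_subgroup.zero_closed[OF J.additive_subgroup_axioms])
  ultimately show "\<zero> \<in> ?K" by blast
  fix x y assume x: "x \<in> ?K" and y: "y \<in> ?K"
  obtain s t where s: "s \<in> J" "snd (h s) = x" and t: "t \<in> J" "snd (h t) = y" using x y by blast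
  have "snd (h (s \<oplus>\<^bsub>S\<^esub> t)) = x \<oplus> y"
   using ring_hom_add[OF h_hom sub[OF s(1)] sub[OF t(1)]] s t
   by (cases "h s"; cases "h t") (simp add: quadratic_sel)
  moreover have "s \<oplus>\<^bsub>S\<^esub> t \<in> J" by (rule J.a_closed[OF s(1) t(1)])
  ultimately show "x \<oplus> y \<in> ?K" using x y by blast
 next
  fix c x assume c: "c \<in> |R|" and x: "x \<in> ?K"
  obtain s where s: "s \<in> J" "snd (h s) = x" using x by blast
  obtain r i where ri: "r \<in> |R|" "i \<in> I" "s = el r i" by (rule S_cases[OF sub[OF s(1)]])
  have "sc c *\<^bsub>S\<^esub> s \<in> J" by (rule J.I_l_closed[OF s(1) sc_closed[OF c]])
  moreover have "snd (h (sc c *\<^bsub>S\<^esub> s)) = c * x"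
   unfolding ri(3) sc_mult_el[OF c ri(1,2)]
   using el(2)[of "c * r" "c * i"] el(2)[OF ri(1,2)] ri s(2) c I.I_l_closed by simp
  ultimately show "c * x \<in> ?K" using c x by blast
 qed
 then show ?thesis using R.ideal_iff_submod by blast
qed

lemma ideal_eqI:
 assumes J: "ideal J S" and K: "ideal K S" and JK: "J \<subseteq> K"
  and s: "{r \<in> carrier R. sc r \<in> K} \<subseteq> {r \<in> carrier R. sc r \<in> J}"
  and c: "{r \<in> carrier R. \<exists>s\<in>K. snd (h s) = r} \<subseteq> {r \<in> carrier R. \<exists>s\<in>J. snd (h s) = r}"
 shows "K \<subseteq> J"
proof
 interpret J: ideal J S by (rule J)
 interpret K: ideal K S by (rule K)
 fix x assume x: "x \<in> K"
 obtain r i where ri: "r \<in> |R|" "i \<in> I" "x = el r i" by (rule S_cases[OF K.Icarr[OF x]])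
 have "i \<in> {r \<in> carrier R. \<exists>s\<in>K. snd (h s) = r}"
  using x ri I_carr el(2)[OF ri(1,2)] by (auto intro!: bexI[of _ x])
 then obtain y where y: "y \<in> J" "snd (h y) = i" using c by blast
 obtain q j where qj: "q \<in> |R|" "j \<in> I" "y = el q j" by (rule S_cases[OF J.Icarr[OF y(1)]])
 have j: "j = i" using y(2) el(2)[OF qj(1,2)] qj(3) by simp
 have xy: "x \<ominus>\<^bsub>S\<^esub> y = sc (r \<ominus> q)"
  unfolding S.minus_eq ri(3) qj(3) j using ri qj I_carr I.a_inv_closed
  by (simp add: el_minus el_add R.r_neg R.minus_eq)
 have "x \<ominus>\<^bsub>S\<^esub> y \<in> K" unfolding S.minus_eq by (rule K.a_closed[OF x K.a_inv_closed]) (use y JK in blast)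
 then have "sc (r \<ominus> q) \<in> J" using s ri(1) qj(1) xy by auto
 then have "sc (r \<ominus> q) \<oplus>\<^bsub>S\<^esub> y \<in> J" using y(1) by (rule J.a_closed)
 moreover have "sc (r \<ominus> q) \<oplus>\<^bsub>S\<^esub> y = x"
  unfolding xy[symmetric] using K.Icarr[OF x] J.Icarr[OF y(1)] S.minus_eq S.a_assoc S.l_neg by simp
 ultimately show "x \<in> J" by simp
qed

text \<open>An ideal is determined, among the ideals comparable to it, by its intersection with $R$ and its ideal of second
coordinates; both are ideals of the Noetherian ring $R$.\<close>

lemma noetherian:
 assumes N: "noetherian_ring R" shows "noetherian_ring S"
proof (rule S.trivial_ideal_chain_imp_noetherian)
 fix C assume C: "C \<noteq> {}" "subset.chain {J. ideal J S} C"
 have id: "ideal J S" if "J \<in> C" for J using C(2) that unfolding pred_on.chain_def by blast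
 have comp: "J \<subseteq> K \<or> K \<subseteq> J" if "J \<in> C" "K \<in> C" for J K using C(2) that unfolding pred_on.chain_def by blast
 define p where "p J = {r \<in> carrier R. sc r \<in> J}" for J
 define q where "q J = {r \<in> carrier R. \<exists>s\<in>J. snd (h s) = r}" for J
 have mono: "p J \<subseteq> p K" "q J \<subseteq> q K" if "J \<subseteq> K" for J K using that unfolding p_def q_def by blast+
 have "\<Union>(p ` C) \<in> p ` C"
 proof (rule noetherian_ring.ideal_chain_is_trivial[OF N])
  show "subset.chain {J. ideal J R} (p ` C)" unfolding pred_on.chain_def
   using contract_ideal id mono(1) comp unfolding p_def by (safe; blast)
 qed (use C in blast)
 then obtain J1 where J1: "J1 \<in> C" "\<Union>(p ` C) = p J1" by blast
 have "\<Union>(q ` C) \<in> q ` C"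
 proof (rule noetherian_ring.ideal_chain_is_trivial[OF N])
  have "ideal (q J) R" if "J \<in> C" for J unfolding q_def by (rule coordinate_ideal[OF id[OF that]])
  moreover have "q J \<subseteq> q K \<or> q K \<subseteq> q J" if "J \<in> C" "K \<in> C" for J K using mono(2) comp[OF that] by meson
  ultimately show "subset.chain {J. ideal J R} (q ` C)" unfolding pred_on.chain_def by (safe; blast)
 qed (use C in blast)
 then obtain J2 where J2: "J2 \<in> C" "\<Union>(q ` C) = q J2" by blast
 obtain M where M: "M \<in> C" "J1 \<subseteq> M" "J2 \<subseteq> M" using comp[OF J1(1) J2(1)] J1(1) J2(1) by blast
 have "K \<subseteq> M" if K: "K \<in> C" for K
 proof (cases "K \<subseteq> M")
  case False
  then have MK: "M \<subseteq> K" using comp[OF K M(1)] by blast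
  have "p K \<subseteq> p M" "q K \<subseteq> q M" using J1(2) J2(2) K mono(1)[OF M(2)] mono(2)[OF M(3)] by blast+
  then show ?thesis unfolding p_def q_def by (rule ideal_eqI[OF id[OF M(1)] id[OF K] MK])
 qed
 then have "\<Union>C = M" using M(1) by blast
 then show "\<Union>C \<in> C" using M(1) by simp
qed

text \<open>An element $u$ of \<open>P'\<close> outside $P$ has its norm in $P$, hence its conjugate in $P$, hence its trace in $P$, hence itself
in $P$.\<close>

lemma incomparable:
 assumes P: "primeideal P S" and P': "primeideal P' S" and sub: "P \<subset> P'"
  and eq: "{r \<in> carrier R. sc r \<in> P'} \<subseteq> {r \<in> carrier R. sc r \<in> P}"
 shows False
proof -
 interpret P: primeideal P S by (rule P)
 interpret P': primeideal P' S by (rule P')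
 obtain u where u: "u \<in> P'" "u \<notin> P" using sub by blast
 note uc = P'.Icarr[OF u(1)]
 note c = conj_tr_nm[OF uc]
 have "sc (nm u) \<in> P'" unfolding c(5)[symmetric] by (rule P'.I_r_closed[OF u(1) c(1)])
 then have "sc (nm u) \<in> P" using eq c(3) by blast
 then have cP: "conj u \<in> P" using P.I_prime[OF uc c(1)] u(2) c(5) by simp
 then have "sc (tr u) \<in> P'" unfolding c(4)[symmetric] using u(1) sub by (intro P'.a_closed) auto
 then have "u \<oplus>\<^bsub>S\<^esub> conj u \<in> P" using eq c(2,4) by auto
 then have "(u \<oplus>\<^bsub>S\<^esub> conj u) \<oplus>\<^bsub>S\<^esub> (\<ominus>\<^bsub>S\<^esub> conj u) \<in> P" using P.a_inv_closed[OF cP] by (rule P.a_closed)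
 moreover have "(u \<oplus>\<^bsub>S\<^esub> conj u) \<oplus>\<^bsub>S\<^esub> (\<ominus>\<^bsub>S\<^esub> conj u) = u"
  using uc c(1) by (simp add: S.a_assoc S.r_neg)
 ultimately show False using u(2) by simp
qed

end

locale quadratic_order_CM = quadratic_order +
 fixes m
 assumes CM: "cohen_macaulay_local R m" and dim: "krull_dim R = 1"
  and I_proper: "I \<subseteq> m" and I_regular: "\<exists>x\<in>I. x \<in> Reg R"
begin

lemma CM_parts: "noetherian_ring R" "local_ring R m" "depth R m = 1"
 using CM dim by (auto simp: cohen_macaulay_local_def)

sublocale m: ideal m R by (rule R.local_ideal(1)[OF CM_parts(2)])

definition max_ideal where "max_ideal = {s \<in> carrier S. fst (h s) \<in> m}"

lemma el_max: "r \<in> |R| ==> i \<in> I ==> el r i \<in> max_ideal \<longleftrightarrow> r \<in> m"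
 unfolding max_ideal_def using el by simp

lemma max_ideal_ideal: "ideal max_ideal S"
proof -
 have "submod S |S| max_ideal" unfolding submod_def
 proof (intro conjI ballI)
  show "max_ideal \<subseteq> |S|" unfolding max_ideal_def by blast
  show "\<zero>\<^bsub>S\<^esub> \<in> max_ideal" unfolding el_zero using zero_I el_max
   additive_subgroup.zero_closed[OF m.additive_subgroup_axioms] by simp
  fix x y assume x: "x \<in> max_ideal" and y: "y \<in> max_ideal"
  have xc: "x \<in> |S|" "y \<in> |S|" using x y by (auto simp: max_ideal_def)
  obtain r i where ri: "r \<in> |R|" "i \<in> I" "x = el r i" by (rule S_cases[OF xc(1)])
  obtain s j where sj: "s \<in> |R|" "j \<in> I" "y = el s j" by (rule S_cases[OF xc(2)])
  show "x \<oplus>\<^bsub>S\<^esub> y \<in> max_ideal" using x y unfolding ri(3) sj(3)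
   using ri sj by (simp add: el_add el_max)
 next
  fix x y assume xc: "x \<in> |S|" and y: "y \<in> max_ideal"
  have yc: "y \<in> |S|" using y by (auto simp: max_ideal_def)
  obtain r i where ri: "r \<in> |R|" "i \<in> I" "x = el r i" by (rule S_cases[OF xc(1)])
  obtain s j where sj: "s \<in> |R|" "j \<in> I" "y = el s j" by (rule S_cases[OF yc])
  have sm: "s \<in> m" using y sj el_max by simp
  have "r * s \<in> m" by (rule m.I_l_closed[OF sm ri(1)])
  moreover have "b * (i * j) \<in> m"
   by (rule m.I_l_closed[OF m.I_l_closed[OF subsetD[OF I_proper sj(2)] I_carr[OF ri(2)]] b])
  ultimately have "r * s \<ominus> b * (i * j) \<in> m" unfolding R.minus_eq using m.a_closed m.a_inv_closed by simp
  moreover have "(r * j \<oplus> i * s) \<ominus> a * (i * j) \<in> I"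
   by (intro I_minus I.a_closed) (use ri sj a I_carr I.I_l_closed I.I_r_closed in auto)
  moreover have "r * s \<ominus> b * (i * j) \<in> |R|" using ri sj b I_carr by simp
  ultimately show "x *\<^bsub>S\<^esub> y \<in> max_ideal" unfolding ri(3) sj(3) using ri sj by (simp add: el_mult el_max)
 qed
 then show ?thesis using S.ideal_iff_submod by blast
qed

text \<open>The norm of $s = r + i t$ is congruent to \<open>r\<^sup>2\<close> modulo $I$, which is contained in $m$.\<close>

lemma unit_if_not_max:
 assumes s: "s \<in> |S|" "s \<notin> max_ideal" shows "\<exists>t\<in>carrier S. s *\<^bsub>S\<^esub> t = \<one>\<^bsub>S\<^esub>"
proof -
 obtain r i where ri: "r \<in> |R|" "i \<in> I" "s = el r i" by (rule S_cases[OF s(1)])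
 have rm: "r \<notin> m" using s ri el_max by simp
 have ic: "i \<in> |R|" "i \<in> m" using ri I_carr I_proper by auto
 note c = conj_tr_nm[OF s(1)]
 have "nm s \<notin> m"
 proof
  assume n: "nm s \<in> m"
  have "r * r = nm s \<oplus> (a * r \<ominus> b * i) * i"
  proof -
   have "r * r = (r * (r \<ominus> a * i) \<oplus> b * (i * i)) \<oplus> (a * r \<ominus> b * i) * i"
    using ri(1) ic(1) a b by algebra
   then show ?thesis unfolding nm_def ri(3) el(2)[OF ri(1,2)] by simp
  qed
  also have "\<dots> \<in> m" by (rule m.a_closed[OF n m.I_l_closed[OF ic(2)]]) (use ri ic a b in auto)
  finally show False using primeideal.I_prime[OF R.local_ideal(4)[OF CM_parts(2)] ri(1) ri(1)] rm by blast
 qed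
 then obtain e where e: "e \<in> |R|" "nm s * e = \<one>" using R.local_unit[OF CM_parts(1,2) c(3)] by blast
 have "s *\<^bsub>S\<^esub> (conj s *\<^bsub>S\<^esub> sc e) = \<one>\<^bsub>S\<^esub>"
  using s(1) c(1) e sc_closed ring_hom_mult[OF sc_hom c(3) e(1)] by (simp add: S.m_assoc[symmetric] c(5) el_one)
 then show ?thesis using c(1) sc_closed[OF e(1)] by blast
qed

lemma one_notin_max: "\<one>\<^bsub>S\<^esub> \<notin> max_ideal"
 unfolding el_one using el_max zero_I R.local_ideal(2)[OF CM_parts(2)] by simp

lemma proper_ideal_max:
 assumes J: "ideal J S" "J \<noteq> |S|" shows "J \<subseteq> max_ideal"
proof
 interpret J: ideal J S by (rule J(1))
 fix s assume s: "s \<in> J"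
 show "s \<in> max_ideal"
 proof (rule ccontr)
  assume "s \<notin> max_ideal"
  then obtain t where t: "t \<in> |S|" "s *\<^bsub>S\<^esub> t = \<one>\<^bsub>S\<^esub>" using unit_if_not_max J.Icarr[OF s] by blast
  have "\<one>\<^bsub>S\<^esub> \<in> J" using J.I_r_closed[OF s t(1)] t(2) by simp
  then show False using J.one_imp_carrier J(2) by blast
 qed
qed

lemma max_proper: "max_ideal \<noteq> |S|" using one_notin_max by blast

lemma local_S: "local_ring S max_ideal"
 unfolding local_ring_def
proof (intro conjI allI impI)
 show "cring S" by (rule S.is_cring)
 show "maximalideal max_ideal S"
 proof (rule maximalidealI[OF max_ideal_ideal])
  show "|S| \<noteq> max_ideal" using max_proper by blast
  fix J assume J: "ideal J S" "max_ideal \<subseteq> J" "J \<subseteq> |S|"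
  show "J = max_ideal \<or> J = |S|" using proper_ideal_max[OF J(1)] J by blast
 qed
 fix n assume n: "maximalideal n S"
 interpret n: maximalideal n S by (rule n)
 have "n \<subseteq> max_ideal" by (rule proper_ideal_max[OF n.is_ideal]) (use n.I_notcarr in blast)
 moreover have "max_ideal \<subseteq> |S|" unfolding max_ideal_def by blast
 ultimately show "n = max_ideal" using n.I_maximal[OF max_ideal_ideal] max_proper by blast
qed

lemma ex_regular_m: "\<exists>x\<in>m. x \<in> Reg R" using I_regular I_proper by blast

text \<open>Chains of primes contract to strict chains in $R$ by incomparability. A prime below the maximal ideal is one that avoids
the powers of a regular element of $m$.\<close>

lemma krull_dim_S: "krull_dim S = 1"
proof -
 let ?X = "{enat n | n. \<exists>P :: nat => 'c set. (\<forall>i\<le>n. primeideal (P i) S) \<and> (\<forall>i<n. P i \<subset> P (Suc i))}"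
 interpret H: ring_hom_ring R S sc
  by (rule ring_hom_ringI2) (use R.ring_axioms S.ring_axioms sc_hom in auto)
 have le: "n \<le> 1" if P: "!!i. i \<le> n ==> primeideal (P i) S" "!!i. i < n ==> P i \<subset> P (Suc i)" for n :: nat and P
 proof (rule ccontr)
  assume "\<not> n \<le> 1"
  then have p: "primeideal (P 0) S" "primeideal (P 1) S" "primeideal (P 2) S" "P 0 \<subset> P 1" "P 1 \<subset> P 2"
   using P(1)[of 0] P(1)[of 1] P(1)[of 2] P(2)[of 0] P(2)[of 1] by (auto simp: numeral_2_eq_2)
  define c where "c J = {r \<in> carrier R. sc r \<in> J}" for J
  have pc: "primeideal (c (P i)) R" if "primeideal (P i) S" for i
   unfolding c_def by (rule H.primeideal_vimage[OF R.is_cring that])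
  have "c (P 0) \<subset> c (P 1)" using incomparable[OF p(1,2,4)] p(4) unfolding c_def by blast
  moreover have "c (P 1) \<subset> c (P 2)" using incomparable[OF p(2,3,5)] p(5) unfolding c_def by blast
  ultimately show False using R.krull_dim_one_no_chain[OF dim pc[OF p(1)] pc[OF p(2)] pc[OF p(3)]] by blast
 qed
 obtain x where x: "x \<in> m" "x \<in> Reg R" using ex_regular_m by blast
 have xc: "x \<in> |R|" using x m.Icarr by blast
 let ?T = "{sc (x [^] (k::nat)) | k. True}"
 have "\<exists>P. primeideal P S \<and> {\<zero>\<^bsub>S\<^esub>} \<subseteq> P \<and> P \<inter> ?T = {}"
 proof (rule S.prime_avoiding[OF noetherian[OF CM_parts(1)] S.zeroideal])
  show "?T \<subseteq> |S|" using sc_closed xc by auto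
  show "\<one>\<^bsub>S\<^esub> \<in> ?T" using el_one by (auto intro!: exI[of _ 0])
  show "s *\<^bsub>S\<^esub> t \<in> ?T" if st: "s \<in> ?T" "t \<in> ?T" for s t
  proof -
   obtain k l :: nat where kl: "s = sc (x [^] k)" "t = sc (x [^] l)" using st by blast
   have "s *\<^bsub>S\<^esub> t = sc (x [^] (k + l))"
    unfolding kl using ring_hom_mult[OF sc_hom, of "x [^] k" "x [^] l"] xc by (simp add: R.nat_pow_mult)
   then show ?thesis by blast
  qed
  have ne: "sc (x [^] k) \<noteq> \<zero>\<^bsub>S\<^esub>" for k :: nat
  proof
   assume "sc (x [^] k) = \<zero>\<^bsub>S\<^esub>"
   then have "sc (x [^] k) = sc \<zero>" unfolding el_zero .
   then have "x [^] k = \<zero>" using el_eq_iff[of "x [^] k" \<zero> \<zero> \<zero>] zero_I xc by simp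
   then have "x [^] k * \<one> = \<zero>" by simp
   then have "\<one> = \<zero>" by (rule R.regularD(2)[OF R.regular_pow[OF x(2)] R.one_closed])
   then show False using R.local_ideal(2)[OF CM_parts(2)]
     additive_subgroup.zero_closed[OF m.additive_subgroup_axioms] by simp
  qed
  show "{\<zero>\<^bsub>S\<^esub>} \<inter> ?T = {}"
  proof (rule equals0I)
   fix y assume "y \<in> {\<zero>\<^bsub>S\<^esub>} \<inter> ?T"
   then obtain k :: nat where "y = \<zero>\<^bsub>S\<^esub>" "y = sc (x [^] k)" by blast
   then show False using ne[of k] by simp
  qed
 qed
 then obtain P where P: "primeideal P S" "P \<inter> ?T = {}" by blast
 interpret P: primeideal P S by (rule P(1))
 have "P \<subseteq> max_ideal" by (rule proper_ideal_max[OF P.is_ideal]) (use P.I_notcarr in blast)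
 moreover have "sc x \<in> max_ideal" using el_max[OF xc zero_I] x(1) by simp
 moreover have "sc x \<notin> P"
 proof -
  have "sc (x [^] (1::nat)) \<in> ?T" by blast
  then show ?thesis using P(2) xc by auto
 qed
 ultimately have sub: "P \<subset> max_ideal" by blast
 have "enat 1 \<in> ?X"
 proof (intro CollectI exI[of _ 1] conjI exI[of _ "%i::nat. if i = 0 then P else max_ideal"] refl allI impI)
  fix i :: nat
  show "primeideal (if i = 0 then P else max_ideal) S" if "i \<le> 1"
   using P(1) S.local_ideal(4)[OF local_S] by simp
  show "(if i = 0 then P else max_ideal) \<subset> (if Suc i = 0 then P else max_ideal)" if "i < 1"
   using sub that by simp
 qed
 moreover have "e \<le> enat 1" if e: "e \<in> ?X" for e
 proof -
  obtain n P where "e = enat n" "\<forall>i\<le>n. primeideal (P i) S" "\<forall>i<n. P i \<subset> P (Suc i)" using e by blast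
  then show ?thesis using le[of n P] by simp
 qed
 ultimately have "Sup ?X = enat 1" by (intro antisym[OF Sup_least Sup_upper]) auto
 then show ?thesis unfolding krull_dim_def by (simp add: one_enat_def)
qed

text \<open>In a regular sequence $x, y$ a power of $y$ would be a multiple of $x$; cancelling $y$ modulo $x$ repeatedly would make \<open>x\<close>
a unit.\<close>

lemma depth_S: "depth S max_ideal = 1"
proof -
 let ?X = "{enat (length xs) | xs. regular_sequence S xs \<and> set xs \<subseteq> max_ideal}"
 have zero: "Idl\<^bsub>S\<^esub> {} = {\<zero>\<^bsub>S\<^esub>}"
  using S.genideal_minimal[OF S.zeroideal, of "{}"] S.genideal_ideal[of "{}"]
   additive_subgroup.zero_closed[OF ideal.axioms(1)] by blast
 have le: "length xs \<le> 1" if xs: "regular_sequence S xs" "set xs \<subseteq> max_ideal" for xs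
 proof (rule ccontr)
  assume "\<not> length xs \<le> 1"
  then have l: "0 < length xs" "1 < length xs" by auto
  have x: "xs ! 0 \<in> max_ideal" "xs ! 1 \<in> max_ideal" using l xs(2) nth_mem by blast+
  have c: "xs ! 0 \<in> |S|" "xs ! 1 \<in> |S|" using x by (auto simp: max_ideal_def)
  have r0: "xs ! 0 \<in> Reg S"
   using xs(1) l(1) c(1) unfolding regular_sequence_def regular_elements_def by (auto dest!: spec[of _ 0] simp: zero)
  have t1: "set (take 1 xs) = {xs ! 0}" using l by (cases xs) auto
  have r1: "r \<in> Idl\<^bsub>S\<^esub> {xs ! 0}" if "r \<in> |S|" "xs ! 1 *\<^bsub>S\<^esub> r \<in> Idl\<^bsub>S\<^esub> {xs ! 0}" for r
   using xs(1) l(2) that unfolding regular_sequence_def by (metis t1)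
  obtain k :: nat and t where k: "t \<in> |S|" "xs ! 1 [^]\<^bsub>S\<^esub> k = xs ! 0 *\<^bsub>S\<^esub> t"
   using S.power_in_principal[OF noetherian[OF CM_parts(1)] local_S krull_dim_S x(2) r0] by blast
  note J = S.genideal_ideal[of "{xs ! 0}"]
  have J1: "ideal (Idl\<^bsub>S\<^esub> {xs ! 0}) S" "xs ! 0 \<in> Idl\<^bsub>S\<^esub> {xs ! 0}" using J S.genideal_self'[OF c(1)] c(1) by auto
  have "xs ! 1 [^]\<^bsub>S\<^esub> k \<in> Idl\<^bsub>S\<^esub> {xs ! 0}" unfolding k(2) by (rule ideal.I_r_closed[OF J1 k(1)])
  then have "\<one>\<^bsub>S\<^esub> \<in> Idl\<^bsub>S\<^esub> {xs ! 0}"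
  proof (induction k)
   case (Suc k)
   have "xs ! 1 *\<^bsub>S\<^esub> xs ! 1 [^]\<^bsub>S\<^esub> k \<in> Idl\<^bsub>S\<^esub> {xs ! 0}"
    using Suc.prems c(2) by (simp add: S.m_comm)
   then show ?case by (rule Suc.IH[OF r1[OF S.nat_pow_closed[OF c(2)]]])
  qed simp
  moreover have "Idl\<^bsub>S\<^esub> {xs ! 0} \<subseteq> max_ideal" by (rule S.genideal_minimal[OF max_ideal_ideal]) (use x in simp)
  ultimately show False using one_notin_max by blast
 qed
 obtain x where x: "x \<in> m" "x \<in> Reg R" using ex_regular_m by blast
 have sx: "sc x \<in> max_ideal" "sc x \<in> Reg S"
  using x m.Icarr el_max zero_I sc_regular by auto
 have "regular_sequence S [sc x]" unfolding regular_sequence_def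
  using S.regularD[OF sx(2)] by (simp add: zero)
 then have "enat 1 \<in> ?X" using sx(1) by (intro CollectI exI[of _ "[sc x]"]) simp
 moreover have "e \<le> enat 1" if "e \<in> ?X" for e using that le by auto
 ultimately have "Sup ?X = enat 1" by (intro antisym[OF Sup_least Sup_upper]) auto
 then show ?thesis unfolding depth_def by (simp add: one_enat_def)
qed

lemma cohen_macaulay_S: "cohen_macaulay_local S max_ideal"
 unfolding cohen_macaulay_local_def using noetherian[OF CM_parts(1)] local_S depth_S krull_dim_S by simp

end

subsection \<open>The Rees algebra as a subring of the polynomial ring\<close>

context cring
begin

lemma finsum_ideal:
 assumes J: "ideal J R" and f: "!!i. i \<in> A ==> f i \<in> J"
 shows "finsum R f A \<in> J"
proof -
 interpret J: ideal J R by (rule J)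
 show ?thesis using f
 proof (induction A rule: infinite_finite_induct)
  case (insert x F)
  have "finsum R f (insert x F) = f x \<oplus> finsum R f F"
   by (rule finsum_insert) (use insert J.Icarr in auto)
  then show ?case using insert J.a_closed by simp
 qed (simp_all add: additive_subgroup.zero_closed[OF J.additive_subgroup_axioms])
qed

lemma ideal_power_ideal: "ideal I R ==> ideal (ideal_power R I n) R"
 by (induction n) (auto simp: oneideal ideal_prod_is_ideal)

lemma ideal_power_mult:
 assumes I: "ideal I R" and y: "y \<in> ideal_power R I j"
 shows "x \<in> ideal_power R I i ==> x * y \<in> ideal_power R I (i + j)"
proof (induction i arbitrary: x)
 case 0
 then show ?case using ideal.I_l_closed[OF ideal_power_ideal[OF I] y] by simp
next
 case (Suc i)
 have yc: "y \<in> |R|" using ideal.Icarr[OF ideal_power_ideal[OF I] y] .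
 have c: "z \<in> I \<cdot> ideal_power R I i ==> z \<in> |R|" for z
  using ideal_prod_in_carrier[OF I ideal_power_ideal[OF I]] by blast
 have "x \<in> I \<cdot> ideal_power R I i" using Suc.prems by simp
 then have "x * y \<in> I \<cdot> ideal_power R I (i + j)"
 proof (induction x rule: ideal_prod.induct)
  case (prod u v)
  have "u * (v * y) \<in> I \<cdot> ideal_power R I (i + j)"
   by (rule ideal_prod.prod[OF prod(1) Suc.IH[OF prod(2)]])
  moreover have "u \<in> |R|" "v \<in> |R|"
   using prod ideal.Icarr[OF I] ideal.Icarr[OF ideal_power_ideal[OF I]] by auto
  ultimately show ?case using yc by (simp add: m_assoc)
 next
  case (sum s t)
  have "(s \<oplus> t) * y = s * y \<oplus> t * y" using c[OF sum(1)] c[OF sum(2)] yc by (rule l_distr)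
  then show ?case using ideal_prod.sum[OF sum(3,4)] by simp
 qed
 then show ?case by simp
qed

lemma ideal_power_sub:
 assumes I: "ideal I R" and n: "0 < n" shows "ideal_power R I n \<subseteq> I"
proof -
 obtain k where k: "n = Suc k" using n gr0_conv_Suc by auto
 show ?thesis unfolding k using ideal_prod_inter[OF I ideal_power_ideal[OF I]] by auto
qed

lemma ideal_power_1:
 assumes I: "ideal I R" and x: "x \<in> I" shows "x \<in> ideal_power R I 1"
proof -
 have "x * \<one> \<in> I \<cdot> |R|" by (rule ideal_prod.prod[OF x one_closed])
 then show ?thesis using ideal.Icarr[OF I x] by simp
qed

lemma rees_subring:
 assumes I: "ideal I R"
 shows "subring ( |rees_algebra R I| ) (UP R)"
proof -
 interpret U: UP_cring R "UP R" by unfold_locales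
 note id = ideal_power_ideal[OF I]
 show ?thesis
 proof (rule U.P.subringI)
  show "|rees_algebra R I| \<subseteq> |UP R|" by (auto simp: rees_algebra_def)
  have "coeff (UP R) \<one>\<^bsub>UP R\<^esub> n \<in> ideal_power R I n" for n :: nat
   using additive_subgroup.zero_closed[OF ideal.axioms(1)[OF id]] by simp
  then show "\<one>\<^bsub>UP R\<^esub> \<in> |rees_algebra R I|" by (simp add: rees_algebra_def)
  fix p assume p: "p \<in> |rees_algebra R I|"
  then show "\<ominus>\<^bsub>UP R\<^esub> p \<in> |rees_algebra R I|"
   using additive_subgroup.a_inv_closed[OF ideal.axioms(1)[OF id]] by (simp add: rees_algebra_def)
  fix q assume q: "q \<in> |rees_algebra R I|"
  show "p \<oplus>\<^bsub>UP R\<^esub> q \<in> |rees_algebra R I|"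
   using p q additive_subgroup.a_closed[OF ideal.axioms(1)[OF id]] by (simp add: rees_algebra_def)
  have pq: "p \<in> |UP R|" "q \<in> |UP R|"
   "!!n. coeff (UP R) p n \<in> ideal_power R I n" "!!n. coeff (UP R) q n \<in> ideal_power R I n"
   using p q by (auto simp: rees_algebra_def)
  have "coeff (UP R) (p *\<^bsub>UP R\<^esub> q) n \<in> ideal_power R I n" for n :: nat
   unfolding U.coeff_mult[OF pq(1,2)]
  proof (rule finsum_ideal[OF id])
   fix i assume i: "i \<in> {..n}"
   have "coeff (UP R) p i * coeff (UP R) q (n - i) \<in> ideal_power R I (i + (n - i))"
    by (rule ideal_power_mult[OF I pq(4) pq(3)])
   then show "coeff (UP R) p i * coeff (UP R) q (n - i) \<in> ideal_power R I n" using i by simp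
  qed
  then show "p *\<^bsub>UP R\<^esub> q \<in> |rees_algebra R I|" using pq by (simp add: rees_algebra_def)
 qed
qed

text \<open>Evaluation of polynomials at $t = (0, 1)$. By division with remainder its kernel on \<open>R[t]\<close> is generated by
\<open>t\<^sup>2 + a t + b\<close>, so on the Rees algebra it is the contracted ideal. The image is \<open>R \<times> I\<close>, since all coefficients of
positive degree lie in $I$.\<close>

lemma rees_quotient_order:
 assumes I: "ideal I R" and a: "a \<in> |R|" and b: "b \<in> |R|" and nt: "\<one> \<noteq> \<zero>"
 shows "\<exists>h. quadratic_order R (rees_quotient R I a b) I a b h"
proof -
 let ?T = "quadratic R a b" and ?j = "%r. (r, \<zero>)" and ?t = "(\<zero>, \<one>)"
 let ?f = "rees_quadratic R a b" and ?A = "rees_algebra R I"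
 interpret T: cring ?T by (rule quadratic_cring[OF a b])
 interpret I: ideal I R by (rule I)
 note zI = additive_subgroup.zero_closed[OF I.additive_subgroup_axioms]
 have j: "?j \<in> ring_hom R ?T"
  by (rule ring_hom_memI) (use a b in \<open>auto simp: quadratic_sel minus_eq\<close>)
 interpret U: UP_cring R "UP R" by unfold_locales
 note E = UP_pre_univ_propI[OF cring_axioms T.is_cring j]
 define ev where "ev = eval R ?T ?j ?t"
 have t: "?t \<in> |?T|" by (simp add: quadratic_sel)
 have ev: "ev \<in> ring_hom (UP R) ?T" unfolding ev_def by (rule UP_pre_univ_prop.eval_ring_hom[OF E t])
 note evh = ring_hom_closed[OF ev] ring_hom_mult[OF ev] ring_hom_add[OF ev] ring_hom_one[OF ev]
 have mon: "ev (monom (UP R) r n) = ?j r *\<^bsub>?T\<^esub> ?t [^]\<^bsub>?T\<^esub> n" if "r \<in> |R|" for r and n :: nat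
  unfolding ev_def by (rule UP_pre_univ_prop.eval_monom[OF E that t])
 have p0: "?t [^]\<^bsub>?T\<^esub> (0::nat) = (\<one>, \<zero>)" unfolding T.nat_pow_0 quadratic_sel ..
 have p1: "?t [^]\<^bsub>?T\<^esub> (1::nat) = ?t" by (rule T.nat_pow_eone[OF t])
 have p2: "?t [^]\<^bsub>?T\<^esub> (2::nat) = (\<ominus> b, \<ominus> a)"
 proof -
  have "?t [^]\<^bsub>?T\<^esub> (2::nat) = ?t [^]\<^bsub>?T\<^esub> (1::nat) *\<^bsub>?T\<^esub> ?t"
   unfolding numeral_2_eq_2 One_nat_def by (rule T.nat_pow_Suc)
  also have "\<dots> = (\<ominus> b, \<ominus> a)" unfolding p1 quadratic_sel using a b by (simp add: minus_eq)
  finally show ?thesis .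
 qed
 have m0: "ev (monom (UP R) r 0) = (r, \<zero>)" if r: "r \<in> |R|" for r
  unfolding mon[OF r] p0 quadratic_sel using r a b by (simp add: minus_eq)
 have m1: "ev (monom (UP R) r 1) = (\<zero>, r)" if r: "r \<in> |R|" for r
  unfolding mon[OF r] p1 quadratic_sel using r a b by (simp add: minus_eq)
 have m2: "ev (monom (UP R) \<one> 2) = (\<ominus> b, \<ominus> a)"
  unfolding mon[OF one_closed] p2 quadratic_sel using a b by (simp add: minus_eq)
 have evl: "ev (monom (UP R) r 0 \<oplus>\<^bsub>UP R\<^esub> monom (UP R) i 1) = (r, i)"
  if r: "r \<in> |R|" and i: "i \<in> |R|" for r i
  unfolding evh(3)[OF U.monom_closed[OF r] U.monom_closed[OF i]] m0[OF r] m1[OF i] quadratic_sel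
  using r i by simp
 have fc: "?f \<in> |UP R|" unfolding rees_quadratic_def using a b by simp
 have ev0: "ev ?f = \<zero>\<^bsub>?T\<^esub>"
 proof -
  have c: "monom (UP R) \<one> 2 \<in> |UP R|" "monom (UP R) a 1 \<in> |UP R|" "monom (UP R) b 0 \<in> |UP R|"
   using a b U.monom_closed by auto
  show ?thesis unfolding rees_quadratic_def evh(3)[OF U.P.a_closed[OF c(1,2)] c(3)] evh(3)[OF c(1,2)]
   m0[OF b] m1[OF a] m2 quadratic_sel using a b by (simp add: l_neg)
 qed
 have ker: "ev p = \<zero>\<^bsub>?T\<^esub> \<longleftrightarrow> p \<in> PIdl\<^bsub>UP R\<^esub> ?f" if p: "p \<in> |UP R|" for p
 proof
  assume "p \<in> PIdl\<^bsub>UP R\<^esub> ?f"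
  then obtain q where q: "q \<in> |UP R|" "p = q *\<^bsub>UP R\<^esub> ?f" unfolding cgenideal_def by blast
  show "ev p = \<zero>\<^bsub>?T\<^esub>" unfolding q(2) evh(2)[OF q(1) fc] ev0 using evh(1)[OF q(1)] by simp
 next
  assume e: "ev p = \<zero>\<^bsub>?T\<^esub>"
  have cf: "coeff (UP R) ?f n = (if n = 2 then \<one> else if n = 1 then a else if n = 0 then b else \<zero>)" for n
   unfolding rees_quadratic_def using a b by simp
  have deg: "deg R ?f = 2"
  proof (rule antisym)
   show "deg R ?f \<le> 2" by (rule U.deg_aboveI) (simp_all add: cf fc)
   show "2 \<le> deg R ?f" by (rule U.deg_belowI) (simp_all add: cf fc nt)
  qed
  then have nz: "?f \<noteq> \<zero>\<^bsub>UP R\<^esub>" by auto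
  obtain q r and k :: nat where q: "q \<in> |UP R|" "r \<in> |UP R|"
    "coeff (UP R) ?f (deg R ?f) [^] k \<odot>\<^bsub>UP R\<^esub> p = ?f *\<^bsub>UP R\<^esub> q \<oplus>\<^bsub>UP R\<^esub> r" "r = \<zero>\<^bsub>UP R\<^esub> \<or> deg R r < deg R ?f"
   using U.long_div_theorem[OF fc p nz] by blast
  have pe: "p = ?f *\<^bsub>UP R\<^esub> q \<oplus>\<^bsub>UP R\<^esub> r" using q(3) p by (simp add: deg cf)
  have r: "r = monom (UP R) (coeff (UP R) r 0) 0 \<oplus>\<^bsub>UP R\<^esub> monom (UP R) (coeff (UP R) r 1) 1"
  proof (rule U.up_eqI)
   fix n :: nat
   have "coeff (UP R) r n = \<zero>" if "n \<noteq> 0" "n \<noteq> 1"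
   proof (cases "r = \<zero>\<^bsub>UP R\<^esub>")
    case False
    then have "deg R r < n" using q(4) deg that by auto
    then show ?thesis using U.deg_aboveD q(2) by blast
   qed simp
   then show "coeff (UP R) r n = coeff (UP R) (monom (UP R) (coeff (UP R) r 0) 0 \<oplus>\<^bsub>UP R\<^esub> monom (UP R) (coeff (UP R) r 1) 1) n"
    using q(2) by (cases "n = 0"; cases "n = 1") simp_all
  qed (use q(2) in simp_all)
  have "ev p = ev r"
   unfolding pe evh(3)[OF U.P.m_closed[OF fc q(1)] q(2)] evh(2)[OF fc q(1)] ev0
   using evh(1)[OF q(1)] evh(1)[OF q(2)] by simp
  moreover have "ev r = (coeff (UP R) r 0, coeff (UP R) r 1)"
   by (subst r, rule evl) (use q(2) in simp_all)
  ultimately have "(coeff (UP R) r 0, coeff (UP R) r 1) = (\<zero>, \<zero>)" using e unfolding quadratic_sel by metis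
  then have "coeff (UP R) r 0 = \<zero>" "coeff (UP R) r 1 = \<zero>" by auto
  then have "r = monom (UP R) \<zero> 0 \<oplus>\<^bsub>UP R\<^esub> monom (UP R) \<zero> 1" by (subst r) (simp only:)
  then have "r = \<zero>\<^bsub>UP R\<^esub>" by simp
  then have "p = q *\<^bsub>UP R\<^esub> ?f" using pe q(1) fc by (simp add: U.P.m_comm)
  then show "p \<in> PIdl\<^bsub>UP R\<^esub> ?f" unfolding cgenideal_def using q(1) by blast
 qed
 have sub: "subring |?A| (UP R)" by (rule rees_subring[OF I])
 have Aeq: "?A = UP R\<lparr>carrier := |?A|\<rparr>" by (simp add: rees_algebra_def)
 have Ac: "|?A| \<subseteq> |UP R|" by (auto simp: rees_algebra_def)
 interpret A: cring ?A
  using U.P.subcring_iff[OF Ac] U.P.subcringI'[OF sub] Aeq by simp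
 have Asel: "monoid.mult ?A = monoid.mult (UP R)" "one ?A = one (UP R)" "ring.add ?A = ring.add (UP R)"
  by (simp_all add: rees_algebra_def)
 have evA: "ev \<in> ring_hom ?A ?T"
  by (rule ring_hom_memI) (use evh(1,4) evh(2,3)[OF subsetD[OF Ac] subsetD[OF Ac]] Ac in \<open>auto simp: Asel\<close>)
 interpret H: ring_hom_ring ?A ?T ev
  by (rule ring_hom_ringI2[OF A.ring_axioms T.ring_axioms evA])
 have kerA: "a_kernel ?A ?T ev = PIdl\<^bsub>UP R\<^esub> ?f \<inter> |?A|"
  unfolding a_kernel_def' using ker Ac by blast
 have S: "rees_quotient R I a b = ?A Quot (a_kernel ?A ?T ev)"
  unfolding rees_quotient_def kerA ..
 have K: "ideal (a_kernel ?A ?T ev) ?A" by (rule H.kernel_is_ideal)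
 have img: "ev ` |?A| = |R| \<times> I"
 proof (intro equalityI subsetI)
  fix x assume "x \<in> ev ` |?A|"
  then obtain p where p: "p \<in> |UP R|" "!!n. coeff (UP R) p n \<in> ideal_power R I n" "x = ev p"
   by (auto simp: rees_algebra_def)
  let ?g = "%i. ?j (coeff (UP R) p i) *\<^bsub>?T\<^esub> ?t [^]\<^bsub>?T\<^esub> i"
  have gI: "?g i \<in> |R| \<times> I" for i :: nat
  proof (cases "i = 0")
   case True then show ?thesis using p(1) a b zI p0 by (simp add: quadratic_sel minus_eq)
  next
   case False
   have ci: "coeff (UP R) p i \<in> I" using p(2)[of i] ideal_power_sub[OF I] False by blast
   obtain u v where uv: "?t [^]\<^bsub>?T\<^esub> i = (u, v)" by (cases "?t [^]\<^bsub>?T\<^esub> i")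
   have c: "u \<in> |R|" "v \<in> |R|" using T.nat_pow_closed[OF t, of i] uv by (auto simp: quadratic_sel)
   show ?thesis unfolding uv using c ci a b I.Icarr[OF ci] I.I_r_closed[OF ci c(2)]
    by (simp add: quadratic_sel minus_eq)
  qed
  have "finsum ?T ?g B \<in> |R| \<times> I" if "finite B" for B using that
  proof (induction B)
   case empty then show ?case using zI by (simp add: quadratic_sel)
  next
   case (insert y F)
   have gc: "?g i \<in> |?T|" for i using gI[of i] I.Icarr by (auto simp: quadratic_sel)
   have e: "finsum ?T ?g (insert y F) = ?g y \<oplus>\<^bsub>?T\<^esub> finsum ?T ?g F"
    by (rule T.finsum_insert) (use insert gc in auto)
   obtain u v where uv: "?g y = (u, v)" by (cases "?g y")
   obtain u' v' where uv': "finsum ?T ?g F = (u', v')" by (cases "finsum ?T ?g F")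
   show ?case unfolding e uv uv' quadratic_sel using gI[of y] insert.IH I.a_closed unfolding uv uv' by simp
  qed
  then show "x \<in> |R| \<times> I" unfolding p(3) ev_def U.eval_on_carrier[OF p(1)] by simp
 next
  fix x assume "x \<in> |R| \<times> I"
  then obtain r i where x: "x = (r, i)" "r \<in> |R|" "i \<in> I" by blast
  let ?p = "monom (UP R) r 0 \<oplus>\<^bsub>UP R\<^esub> monom (UP R) i 1"
  have "coeff (UP R) ?p n \<in> ideal_power R I n" for n
   using x I.Icarr[OF x(3)] ideal_power_1[OF I x(3)]
    additive_subgroup.zero_closed[OF ideal.axioms(1)[OF ideal_power_ideal[OF I]]]
   by (cases "n = 0"; cases "n = 1") simp_all
  then have "?p \<in> |?A|" using x I.Icarr[OF x(3)] by (simp add: rees_algebra_def)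
  then show "x \<in> ev ` |?A|" using evl[OF x(2) I.Icarr[OF x(3)]] x(1) by force
 qed
 let ?h = "%X. the_elem (ev ` X)"
 have iso: "?h \<in> ring_iso (rees_quotient R I a b) (?T\<lparr>carrier := |R| \<times> I\<rparr>)"
  using H.FactRing_iso_set_aux unfolding S img .
 have bij: "bij_betw ?h ( |rees_quotient R I a b| ) ( |R| \<times> I)" using ring_iso_memE(5)[OF iso] by simp
 have "quadratic_order R (rees_quotient R I a b) I a b ?h"
 proof (intro quadratic_order.intro quadratic_order_axioms.intro)
  show "cring R" by (rule is_cring)
  show "cring (rees_quotient R I a b)" unfolding S by (rule ideal.quotient_is_cring[OF K A.is_cring])
  have im: "?h X \<in> |R| \<times> I" if "X \<in> |rees_quotient R I a b|" for X
   using bij that unfolding bij_betw_def by blast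
  show "?h \<in> ring_hom (rees_quotient R I a b) ?T"
  proof (rule ring_hom_memI)
   fix X Y assume X: "X \<in> |rees_quotient R I a b|" and Y: "Y \<in> |rees_quotient R I a b|"
   show "?h X \<in> |?T|" using im[OF X] I.Icarr by (auto simp: quadratic_sel)
   show "?h (X *\<^bsub>rees_quotient R I a b\<^esub> Y) = ?h X *\<^bsub>?T\<^esub> ?h Y"
    using ring_iso_memE(2)[OF iso X Y] by simp
   show "?h (X \<oplus>\<^bsub>rees_quotient R I a b\<^esub> Y) = ?h X \<oplus>\<^bsub>?T\<^esub> ?h Y"
    using ring_iso_memE(3)[OF iso X Y] by simp
  next
   show "?h \<one>\<^bsub>rees_quotient R I a b\<^esub> = \<one>\<^bsub>?T\<^esub>" using ring_iso_memE(4)[OF iso] by simp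
  qed
  show "inj_on ?h ( |rees_quotient R I a b| )" using bij unfolding bij_betw_def by blast
  show "?h ` |rees_quotient R I a b| = |R| \<times> I" using bij unfolding bij_betw_def by blast
 qed (rule I a b)+
 then show ?thesis by blast
qed

end

subsection \<open>The total ring of fractions of a quadratic order\<close>

lemma (in cring) quadratic_scalar_mult:
 assumes "a \<in> |R|" "b \<in> |R|" "u \<in> |R|" "x \<in> |R|" "y \<in> |R|"
 shows "(u, \<zero>) *\<^bsub>quadratic R a b\<^esub> (x, y) = (u * x, u * y)"
 using assms by (simp add: quadratic_sel minus_eq)

lemma (in cring) quadratic_scalar_unit:
 assumes a: "a \<in> |R|" and b: "b \<in> |R|" and u: "u \<in> Units R"
 shows "(u, \<zero>) \<in> Units (quadratic R a b)"
proof -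
 interpret P: cring "quadratic R a b" by (rule quadratic_cring[OF a b])
 have i: "inv u \<in> |R|" "u \<in> |R|" using u by auto
 have c: "(u, \<zero>) \<in> |quadratic R a b|" "(inv u, \<zero>) \<in> |quadratic R a b|"
  unfolding quadratic_sel using i by simp_all
 have e: "(inv u, \<zero>) *\<^bsub>quadratic R a b\<^esub> (u, \<zero>) = \<one>\<^bsub>quadratic R a b\<^esub>"
  unfolding quadratic_sel using u i a b by (simp add: minus_eq)
 show ?thesis unfolding Units_def
  by (intro CollectI conjI bexI[OF _ c(2)] c(1) e) (use e P.m_comm[OF c] in metis)
qed

lemma (in cring) quadratic_minus:
 assumes a: "a \<in> |R|" and b: "b \<in> |R|"
  and c: "r \<in> |R|" "i \<in> |R|" "s \<in> |R|" "j \<in> |R|"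
 shows "(r, i) \<ominus>\<^bsub>quadratic R a b\<^esub> (s, j) = (r \<ominus> s, i \<ominus> j)"
proof -
 interpret P: cring "quadratic R a b" by (rule quadratic_cring[OF a b])
 have "(\<ominus> s, \<ominus> j) \<oplus>\<^bsub>quadratic R a b\<^esub> (s, j) = \<zero>\<^bsub>quadratic R a b\<^esub>"
  unfolding quadratic_sel using c by (simp add: l_neg)
 then have "\<ominus>\<^bsub>quadratic R a b\<^esub> (s, j) = (\<ominus> s, \<ominus> j)"
  by (rule P.minus_equality) (use c in \<open>simp_all add: quadratic_sel(1)\<close>)
 then show ?thesis unfolding P.minus_eq minus_eq by (simp only: quadratic_sel)
qed

context quadratic_order
begin

abbreviation K where "K \<equiv> Frac R"
abbreviation P where "P \<equiv> quadratic (Frac R) (to_frac R a) (to_frac R b)"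
definition emb where "emb s = map_prod (to_frac R) (to_frac R) (h s)"

lemma K_cring: "cring K" by (rule R.total_frac_cring)

lemmas \<iota> = ring_hom_closed[OF R.to_frac_hom] ring_hom_mult[OF R.to_frac_hom]
 ring_hom_add[OF R.to_frac_hom] ring_hom_one[OF R.to_frac_hom]

lemma P_cring: "cring P"
 by (rule cring.quadratic_cring[OF K_cring]) (use \<iota> a b in auto)

lemma \<iota>_minus:
 assumes "r \<in> |R|" "s \<in> |R|"
 shows "to_frac R (r \<ominus> s) = to_frac R r \<ominus>\<^bsub>K\<^esub> to_frac R s"
proof -
 interpret K: cring K by (rule K_cring)
 have "to_frac R (r \<ominus> s) \<oplus>\<^bsub>K\<^esub> to_frac R s = to_frac R ((r \<ominus> s) \<oplus> s)" using assms by (simp add: \<iota>)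
 also have "(r \<ominus> s) \<oplus> s = r" using assms by algebra
 finally show ?thesis using assms \<iota>(1) by (simp add: K.minus_eq K.add.inv_solve_right)
qed

lemma emb_el: "r \<in> |R| ==> i \<in> I ==> emb (el r i) = (to_frac R r, to_frac R i)"
 unfolding emb_def using el(2) by simp

lemma emb_hom: "emb \<in> ring_hom S P"
proof (rule ring_hom_memI)
 fix s t assume s: "s \<in> |S|" and t: "t \<in> |S|"
 obtain r i where ri: "r \<in> |R|" "i \<in> I" "s = el r i" by (rule S_cases[OF s])
 obtain q j where qj: "q \<in> |R|" "j \<in> I" "t = el q j" by (rule S_cases[OF t])
 have c: "i \<in> |R|" "j \<in> |R|" using ri qj I_carr by auto
 show "emb s \<in> |P|" unfolding ri(3) emb_el[OF ri(1,2)] using ri c \<iota> by (simp add: quadratic_sel)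
 have "(r * j \<oplus> i * q) \<ominus> a * (i * j) \<in> I"
  by (intro I_minus I.a_closed) (use ri qj c a I.I_l_closed I.I_r_closed in auto)
 then show "emb (s *\<^bsub>S\<^esub> t) = emb s *\<^bsub>P\<^esub> emb t"
  unfolding ri(3) qj(3) el_mult[OF ri(1,2) qj(1,2)] emb_el[OF ri(1,2)] emb_el[OF qj(1,2)]
  using ri qj c a b by (subst emb_el) (simp_all add: \<iota> \<iota>_minus quadratic_sel)
 show "emb (s \<oplus>\<^bsub>S\<^esub> t) = emb s \<oplus>\<^bsub>P\<^esub> emb t"
  unfolding ri(3) qj(3) el_add[OF ri(1,2) qj(1,2)] emb_el[OF ri(1,2)] emb_el[OF qj(1,2)]
  using ri qj c by (subst emb_el) (simp_all add: \<iota> quadratic_sel)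
next
 show "emb \<one>\<^bsub>S\<^esub> = \<one>\<^bsub>P\<^esub>" unfolding el_one emb_el[OF R.one_closed zero_I]
  by (simp add: quadratic_sel R.total_frac_zero R.total_frac_one)
qed

lemma emb_inj: "inj_on emb |S|"
proof (rule inj_onI)
 fix s t assume s: "s \<in> |S|" and t: "t \<in> |S|" and e: "emb s = emb t"
 obtain r i where ri: "r \<in> |R|" "i \<in> I" "s = el r i" by (rule S_cases[OF s])
 obtain q j where qj: "q \<in> |R|" "j \<in> I" "t = el q j" by (rule S_cases[OF t])
 have "to_frac R r = to_frac R q" "to_frac R i = to_frac R j"
  using e unfolding ri(3) qj(3) emb_el[OF ri(1,2)] emb_el[OF qj(1,2)] by auto
 then have "r = q" "i = j" using inj_onD[OF R.to_frac_inj] ri qj I_carr by blast+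
 then show "s = t" using ri qj by simp
qed

lemma emb_image: "emb ` |S| = (to_frac R ` |R| ) \<times> (to_frac R ` I)"
proof -
 have "emb ` |S| = map_prod (to_frac R) (to_frac R) ` ( |R| \<times> I)"
  unfolding emb_def image_image[symmetric, of _ h] h_image ..
 then show ?thesis by (simp add: map_prod_surj_on)
qed

text \<open>The product of a regular element with its conjugate is a regular element of $R$. For denominators, a regular element
of $I$ moves the second coordinate into $I$.\<close>

lemma embedding:
 assumes reg: "\<exists>x\<in>I. x \<in> Reg R"
 shows "fraction_embedding S P emb"
proof (intro fraction_embedding.intro fraction_embedding_axioms.intro)
 interpret K: cring K by (rule K_cring)
 interpret P: cring P by (rule P_cring)
 note hom = ring_hom_closed[OF emb_hom] ring_hom_mult[OF emb_hom]
 show "emb s \<in> Units P" if s: "s \<in> Reg S" for s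
 proof -
  have sc: "s \<in> |S|" using S.regularD(1)[OF s] .
  note c = conj_tr_nm[OF sc]
  have "emb s *\<^bsub>P\<^esub> emb (conj s) = emb (sc (nm s))" using hom(2)[OF sc c(1)] c(5) by simp
  also have "\<dots> = (to_frac R (nm s), \<zero>\<^bsub>K\<^esub>)" using emb_el[OF c(3) zero_I] by (simp add: R.total_frac_zero)
  also have "\<dots> \<in> Units P"
   by (rule K.quadratic_scalar_unit[OF _ _ R.to_frac_regular_Units[OF nm_regular[OF s]]]) (use \<iota>(1) a b in auto)
  finally have u: "emb s *\<^bsub>P\<^esub> emb (conj s) \<in> Units P" .
  show ?thesis by (rule P.unit_factor[OF u]) (use hom(1) sc c in auto)
 qed
 fix p assume "p \<in> |P|"
 then obtain q1 q2 where q: "p = (q1, q2)" "q1 \<in> |K|" "q2 \<in> |K|" by (auto simp: quadratic_sel)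
 obtain r1 d1 where 1: "r1 \<in> |R|" "d1 \<in> Reg R" "q1 = fraction R r1 d1"
  by (rule R.total_frac_cases[OF q(2)])
 obtain r2 d2 where 2: "r2 \<in> |R|" "d2 \<in> Reg R" "q2 = fraction R r2 d2"
  by (rule R.total_frac_cases[OF q(3)])
 obtain x where x: "x \<in> I" "x \<in> Reg R" using reg by blast
 note dc = R.regularD(1)[OF 1(2)] R.regularD(1)[OF 2(2)] R.regularD(1)[OF x(2)]
 let ?d = "x * (d1 * d2)"
 have d: "?d \<in> Reg R" by (intro R.regular_mult x 1 2)
 have dcc: "?d \<in> |R|" using dc by simp
 have e1: "to_frac R ?d *\<^bsub>K\<^esub> q1 = to_frac R (x * d2 * r1)"
 proof -
  have "to_frac R ?d = to_frac R (x * d2) *\<^bsub>K\<^esub> to_frac R d1" using dc by (simp add: \<iota>(2)[symmetric] R.m_ac)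
  then show ?thesis using R.fraction_denominator[OF 1(1,2)] \<iota>(1) dc 1 q
   by (simp add: K.m_assoc \<iota>(2))
 qed
 have e2: "to_frac R ?d *\<^bsub>K\<^esub> q2 = to_frac R (x * d1 * r2)"
 proof -
  have "to_frac R ?d = to_frac R (x * d1) *\<^bsub>K\<^esub> to_frac R d2" using dc by (simp add: \<iota>(2)[symmetric] R.m_ac)
  then show ?thesis using R.fraction_denominator[OF 2(1,2)] \<iota>(1) dc 2 q
   by (simp add: K.m_assoc \<iota>(2))
 qed
 have "emb (sc ?d) *\<^bsub>P\<^esub> p = (to_frac R ?d *\<^bsub>K\<^esub> q1, to_frac R ?d *\<^bsub>K\<^esub> q2)"
  unfolding emb_el[OF dcc zero_I] q(1) using q(2,3) dcc \<iota>(1) a b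
  by (simp add: quadratic_sel R.total_frac_zero[symmetric] K.minus_eq)
 also have "\<dots> \<in> emb ` |S|" unfolding emb_image e1 e2
  using dc 1 2 x I.I_r_closed by (auto simp: R.m_assoc intro!: imageI)
 finally show "\<exists>s\<in>Reg S. emb s *\<^bsub>P\<^esub> p \<in> emb ` |S|" using sc_regular[OF d] by blast
qed (rule S.is_cring P_cring emb_hom emb_inj)+

end

section \<open>Dualizing modules of quadratic orders\<close>

lemma colonI: "q \<in> |Q| ==> (!!y. y \<in> Y ==> q *\<^bsub>Q\<^esub> y \<in> X) ==> q \<in> colon Q X Y"
 by (simp add: colon_def)

locale quadratic_dual = one_dim_frac Q A n for Q (structure) and A n +
 fixes J w a b
 assumes w: "dualizing Q A n w" and J: "regfrac J" and Jn: "J \<subseteq> n"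
  and a: "a \<in> A" and b: "b \<in> A"
  and order: "one_dim_frac (quadratic Q a b) (A \<times> J) (n \<times> J)"
begin

abbreviation P where "P \<equiv> quadratic Q a b"
abbreviation D where "D \<equiv> colon Q w J"

sublocale P: one_dim_frac P "A \<times> J" "n \<times> J" by (rule order)

lemmas w_sub = dualizingD(1)[OF w] and A_w = dualizingD(2)[OF w]
lemmas J_sub = regfracD(1)[OF J]

lemma ac: "a \<in> |Q|" and bc: "b \<in> |Q|" using a b by auto

lemma J_A: "j \<in> J ==> j \<in> A" using Jn n_A by blast

lemma D_regfrac: "regfrac D" by (rule colon_regfrac[OF dualizingD(3)[OF w] J])

lemmas D_sub = regfracD(1)[OF D_regfrac]

lemma w_D: "v \<in> w ==> v \<in> D"
 unfolding colon_def using w_sub submodD(1)[OF w_sub] J_A submodD(4)[OF w_sub] m_comm by fastforce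

lemma A_D: "v \<in> A ==> v \<in> D" using A_w w_D by blast

lemma P_carr: "x \<in> |P| \<longleftrightarrow> fst x \<in> |Q| \<and> snd x \<in> |Q|"
 by (cases x) (simp add: quadratic_sel)

lemma JD: assumes "j \<in> J" "u \<in> D" shows "j * u \<in> w"
 using colonD(2)[OF assms(2,1)] m_comm[of j u] colonD(1)[OF assms(2)] submodD(1)[OF J_sub assms(1)] by simp

lemma aJ: "j \<in> J ==> v \<in> w ==> c \<in> A ==> c * (j * v) \<in> w"
 using submodD(4)[OF w_sub] J_A by blast

lemma canonical_submod: "submod P (A \<times> J) (D \<times> w)"
 unfolding submod_def
proof (intro conjI ballI)
 show "D \<times> w \<subseteq> |P|" using submodD(1)[OF D_sub] submodD(1)[OF w_sub] by (auto simp: quadratic_sel)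
 show "\<zero>\<^bsub>P\<^esub> \<in> D \<times> w" unfolding quadratic_sel using submodD(2)[OF D_sub] submodD(2)[OF w_sub] by simp
 fix x y assume x: "x \<in> D \<times> w" and y: "y \<in> D \<times> w"
 then show "x \<oplus>\<^bsub>P\<^esub> y \<in> D \<times> w"
  using submodD(3)[OF D_sub] submodD(3)[OF w_sub] by (cases x; cases y) (simp add: quadratic_sel)
next
 fix q x assume "q \<in> A \<times> J" "x \<in> D \<times> w"
 then obtain r i u v where q: "q = (r, i)" "r \<in> A" "i \<in> J" and x: "x = (u, v)" "u \<in> D" "v \<in> w" by blast
 have "i * v \<in> w" using submodD(4)[OF w_sub] J_A q x by blast
 then have "b * (i * v) \<in> D" using submodD(4)[OF w_sub b] w_D by blast
 then have 1: "r * u \<ominus> b * (i * v) \<in> D" by (rule submod_minus[OF D_sub submodD(4)[OF D_sub q(2) x(2)]])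
 have 2: "(r * v \<oplus> i * u) \<ominus> a * (i * v) \<in> w"
  by (rule submod_minus[OF w_sub submodD(3)[OF w_sub submodD(4)[OF w_sub q(2) x(3)] JD[OF q(3) x(2)]] aJ[OF q(3) x(3) a]])
 show "q *\<^bsub>P\<^esub> x \<in> D \<times> w" unfolding q x quadratic_sel using 1 2 by simp
qed

text \<open>The second coordinate is a pairing that determines the module.\<close>

lemma mem_canonical_iff:
 assumes q: "q \<in> |P|"
 shows "q \<in> D \<times> w \<longleftrightarrow> (\<forall>y\<in>A \<times> J. snd (y *\<^bsub>P\<^esub> q) \<in> w)"
proof
 assume "q \<in> D \<times> w"
 then show "\<forall>y\<in>A \<times> J. snd (y *\<^bsub>P\<^esub> q) \<in> w" using P.submodD(4)[OF canonical_submod] by fastforce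
next
 assume h: "\<forall>y\<in>A \<times> J. snd (y *\<^bsub>P\<^esub> q) \<in> w"
 obtain u v where uv: "q = (u, v)" "u \<in> |Q|" "v \<in> |Q|" using q by (auto simp: quadratic_sel)
 have z: "\<zero> \<in> J" using submodD(2)[OF J_sub] .
 have "snd ((\<one>, \<zero>) *\<^bsub>P\<^esub> q) \<in> w" using bspec[OF h, of "(\<one>, \<zero>)"] z one_A by simp
 then have v: "v \<in> w" unfolding uv(1) quadratic_scalar_mult[OF ac bc one_closed uv(2,3)] using uv by simp
 have "u * j \<in> w" if j: "j \<in> J" for j
 proof -
  have jc: "j \<in> |Q|" using J_A j by blast
  have "snd ((\<zero>, j) *\<^bsub>P\<^esub> q) \<in> w" using bspec[OF h, of "(\<zero>, j)"] j A_zero by simp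
  then have "(\<zero> * v \<oplus> j * u) \<ominus> a * (j * v) \<in> w" unfolding uv(1) quadratic_sel by simp
  then have "((\<zero> * v \<oplus> j * u) \<ominus> a * (j * v)) \<oplus> a * (j * v) \<in> w"
   using submodD(3)[OF w_sub] aJ[OF j v a] by blast
  moreover have "((\<zero> * v \<oplus> j * u) \<ominus> a * (j * v)) \<oplus> a * (j * v) = u * j"
   using uv(2,3) jc ac by algebra
  ultimately show ?thesis by simp
 qed
 then have "u \<in> D" unfolding colon_def using uv(2) by simp
 then show "q \<in> D \<times> w" using uv v by simp
qed

text \<open>An element $(u, v)$ multiplies \<open>n \<times> J\<close> into \<open>D \<times> w\<close> iff $v$ lies in $w : n$ and $u - a v$ lies in $D$. So the socle
generator $s$ of $w$ gives the generator $(a s, s)$.\<close>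

lemma canonical_socle:
 "\<exists>s\<in>colon P (D \<times> w) (n \<times> J). s \<notin> D \<times> w \<and>
  (\<forall>q\<in>colon P (D \<times> w) (n \<times> J). \<exists>c\<in>A \<times> J. q \<ominus>\<^bsub>P\<^esub> c *\<^bsub>P\<^esub> s \<in> D \<times> w)"
proof -
 obtain s where s: "s \<in> colon Q w n" "s \<notin> w" "!!q. q \<in> colon Q w n ==> \<exists>c\<in>A. q \<ominus> c * s \<in> w"
  using dualizingD(5)[OF w] by blast
 have sc: "s \<in> |Q|" by (rule colonD(1)[OF s(1)])
 have as: "a * s \<in> |Q|" using ac sc by simp
 let ?s = "(a * s, s)"
 have sP: "?s \<in> |P|" unfolding quadratic_sel using as sc by simp
 have pair: "snd ((r, i) *\<^bsub>P\<^esub> ?s) = r * s" if "r \<in> |Q|" "i \<in> |Q|" for r i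
  unfolding quadratic_sel snd_conv using that ac sc by algebra
 have zJ: "\<zero> \<in> J" using submodD(2)[OF J_sub] .
 have s1: "?s \<in> colon P (D \<times> w) (n \<times> J)"
 proof (rule colonI[OF sP])
  fix x assume x: "x \<in> n \<times> J"
  have xc: "x \<in> |P|" by (rule P.n_carr[OF x])
  have "x *\<^bsub>P\<^esub> ?s \<in> D \<times> w"
  proof (subst mem_canonical_iff)
   show "x *\<^bsub>P\<^esub> ?s \<in> |P|" by (rule P.m_closed[OF xc sP])
   show "\<forall>y\<in>A \<times> J. snd (y *\<^bsub>P\<^esub> (x *\<^bsub>P\<^esub> ?s)) \<in> w"
   proof
    fix y assume y: "y \<in> A \<times> J"
    have yc: "y \<in> |P|" by (rule P.A_carr[OF y])
    have "y *\<^bsub>P\<^esub> x \<in> n \<times> J" by (rule P.submodD(4)[OF P.sub_n y x])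
    then obtain r i where ri: "y *\<^bsub>P\<^esub> x = (r, i)" "r \<in> n" "i \<in> J" by blast
    have "snd (y *\<^bsub>P\<^esub> (x *\<^bsub>P\<^esub> ?s)) = r * s"
     unfolding P.m_assoc[OF yc xc sP, symmetric] ri(1) by (rule pair) (use ri J_A in auto)
    also have "r * s = s * r" using m_comm[OF n_carr[OF ri(2)] sc] .
    also have "s * r \<in> w" by (rule colonD(2)[OF s(1) ri(2)])
    finally show "snd (y *\<^bsub>P\<^esub> (x *\<^bsub>P\<^esub> ?s)) \<in> w" .
   qed
  qed
  then show "?s *\<^bsub>P\<^esub> x \<in> D \<times> w" by (subst P.m_comm[OF sP xc])
 qed
 have "\<exists>c\<in>A \<times> J. q \<ominus>\<^bsub>P\<^esub> c *\<^bsub>P\<^esub> ?s \<in> D \<times> w" if q: "q \<in> colon P (D \<times> w) (n \<times> J)" for q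
 proof -
  obtain u v where uv: "q = (u, v)" "u \<in> |Q|" "v \<in> |Q|"
   using P.colonD(1)[OF q] by (auto simp: quadratic_sel)
  have qx: "x *\<^bsub>P\<^esub> q \<in> D \<times> w" if "x \<in> n \<times> J" for x
   using P.colonD(2)[OF q that] P.m_comm[OF P.n_carr[OF that] P.colonD(1)[OF q]] by simp
  have "v \<in> colon Q w n" unfolding colon_def
  proof (intro CollectI conjI ballI uv(3))
   fix r assume r: "r \<in> n"
   have "(r, \<zero>) *\<^bsub>P\<^esub> q \<in> D \<times> w" by (rule qx) (use r zJ in simp)
   then have "r * v \<in> w" unfolding uv(1) quadratic_scalar_mult[OF ac bc n_carr[OF r] uv(2,3)] by simp
   then show "v * r \<in> w" using m_comm[OF n_carr[OF r] uv(3)] by simp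
  qed
  then obtain c where c: "c \<in> A" "v \<ominus> c * s \<in> w" using s(3) by blast
  have cc: "c \<in> |Q|" using c by blast
  have "u \<ominus> a * v \<in> D" unfolding colon_def
  proof (intro CollectI conjI ballI)
   show "u \<ominus> a * v \<in> |Q|" using uv ac by simp
   fix j assume j: "j \<in> J"
   have jc: "j \<in> |Q|" using J_A j by blast
   have "(\<zero>, j) *\<^bsub>P\<^esub> q \<in> D \<times> w" by (rule qx) (use j submodD(2)[OF sub_n] in simp)
   then have "(\<zero> * v \<oplus> j * u) \<ominus> a * (j * v) \<in> w" unfolding uv(1) quadratic_sel by simp
   moreover have "(\<zero> * v \<oplus> j * u) \<ominus> a * (j * v) = (u \<ominus> a * v) * j" using uv(2,3) ac jc by algebra
   ultimately show "(u \<ominus> a * v) * j \<in> w" by simp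
  qed
  moreover have "a * (v \<ominus> c * s) \<in> D" by (rule submodD(4)[OF D_sub a w_D[OF c(2)]])
  ultimately have "(u \<ominus> a * v) \<oplus> a * (v \<ominus> c * s) \<in> D" by (rule submodD(3)[OF D_sub])
  moreover have "(u \<ominus> a * v) \<oplus> a * (v \<ominus> c * s) = u \<ominus> c * (a * s)" using uv(2,3) ac sc cc by algebra
  ultimately have d: "u \<ominus> c * (a * s) \<in> D" by simp
  have "q \<ominus>\<^bsub>P\<^esub> (c, \<zero>) *\<^bsub>P\<^esub> ?s = (u \<ominus> c * (a * s), v \<ominus> c * s)"
   unfolding uv(1) quadratic_scalar_mult[OF ac bc cc as sc]
   by (rule quadratic_minus[OF ac bc]) (use uv cc as sc in simp_all)
  then have "q \<ominus>\<^bsub>P\<^esub> (c, \<zero>) *\<^bsub>P\<^esub> ?s \<in> D \<times> w" using d c(2) by simp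
  then show ?thesis using c(1) zJ by (intro bexI[of _ "(c, \<zero>)"]) auto
 qed
 then show ?thesis using s1 s(2) by (intro bexI[OF _ s1]) auto
qed

text \<open>The second coordinate of $f$ is a homomorphism modulo $w$ on pairs, so it is \<open>(r, i) \<mapsto> r u\<^sub>0 + i u\<^sub>1\<close> by \<open>inj_vectors\<close>.
This is the second coordinate of the product with \<open>(u\<^sub>1 + a u\<^sub>0, u\<^sub>0)\<close>, and by \<open>mem_canonical_iff\<close> the second
coordinate decides.\<close>

lemma canonical_injective:
 assumes f: "hom_mod P (A \<times> J) (D \<times> w) (n \<times> J) f"
 shows "\<exists>c\<in>carrier P. \<forall>x\<in>n \<times> J. f x \<ominus>\<^bsub>P\<^esub> x *\<^bsub>P\<^esub> c \<in> D \<times> w"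
proof -
 define V where "V = {v :: nat => _. v 0 \<in> n \<and> v 1 \<in> J \<and> (\<forall>j\<ge>2. v j = \<zero>)}"
 define g where "g v = snd (f (v 0, v 1))" for v :: "nat => _"
 have zJ: "\<zero> \<in> J" using submodD(2)[OF J_sub] .
 have fc: "f x \<in> |P|" if "x \<in> n \<times> J" for x by (rule P.hom_modD(1)[OF f that])
 have sndminus: "snd (x \<ominus>\<^bsub>P\<^esub> y) = snd x \<ominus> snd y" if "x \<in> |P|" "y \<in> |P|" for x y
  using that quadratic_minus[OF ac bc] by (cases x; cases y) (simp add: quadratic_sel(1))
 have mem: "(v 0, v 1) \<in> n \<times> J" if "v \<in> V" for v using that by (simp add: V_def)
 have "\<exists>u. (\<forall>j<2. u j \<in> |Q| ) \<and> (\<forall>v\<in>V. g v \<ominus> dot Q 2 v u \<in> w)"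
 proof (rule inj_vectors[OF w_sub A_w dualizingD(4)[OF w]])
  show "(%_. \<zero>) \<in> V" using zJ submodD(2)[OF sub_n] by (simp add: V_def)
  show "(%j. u j \<oplus> v j) \<in> V" if "u \<in> V" "v \<in> V" for u v
   using that submodD(3)[OF sub_n] submodD(3)[OF J_sub] by (simp add: V_def)
  show "(%j. c * v j) \<in> V" if "c \<in> A" "v \<in> V" for c v
   using that submodD(4)[OF sub_n] submodD(4)[OF J_sub] by (simp add: V_def)
  show "v j \<in> A" if "v \<in> V" "j < 2" for v and j :: nat
   using that n_A J_A by (auto simp: V_def less_2_cases_iff)
  show "g v \<in> |Q|" if "v \<in> V" for v using fc[OF mem[OF that]] by (simp add: g_def P_carr)
  show "g (%j. u j \<oplus> v j) \<ominus> (g u \<oplus> g v) \<in> w" if u: "u \<in> V" and v: "v \<in> V" for u v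
  proof -
   have e: "(u 0 \<oplus> v 0, u 1 \<oplus> v 1) = (u 0, u 1) \<oplus>\<^bsub>P\<^esub> (v 0, v 1)" by (simp add: quadratic_sel)
   note c = fc[OF mem[OF u]] fc[OF mem[OF v]]
   have "f ((u 0, u 1) \<oplus>\<^bsub>P\<^esub> (v 0, v 1)) \<ominus>\<^bsub>P\<^esub> (f (u 0, u 1) \<oplus>\<^bsub>P\<^esub> f (v 0, v 1)) \<in> D \<times> w"
    by (rule P.hom_modD(2)[OF f mem[OF u] mem[OF v]])
   then have "snd (f ((u 0, u 1) \<oplus>\<^bsub>P\<^esub> (v 0, v 1)) \<ominus>\<^bsub>P\<^esub> (f (u 0, u 1) \<oplus>\<^bsub>P\<^esub> f (v 0, v 1))) \<in> w" by auto
   moreover have "snd (f (u 0, u 1) \<oplus>\<^bsub>P\<^esub> f (v 0, v 1)) = snd (f (u 0, u 1)) \<oplus> snd (f (v 0, v 1))"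
    by (cases "f (u 0, u 1)"; cases "f (v 0, v 1)") (simp add: quadratic_sel)
   ultimately show ?thesis unfolding g_def e
    using sndminus[OF fc[OF P.submodD(3)[OF P.sub_n mem[OF u] mem[OF v]]] P.a_closed[OF c]] by simp
  qed
  show "g (%j. c * v j) \<ominus> c * g v \<in> w" if cA: "c \<in> A" and v: "v \<in> V" for c v
  proof -
   have cc: "c \<in> |Q|" using cA by blast
   have vc: "v 0 \<in> |Q|" "v 1 \<in> |Q|" using mem[OF v] J_A by auto
   have cz: "(c, \<zero>) \<in> A \<times> J" using cA zJ by simp
   have e: "(c * v 0, c * v 1) = (c, \<zero>) *\<^bsub>P\<^esub> (v 0, v 1)"
    by (rule quadratic_scalar_mult[OF ac bc cc vc, symmetric])
   note fv = fc[OF mem[OF v]]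
   have "f ((c, \<zero>) *\<^bsub>P\<^esub> (v 0, v 1)) \<ominus>\<^bsub>P\<^esub> (c, \<zero>) *\<^bsub>P\<^esub> f (v 0, v 1) \<in> D \<times> w"
    by (rule P.hom_modD(3)[OF f cz mem[OF v]])
   then have "snd (f ((c, \<zero>) *\<^bsub>P\<^esub> (v 0, v 1)) \<ominus>\<^bsub>P\<^esub> (c, \<zero>) *\<^bsub>P\<^esub> f (v 0, v 1)) \<in> w" by auto
   moreover have "snd ((c, \<zero>) *\<^bsub>P\<^esub> f (v 0, v 1)) = c * snd (f (v 0, v 1))"
    using fv quadratic_scalar_mult[OF ac bc cc] by (cases "f (v 0, v 1)") (simp add: quadratic_sel(1))
   ultimately show ?thesis unfolding g_def e
    using sndminus[OF fc[OF P.submodD(4)[OF P.sub_n cz mem[OF v]]] P.m_closed[OF P.A_carr[OF cz] fv]] by simp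
  qed
  show "g v \<in> w" if v: "v \<in> V" "\<forall>j<2. v j = \<zero>" for v
  proof -
   have "(v 0, v 1) = \<zero>\<^bsub>P\<^esub>" using v(2) by (simp add: quadratic_sel)
   then show ?thesis using P.hom_mod_zero[OF P.sub_n f] unfolding g_def by auto
  qed
 qed
 then obtain u where u': "\<forall>j<2. u j \<in> |Q|" "!!v. v \<in> V ==> g v \<ominus> dot Q 2 v u \<in> w" by blast
 have u: "u 0 \<in> |Q|" "u 1 \<in> |Q|" using u'(1) by simp_all
 let ?c = "(u 1 \<oplus> a * u 0, u 0)"
 have cP: "?c \<in> |P|" using u ac by (simp add: quadratic_sel(1))
 have pair: "snd (f x) \<ominus> snd (x *\<^bsub>P\<^esub> ?c) \<in> w" if x: "x \<in> n \<times> J" for x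
 proof -
  obtain r i where ri: "x = (r, i)" "r \<in> n" "i \<in> J" using x by blast
  have rc: "r \<in> |Q|" "i \<in> |Q|" using ri J_A by auto
  let ?v = "%j::nat. if j = 0 then r else if j = 1 then i else \<zero>"
  have vV: "?v \<in> V" using ri by (simp add: V_def)
  have gv: "g ?v = snd (f x)" unfolding g_def ri(1) by simp
  have "dot Q 2 ?v u = i * u 1 \<oplus> (r * u 0 \<oplus> \<zero>)"
  proof -
   have uc: "u j \<in> |Q|" if "j \<le> 1" for j using u'(1) that by simp
   have "dot Q (Suc 1) ?v u = ?v 1 * u 1 \<oplus> dot Q (Suc 0) ?v u"
    unfolding One_nat_def by (rule dot_Suc) (use rc uc in simp_all)
   moreover have "dot Q (Suc 0) ?v u = ?v 0 * u 0 \<oplus> dot Q 0 ?v u"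
    by (rule dot_Suc) (use rc uc in simp_all)
   ultimately show ?thesis by (simp add: numeral_2_eq_2)
  qed
  also have "\<dots> = (r * u 0 \<oplus> i * (u 1 \<oplus> a * u 0)) \<ominus> a * (i * u 0)" using u(1,2) rc ac by algebra
  also have "\<dots> = snd (x *\<^bsub>P\<^esub> ?c)" unfolding ri(1) quadratic_sel by simp
  finally show ?thesis using u'(2)[OF vV] gv by simp
 qed
 have "f x \<ominus>\<^bsub>P\<^esub> x *\<^bsub>P\<^esub> ?c \<in> D \<times> w" if x: "x \<in> n \<times> J" for x
 proof (subst mem_canonical_iff)
  have xc: "x \<in> |P|" by (rule P.n_carr[OF x])
  have xcc: "x *\<^bsub>P\<^esub> ?c \<in> |P|" by (rule P.m_closed[OF xc cP])
  show "f x \<ominus>\<^bsub>P\<^esub> x *\<^bsub>P\<^esub> ?c \<in> |P|" using fc[OF x] xcc by (rule P.minus_closed)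
  show "\<forall>y\<in>A \<times> J. snd (y *\<^bsub>P\<^esub> (f x \<ominus>\<^bsub>P\<^esub> x *\<^bsub>P\<^esub> ?c)) \<in> w"
  proof
   fix y assume y: "y \<in> A \<times> J"
   have yc: "y \<in> |P|" by (rule P.A_carr[OF y])
   have yx: "y *\<^bsub>P\<^esub> x \<in> n \<times> J" by (rule P.submodD(4)[OF P.sub_n y x])
   have yf: "y *\<^bsub>P\<^esub> f x \<in> |P|" by (rule P.m_closed[OF yc fc[OF x]])
   have e: "y *\<^bsub>P\<^esub> (f x \<ominus>\<^bsub>P\<^esub> x *\<^bsub>P\<^esub> ?c) = y *\<^bsub>P\<^esub> f x \<ominus>\<^bsub>P\<^esub> (y *\<^bsub>P\<^esub> x) *\<^bsub>P\<^esub> ?c"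
    using yc xc cP fc[OF x] by (simp add: P.minus_eq P.r_distr P.r_minus P.m_assoc)
   have yxc: "(y *\<^bsub>P\<^esub> x) *\<^bsub>P\<^esub> ?c \<in> |P|" by (intro P.m_closed yc xc cP)
   have s: "snd z \<in> |Q|" if "z \<in> |P|" for z using that by (simp add: P_carr)
   have "f (y *\<^bsub>P\<^esub> x) \<ominus>\<^bsub>P\<^esub> y *\<^bsub>P\<^esub> f x \<in> D \<times> w" by (rule P.hom_modD(3)[OF f y x])
   then have "snd (f (y *\<^bsub>P\<^esub> x) \<ominus>\<^bsub>P\<^esub> y *\<^bsub>P\<^esub> f x) \<in> w" by auto
   then have "snd (f (y *\<^bsub>P\<^esub> x)) \<ominus> snd (y *\<^bsub>P\<^esub> f x) \<in> w" using sndminus[OF fc[OF yx] yf] by simp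
   then have "snd (y *\<^bsub>P\<^esub> f x) \<ominus> snd (f (y *\<^bsub>P\<^esub> x)) \<in> w"
    by (rule cong_sym[OF w_sub s[OF fc[OF yx]] s[OF yf]])
   then have "snd (y *\<^bsub>P\<^esub> f x) \<ominus> snd ((y *\<^bsub>P\<^esub> x) *\<^bsub>P\<^esub> ?c) \<in> w"
    by (rule cong_trans[OF w_sub s[OF yf] s[OF fc[OF yx]] s[OF yxc] _ pair[OF yx]])
   then show "snd (y *\<^bsub>P\<^esub> (f x \<ominus>\<^bsub>P\<^esub> x *\<^bsub>P\<^esub> ?c)) \<in> w" unfolding e sndminus[OF yf yxc] .
  qed
 qed
 then show ?thesis using cP by blast
qed

lemma canonical_bounded: "\<exists>d\<in>(A \<times> J) \<inter> Units P. \<forall>x\<in>D \<times> w. d *\<^bsub>P\<^esub> x \<in> A \<times> J"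
proof -
 obtain d where d: "d \<in> A \<inter> Units Q" "!!x. x \<in> D ==> d * x \<in> A" using regfracD(3)[OF D_regfrac] by blast
 obtain e where e: "e \<in> A \<inter> Units Q" "!!x. x \<in> w ==> e * x \<in> J"
  using regfrac_common[OF J dualizingD(3)[OF w]] by blast
 have dc: "d \<in> |Q|" "e \<in> |Q|" using d e by auto
 have de: "d * e \<in> A \<inter> Units Q" using d e A_mult Units_m_closed by blast
 have z: "\<zero> \<in> J" using submodD(2)[OF J_sub] .
 have "(d * e, \<zero>) \<in> (A \<times> J) \<inter> Units P" using de z quadratic_scalar_unit[OF ac bc] by blast
 moreover have "(d * e, \<zero>) *\<^bsub>P\<^esub> x \<in> A \<times> J" if x: "x \<in> D \<times> w" for x
 proof -
  obtain u v where uv: "x = (u, v)" "u \<in> D" "v \<in> w" using x by blast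
  have c: "u \<in> |Q|" "v \<in> |Q|" using submodD(1)[OF D_sub] submodD(1)[OF w_sub] uv by auto
  have "d * e * u = e * (d * u)" "d * e * v = d * (e * v)" using dc c by (simp_all add: m_ac)
  then have "d * e * u \<in> A" "d * e * v \<in> J" using d e uv A_mult submodD(4)[OF J_sub] by auto
  then show ?thesis unfolding uv(1) quadratic_scalar_mult[OF ac bc m_closed[OF dc] c] by simp
 qed
 ultimately show ?thesis by blast
qed

lemma canonical_dualizing: "dualizing P (A \<times> J) (n \<times> J) (D \<times> w)"
proof -
 have "A \<times> J \<subseteq> D \<times> w" using A_D J_A A_w by auto
 then show ?thesis unfolding dualizing_def
  using canonical_submod canonical_bounded canonical_socle canonical_injective by blast
qed

subsection \<open>The almost Gorenstein condition\<close>

text \<open>The module is \<open>z\<^sup>-\<^sup>1 (D \<times> w)\<close>. Besides the two hypotheses the product formula needs \<open>n w \<subseteq> z J\<close>, which follows from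
$n D = z n$ and $J = w : D$.\<close>

lemma D_absorbs:
 assumes z: "z \<in> Units Q" "z \<in> D"
  and zn: "!!r u. r \<in> n ==> u \<in> D ==> \<exists>s\<in>n. r * u = z * s"
  and zJ: "!!j u. j \<in> J ==> u \<in> D ==> \<exists>k\<in>J. j * u = z * k"
 shows "\<exists>v. dualizing P (A \<times> J) (n \<times> J) v \<and> (\<forall>x\<in>n \<times> J. \<forall>y\<in>v. x *\<^bsub>P\<^esub> y \<in> n \<times> J)"
proof -
 let ?i = "inv z"
 have zc: "z \<in> |Q|" "?i \<in> |Q|" "?i * z = \<one>" "z * ?i = \<one>" using z by auto
 have iz: "?i * (z * x) = x" if "x \<in> |Q|" for x using zc that by (simp add: m_assoc[symmetric])
 have iu: "(?i, \<zero>) \<in> Units P" by (rule quadratic_scalar_unit[OF ac bc]) (use z in simp)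
 have sc: "(?i, \<zero>) *\<^bsub>P\<^esub> (u, v) = (?i * u, ?i * v)" if "u \<in> D" "v \<in> w" for u v
  using quadratic_scalar_mult[OF ac bc zc(2)] submodD(1)[OF D_sub] submodD(1)[OF w_sub] that by blast
 have Dc: "u \<in> |Q|" if "u \<in> D" for u using submodD(1)[OF D_sub that] .
 have wc: "u \<in> |Q|" if "u \<in> w" for u using submodD(1)[OF w_sub that] .
 let ?v = "(%x. (?i, \<zero>) *\<^bsub>P\<^esub> x) ` (D \<times> w)"
 have n1: "?i * (r * u) \<in> n" if ru: "r \<in> n" "u \<in> D" for r u
 proof -
  obtain s where "s \<in> n" "r * u = z * s" using zn[OF ru] by blast
  then show ?thesis using iz by simp
 qed
 have n2: "?i * (j * u) \<in> J" if ju: "j \<in> J" "u \<in> D" for j u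
 proof -
  obtain s where "s \<in> J" "j * u = z * s" using zJ[OF ju] by blast
  then show ?thesis using iz J_A by auto
 qed
 have n3: "?i * (r * v) \<in> J" if rv: "r \<in> n" "v \<in> w" for r v
 proof -
  have rc: "r \<in> |Q|" "v \<in> |Q|" using rv wc by auto
  have "?i * (r * v) \<in> colon Q w D"
  proof (rule colonI)
   show "?i * (r * v) \<in> |Q|" using zc rc by simp
   fix u assume u: "u \<in> D"
   have "?i * (r * v) * u = (?i * (r * u)) * v" using zc rc Dc[OF u] by (simp add: m_ac)
   moreover have "(?i * (r * u)) * v \<in> w" by (rule submodD(4)[OF w_sub n_A[OF n1[OF rv(1) u]] rv(2)])
   ultimately show "?i * (r * v) * u \<in> w" by simp
  qed
  then show ?thesis using colon_colon[OF w J] by simp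
 qed
 have AJ: "A \<times> J \<subseteq> ?v"
 proof
  fix x assume "x \<in> A \<times> J"
  then obtain r j where x: "x = (r, j)" "r \<in> A" "j \<in> J" by blast
  have "r * z \<in> D" by (rule submodD(4)[OF D_sub x(2) z(2)])
  then have 1: "z * r \<in> D" using x zc by (simp add: m_comm)
  have 2: "z * j \<in> w" by (rule colonD(2)[OF z(2) x(3)])
  have "x = (?i, \<zero>) *\<^bsub>P\<^esub> (z * r, z * j)" unfolding sc[OF 1 2] using iz x J_A by simp
  then show "x \<in> ?v" using 1 2 by blast
 qed
 have d: "dualizing P (A \<times> J) (n \<times> J) ?v" by (rule P.dualizing_scale[OF canonical_dualizing iu AJ])
 have "x *\<^bsub>P\<^esub> y \<in> n \<times> J" if x: "x \<in> n \<times> J" and y: "y \<in> ?v" for x y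
 proof -
  obtain u v where uv: "y = (?i * u, ?i * v)" "u \<in> D" "v \<in> w" using y sc by blast
  obtain r i where ri: "x = (r, i)" "r \<in> n" "i \<in> J" using x by blast
  have c: "r \<in> |Q|" "i \<in> |Q|" "u \<in> |Q|" "v \<in> |Q|" using ri uv J_A Dc wc by auto
  have "i \<in> n" using ri Jn by blast
  then have 1: "b * (?i * (i * v)) \<in> n" "a * (?i * (i * v)) \<in> J"
   using submodD(4)[OF sub_n b] submodD(4)[OF J_sub a] n1 n3 w_D[OF uv(3)] uv(3) by auto
  have "r * (?i * u) \<ominus> b * (i * (?i * v)) = ?i * (r * u) \<ominus> b * (?i * (i * v))"
   using c zc bc by (simp add: m_ac)
  moreover have "?i * (r * u) \<ominus> b * (?i * (i * v)) \<in> n"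
   by (rule submod_minus[OF sub_n n1[OF ri(2) uv(2)] 1(1)])
  moreover have "(r * (?i * v) \<oplus> i * (?i * u)) \<ominus> a * (i * (?i * v)) =
    (?i * (r * v) \<oplus> ?i * (i * u)) \<ominus> a * (?i * (i * v))"
   using c zc ac by (simp add: m_ac)
  moreover have "(?i * (r * v) \<oplus> ?i * (i * u)) \<ominus> a * (?i * (i * v)) \<in> J"
   by (rule submod_minus[OF J_sub submodD(3)[OF J_sub n3[OF ri(2) uv(3)] n2[OF ri(3) uv(2)]] 1(2)])
  ultimately show ?thesis unfolding ri(1) uv(1) quadratic_sel by simp
 qed
 then show ?thesis using d by blast
qed

text \<open>The module $M$ is a fractional ideal on which \<open>z\<^sup>-\<^sup>1 D\<close> acts, so that all elements of \<open>z\<^sup>-\<^sup>1 (D \<times> w)\<close> are almost integral.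
If $v$ is $c$ times this module, both $c$ and, by the stabilising chain, \<open>c\<^sup>-\<^sup>1\<close> map \<open>n \<times> J\<close> into itself, and $v$ may be
replaced by \<open>z\<^sup>-\<^sup>1 (D \<times> w)\<close>.\<close>

lemma D_absorbed:
 assumes z: "z \<in> Units Q" "z \<in> D"
  and M: "submod Q A M" "\<one> \<in> M" "!!u q. u \<in> D ==> q \<in> M ==> \<exists>q'\<in>M. u * q = z * q'"
  and M_bound: "d \<in> A \<inter> Units Q" "!!x. x \<in> M ==> d * x \<in> A"
  and v: "dualizing P (A \<times> J) (n \<times> J) v" "!!x y. x \<in> n \<times> J ==> y \<in> v ==> x *\<^bsub>P\<^esub> y \<in> n \<times> J"
 shows "!!r u. r \<in> n ==> u \<in> D ==> \<exists>s\<in>n. r * u = z * s"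
  and "!!j u. j \<in> J ==> u \<in> D ==> \<exists>k\<in>J. j * u = z * k"
proof -
 let ?i = "inv z"
 have zc: "z \<in> |Q|" "?i \<in> |Q|" "?i * z = \<one>" "z * ?i = \<one>" using z by auto
 have iz: "?i * (z * x) = x" "z * (?i * x) = x" if "x \<in> |Q|" for x
  using zc that by (simp_all add: m_assoc[symmetric])
 have Dc: "u \<in> |Q|" if "u \<in> D" for u using submodD(1)[OF D_sub that] .
 have wc: "u \<in> |Q|" if "u \<in> w" for u using submodD(1)[OF w_sub that] .
 have Mc: "u \<in> |Q|" if "u \<in> M" for u using submodD(1)[OF M(1) that] .
 have zJ: "\<zero> \<in> J" "\<zero> \<in> w" "\<zero> \<in> D" "\<zero> \<in> n"
  using submodD(2)[OF J_sub] submodD(2)[OF w_sub] submodD(2)[OF D_sub] submodD(2)[OF sub_n] .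
 have iu: "(?i, \<zero>) \<in> Units P" by (rule quadratic_scalar_unit[OF ac bc]) (use z in simp)
 let ?g = "%x. (?i, \<zero>) *\<^bsub>P\<^esub> x" and ?v = "(%x. (?i, \<zero>) *\<^bsub>P\<^esub> x) ` (D \<times> w)"
 have sc: "?g (u, y) = (?i * u, ?i * y)" if "u \<in> D" "y \<in> w" for u y
  by (rule quadratic_scalar_mult[OF ac bc zc(2) Dc[OF that(1)] wc[OF that(2)]])
 have one: "\<one>\<^bsub>P\<^esub> \<in> ?v"
 proof -
  have "\<one>\<^bsub>P\<^esub> = ?g (z, \<zero>)" unfolding sc[OF z(2) zJ(2)] quadratic_sel(3) using zc by simp
  then show ?thesis using z(2) zJ by blast
 qed
 have AJ: "A \<times> J \<subseteq> ?v"
 proof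
  fix x assume x: "x \<in> A \<times> J"
  have "x *\<^bsub>P\<^esub> \<one>\<^bsub>P\<^esub> \<in> ?v"
   by (rule P.submodD(4)[OF P.submod_scale[OF canonical_submod] x one]) (use iu in blast)
  then show "x \<in> ?v" using P.A_carr[OF x] by simp
 qed
 have d: "dualizing P (A \<times> J) (n \<times> J) ?v" by (rule P.dualizing_scale[OF canonical_dualizing iu AJ])
 obtain c where c: "c \<in> Units P" "v = (%x. c *\<^bsub>P\<^esub> x) ` ?v" using P.dualizing_unique[OF d v(1)] by blast
 have cc: "c \<in> |P|" "inv\<^bsub>P\<^esub> c \<in> |P|" using c by auto
 have vc: "y \<in> |P|" if "y \<in> ?v" for y
  using that P.submodD(1)[OF canonical_submod] iu P.Units_carr by auto
 (* So c maps n \<times> J into itself. *)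
 have cv: "c \<in> v" unfolding c(2) by (rule image_eqI[OF _ one]) (use cc in simp)
 have iv: "inv\<^bsub>P\<^esub> c \<in> ?v"
 proof -
  have "\<one>\<^bsub>P\<^esub> \<in> v" by (rule subsetD[OF P.dualizingD(2)[OF v(1)] P.one_A])
  then obtain y where y: "y \<in> ?v" "\<one>\<^bsub>P\<^esub> = c *\<^bsub>P\<^esub> y" unfolding c(2) by blast
  have "inv\<^bsub>P\<^esub> c = y" using P.comm_inv_char[OF cc(1) vc[OF y(1)]] y(2) by simp
  then show ?thesis using y(1) by simp
 qed
 let ?c = "inv\<^bsub>P\<^esub> c"
 have Mz: "?i * u * q \<in> M" if uq: "u \<in> D" "q \<in> M" for u q
 proof -
  obtain q' where q': "q' \<in> M" "u * q = z * q'" using M(3)[OF uq] by blast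
  have "?i * u * q = ?i * (u * q)" using zc Dc Mc uq by (simp add: m_assoc)
  then show ?thesis using q' iz(1)[OF Mc[OF q'(1)]] by simp
 qed
 (* Hence all powers of the inverse of c lie in M \<times> M: it is almost integral. *)
 have step: "?c *\<^bsub>P\<^esub> x \<in> M \<times> M" if x: "x \<in> M \<times> M" for x
 proof -
  obtain u y where uy': "?c = ?g (u, y)" "u \<in> D" "y \<in> w" using iv by blast
  have uy: "?c = (?i * u, ?i * y)" "u \<in> D" "y \<in> w" using uy' unfolding sc[OF uy'(2,3)] by simp_all
  obtain p q where pq: "x = (p, q)" "p \<in> M" "q \<in> M" using x by blast
  have yD: "y \<in> D" using w_D uy by blast
  note m = Mz[OF uy(2) pq(2)] Mz[OF uy(2) pq(3)] Mz[OF yD pq(2)] Mz[OF yD pq(3)]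
  have "?i * u * p \<ominus> b * (?i * y * q) \<in> M" by (rule submod_minus[OF M(1) m(1) submodD(4)[OF M(1) b m(4)]])
  moreover have "(?i * u * q \<oplus> ?i * y * p) \<ominus> a * (?i * y * q) \<in> M"
   by (rule submod_minus[OF M(1) submodD(3)[OF M(1) m(2,3)] submodD(4)[OF M(1) a m(4)]])
  ultimately show ?thesis unfolding uy(1) pq(1) quadratic_sel by simp
 qed
 have pw: "?c [^]\<^bsub>P\<^esub> k \<in> M \<times> M" for k :: nat
 proof (induction k)
  case 0 show ?case using M(2) submodD(2)[OF M(1)] by (simp add: quadratic_sel(3))
 next
  case (Suc k)
  have "?c [^]\<^bsub>P\<^esub> Suc k = ?c *\<^bsub>P\<^esub> ?c [^]\<^bsub>P\<^esub> k" by (rule P.nat_pow_Suc2[OF cc(2)])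
  then show ?case using step[OF Suc.IH] by simp
 qed
 have cn: "c *\<^bsub>P\<^esub> x \<in> n \<times> J" if "x \<in> n \<times> J" for x
  using v(2)[OF that cv] P.m_comm[OF P.n_carr[OF that] cc(1)] by simp
 let ?F = "%k::nat. (%x. ?c [^]\<^bsub>P\<^esub> k *\<^bsub>P\<^esub> x) ` (n \<times> J)"
 have pc: "?c [^]\<^bsub>P\<^esub> k \<in> |P|" for k :: nat by (rule P.nat_pow_closed[OF cc(2)])
 have cinv: "?c *\<^bsub>P\<^esub> (c *\<^bsub>P\<^esub> x) = x" if "x \<in> |P|" for x
  using c(1) cc that by (simp add: P.m_assoc[symmetric])
 obtain y0 where y0: "y0 \<in> J" "y0 \<in> Units Q" using regfracD(2)[OF J] by blast
 let ?d = "d * y0"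
 have y0c: "y0 \<in> |Q|" "d \<in> |Q|" using y0 M_bound by auto
 have du: "(?d, \<zero>) \<in> Units P" by (rule quadratic_scalar_unit[OF ac bc]) (use y0 M_bound in auto)
 have dM: "(?d, \<zero>) *\<^bsub>P\<^esub> x \<in> A \<times> J" if x: "x \<in> M \<times> M" for x
 proof -
  obtain p q where pq: "x = (p, q)" "p \<in> M" "q \<in> M" using x by blast
  have "?d * p = y0 * (d * p)" "?d * q = (d * q) * y0" using y0c Mc pq by (simp_all add: m_ac)
  then have "?d * p \<in> A" "?d * q \<in> J"
   using A_mult[OF J_A[OF y0(1)] M_bound(2)[OF pq(2)]] submodD(4)[OF J_sub M_bound(2)[OF pq(3)] y0(1)] by auto
  then show ?thesis unfolding pq(1) using quadratic_scalar_mult[OF ac bc _ Mc[OF pq(2)] Mc[OF pq(3)], of ?d] y0c by simp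
 qed
 have "\<exists>N. \<forall>i. ?F i \<subseteq> ?F N"
 proof (rule P.chain_stabilizes)
  show "submod P (A \<times> J) (?F k)" for k by (rule P.submod_scale[OF P.sub_n pc])
  show "(?d, \<zero>) \<in> Units P" by (rule du)
  show "(?d, \<zero>) *\<^bsub>P\<^esub> x \<in> A \<times> J" if x: "x \<in> ?F k" for k x
  proof -
   obtain y where y: "y \<in> n \<times> J" "x = ?c [^]\<^bsub>P\<^esub> k *\<^bsub>P\<^esub> y" using x by blast
   have "(?d, \<zero>) *\<^bsub>P\<^esub> x = ((?d, \<zero>) *\<^bsub>P\<^esub> ?c [^]\<^bsub>P\<^esub> k) *\<^bsub>P\<^esub> y"
    unfolding y(2) by (rule P.m_assoc[OF P.Units_carr[OF du] pc P.n_carr[OF y(1)], symmetric])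
   also have "\<dots> \<in> A \<times> J" by (rule P.A_mult[OF dM[OF pw] P.n_A[OF y(1)]])
   finally show ?thesis .
  qed
  show "?F k \<subseteq> ?F (Suc k)" for k
  proof
   fix x assume "x \<in> ?F k"
   then obtain y where y: "y \<in> n \<times> J" "x = ?c [^]\<^bsub>P\<^esub> k *\<^bsub>P\<^esub> y" by blast
   have yc: "y \<in> |P|" by (rule P.n_carr[OF y(1)])
   have "?c [^]\<^bsub>P\<^esub> Suc k *\<^bsub>P\<^esub> (c *\<^bsub>P\<^esub> y) = ?c [^]\<^bsub>P\<^esub> k *\<^bsub>P\<^esub> (?c *\<^bsub>P\<^esub> (c *\<^bsub>P\<^esub> y))"
    unfolding P.nat_pow_Suc by (rule P.m_assoc[OF pc cc(2) P.m_closed[OF cc(1) yc]])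
   then have "x = ?c [^]\<^bsub>P\<^esub> Suc k *\<^bsub>P\<^esub> (c *\<^bsub>P\<^esub> y)" unfolding cinv[OF yc] y(2) by simp
   then show "x \<in> ?F (Suc k)" by (rule image_eqI[OF _ cn[OF y(1)]])
  qed
 qed
 then obtain N where N: "?F (Suc N) \<subseteq> ?F N" by blast
 have cn': "?c *\<^bsub>P\<^esub> x \<in> n \<times> J" if x: "x \<in> n \<times> J" for x
 proof -
  have xc: "x \<in> |P|" by (rule P.n_carr[OF x])
  have "?c [^]\<^bsub>P\<^esub> Suc N *\<^bsub>P\<^esub> x \<in> ?F N" using N x by blast
  then obtain y where y: "y \<in> n \<times> J" "?c [^]\<^bsub>P\<^esub> Suc N *\<^bsub>P\<^esub> x = ?c [^]\<^bsub>P\<^esub> N *\<^bsub>P\<^esub> y" by blast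
  have "?c [^]\<^bsub>P\<^esub> N *\<^bsub>P\<^esub> (?c *\<^bsub>P\<^esub> x) = ?c [^]\<^bsub>P\<^esub> N *\<^bsub>P\<^esub> y"
   using y(2) unfolding P.nat_pow_Suc P.m_assoc[OF pc cc(2) xc] .
  moreover have "?c [^]\<^bsub>P\<^esub> N \<in> Units P" by (rule P.Units_pow) (use c in simp)
  ultimately have "?c *\<^bsub>P\<^esub> x = y" using P.Units_l_cancel P.n_carr[OF y(1)] P.m_closed[OF cc(2) xc] by metis
  then show ?thesis using y(1) by simp
 qed
 have fin: "x *\<^bsub>P\<^esub> y \<in> n \<times> J" if x: "x \<in> n \<times> J" and y: "y \<in> ?v" for x y
 proof -
  have xc: "x \<in> |P|" "y \<in> |P|" using P.n_carr[OF x] vc[OF y] by auto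
  have "c *\<^bsub>P\<^esub> y \<in> v" unfolding c(2) using y by blast
  then have "?c *\<^bsub>P\<^esub> (x *\<^bsub>P\<^esub> (c *\<^bsub>P\<^esub> y)) \<in> n \<times> J" using cn' v(2)[OF x] by blast
  moreover have "x *\<^bsub>P\<^esub> (c *\<^bsub>P\<^esub> y) = c *\<^bsub>P\<^esub> (x *\<^bsub>P\<^esub> y)" by (rule P.m_lcomm[OF xc(1) cc(1) xc(2)])
  ultimately show ?thesis using cinv[OF P.m_closed[OF xc]] by simp
 qed
 show "\<exists>s\<in>n. r * u = z * s" if r: "r \<in> n" and u: "u \<in> D" for r u
 proof
  have "?g (u, \<zero>) \<in> ?v" using u zJ by blast
  then have "(r, \<zero>) *\<^bsub>P\<^esub> ?g (u, \<zero>) \<in> n \<times> J" by (rule fin[rotated]) (use r zJ in simp)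
  then show "r * (?i * u) \<in> n"
   unfolding sc[OF u zJ(2)] using quadratic_scalar_mult[OF ac bc n_carr[OF r]] zc(2) Dc[OF u] by simp
  have rc: "r \<in> |Q|" using r by simp
  have "z * (r * (?i * u)) = r * (z * (?i * u))" using zc rc Dc[OF u] by (simp add: m_lcomm)
  then show "r * u = z * (r * (?i * u))" using iz(2)[OF Dc[OF u]] by simp
 qed
 show "\<exists>k\<in>J. j * u = z * k" if j: "j \<in> J" and u: "u \<in> D" for j u
 proof
  have jc: "j \<in> |Q|" "?i * u \<in> |Q|" using J_A j zc Dc[OF u] by auto
  have "?g (u, \<zero>) \<in> ?v" using u zJ by blast
  then have "(\<zero>, j) *\<^bsub>P\<^esub> ?g (u, \<zero>) \<in> n \<times> J" by (rule fin[rotated]) (use j zJ in simp)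
  then have "(\<zero>, j) *\<^bsub>P\<^esub> (?i * u, ?i * \<zero>) \<in> n \<times> J" unfolding sc[OF u zJ(2)] .
  then have "(\<zero> * (?i * \<zero>) \<oplus> j * (?i * u)) \<ominus> a * (j * (?i * \<zero>)) \<in> J"
   unfolding quadratic_sel by simp
  then show "j * (?i * u) \<in> J" using jc ac zc by (simp add: minus_eq)
  have "z * (j * (?i * u)) = j * (z * (?i * u))" using zc jc by (simp add: m_lcomm)
  then show "j * u = z * (j * (?i * u))" using iz(2)[OF Dc[OF u]] by simp
 qed
qed

end

section \<open>Minimal reductions of fractional ideals\<close>

lemma mem_l_coset: "x \<in> z <#\<^bsub>G\<^esub> H \<longleftrightarrow> (\<exists>s\<in>H. x = z *\<^bsub>G\<^esub> s)"
 by (auto simp: l_coset_def)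

context cring
begin

lemma ideal_prod_eq_coset_iff:
 assumes N: "submod R A N" and D: "D \<subseteq> |R|" and z: "z \<in> D"
 shows "N \<cdot> D = z <# N \<longleftrightarrow> (\<forall>r\<in>N. \<forall>u\<in>D. \<exists>s\<in>N. r * u = z * s)"
proof
 assume e: "N \<cdot> D = z <# N"
 show "\<forall>r\<in>N. \<forall>u\<in>D. \<exists>s\<in>N. r * u = z * s"
  using ideal_prod.prod[of _ N _ D R] unfolding e mem_l_coset by blast
next
 assume h: "\<forall>r\<in>N. \<forall>u\<in>D. \<exists>s\<in>N. r * u = z * s"
 have c: "s \<in> |R|" if "s \<in> N" for s using N that unfolding submod_def by blast
 have zc: "z \<in> |R|" using z D by blast
 show "N \<cdot> D = z <# N"
 proof (intro equalityI subsetI)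
  fix x assume "x \<in> N \<cdot> D"
  then show "x \<in> z <# N"
  proof (induction x rule: ideal_prod.induct)
   case (prod r u) then show ?case using h unfolding mem_l_coset by blast
  next
   case (sum x y)
   obtain s t where st: "s \<in> N" "x = z * s" "t \<in> N" "y = z * t" using sum unfolding mem_l_coset by blast
   have "x \<oplus> y = z * (s \<oplus> t)" unfolding st using c st zc by (simp add: r_distr)
   moreover have "s \<oplus> t \<in> N" using N st unfolding submod_def by blast
   ultimately show ?case unfolding mem_l_coset by blast
  qed
 next
  fix x assume "x \<in> z <# N"
  then obtain s where s: "s \<in> N" "x = z * s" unfolding mem_l_coset by blast
  have "x = s * z" using s c zc by (simp add: m_comm)
  then show "x \<in> N \<cdot> D" using ideal_prod.prod[OF s(1) z] by simp
 qed
qed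

text \<open>For the ideal $L = y D$ with reduction $x R$ and \<open>x L\<^sup>k = L\<^bsup>k+1\<^esup>\<close>, take \<open>M = x\<^bsup>-k\<^esup> L\<^sup>k\<close>. Then \<open>D M = y\<^sup>-\<^sup>1 x\<^bsup>-k\<^esup> L\<^bsup>k+1\<^esup> = (x / y) M\<close>,
and $z$ generates the same module as $x / y$. The element $x$ is regular since a power of the regular element $y$ of $L$ is a
multiple of $x$.\<close>

lemma reduction_absorbs:
 fixes D z
 defines "K \<equiv> Frac R" and "\<iota> \<equiv> to_frac R"
 assumes z: "z \<in> |K|" and D: "submod K (\<iota> ` |R| ) D" and one: "\<one>\<^bsub>K\<^esub> \<in> D"
  and red: "frac_minimal_reduction R (z <#\<^bsub>K\<^esub> \<iota> ` |R| ) D"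
 shows "z \<in> Units K" "z \<in> D"
  "\<exists>M. submod K (\<iota> ` |R| ) M \<and> \<one>\<^bsub>K\<^esub> \<in> M \<and> (\<forall>u\<in>D. \<forall>q\<in>M. \<exists>q'\<in>M. u *\<^bsub>K\<^esub> q = z *\<^bsub>K\<^esub> q') \<and>
   (\<exists>d\<in>\<iota> ` |R| \<inter> Units K. \<forall>x\<in>M. d *\<^bsub>K\<^esub> x \<in> \<iota> ` |R| )"
proof -
 interpret K: cring K unfolding K_def by (rule total_frac_cring)
 note ih = ring_hom_closed[OF to_frac_hom, folded K_def \<iota>_def] ring_hom_mult[OF to_frac_hom, folded K_def \<iota>_def]
  ring_hom_add[OF to_frac_hom, folded K_def \<iota>_def] ring_hom_one[OF to_frac_hom, folded K_def \<iota>_def]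
 note iU = to_frac_regular_Units[folded K_def \<iota>_def]
 have Dc: "u \<in> |K|" if "u \<in> D" for u using D that unfolding submod_def by blast
 have Ds: "\<iota> r *\<^bsub>K\<^esub> u \<in> D" if "u \<in> D" "r \<in> |R|" for u r using D that unfolding submod_def by blast
 obtain x y where y: "y \<in> Reg R" and x: "x \<in> |R|"
  and yD: "\<iota> y <#\<^bsub>K\<^esub> D \<subseteq> \<iota> ` |R|"
  and mr: "is_minimal_reduction R (PIdl x) {r \<in> carrier R. \<iota> r \<in> \<iota> y <#\<^bsub>K\<^esub> D}"
  and Z: "z <#\<^bsub>K\<^esub> \<iota> ` |R| = fraction R x y <#\<^bsub>K\<^esub> \<iota> ` |R|"
  using red unfolding frac_minimal_reduction_def K_def \<iota>_def by blast
 define L where "L = {r \<in> carrier R. \<iota> r \<in> \<iota> y <#\<^bsub>K\<^esub> D}"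
 have "is_reduction R (PIdl x) L" using mr unfolding is_minimal_reduction_def L_def by blast
 then obtain k where L: "ideal L R" "PIdl x \<subseteq> L" and k: "(PIdl x) \<cdot> ideal_power R L k = ideal_power R L (Suc k)"
  unfolding is_reduction_def by blast
 have yc: "y \<in> |R|" by (rule regularD(1)[OF y])
 have pid: "ideal (ideal_power R L j) R" for j by (rule ideal_power_ideal[OF L(1)])
 have Lc: "l \<in> ideal_power R L j ==> l \<in> |R|" for l j using ideal.Icarr[OF pid] .
 have pw: "r [^] j \<in> ideal_power R L j" if r: "r \<in> L" for r and j :: nat
 proof (induction j)
  case (Suc j)
  have rc: "r \<in> |R|" using ideal.Icarr[OF L(1) r] .
  have "r * r [^] j \<in> L \<cdot> ideal_power R L j" by (rule ideal_prod.prod[OF r Suc.IH])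
  then show ?case using rc by (simp add: m_comm)
 qed simp
 have cg: "\<exists>l\<in>ideal_power R L k. s = x * l" if s: "s \<in> ideal_power R L (Suc k)" for s
 proof -
  have "s \<in> (PIdl x) \<cdot> ideal_power R L k" using s k by simp
  then show ?thesis
  proof (induction s rule: ideal_prod.induct)
   case (prod i j)
   obtain t where t: "t \<in> |R|" "i = t * x" using prod(1) unfolding cgenideal_def by blast
   have "i * j = x * (t * j)" using t x Lc[OF prod(2)] by (simp add: m_ac)
   then show ?case using ideal.I_l_closed[OF pid prod(2) t(1)] by blast
  next
   case (sum s t)
   obtain l l' where l: "l \<in> ideal_power R L k" "s = x * l" "l' \<in> ideal_power R L k" "t = x * l'" using sum by blast
   have "s \<oplus> t = x * (l \<oplus> l')" using l x Lc by (simp add: r_distr)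
   then show ?case using additive_subgroup.a_closed[OF ideal.axioms(1)[OF pid] l(1,3)] by blast
  qed
 qed
 (* This uses that 1 is in D. *)
 have yL: "y \<in> L"
 proof -
  have "\<iota> y = \<iota> y *\<^bsub>K\<^esub> \<one>\<^bsub>K\<^esub>" using ih(1)[OF yc] by simp
  then show ?thesis unfolding L_def mem_l_coset using yc one by blast
 qed
 have "x \<in> L" using L(2) cgenideal_self[OF x] by blast
 then obtain p where p: "p \<in> D" "\<iota> x = \<iota> y *\<^bsub>K\<^esub> p" unfolding L_def mem_l_coset by blast
 have pc: "p \<in> |K|" by (rule Dc[OF p(1)])
 obtain l where l: "l \<in> ideal_power R L k" "y [^] Suc k = x * l" using cg[OF pw[OF yL]] by blast
 have xr: "x \<in> Reg R"
 proof (rule regular_factor[OF _ x Lc[OF l(1)]])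
  show "x * l \<in> Reg R" unfolding l(2)[symmetric] by (rule regular_pow[OF y])
 qed
 have pU: "p \<in> Units K"
 proof (rule K.unit_factor[OF _ pc ih(1)[OF yc]])
  show "p *\<^bsub>K\<^esub> \<iota> y \<in> Units K" using iU[OF xr] unfolding p(2) by (simp add: K.m_comm[OF pc ih(1)[OF yc]])
 qed
 have fp: "fraction R x y = p"
 proof -
  have f: "fraction R x y \<in> |K|" unfolding K_def by (rule fraction_closed[OF x y])
  have "\<iota> y *\<^bsub>K\<^esub> fraction R x y = \<iota> x" using fraction_denominator[OF x y] unfolding K_def \<iota>_def .
  then show ?thesis unfolding p(2) using K.Units_l_cancel[OF iU[OF y] f pc] by simp
 qed
 have "z \<in> z <#\<^bsub>K\<^esub> \<iota> ` |R|" unfolding mem_l_coset using ih(4) z K.r_one by (metis imageI one_closed)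
 then obtain s where s: "s \<in> |R|" "z = p *\<^bsub>K\<^esub> \<iota> s" unfolding Z fp mem_l_coset by blast
 have "p \<in> p <#\<^bsub>K\<^esub> \<iota> ` |R|" unfolding mem_l_coset using ih(4) pc K.r_one by (metis imageI one_closed)
 then obtain t where t: "t \<in> |R|" "p = z *\<^bsub>K\<^esub> \<iota> t" unfolding Z[unfolded fp, symmetric] mem_l_coset by blast
 show "z \<in> D" using Ds[OF p(1) s(1)] unfolding s(2) using K.m_comm[OF pc ih(1)[OF s(1)]] by simp
 show zU: "z \<in> Units K" by (rule K.unit_factor[OF _ z ih(1)[OF t(1)]]) (use t(2) pU in simp)
 define X where "X = \<iota> (x [^] k)"
 have XU: "X \<in> Units K" unfolding X_def by (rule iU[OF regular_pow[OF xr]])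
 have Xc: "X \<in> |K|" using XU by (rule K.Units_closed)
 have XA: "X \<in> \<iota> ` |R|" unfolding X_def using x by simp
 (* M is the k-th power of L divided by the k-th power of x. *)
 define M where "M = {q \<in> carrier K. X *\<^bsub>K\<^esub> q \<in> \<iota> ` ideal_power R L k}"
 have "submod K (\<iota> ` |R| ) (\<iota> ` ideal_power R L k)"
  unfolding K_def \<iota>_def by (rule fraction_embedding.image_submod[OF total_frac_embedding pid])
 then have iL: "\<iota> ` ideal_power R L k \<subseteq> |K|" "\<zero>\<^bsub>K\<^esub> \<in> \<iota> ` ideal_power R L k"
  "!!u v. u \<in> \<iota> ` ideal_power R L k ==> v \<in> \<iota> ` ideal_power R L k ==> u \<oplus>\<^bsub>K\<^esub> v \<in> \<iota> ` ideal_power R L k"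
  "!!u v. u \<in> \<iota> ` |R| ==> v \<in> \<iota> ` ideal_power R L k ==> u *\<^bsub>K\<^esub> v \<in> \<iota> ` ideal_power R L k"
  unfolding submod_def by auto
 have "submod K (\<iota> ` |R| ) M" unfolding submod_def
 proof (intro conjI ballI)
  show "M \<subseteq> |K|" unfolding M_def by blast
  show "\<zero>\<^bsub>K\<^esub> \<in> M" unfolding M_def using iL(2) Xc by simp
  show "u \<oplus>\<^bsub>K\<^esub> v \<in> M" if "u \<in> M" "v \<in> M" for u v using that Xc iL(3) unfolding M_def by (simp add: K.r_distr)
  fix c u assume c: "c \<in> \<iota> ` |R|" and u: "u \<in> M"
  have cc: "c \<in> |K|" "u \<in> |K|" using c ih(1) u unfolding M_def by auto
  have "X *\<^bsub>K\<^esub> (c *\<^bsub>K\<^esub> u) = c *\<^bsub>K\<^esub> (X *\<^bsub>K\<^esub> u)" by (rule K.m_lcomm[OF Xc cc])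
  then show "c *\<^bsub>K\<^esub> u \<in> M" using iL(4)[OF c] u cc unfolding M_def by simp
 qed
 moreover have "\<one>\<^bsub>K\<^esub> \<in> M" unfolding M_def X_def using pw[OF \<open>x \<in> L\<close>] Xc unfolding X_def by simp
 moreover have "\<exists>q'\<in>M. u *\<^bsub>K\<^esub> q = z *\<^bsub>K\<^esub> q'" if u: "u \<in> D" and q: "q \<in> M" for u q
 proof -
  note uc = Dc[OF u]
  have qc: "q \<in> |K|" using q unfolding M_def by blast
  obtain l0 where l0: "l0 \<in> ideal_power R L k" "X *\<^bsub>K\<^esub> q = \<iota> l0" using q unfolding M_def by blast
  have "\<iota> y *\<^bsub>K\<^esub> u \<in> \<iota> y <#\<^bsub>K\<^esub> D" unfolding mem_l_coset using u by blast
  then obtain l1 where l1: "l1 \<in> L" "\<iota> y *\<^bsub>K\<^esub> u = \<iota> l1" using yD unfolding L_def by auto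
  have l1c: "l1 \<in> |R|" using ideal.Icarr[OF L(1) l1(1)] .
  have "l1 * l0 \<in> ideal_power R L (Suc k)" using ideal_prod.prod[OF l1(1) l0(1)] by simp
  then obtain l2 where l2: "l2 \<in> ideal_power R L k" "l1 * l0 = x * l2" using cg by blast
  note lc = ih(1)[OF Lc[OF l2(1)]] ih(1)[OF yc]
  have "\<iota> y *\<^bsub>K\<^esub> (X *\<^bsub>K\<^esub> (u *\<^bsub>K\<^esub> q)) = (\<iota> y *\<^bsub>K\<^esub> u) *\<^bsub>K\<^esub> (X *\<^bsub>K\<^esub> q)"
   using lc uc qc Xc by (simp add: K.m_ac)
  also have "\<dots> = \<iota> (l1 * l0)" unfolding l1(2) l0(2) using ih(2)[OF l1c Lc[OF l0(1)]] by simp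
  also have "\<dots> = \<iota> y *\<^bsub>K\<^esub> (p *\<^bsub>K\<^esub> \<iota> l2)"
   unfolding l2(2) ih(2)[OF x Lc[OF l2(1)]] p(2) using lc pc by (simp add: K.m_assoc)
  finally have e: "X *\<^bsub>K\<^esub> (u *\<^bsub>K\<^esub> q) = p *\<^bsub>K\<^esub> \<iota> l2"
   using K.Units_l_cancel[OF iU[OF y]] Xc uc qc pc lc by simp
  let ?q = "inv\<^bsub>K\<^esub> z *\<^bsub>K\<^esub> (u *\<^bsub>K\<^esub> q)"
  have iz: "inv\<^bsub>K\<^esub> z \<in> |K|" "z *\<^bsub>K\<^esub> inv\<^bsub>K\<^esub> z = \<one>\<^bsub>K\<^esub>" "inv\<^bsub>K\<^esub> z *\<^bsub>K\<^esub> z = \<one>\<^bsub>K\<^esub>" using zU by auto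
  have "X *\<^bsub>K\<^esub> ?q = inv\<^bsub>K\<^esub> z *\<^bsub>K\<^esub> (X *\<^bsub>K\<^esub> (u *\<^bsub>K\<^esub> q))" by (rule K.m_lcomm) (use Xc iz uc qc in auto)
  also have "\<dots> = (inv\<^bsub>K\<^esub> z *\<^bsub>K\<^esub> z) *\<^bsub>K\<^esub> (\<iota> t *\<^bsub>K\<^esub> \<iota> l2)"
   unfolding e t(2) using z iz(1) ih(1)[OF t(1)] lc by (simp add: K.m_assoc)
  also have "\<dots> = \<iota> t *\<^bsub>K\<^esub> \<iota> l2" using iz(3) ih(1)[OF t(1)] lc by simp
  also have "\<dots> \<in> \<iota> ` ideal_power R L k" by (rule iL(4)) (use t l2 in auto)
  finally have "?q \<in> M" unfolding M_def using iz uc qc by simp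
  moreover have "u *\<^bsub>K\<^esub> q = z *\<^bsub>K\<^esub> ?q" using z iz uc qc by (simp add: K.m_assoc[symmetric])
  ultimately show ?thesis by blast
 qed
 moreover have "\<forall>v\<in>M. X *\<^bsub>K\<^esub> v \<in> \<iota> ` |R|" unfolding M_def using Lc by blast
 ultimately show "\<exists>M. submod K (\<iota> ` |R| ) M \<and> \<one>\<^bsub>K\<^esub> \<in> M \<and> (\<forall>u\<in>D. \<forall>q\<in>M. \<exists>q'\<in>M. u *\<^bsub>K\<^esub> q = z *\<^bsub>K\<^esub> q') \<and>
   (\<exists>d\<in>\<iota> ` |R| \<inter> Units K. \<forall>x\<in>M. d *\<^bsub>K\<^esub> x \<in> \<iota> ` |R| )"
  using XU XA by blast
qed

end

section \<open>Almost Gorenstein rings\<close>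

lemma dualizing_basic:
 assumes "dualizing Q A n w"
 shows "submod Q A w" "A \<subseteq> w" "\<exists>d\<in>A \<inter> Units Q. \<forall>x\<in>w. d *\<^bsub>Q\<^esub> x \<in> A" "w \<subseteq> |Q|"
 using assms by (simp_all add: dualizing_def submod_def)

context fraction_embedding
begin

lemma lift_image: "X \<subseteq> |S| ==> lift ` to_frac S ` X = \<phi> ` X"
 unfolding image_image by (rule image_cong) (auto simp: lift_to_frac)

text \<open>The definition is transported from the total ring of fractions of $S$ to $P$.\<close>

lemma almost_gorenstein_iff:
 assumes CM: "cohen_macaulay_local S n" and dim: "krull_dim S = 1"
 shows "almost_gorenstein S \<longleftrightarrow>
  (\<exists>v. dualizing P (\<phi> ` |S| ) (\<phi> ` n) v \<and> (\<forall>x\<in>\<phi> ` n. \<forall>y\<in>v. x *\<^bsub>P\<^esub> y \<in> \<phi> ` n))"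
proof -
 let ?F = "Frac S" and ?\<iota> = "to_frac S"
 interpret F: cring ?F by (rule S.total_frac_cring)
 interpret E: fraction_embedding S ?F ?\<iota> by (rule S.total_frac_embedding)
 have L: "local_ring S n" using CM by (simp add: cohen_macaulay_local_def)
 note n = S.local_ideal[OF L]
 have nc: "\<phi> ` n \<subseteq> \<phi> ` |S|" "?\<iota> ` n \<subseteq> ?\<iota> ` |S|" using n(3) by blast+
 have carr: "\<phi> ` |S| \<subseteq> |P|" "?\<iota> ` |S| \<subseteq> |?F|" using phi_hom(1) E.phi_hom(1) by blast+
 note li = lift_iso
 have lm: "lift (x *\<^bsub>?F\<^esub> y) = lift x *\<^bsub>P\<^esub> lift y" if "x \<in> |?F|" "y \<in> |?F|" for x y
  by (rule ring_iso_memE(2)[OF li that])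
 have lb: "bij_betw lift |?F| |P|" by (rule ring_iso_memE(5)[OF li])
 let ?g = "inv_into |?F| lift"
 have gi: "?g \<in> ring_iso P ?F" by (rule ring_iso_set_sym[OF F.ring_axioms li])
 have gl: "?g (\<phi> s) = ?\<iota> s" if s: "s \<in> |S|" for s
  unfolding lift_to_frac[OF s, symmetric] by (rule bij_betw_inv_into_left[OF lb E.phi_hom(1)[OF s]])
 have g_image: "?g ` \<phi> ` X = ?\<iota> ` X" if "X \<subseteq> |S|" for X
  unfolding image_image by (rule image_cong) (use that gl in auto)
 have sn: "submod P (\<phi> ` |S| ) (\<phi> ` n)" "submod ?F (?\<iota> ` |S| ) (?\<iota> ` n)"
  using image_submod[OF n(1)] E.image_submod[OF n(1)] by auto
 show ?thesis
 proof
  assume "almost_gorenstein S"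
  then obtain n' \<omega> where AG: "cohen_macaulay_local S n'" "fractional_ideal S \<omega>"
    "canonical_module S n' (frac_module S \<omega>)" "?\<iota> ` |S| \<subseteq> \<omega>"
    "\<omega> \<subseteq> frac_colon S (?\<iota> ` n') (?\<iota> ` n')"
   unfolding almost_gorenstein_def by blast
  have "n' = n" using AG(1) L unfolding cohen_macaulay_local_def local_ring_def by blast
  note AG = AG[unfolded this]
  have "dualizing ?F (?\<iota> ` |S| ) (?\<iota> ` n) \<omega>"
   using AG(3) S.canonical_iff_dualizing[OF CM dim AG(2,4)] by simp
  then have "dualizing P (lift ` ?\<iota> ` |S| ) (lift ` ?\<iota> ` n) (lift ` \<omega>)"
   by (rule dualizing_iso[OF F.is_cring P.is_cring li carr(2) nc(2) sn(2)])
  then have d: "dualizing P (\<phi> ` |S| ) (\<phi> ` n) (lift ` \<omega>)" using lift_image n(3) by simp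
  have "x *\<^bsub>P\<^esub> y \<in> \<phi> ` n" if x: "x \<in> \<phi> ` n" and y: "y \<in> lift ` \<omega>" for x y
  proof -
   obtain s where s: "s \<in> n" "x = \<phi> s" using x by blast
   obtain q where q: "q \<in> \<omega>" "y = lift q" using y by blast
   have sc: "s \<in> |S|" using s n(3) by blast
   have qc: "q \<in> |?F|" "q *\<^bsub>?F\<^esub> ?\<iota> s \<in> ?\<iota> ` n"
    using q(1) AG(5) s(1) unfolding frac_colon_def by blast+
   note c = E.phi_hom(1)[OF sc]
   have "x *\<^bsub>P\<^esub> y = lift (?\<iota> s *\<^bsub>?F\<^esub> q)" unfolding s(2) q(2) lm[OF c qc(1)] lift_to_frac[OF sc] ..
   also have "?\<iota> s *\<^bsub>?F\<^esub> q = q *\<^bsub>?F\<^esub> ?\<iota> s" by (rule F.m_comm[OF c qc(1)])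
   also have "lift \<dots> \<in> lift ` ?\<iota> ` n" using qc(2) by blast
   finally show ?thesis using lift_image n(3) by simp
  qed
  then show "\<exists>v. dualizing P (\<phi> ` |S| ) (\<phi> ` n) v \<and> (\<forall>x\<in>\<phi> ` n. \<forall>y\<in>v. x *\<^bsub>P\<^esub> y \<in> \<phi> ` n)"
   using d by blast
 next
  assume "\<exists>v. dualizing P (\<phi> ` |S| ) (\<phi> ` n) v \<and> (\<forall>x\<in>\<phi> ` n. \<forall>y\<in>v. x *\<^bsub>P\<^esub> y \<in> \<phi> ` n)"
  then obtain v where v: "dualizing P (\<phi> ` |S| ) (\<phi> ` n) v"
    "!!x y. x \<in> \<phi> ` n ==> y \<in> v ==> x *\<^bsub>P\<^esub> y \<in> \<phi> ` n" by blast
  have "dualizing ?F (?g ` \<phi> ` |S| ) (?g ` \<phi> ` n) (?g ` v)"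
   by (rule dualizing_iso[OF P.is_cring F.is_cring gi carr(1) nc(1) sn(1) v(1)])
  then have d: "dualizing ?F (?\<iota> ` |S| ) (?\<iota> ` n) (?g ` v)" using g_image n(3) by simp
  have vc: "v \<subseteq> |P|" by (rule dualizing_basic(4)[OF v(1)])
  have Av: "?\<iota> ` |S| \<subseteq> ?g ` v" by (rule dualizing_basic(2)[OF d])
  have "fractional_ideal S (?g ` v)" unfolding S.fractional_ideal_iff
  proof
   show "submod ?F (?\<iota> ` |S| ) (?g ` v)" by (rule dualizing_basic(1)[OF d])
   obtain e where e: "e \<in> ?\<iota> ` |S|" "e \<in> Units ?F" "\<forall>x\<in>?g ` v. e *\<^bsub>?F\<^esub> x \<in> ?\<iota> ` |S|"
    using dualizing_basic(3)[OF d] by blast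
   obtain s where s: "s \<in> |S|" "e = ?\<iota> s" using e(1) by blast
   have "s \<in> Reg S" by (rule E.regular_if_Unit[OF s(1)]) (use s e in simp)
   then show "\<exists>y\<in>Reg S. \<forall>x\<in>?g ` v. ?\<iota> y *\<^bsub>?F\<^esub> x \<in> ?\<iota> ` |S|" using e(3) s(2) by blast
  qed
  moreover have "canonical_module S n (frac_module S (?g ` v))"
   using d S.canonical_iff_dualizing[OF CM dim calculation Av] by simp
  moreover have "?g ` v \<subseteq> frac_colon S (?\<iota> ` n) (?\<iota> ` n)"
  proof
   fix q assume "q \<in> ?g ` v"
   then obtain y where y: "y \<in> v" "q = ?g y" by blast
   have yc: "y \<in> |P|" using y vc by blast
   have gc: "?g y \<in> |?F|" by (rule ring_iso_memE(1)[OF gi yc])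
   have "?g y *\<^bsub>?F\<^esub> ?\<iota> s \<in> ?\<iota> ` n" if s: "s \<in> n" for s
   proof -
    have sc: "s \<in> |S|" using s n(3) by blast
    have "?g y *\<^bsub>?F\<^esub> ?\<iota> s = ?\<iota> s *\<^bsub>?F\<^esub> ?g y" by (rule F.m_comm[OF gc E.phi_hom(1)[OF sc]])
    also have "\<dots> = ?g (\<phi> s *\<^bsub>P\<^esub> y)" unfolding ring_iso_memE(2)[OF gi phi_hom(1)[OF sc] yc] gl[OF sc] ..
    also have "\<dots> \<in> ?g ` \<phi> ` n" using v(2) y(1) s by blast
    finally show ?thesis using g_image n(3) by simp
   qed
   then show "q \<in> frac_colon S (?\<iota> ` n) (?\<iota> ` n)" unfolding frac_colon_def y(2) using gc by blast
  qed
  ultimately show "almost_gorenstein S" unfolding almost_gorenstein_def using CM dim Av by blast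
 qed
qed

end

theorem theorem2p3:
  fixes R :: "('a, 'r) ring_scheme"
    and m I :: "'a set"
    and \<omega> I_dual :: "('a \<times> 'a) set set"
    and z :: "('a \<times> 'a) set"
    and a b :: 'a
  assumes CM: "cohen_macaulay_local R m"
    and dim_one: "krull_dim R = 1"
    and infinite_residue_field: "infinite (carrier (R Quot m))"
    and frac_\<omega>: "fractional_ideal R \<omega>"
    and canonical_\<omega>: "canonical_module R m (frac_module R \<omega>)"
    and R_sub_\<omega>: "to_frac R ` carrier R \<subseteq> \<omega>"
    and \<omega>_sub_closure: "\<omega> \<subseteq> integral_closure R"
    and I_primary: "primary_ideal R m I"
    and I_dual_def: "I_dual = frac_colon R \<omega> (to_frac R ` I)"
    and z_carrier: "z \<in> carrier (total_frac R)"
    and z_reduction: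
      "frac_minimal_reduction R (z <#\<^bsub>total_frac R\<^esub> to_frac R ` carrier R) I_dual"
    and a_carrier: "a \<in> carrier R"
    and b_carrier: "b \<in> carrier R"
  shows "(almost_gorenstein (rees_quotient R I a b) \<longleftrightarrow>
            (to_frac R ` I) \<cdot>\<^bsub>total_frac R\<^esub> I_dual = z <#\<^bsub>total_frac R\<^esub> to_frac R ` I \<and>
            z <#\<^bsub>total_frac R\<^esub> to_frac R ` m = (to_frac R ` m) \<cdot>\<^bsub>total_frac R\<^esub> I_dual)
       \<and> (\<forall>a'\<in>carrier R. \<forall>b'\<in>carrier R.
            almost_gorenstein (rees_quotient R I a b) \<longleftrightarrow>
            almost_gorenstein (rees_quotient R I a' b'))"
proof -
 let ?K = "Frac R" and ?\<iota> = "to_frac R"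
 have L: "local_ring R m" using CM by (simp add: cohen_macaulay_local_def)
 interpret R: cring R using L by (simp add: local_ring_def)
 interpret E: fraction_embedding R ?K ?\<iota> by (rule R.total_frac_embedding)
 note m = R.local_ideal[OF L]
 interpret F: one_dim_frac ?K "?\<iota> ` |R|" "?\<iota> ` m" by (rule E.embedding_one_dim_frac[OF CM dim_one])
 have nt: "\<one>\<^bsub>R\<^esub> \<noteq> \<zero>\<^bsub>R\<^esub>" using m(2) additive_subgroup.zero_closed[OF ideal.axioms(1)[OF m(1)]] by metis
 have I: "ideal I R" and rad: "radical R I = m" using I_primary by (auto simp: primary_ideal_def)
 have Im: "I \<subseteq> m"
 proof
  fix i assume i: "i \<in> I"
  have ic: "i \<in> |R|" by (rule ideal.Icarr[OF I i])
  have "i [^]\<^bsub>R\<^esub> (1::nat) \<in> I" using i ic by simp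
  then show "i \<in> m" unfolding rad[symmetric] radical_def using ic by blast
 qed
 have I_reg: "\<exists>x\<in>I. x \<in> Reg R"
 proof -
  have "depth R m = 1" using CM dim_one by (simp add: cohen_macaulay_local_def)
  then obtain x where x: "x \<in> m" "x \<in> Reg R" using R.depth_pos_regular by blast
  then obtain k :: nat where "x [^]\<^bsub>R\<^esub> k \<in> I" unfolding rad[symmetric] radical_def by blast
  then show ?thesis using R.regular_pow[OF x(2)] by blast
 qed
 have W: "dualizing ?K (?\<iota> ` |R| ) (?\<iota> ` m) \<omega>"
  using canonical_\<omega> R.canonical_iff_dualizing[OF CM dim_one frac_\<omega> R_sub_\<omega>] by simp
 have J: "F.regfrac (?\<iota> ` I)"
  unfolding F.regfrac_def
 proof (intro conjI)
  show "submod ?K (?\<iota> ` |R| ) (?\<iota> ` I)" by (rule E.image_submod[OF I])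
  show "\<exists>y\<in>?\<iota> ` I. y \<in> Units ?K" using I_reg R.to_frac_regular_Units by blast
  have "\<one>\<^bsub>?K\<^esub> *\<^bsub>?K\<^esub> ?\<iota> i \<in> ?\<iota> ` |R|" if "i \<in> I" for i
   using ideal.Icarr[OF I that] E.phi_hom(1) by simp
  then show "\<exists>d\<in>?\<iota> ` |R| \<inter> Units ?K. \<forall>x\<in>?\<iota> ` I. d *\<^bsub>?K\<^esub> x \<in> ?\<iota> ` |R|"
   using F.one_A by (intro bexI[of _ "\<one>\<^bsub>?K\<^esub>"]) auto
 qed
 have D: "I_dual = colon ?K \<omega> (?\<iota> ` I)" unfolding I_dual_def frac_colon_def colon_def ..
 have D_sub: "submod ?K (?\<iota> ` |R| ) I_dual"
  unfolding D by (rule F.regfracD(1)[OF F.colon_regfrac[OF F.dualizingD(3)[OF W] J]])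
 (* R \<subseteq> \<omega> gives 1 in the dual of I, hence R \<times> I \<subseteq> z\<^sup>-\<^sup>1 (D \<times> \<omega>) later on. *)
 have one_D: "\<one>\<^bsub>?K\<^esub> \<in> I_dual" unfolding D
 proof (rule colonI)
  fix x assume "x \<in> ?\<iota> ` I"
  then have "x \<in> ?\<iota> ` |R|" using ideal.Icarr[OF I] by blast
  then show "\<one>\<^bsub>?K\<^esub> *\<^bsub>?K\<^esub> x \<in> \<omega>" using R_sub_\<omega> F.A_carr by auto
 qed simp
 note z = R.reduction_absorbs[OF z_carrier D_sub one_D z_reduction]
 obtain M d where M: "submod ?K (?\<iota> ` |R| ) M" "\<one>\<^bsub>?K\<^esub> \<in> M"
   "!!u q. u \<in> I_dual ==> q \<in> M ==> \<exists>q'\<in>M. u *\<^bsub>?K\<^esub> q = z *\<^bsub>?K\<^esub> q'"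
   "d \<in> ?\<iota> ` |R| \<inter> Units ?K" "!!x. x \<in> M ==> d *\<^bsub>?K\<^esub> x \<in> ?\<iota> ` |R|"
  using z(3) by blast
 have Dc: "I_dual \<subseteq> |?K|" using D_sub unfolding submod_def by blast
 (* C does not mention a and b, so the equivalence below also gives the independence. *)
 define C where "C \<longleftrightarrow> (?\<iota> ` I) \<cdot>\<^bsub>?K\<^esub> I_dual = z <#\<^bsub>?K\<^esub> ?\<iota> ` I \<and> z <#\<^bsub>?K\<^esub> ?\<iota> ` m = (?\<iota> ` m) \<cdot>\<^bsub>?K\<^esub> I_dual"
 have C_iff: "C \<longleftrightarrow> (\<forall>r\<in>?\<iota> ` I. \<forall>u\<in>I_dual. \<exists>s\<in>?\<iota> ` I. r *\<^bsub>?K\<^esub> u = z *\<^bsub>?K\<^esub> s) \<and>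
   (\<forall>r\<in>?\<iota> ` m. \<forall>u\<in>I_dual. \<exists>s\<in>?\<iota> ` m. r *\<^bsub>?K\<^esub> u = z *\<^bsub>?K\<^esub> s)"
  unfolding C_def
   cring.ideal_prod_eq_coset_iff[OF R.total_frac_cring F.regfracD(1)[OF J] Dc z(2), symmetric]
   cring.ideal_prod_eq_coset_iff[OF R.total_frac_cring F.sub_n Dc z(2), symmetric] by (simp only: eq_commute[of "z <#\<^bsub>?K\<^esub> ?\<iota> ` m"])
 have main: "almost_gorenstein (rees_quotient R I a b) \<longleftrightarrow> C" if a: "a \<in> |R|" and b: "b \<in> |R|" for a b
 proof -
  let ?S = "rees_quotient R I a b"
  obtain h where h: "quadratic_order R ?S I a b h" using R.rees_quotient_order[OF I a b nt] by blast
  interpret S: quadratic_order_CM R ?S I a b h m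
   by (intro quadratic_order_CM.intro quadratic_order_CM_axioms.intro h CM dim_one Im I_reg)
  interpret G: fraction_embedding ?S S.P S.emb by (rule S.embedding[OF I_reg])
  have em: "S.emb ` S.max_ideal = (?\<iota> ` m) \<times> (?\<iota> ` I)"
  proof (intro equalityI subsetI)
   fix x assume "x \<in> S.emb ` S.max_ideal"
   then obtain s where s: "s \<in> S.max_ideal" "x = S.emb s" by blast
   have sc: "s \<in> |?S|" using s(1) unfolding S.max_ideal_def by blast
   obtain r i where ri: "r \<in> |R|" "i \<in> I" "s = S.el r i" by (rule S.S_cases[OF sc])
   have "r \<in> m" using s(1) S.el_max[OF ri(1,2)] ri(3) by simp
   then show "x \<in> (?\<iota> ` m) \<times> (?\<iota> ` I)" unfolding s(2) ri(3) S.emb_el[OF ri(1,2)] using ri(2) by blast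
  next
   fix x assume "x \<in> (?\<iota> ` m) \<times> (?\<iota> ` I)"
   then obtain r i where ri: "r \<in> m" "i \<in> I" "x = (?\<iota> r, ?\<iota> i)" by blast
   have rc: "r \<in> |R|" using m(3) ri by blast
   have "S.el r i \<in> S.max_ideal" using S.el_max[OF rc ri(2)] ri(1) by simp
   then show "x \<in> S.emb ` S.max_ideal" unfolding ri(3) S.emb_el[OF rc ri(2), symmetric] by blast
  qed
  have ord: "one_dim_frac S.P ((?\<iota> ` |R| ) \<times> (?\<iota> ` I)) ((?\<iota> ` m) \<times> (?\<iota> ` I))"
   using G.embedding_one_dim_frac[OF S.cohen_macaulay_S S.krull_dim_S] unfolding em S.emb_image .
  interpret Q: quadratic_dual ?K "?\<iota> ` |R|" "?\<iota> ` m" "?\<iota> ` I" \<omega> "?\<iota> a" "?\<iota> b"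
   by (intro quadratic_dual.intro quadratic_dual_axioms.intro F.one_dim_frac_axioms W J ord) (use Im a b in auto)
  have AG: "almost_gorenstein ?S \<longleftrightarrow> (\<exists>v. dualizing S.P ((?\<iota> ` |R| ) \<times> (?\<iota> ` I)) ((?\<iota> ` m) \<times> (?\<iota> ` I)) v \<and>
    (\<forall>x\<in>(?\<iota> ` m) \<times> (?\<iota> ` I). \<forall>y\<in>v. x *\<^bsub>S.P\<^esub> y \<in> (?\<iota> ` m) \<times> (?\<iota> ` I)))"
   using G.almost_gorenstein_iff[OF S.cohen_macaulay_S S.krull_dim_S] unfolding em S.emb_image .
  note z' = z(1) z(2)[unfolded D]
  show ?thesis
  proof
   assume "almost_gorenstein ?S"
   then obtain v where v: "dualizing S.P ((?\<iota> ` |R| ) \<times> (?\<iota> ` I)) ((?\<iota> ` m) \<times> (?\<iota> ` I)) v"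
     "!!x y. x \<in> (?\<iota> ` m) \<times> (?\<iota> ` I) ==> y \<in> v ==> x *\<^bsub>S.P\<^esub> y \<in> (?\<iota> ` m) \<times> (?\<iota> ` I)"
    unfolding AG by blast
   show C unfolding C_iff
    using Q.D_absorbed[OF z' M(1,2) M(3)[unfolded D] M(4,5) v] unfolding D by blast
  next
   assume C
   then have c: "!!r u. r \<in> ?\<iota> ` m ==> u \<in> I_dual ==> \<exists>s\<in>?\<iota> ` m. r *\<^bsub>?K\<^esub> u = z *\<^bsub>?K\<^esub> s"
    "!!r u. r \<in> ?\<iota> ` I ==> u \<in> I_dual ==> \<exists>s\<in>?\<iota> ` I. r *\<^bsub>?K\<^esub> u = z *\<^bsub>?K\<^esub> s"
    unfolding C_iff by blast+
   show "almost_gorenstein ?S" unfolding AG by (rule Q.D_absorbs[OF z' c[unfolded D]])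
  qed
 qed
 show ?thesis using main[OF a_carrier b_carrier] main unfolding C_def by simp
qed

end
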